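(* Let $\alpha\in\mathbb{R}$. Then for all $\lambda\in\mathbb{C}\setminus\mathbb{R}$ one has $$\lim_{c\to\infty}\left(A_{-\alpha c^2/2,\,\alpha c^2/2}-(\lambda+c^2/2)\right)^{-1}=\begin{pmatrix}(T_\alpha-\lambda)^{-1}&0\\0&0\end{pmatrix},$$ where the convergence is in the operator norm (of bounded operators on $L^2(\mathbb{R}^2)^2$) and the convergence rate is $\mathcal{O}\left(\frac1c\right)$.
   Context: Setting: $\Omega_+\subseteq\mathbb{R}^2$ is a bounded and simply connected $C^\infty$-domain, $\Omega_-=\mathbb{R}^2\setminus\overline{\Omega_+}$ is the exterior domain, $\Sigma=\partial\Omega_+=\partial\Omega_-$, and $\nu=(\nu_1,\nu_2)$ is the unit normal vector field on $\Sigma$ pointing outwards of $\Omega_+$. $H^s$ denotes the standard $L^2$-based Sobolev space of order $s$, $f_\pm$ is the restriction of a function $f$ on $\mathbb{R}^2$ to $\Omega_\pm$, and $f$ is identified with $f_+\oplus f_-$. $\gamma_D^\pm:H^1(\Omega_\pm)\to L^2(\Sigma)$ are the Dirichlet trace operators (applied componentwise to vector-valued functions). $\partial_{\overline z}=\frac12(\partial_1+i\partial_2)$ is the Wirtinger derivative. Definition of $T_\alpha$ ($\alpha\in\mathbb{R}$), a self-adjoint operator in $L^2(\mathbb{R}^2)$: $$T_\alpha f=(-\Delta f_+)\oplus(-\Delta f_-),$$ $$\operatorname{dom}T_\alpha=\Big\{f\in H^1(\Omega_+)\oplus H^1(\Omega_-)\ \Big|\ \partial_{\overline z}f_+\oplus\partial_{\overline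 z}f_-\in H^1(\mathbb{R}^2),\ (\nu_1+i\nu_2)\big(\gamma_D^+f_+-\gamma_D^-f_-\big)=-\alpha\big(\gamma_D^+(\partial_{\overline z}f_+)+\gamma_D^-(\partial_{\overline z}f_-)\big)\Big\}.$$ Pauli matrices: $$\sigma_1=\begin{pmatrix}0&1\\1&0\end{pmatrix},\quad\sigma_2=\begin{pmatrix}0&-i\\i&0\end{pmatrix},\quad\sigma_3=\begin{pmatrix}1&0\\0&-1\end{pmatrix};$$ $I_2$ is the $2\times2$ identity matrix, $\sigma\cdot x=\sigma_1x_1+\sigma_2x_2$ for $x=(x_1,x_2)$, and $\sigma\cdot\nabla=\sigma_1\partial_1+\sigma_2\partial_2$. Dirac operators (units with $\hbar=1$, mass $\frac12$, speed of light $c>0$ a parameter): for $\eta,\tau\in\mathbb{R}$, $A_{\eta,\tau}$ is the operator in $L^2(\mathbb{R}^2)^2$ given by $$A_{\eta,\tau}f=\Big(-ic(\sigma\cdot\nabla)+\tfrac{c^2}{2}\sigma_3\Big)f_+\oplus\Big(-ic(\sigma\cdot\nabla)+\tfrac{c^2}{2}\sigma_3\Big)f_-,$$ $$\operatorname{dom}A_{\eta,\tau}=\Big\{f\in H^1(\Omega_+)^2\oplus H^1(\Omega_-)^2\ \Big|\ ic(\sigma\cdot\nu)\big(\gamma_D^+f_+-\gamma_D^-f_-\big)+\tfrac12(\eta I_2+\tau\sigma_3)\big(\gamma_D^+f_++\gamma_D^-f_-\big)=0\Big\}.$$ It is known that $A_{\eta,\tau}$ is self-adjoint in $L^2(\mathbb{R}^2)^2$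 whenever $\eta^2-\tau^2\ne4c^2$. *)

theory Defs
  imports "HOL-Analysis.Analysis" "HOL-Library.Landau_Symbols"
begin

section \<open>Complex normed spaces, unbounded operators and resolvents\<close>

class complex_normed_space = real_normed_vector +
  fixes scaleC :: "complex \<Rightarrow> 'a \<Rightarrow> 'a"  (infixr "*\<^sub>C" 75)
  assumes scaleC_add_right: "a *\<^sub>C (x + y) = a *\<^sub>C x + a *\<^sub>C y"
    and scaleC_add_left: "(a + b) *\<^sub>C x = a *\<^sub>C x + b *\<^sub>C x"
    and scaleC_scaleC: "a *\<^sub>C (b *\<^sub>C x) = (a * b) *\<^sub>C x"
    and scaleC_of_real: "of_real r *\<^sub>C x = r *\<^sub>R x"
    and norm_scaleC: "norm (a *\<^sub>C x) = cmod a * norm x"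

instantiation prod :: (complex_normed_space, complex_normed_space) complex_normed_space
begin

definition scaleC_prod :: "complex \<Rightarrow> 'a \<times> 'b \<Rightarrow> 'a \<times> 'b" where
  "scaleC_prod a p = (a *\<^sub>C fst p, a *\<^sub>C snd p)"

instance
proof
  fix a :: complex and p :: "'a \<times> 'b"
  have "(norm (a *\<^sub>C p))\<^sup>2 = (cmod a * norm p)\<^sup>2"
    by (simp add: scaleC_prod_def norm_prod_def norm_scaleC power_mult_distrib algebra_simps)
  then show "norm (a *\<^sub>C p) = cmod a * norm p"
    by (simp add: power2_eq_iff_nonneg)
qed (auto simp: scaleC_prod_def scaleC_add_right scaleC_add_left scaleC_scaleC
      scaleC_of_real prod_eq_iff)

end

text \<open>An unbounded operator in \<open>'a\<close> is represented by its graph, a subset of \<open>'a \<times> 'a\<close>.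
  Its inverse is regarded as defined when it is an everywhere defined bounded operator.\<close>

definition is_bounded_inverse ::
    "('a::complex_normed_space \<times> 'a) set \<Rightarrow> ('a \<Rightarrow>\<^sub>L 'a) \<Rightarrow> bool" where
  "is_bounded_inverse S R \<longleftrightarrow> (\<forall>f g. (f, g) \<in> S \<longleftrightarrow> blinfun_apply R g = f)"

definition op_minus :: "('a::complex_normed_space \<times> 'a) set \<Rightarrow> complex \<Rightarrow> ('a \<times> 'a) set" where
  "op_minus T z = {(f, g - z *\<^sub>C f) | f g. (f, g) \<in> T}"

definition resolvent_set :: "('a::complex_normed_space \<times> 'a) set \<Rightarrow> complex set" where
  "resolvent_set T = {z. \<exists>R. is_bounded_inverse (op_minus T z) R}"

definition resolvent :: "('a::complex_normed_space \<times> 'a) set \<Rightarrow> complex \<Rightarrow> 'a \<Rightarrow>\<^sub>L 'a" where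
  "resolvent T z = (THE R. is_bounded_inverse (op_minus T z) R)"

lemma is_bounded_inverse_unique:
  assumes "is_bounded_inverse S R" "is_bounded_inverse S R'"
  shows "R = R'"
  using assms by (intro blinfun_eqI) (auto simp: is_bounded_inverse_def)

lemma is_bounded_inverse_resolvent:
  assumes "z \<in> resolvent_set T"
  shows "is_bounded_inverse (op_minus T z) (resolvent T z)"
  using assms unfolding resolvent_set_def resolvent_def
  by (auto intro: theI' is_bounded_inverse_unique)

text \<open>The operator on \<open>'a \<times> 'a\<close> with block matrix \<open>(A, B; C, D)\<close>.\<close>

lift_definition block_op ::
    "('a::real_normed_vector \<Rightarrow>\<^sub>L 'a) \<Rightarrow> ('a \<Rightarrow>\<^sub>L 'a) \<Rightarrow> ('a \<Rightarrow>\<^sub>L 'a) \<Rightarrow> ('a \<Rightarrow>\<^sub>L 'a) \<Rightarrow>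
      ('a \<times> 'a) \<Rightarrow>\<^sub>L ('a \<times> 'a)"
  is "\<lambda>A B C D p. (A (fst p) + B (snd p), C (fst p) + D (snd p))"
  by (intro bounded_linear_Pair bounded_linear_add)
     (auto intro: bounded_linear_compose bounded_linear_fst bounded_linear_snd)

section \<open>The Hilbert space \<open>L\<^sup>2(\<real>\<^sup>2)\<close>\<close>

definition square_integrable :: "'a measure \<Rightarrow> ('a \<Rightarrow> complex) \<Rightarrow> bool" where
  "square_integrable M f \<longleftrightarrow> f \<in> borel_measurable M \<and> integrable M (\<lambda>x. (cmod (f x))\<^sup>2)"

lemma square_integrable_zero: "square_integrable M (\<lambda>x. 0)"
  by (simp add: square_integrable_def)

lemma square_integrable_mult:
  "square_integrable M f \<Longrightarrow> square_integrable M (\<lambda>x. c * f x)"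
  by (auto simp: square_integrable_def norm_mult power_mult_distrib)

lemma square_integrable_scaleR:
  "square_integrable M f \<Longrightarrow> square_integrable M (\<lambda>x. c *\<^sub>R f x)"
  by (auto simp: square_integrable_def power_mult_distrib)

lemma square_integrable_minus:
  "square_integrable M f \<Longrightarrow> square_integrable M (\<lambda>x. - f x)"
  by (auto simp: square_integrable_def)

lemma square_integrable_add:
  assumes "square_integrable M f" "square_integrable M g"
  shows "square_integrable M (\<lambda>x. f x + g x)"
proof -
  have [measurable]: "f \<in> borel_measurable M" "g \<in> borel_measurable M"
    using assms by (auto simp: square_integrable_def)
  have *: "(cmod (a + b))\<^sup>2 \<le> 2 * (cmod a)\<^sup>2 + 2 * (cmod b)\<^sup>2" for a b
  proof -
    have "(cmod (a + b))\<^sup>2 \<le> (cmod a + cmod b)\<^sup>2"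
      by (intro power_mono norm_triangle_ineq) auto
    also have "\<dots> \<le> 2 * (cmod a)\<^sup>2 + 2 * (cmod b)\<^sup>2"
      using sum_squares_bound[of "cmod a" "cmod b"] by (simp add: power2_sum)
    finally show ?thesis .
  qed
  have "integrable M (\<lambda>x. 2 * (cmod (f x))\<^sup>2 + 2 * (cmod (g x))\<^sup>2)"
    using assms by (auto simp: square_integrable_def)
  then have "integrable M (\<lambda>x. (cmod (f x + g x))\<^sup>2)"
    by (rule Bochner_Integration.integrable_bound) (auto intro!: AE_I2 *)
  then show ?thesis by (simp add: square_integrable_def)
qed

lemma square_integrable_diff:
  assumes "square_integrable M f" "square_integrable M g"
  shows "square_integrable M (\<lambda>x. f x - g x)"
  using square_integrable_add[OF assms(1) square_integrable_minus[OF assms(2)]] by simp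

lemma square_integrable_inner:
  assumes "square_integrable M f" "square_integrable M g"
  shows "integrable M (\<lambda>x. f x \<bullet> g x)"
proof -
  have [measurable]: "f \<in> borel_measurable M" "g \<in> borel_measurable M"
    using assms by (auto simp: square_integrable_def)
  have *: "\<bar>a \<bullet> b\<bar> \<le> (cmod a)\<^sup>2 + (cmod b)\<^sup>2" for a b :: complex
  proof -
    have "\<bar>a \<bullet> b\<bar> \<le> cmod a * cmod b" by (rule Cauchy_Schwarz_ineq2)
    also have "\<dots> \<le> 2 * cmod a * cmod b" by simp
    also have "\<dots> \<le> (cmod a)\<^sup>2 + (cmod b)\<^sup>2" by (rule sum_squares_bound)
    finally show ?thesis .
  qed
  have "integrable M (\<lambda>x. (cmod (f x))\<^sup>2 + (cmod (g x))\<^sup>2)"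
    using assms by (auto simp: square_integrable_def)
  then show ?thesis
    by (rule Bochner_Integration.integrable_bound) (auto intro!: AE_I2 simp: *)
qed

definition L2_eq :: "(real^2 \<Rightarrow> complex) \<Rightarrow> (real^2 \<Rightarrow> complex) \<Rightarrow> bool" where
  "L2_eq f g \<longleftrightarrow> square_integrable lborel f \<and> square_integrable lborel g \<and>
     (AE x in lborel. f x = g x)"

quotient_type L2 = "real^2 \<Rightarrow> complex" / partial: L2_eq
proof (rule part_equivpI)
  show "\<exists>f. L2_eq f f"
    by (rule exI[of _ "\<lambda>x. 0"]) (simp add: L2_eq_def square_integrable_zero)
  show "symp L2_eq"
    by (auto simp: symp_def L2_eq_def)
  show "transp L2_eq"
    unfolding transp_def L2_eq_def by (auto elim: AE_mp)
qed

instantiation L2 :: real_vector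
begin

lift_definition zero_L2 :: L2 is "\<lambda>x. 0"
  by (simp add: L2_eq_def square_integrable_zero)

lift_definition plus_L2 :: "L2 \<Rightarrow> L2 \<Rightarrow> L2" is "\<lambda>f g x. f x + g x"
  by (auto simp: L2_eq_def square_integrable_add)

lift_definition minus_L2 :: "L2 \<Rightarrow> L2 \<Rightarrow> L2" is "\<lambda>f g x. f x - g x"
  by (auto simp: L2_eq_def square_integrable_diff)

lift_definition uminus_L2 :: "L2 \<Rightarrow> L2" is "\<lambda>f x. - f x"
  by (auto simp: L2_eq_def square_integrable_minus)

lift_definition scaleR_L2 :: "real \<Rightarrow> L2 \<Rightarrow> L2" is "\<lambda>r f x. r *\<^sub>R f x"
  by (auto simp: L2_eq_def square_integrable_scaleR)

instance
proof
  fix f g h :: L2 and r s :: real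
  show "f + g + h = f + (g + h)"
    by transfer (simp add: L2_eq_def square_integrable_add add.assoc)
  show "f + g = g + f"
    by transfer (simp add: L2_eq_def square_integrable_add add.commute)
  show "0 + f = f" by transfer (simp add: L2_eq_def)
  show "- f + f = 0" by transfer (simp add: L2_eq_def square_integrable_zero)
  show "f - g = f + - g"
    by transfer (simp add: L2_eq_def square_integrable_diff)
  show "r *\<^sub>R (f + g) = r *\<^sub>R f + r *\<^sub>R g"
    by transfer (auto simp: L2_eq_def square_integrable_add square_integrable_scaleR
        scaleR_add_right)
  show "(r + s) *\<^sub>R f = r *\<^sub>R f + s *\<^sub>R f"
    by transfer (auto simp: L2_eq_def square_integrable_add square_integrable_scaleR
        scaleR_add_left)
  show "r *\<^sub>R s *\<^sub>R f = (r * s) *\<^sub>R f"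
    by transfer (auto simp: L2_eq_def square_integrable_scaleR)
  show "1 *\<^sub>R f = f" by transfer (simp add: L2_eq_def)
qed

end

text \<open>The real inner product on \<open>L\<^sup>2\<close> is the real part of the usual Hermitian one, so it induces
  the usual norm.\<close>

instantiation L2 :: real_inner
begin

lift_definition inner_L2 :: "L2 \<Rightarrow> L2 \<Rightarrow> real" is "\<lambda>f g. \<integral>x. f x \<bullet> g x \<partial>lborel"
  by (rule integral_cong_AE)
     (auto simp: L2_eq_def square_integrable_def)

definition norm_L2 :: "L2 \<Rightarrow> real" where "norm_L2 f = sqrt (f \<bullet> f)"
definition sgn_L2 :: "L2 \<Rightarrow> L2" where "sgn_L2 f = f /\<^sub>R norm f"
definition dist_L2 :: "L2 \<Rightarrow> L2 \<Rightarrow> real" where "dist_L2 f g = norm (f - g)"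
definition uniformity_L2 :: "(L2 \<times> L2) filter" where
  "uniformity_L2 = (INF e\<in>{0<..}. principal {(f, g). dist f g < e})"
definition open_L2 :: "L2 set \<Rightarrow> bool" where
  "open_L2 U = (\<forall>f\<in>U. eventually (\<lambda>(f', g). f' = f \<longrightarrow> g \<in> U) uniformity)"

instance
proof
  fix f g h :: L2 and r :: real
  show "f \<bullet> g = g \<bullet> f" by transfer (simp add: inner_commute)
  show "(f + g) \<bullet> h = f \<bullet> h + g \<bullet> h"
    by transfer (simp add: L2_eq_def inner_add_left square_integrable_inner)
  show "(r *\<^sub>R f) \<bullet> g = r * (f \<bullet> g)" by transfer simp
  show "0 \<le> f \<bullet> f" by transfer simp
  show "f \<bullet> f = 0 \<longleftrightarrow> f = 0"
  proof transfer
    fix f assume "L2_eq f f"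
    then have f: "square_integrable lborel f" by (simp add: L2_eq_def)
    have "(\<integral>x. f x \<bullet> f x \<partial>lborel) = 0 \<longleftrightarrow> (AE x in lborel. f x \<bullet> f x = 0)"
      by (rule integral_nonneg_eq_0_iff_AE[OF square_integrable_inner[OF f f]]) simp
    then show "(\<integral>x. f x \<bullet> f x \<partial>lborel) = 0 \<longleftrightarrow> L2_eq f (\<lambda>x. 0)"
      using f by (simp add: L2_eq_def square_integrable_zero)
  qed
qed (simp_all add: norm_L2_def sgn_L2_def dist_L2_def uniformity_L2_def open_L2_def)

end

lemma norm_L2_abs:
  assumes "square_integrable lborel f"
  shows "norm (abs_L2 f) = sqrt (\<integral>x. (cmod (f x))\<^sup>2 \<partial>lborel)"
  using assms unfolding norm_L2_def by (subst inner_L2.abs_eq) (auto simp: L2_eq_def dot_square_norm)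

instantiation L2 :: complex_normed_space
begin

lift_definition scaleC_L2 :: "complex \<Rightarrow> L2 \<Rightarrow> L2" is "\<lambda>a f x. a * f x"
  by (auto simp: L2_eq_def square_integrable_mult)

instance
proof
  fix a b :: complex and f g :: L2 and r :: real
  show "a *\<^sub>C (f + g) = a *\<^sub>C f + a *\<^sub>C g"
    by transfer (auto simp: L2_eq_def square_integrable_add square_integrable_mult distrib_left)
  show "(a + b) *\<^sub>C f = a *\<^sub>C f + b *\<^sub>C f"
    by transfer (auto simp: L2_eq_def square_integrable_add square_integrable_mult distrib_right)
  show "a *\<^sub>C b *\<^sub>C f = (a * b) *\<^sub>C f"
    by transfer (auto simp: L2_eq_def square_integrable_mult mult.assoc)
  show "of_real r *\<^sub>C f = r *\<^sub>R f"
    by transfer (simp add: L2_eq_def square_integrable_mult scaleR_conv_of_real)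
  have "(a *\<^sub>C f) \<bullet> (a *\<^sub>C f) = (cmod a)\<^sup>2 * (f \<bullet> f)"
    by transfer (simp add: dot_square_norm norm_mult power_mult_distrib)
  then show "norm (a *\<^sub>C f) = cmod a * norm f"
    by (simp add: norm_L2_def real_sqrt_mult)
qed

end

section \<open>Smooth domains, boundary measure and normal\<close>

text \<open>Near every boundary point, a \<open>C\<^sup>\<infinity>\<close>-domain is, up to an orthogonal change of coordinates, the
  region below the graph of a \<open>C\<^sup>\<infinity>\<close>-function \<open>h\<close>.\<close>

definition smooth_domain :: "(real^2) set \<Rightarrow> bool" where
  "smooth_domain \<Omega> \<longleftrightarrow> open \<Omega> \<and> connected \<Omega> \<and> \<Omega> \<noteq> {} \<and>
    (\<forall>p\<in>frontier \<Omega>. \<exists>W Q h. open W \<and> p \<in> W \<and> orthogonal_transformation (Q :: real^2 \<Rightarrow> real^2) \<and>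
       (\<forall>n t. ((deriv ^^ n) (h :: real \<Rightarrow> real)) differentiable (at t)) \<and>
       \<Omega> \<inter> W = {x \<in> W. Q x $ 2 < h (Q x $ 1)})"

abbreviation exterior :: "(real^2) set \<Rightarrow> (real^2) set" where
  "exterior \<Omega> \<equiv> - closure \<Omega>"

text \<open>One-dimensional Hausdorff measure on the Borel sets; on a smooth curve it is the arc length
  measure. By Caratheodory's criterion, the Hausdorff outer measure is countably additive on the
  Borel sets, as the side condition of \<^const>\<open>measure_of\<close> requires.\<close>

definition hausdorff1_pre :: "real \<Rightarrow> (real^2) set \<Rightarrow> ennreal" where
  "hausdorff1_pre \<delta> S =
    (INF U\<in>{U :: nat \<Rightarrow> (real^2) set. S \<subseteq> (\<Union>n. U n) \<and> (\<forall>n. bounded (U n) \<and> diameter (U n) \<le> \<delta>)}.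
       \<Sum>n. ennreal (diameter (U n)))"

definition hausdorff1 :: "(real^2) measure" where
  "hausdorff1 = measure_of UNIV (sets borel) (\<lambda>S. SUP \<delta>\<in>{0<..}. hausdorff1_pre \<delta> S)"

definition surface_measure :: "(real^2) set \<Rightarrow> (real^2) measure" where
  "surface_measure \<Sigma> = restrict_space hausdorff1 \<Sigma>"

text \<open>A unit vector orthogonal to all vectors tangent to the boundary at \<open>x\<close> and pointing out of
  \<open>\<Omega>\<close>. For a smooth domain there is exactly one such vector at each boundary point.\<close>

definition is_outward_normal :: "(real^2) set \<Rightarrow> real^2 \<Rightarrow> real^2 \<Rightarrow> bool" where
  "is_outward_normal \<Omega> x n \<longleftrightarrow> norm n = 1 \<and>
    (\<forall>\<gamma> v. \<gamma> 0 = x \<and> (\<forall>t. \<gamma> t \<in> frontier \<Omega>) \<and> (\<gamma> has_vector_derivative v) (at (0::real))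
       \<longrightarrow> v \<bullet> n = 0) \<and>
    (\<exists>\<epsilon>>0. \<forall>t. 0 < t \<and> t < \<epsilon> \<longrightarrow> x + t *\<^sub>R n \<notin> closure \<Omega>)"

definition outward_normal :: "(real^2) set \<Rightarrow> real^2 \<Rightarrow> real^2" where
  "outward_normal \<Omega> x = (THE n. is_outward_normal \<Omega> x n)"

section \<open>Sobolev spaces and traces\<close>

definition pd :: "2 \<Rightarrow> (real^2 \<Rightarrow> complex) \<Rightarrow> real^2 \<Rightarrow> complex" where
  "pd j f x = frechet_derivative f (at x) (axis j 1)"

definition smooth_fun :: "(real^2 \<Rightarrow> complex) \<Rightarrow> bool" where
  "smooth_fun f \<longleftrightarrow> (\<forall>js x. foldr pd js f differentiable (at x))"

definition test_fun :: "(real^2) set \<Rightarrow> (real^2 \<Rightarrow> complex) \<Rightarrow> bool" where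
  "test_fun \<Omega> \<phi> \<longleftrightarrow> smooth_fun \<phi> \<and> compact (closure {x. \<phi> x \<noteq> 0}) \<and> closure {x. \<phi> x \<noteq> 0} \<subseteq> \<Omega>"

text \<open>Functions on an open set \<open>\<Omega>\<close> are represented by functions on the plane of which only the
  restriction to \<open>\<Omega>\<close> matters.\<close>

definition L2_on :: "(real^2) set \<Rightarrow> (real^2 \<Rightarrow> complex) \<Rightarrow> bool" where
  "L2_on \<Omega> f \<longleftrightarrow> square_integrable (restrict_space lborel \<Omega>) f"

definition is_weak_pd ::
    "(real^2) set \<Rightarrow> 2 \<Rightarrow> (real^2 \<Rightarrow> complex) \<Rightarrow> (real^2 \<Rightarrow> complex) \<Rightarrow> bool" where
  "is_weak_pd \<Omega> j f g \<longleftrightarrow> L2_on \<Omega> f \<and> L2_on \<Omega> g \<and>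
    (\<forall>\<phi>. test_fun \<Omega> \<phi> \<longrightarrow>
      (LINT x:\<Omega>|lborel. f x * pd j \<phi> x) = - (LINT x:\<Omega>|lborel. g x * \<phi> x))"

definition H1 :: "(real^2) set \<Rightarrow> (real^2 \<Rightarrow> complex) \<Rightarrow> bool" where
  "H1 \<Omega> f \<longleftrightarrow> L2_on \<Omega> f \<and> (\<forall>j. \<exists>g. is_weak_pd \<Omega> j f g)"

text \<open>For \<open>f\<close> in \<open>H\<^sup>1(\<Omega>)\<close> the following is determined almost everywhere on \<open>\<Omega>\<close>.\<close>

definition weak_pd :: "(real^2) set \<Rightarrow> 2 \<Rightarrow> (real^2 \<Rightarrow> complex) \<Rightarrow> real^2 \<Rightarrow> complex" where
  "weak_pd \<Omega> j f = (SOME g. is_weak_pd \<Omega> j f g)"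

definition wirtinger_dbar :: "(real^2) set \<Rightarrow> (real^2 \<Rightarrow> complex) \<Rightarrow> real^2 \<Rightarrow> complex" where
  "wirtinger_dbar \<Omega> f x = (weak_pd \<Omega> 1 f x + \<i> * weak_pd \<Omega> 2 f x) / 2"

definition is_weak_laplacian ::
    "(real^2) set \<Rightarrow> (real^2 \<Rightarrow> complex) \<Rightarrow> (real^2 \<Rightarrow> complex) \<Rightarrow> bool" where
  "is_weak_laplacian \<Omega> f g \<longleftrightarrow> L2_on \<Omega> f \<and> L2_on \<Omega> g \<and>
    (\<forall>\<phi>. test_fun \<Omega> \<phi> \<longrightarrow>
      (LINT x:\<Omega>|lborel. f x * (pd 1 (pd 1 \<phi>) x + pd 2 (pd 2 \<phi>) x)) =
      (LINT x:\<Omega>|lborel. g x * \<phi> x))"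

definition H1_norm :: "(real^2) set \<Rightarrow> (real^2 \<Rightarrow> complex) \<Rightarrow> real" where
  "H1_norm \<Omega> f = sqrt ((LINT x:\<Omega>|lborel. (cmod (f x))\<^sup>2)
      + (\<Sum>j\<in>UNIV. LINT x:\<Omega>|lborel. (cmod (weak_pd \<Omega> j f x))\<^sup>2))"

text \<open>The graph of the Dirichlet trace operator \<open>H\<^sup>1(\<Omega>) \<rightarrow> L\<^sup>2(\<partial>\<Omega>)\<close>, the continuous extension of
  \<open>u \<mapsto> u|\<^bsub>\<partial>\<Omega>\<^esub>\<close> from the dense subspace of restrictions to \<open>\<Omega>\<close> of functions in \<open>C\<^sub>c\<^sup>\<infinity>(\<real>\<^sup>2)\<close>; the
  trace is determined almost everywhere on the boundary.\<close>

definition has_trace :: "(real^2) set \<Rightarrow> (real^2 \<Rightarrow> complex) \<Rightarrow> (real^2 \<Rightarrow> complex) \<Rightarrow> bool" where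
  "has_trace \<Omega> f g \<longleftrightarrow> H1 \<Omega> f \<and> square_integrable (surface_measure (frontier \<Omega>)) g \<and>
    (\<exists>u. (\<forall>n. test_fun UNIV (u n)) \<and>
      (\<lambda>n. H1_norm \<Omega> (\<lambda>x. u n x - f x)) \<longlonglongrightarrow> 0 \<and>
      (\<lambda>n. \<integral>x. (cmod (u n x - g x))\<^sup>2 \<partial>surface_measure (frontier \<Omega>)) \<longlonglongrightarrow> 0)"

section \<open>The Schroedinger operator with oblique transmission conditions\<close>

text \<open>The function \<open>f\<^sub>+ \<oplus> f\<^sub>-\<close>; its value on the null set \<open>\<Sigma>\<close> is irrelevant.\<close>

definition glue :: "(real^2) set \<Rightarrow> (real^2 \<Rightarrow> complex) \<Rightarrow> (real^2 \<Rightarrow> complex) \<Rightarrow> real^2 \<Rightarrow> complex" where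
  "glue \<Omega> fp fm x = (if x \<in> \<Omega> then fp x else if x \<in> exterior \<Omega> then fm x else 0)"

definition dom_T :: "(real^2) set \<Rightarrow> real \<Rightarrow> L2 set" where
  "dom_T \<Omega> \<alpha> = {F. let f = rep_L2 F; \<nu> = outward_normal \<Omega>;
        dp = wirtinger_dbar \<Omega> f; dm = wirtinger_dbar (exterior \<Omega>) f in
      H1 \<Omega> f \<and> H1 (exterior \<Omega>) f \<and> H1 UNIV (glue \<Omega> dp dm) \<and>
      (\<exists>a b p q. has_trace \<Omega> f a \<and> has_trace (exterior \<Omega>) f b \<and>
         has_trace \<Omega> dp p \<and> has_trace (exterior \<Omega>) dm q \<and>
         (AE x in surface_measure (frontier \<Omega>).
            (of_real (\<nu> x $ 1) + \<i> * of_real (\<nu> x $ 2)) * (a x - b x)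
              = - of_real \<alpha> * (p x + q x)))}"

definition op_T :: "(real^2) set \<Rightarrow> real \<Rightarrow> (L2 \<times> L2) set" where
  "op_T \<Omega> \<alpha> = {(F, G). F \<in> dom_T \<Omega> \<alpha> \<and>
      is_weak_laplacian \<Omega> (rep_L2 F) (\<lambda>x. - rep_L2 G x) \<and>
      is_weak_laplacian (exterior \<Omega>) (rep_L2 F) (\<lambda>x. - rep_L2 G x)}"

section \<open>The Dirac operators\<close>

definition pauli1 :: "complex^2^2" where "pauli1 = vector [vector [0, 1], vector [1, 0]]"
definition pauli2 :: "complex^2^2" where "pauli2 = vector [vector [0, -\<i>], vector [\<i>, 0]]"
definition pauli3 :: "complex^2^2" where "pauli3 = vector [vector [1, 0], vector [0, -1]]"

definition sigma_dot :: "real^2 \<Rightarrow> complex^2^2" where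
  "sigma_dot x = x $ 1 *\<^sub>R pauli1 + x $ 2 *\<^sub>R pauli2"

text \<open>\<open>L\<^sup>2(\<real>\<^sup>2)\<^sup>2\<close> is the product type \<^typ>\<open>L2 \<times> L2\<close>, whose norm is the Hilbert space norm.\<close>

definition spinor :: "L2 \<times> L2 \<Rightarrow> real^2 \<Rightarrow> complex^2" where
  "spinor F x = vector [rep_L2 (fst F) x, rep_L2 (snd F) x]"

definition H1_spinor :: "(real^2) set \<Rightarrow> (real^2 \<Rightarrow> complex^2) \<Rightarrow> bool" where
  "H1_spinor \<Omega> f \<longleftrightarrow> (\<forall>k. H1 \<Omega> (\<lambda>x. f x $ k))"

definition weak_pd_spinor :: "(real^2) set \<Rightarrow> 2 \<Rightarrow> (real^2 \<Rightarrow> complex^2) \<Rightarrow> real^2 \<Rightarrow> complex^2" where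
  "weak_pd_spinor \<Omega> j f x = (\<chi> k. weak_pd \<Omega> j (\<lambda>y. f y $ k) x)"

definition has_trace_spinor ::
    "(real^2) set \<Rightarrow> (real^2 \<Rightarrow> complex^2) \<Rightarrow> (real^2 \<Rightarrow> complex^2) \<Rightarrow> bool" where
  "has_trace_spinor \<Omega> f g \<longleftrightarrow> (\<forall>k. has_trace \<Omega> (\<lambda>x. f x $ k) (\<lambda>x. g x $ k))"

definition dirac_expr :: "(real^2) set \<Rightarrow> real \<Rightarrow> (real^2 \<Rightarrow> complex^2) \<Rightarrow> real^2 \<Rightarrow> complex^2" where
  "dirac_expr \<Omega> c f x =
     (- \<i> * of_real c) *s (pauli1 *v weak_pd_spinor \<Omega> 1 f x + pauli2 *v weak_pd_spinor \<Omega> 2 f x)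
     + of_real (c\<^sup>2 / 2) *s (pauli3 *v f x)"

definition dom_A :: "(real^2) set \<Rightarrow> real \<Rightarrow> real \<Rightarrow> real \<Rightarrow> (L2 \<times> L2) set" where
  "dom_A \<Omega> c \<eta> \<tau> = {F. let f = spinor F in
      H1_spinor \<Omega> f \<and> H1_spinor (exterior \<Omega>) f \<and>
      (\<exists>a b. has_trace_spinor \<Omega> f a \<and> has_trace_spinor (exterior \<Omega>) f b \<and>
         (AE x in surface_measure (frontier \<Omega>).
            (\<i> * of_real c) *s (sigma_dot (outward_normal \<Omega> x) *v (a x - b x))
            + (1 / 2) *s ((\<eta> *\<^sub>R mat 1 + \<tau> *\<^sub>R pauli3) *v (a x + b x)) = 0))}"

definition op_A ::
    "(real^2) set \<Rightarrow> real \<Rightarrow> real \<Rightarrow> real \<Rightarrow> ((L2 \<times> L2) \<times> (L2 \<times> L2)) set" where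
  "op_A \<Omega> c \<eta> \<tau> = {(F, G). F \<in> dom_A \<Omega> c \<eta> \<tau> \<and>
      (AE x in lborel. x \<in> \<Omega> \<longrightarrow> spinor G x = dirac_expr \<Omega> c (spinor F) x) \<and>
      (AE x in lborel. x \<in> exterior \<Omega> \<longrightarrow>
         spinor G x = dirac_expr (exterior \<Omega>) c (spinor F) x)}"

end

theory Submission
  imports Defs "HOL-Real_Asymp.Real_Asymp" "HOL-Computational_Algebra.Polynomial"
begin

text \<open>Let \<open>h\<close> be the Wirtinger derivative of \<open>F\<close> when \<open>(T - z) F = g\<^sub>1\<close>, and \<open>h = (i c / 2) f\<^sub>2\<close> when
 \<open>f = (f\<^sub>1, f\<^sub>2)\<close> solves the Dirac resolvent equation with right-hand side \<open>(g\<^sub>1, g\<^sub>2)\<close>. In both cases \<open>h\<close> has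
 no jump, so it lies in \<open>H\<^sup>1\<close> of the plane, and the upper component is \<open>- (g\<^sub>1 + 4 D h) / z\<close> with
 \<open>D = (\<partial>\<^sub>1 - i \<partial>\<^sub>2) / 2\<close>. By Green's formula, the remaining equation and jump condition say that, for all \<open>v\<close>
 in \<open>H\<^sup>1\<close> of the plane and with \<open>\<kappa> = 1 / c\<^sup>2\<close>,
 \<open>(4 / z) \<langle>D h, D v\<rangle> - \<alpha> \<langle>h, v\<rangle>\<^sub>\<Sigma> - (1 + z \<kappa>) \<langle>h, v\<rangle> = - \<langle>g\<^sub>1, D v\<rangle> / z + (i / 2c) \<langle>g\<^sub>2, v\<rangle>\<close>;
 the operator \<open>T\<close> is the case \<open>\<kappa> = 0\<close>, \<open>g\<^sub>2 = 0\<close>. Conversely, if \<open>h\<close> solves this, subtracting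
 \<open>- 2 \<alpha> (\<nu>\<^sub>1 - i \<nu>\<^sub>2) h\<close> inside the domain removes the jump of the upper component, and the difference is in
 \<open>H\<^sup>1\<close> of the plane because both it and its Wirtinger derivative are square integrable. After multiplication by
 a suitable complex number the form is coercive uniformly in \<open>\<kappa> \<ge> 0\<close>, so the Lax-Milgram theorem yields
 both resolvents, and the two equations differ only by terms of order \<open>1 / c\<close>.\<close>

text \<open>The form method works for \<open>h\<close> because \<open>h\<close> does not jump: the
  condition on the jump of the upper component becomes a boundary term, and one form domain serves
  every \<open>c\<close>. That term may have either sign, as \<alpha> does. But it is hermitian, so
  after multiplication by \<open>\<omega>\<close> it feels only \<open>Re \<omega>\<close>, fixed at
  \<open>- 1\<close>; as \<open>z\<close> is not real, \<open>Im \<omega>\<close> can be chosen to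
  make the gradient term as large as required. The correction carries the conjugate of the complex
  normal since their product is 1 on the boundary. Square integrability of a function and its
  Wirtinger derivative gives \<open>H\<^sup>1\<close> for two reasons: on test functions one
  Wirtinger derivative carries the whole gradient norm, and test functions are dense in the graph
  norm. Density is reduced to uniqueness for \<open>\<Delta> a = 4 a\<close>, hence to a maximum
  principle. The boundary form is defined as an integral over the domain: it is then bounded on
  \<open>H\<^sup>1\<close> at once and yields the traces. The inner product of \<open>L2\<close> is
  the real part of the hermitian one; complex identities are recovered by testing with multiples by
  \<open>\<i>\<close> as well.\<close>

lemmas lint_cong = Bochner_Integration.integral_cong
lemmas lint_add = Bochner_Integration.integral_add
lemmas bl_comp = bounded_linear_compose

section \<open>Smooth functions and bump functions\<close>

lemma pd_eq: "(f has_derivative f') (at x) ==> pd j f x = f' (axis j 1)"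
 unfolding pd_def using frechet_derivative_at by metis

lemma has_derivative_frechet:
 "f differentiable (at x) ==> (f has_derivative frechet_derivative f (at x)) (at x)"
 by (simp add: frechet_derivative_works)

lemma pd_const [simp]: "pd j (%x. c) x = 0"
 by (simp add: pd_def)

lemma pd_add:
 assumes "f differentiable (at x)" "g differentiable (at x)"
 shows "pd j (%x. f x + g x) x = pd j f x + pd j g x"
 using pd_eq[OF has_derivative_add[OF assms[THEN has_derivative_frechet]]] by (simp add: pd_def)

lemma pd_diff:
 assumes "f differentiable (at x)" "g differentiable (at x)"
 shows "pd j (%x. f x - g x) x = pd j f x - pd j g x"
 using pd_eq[OF has_derivative_diff[OF assms[THEN has_derivative_frechet]]] by (simp add: pd_def)

lemma pd_mult:
 assumes "f differentiable (at x)" "g differentiable (at x)"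
 shows "pd j (%x. f x * g x) x = pd j f x * g x + f x * pd j g x"
 using pd_eq[OF has_derivative_mult[OF assms[THEN has_derivative_frechet]]]
 by (simp add: pd_def algebra_simps)

lemma pd_cnj:
 assumes "f differentiable (at x)"
 shows "pd j (%x. cnj (f x)) x = cnj (pd j f x)"
 using pd_eq[OF has_derivative_cnj[OF assms[THEN has_derivative_frechet]]] by (simp add: pd_def)

lemma pd_local:
 assumes "open U" "x \<in> U" "!!y. y \<in> U ==> f y = g y" "g differentiable (at x)"
 shows "f differentiable (at x)" "pd j f x = pd j g x"
proof -
 have *: "(f has_derivative frechet_derivative g (at x)) (at x)"
  by (rule has_derivative_transform_within_open[OF has_derivative_frechet[OF assms(4)] assms(1,2)])
   (use assms(3) in auto)
 then show "f differentiable (at x)" by (auto simp: differentiable_def)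
 show "pd j f x = pd j g x" using pd_eq[OF *] by (simp add: pd_def)
qed

text \<open>\<open>smooth_fun\<close> speaks of all lists of directions at once, which leaves
  nothing to induct on. Stopping at order \<open>k\<close> gives a recursion, and smoothness is
  \<open>kdiff k\<close> for every \<open>k\<close>.\<close>

fun kdiff :: "nat => (real^2 => complex) => bool" where
 "kdiff 0 f = (\<forall>x. f differentiable (at x))"
| "kdiff (Suc k) f = ((\<forall>x. f differentiable (at x)) \<and> (\<forall>j. kdiff k (pd j f)))"

lemma kdiff_differentiable: "kdiff k f ==> f differentiable (at x)"
 by (cases k) auto

lemma kdiff_Suc_D: "kdiff (Suc k) f ==> kdiff k f"
 by (induction k arbitrary: f) auto

lemma kdiff_iff: "kdiff k f \<longleftrightarrow> (\<forall>js x. length js \<le> k --> foldr pd js f differentiable (at x))"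
proof (induction k arbitrary: f)
 case (Suc k)
 show ?case
 proof
  assume a: "kdiff (Suc k) f"
  show "\<forall>js x. length js \<le> Suc k --> foldr pd js f differentiable (at x)"
  proof (intro allI impI)
   fix js :: "2 list" and x assume "length js \<le> Suc k"
   \<comment> \<open>\<open>foldr pd\<close> applies the last entry of the list first, and
     \<open>kdiff\<close> peels off this innermost derivative; hence the list is split at its
     end.\<close>
   then show "foldr pd js f differentiable (at x)"
    using a Suc.IH by (cases js rule: rev_cases) auto
  qed
 next
  assume a: "\<forall>js x. length js \<le> Suc k --> foldr pd js f differentiable (at x)"
  have "foldr pd js (pd j f) differentiable (at x)" if "length js \<le> k" for js j x
   using a[rule_format, of "js @ [j]"] that by simp
  moreover have "f differentiable (at x)" for x using a[rule_format, of "[]"] by simp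
  ultimately show "kdiff (Suc k) f" using Suc.IH by simp
 qed
qed auto

lemma smooth_fun_iff_kdiff: "smooth_fun f \<longleftrightarrow> (\<forall>k. kdiff k f)"
 unfolding smooth_fun_def kdiff_iff by auto

lemma smooth_fun_diffb: "smooth_fun f ==> f differentiable (at x)"
 using kdiff_differentiable smooth_fun_iff_kdiff by blast

lemma smooth_fun_pd: "smooth_fun f ==> smooth_fun (pd j f)"
 unfolding smooth_fun_iff_kdiff by (meson kdiff.simps(2))

lemma smooth_fun_continuous: "smooth_fun f ==> continuous_on S f"
 using smooth_fun_diffb differentiable_imp_continuous_within
 by (metis continuous_at_imp_continuous_on)

lemma smooth_fun_measurable: "smooth_fun f ==> f \<in> borel_measurable borel"
 by (simp add: borel_measurable_continuous_onI smooth_fun_continuous)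

lemma kdiff_const: "kdiff k (%x. c)"
proof (induction k arbitrary: c)
 case (Suc k)
 have "pd j (%x. c) = (%x. 0)" for j by (rule ext) simp
 then show ?case using Suc by simp
qed simp

lemma kdiff_add: "kdiff k f ==> kdiff k g ==> kdiff k (%x. f x + g x)"
proof (induction k arbitrary: f g)
 case (Suc k)
 have "pd j (%x. f x + g x) = (%x. pd j f x + pd j g x)" for j
  by (rule ext, rule pd_add) (use Suc.prems in auto)
 then show ?case using Suc by simp
qed simp

lemma kdiff_mult: "kdiff k f ==> kdiff k g ==> kdiff k (%x. f x * g x)"
proof (induction k arbitrary: f g)
 case (Suc k)
 have "pd j (%x. f x * g x) = (%x. pd j f x * g x + f x * pd j g x)" for j
  by (rule ext, rule pd_mult) (use Suc.prems in auto)
 then show ?case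
  using Suc.IH Suc.prems Suc.prems[THEN kdiff_Suc_D] by (simp add: kdiff_add)
qed simp

lemma kdiff_cnj: "kdiff k f ==> kdiff k (%x. cnj (f x))"
proof (induction k arbitrary: f)
 case 0 then show ?case
  using has_derivative_cnj unfolding differentiable_def kdiff.simps by blast
next
 case (Suc k)
 have "pd j (%x. cnj (f x)) = (%x. cnj (pd j f x))" for j
  by (rule ext, rule pd_cnj) (use Suc.prems in auto)
 moreover have "(%x. cnj (f x)) differentiable (at x)" for x
  using Suc.prems has_derivative_cnj unfolding differentiable_def kdiff.simps by blast
 ultimately show ?case using Suc by simp
qed

text \<open>The local model \<open>g\<close> may vary with the point. The recursion works because on
  \<open>U\<close> also \<open>pd j f\<close> and \<open>pd j g\<close> agree, so the same open set
  serves for the next order.\<close>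

lemma kdiff_local:
 assumes "!!x. \<exists>U g. open U \<and> x \<in> U \<and> (\<forall>y\<in>U. f y = g y) \<and> kdiff k g"
 shows "kdiff k f"
 using assms
proof (induction k arbitrary: f)
 case 0
 show ?case unfolding kdiff.simps
 proof
  fix x
  obtain U g where "open U" "x \<in> U" "\<forall>y\<in>U. f y = g y" "kdiff 0 g" using 0 by blast
  then show "f differentiable (at x)" using pd_local(1)[of U x f g] by auto
 qed
next
 case (Suc k)
 have 1: "\<exists>U g. open U \<and> x \<in> U \<and> (\<forall>y\<in>U. pd j f y = pd j g y) \<and> kdiff (Suc k) g
   \<and> f differentiable (at x)" for x j
 proof -
  obtain U g where U: "open U" "x \<in> U" "\<forall>y\<in>U. f y = g y" "kdiff (Suc k) g" using Suc.prems by blast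
  then have "\<forall>y\<in>U. pd j f y = pd j g y" using pd_local(2)[of U _ f g] by auto
  with U show ?thesis using pd_local(1)[of U x f g] by auto
 qed
 have "kdiff k (pd j f)" for j
 proof (rule Suc.IH)
  fix x show "\<exists>U g. open U \<and> x \<in> U \<and> (\<forall>y\<in>U. pd j f y = g y) \<and> kdiff k g"
  proof -
   obtain U g where "open U" "x \<in> U" "\<forall>y\<in>U. pd j f y = pd j g y" "kdiff (Suc k) g"
    using 1[of x j] by blast
   then show ?thesis by (intro exI[of _ U] exI[of _ "pd j g"]) auto
  qed
 qed
 then show ?case using 1 by auto
qed

lemma smooth_fun_const [simp]: "smooth_fun (%x. c)"
 by (simp add: smooth_fun_iff_kdiff kdiff_const)

lemma smooth_fun_add: "smooth_fun f ==> smooth_fun g ==> smooth_fun (%x. f x + g x)"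
 by (simp add: smooth_fun_iff_kdiff kdiff_add)

lemma smooth_fun_mult: "smooth_fun f ==> smooth_fun g ==> smooth_fun (%x. f x * g x)"
 by (simp add: smooth_fun_iff_kdiff kdiff_mult)

lemma smooth_fun_cnj: "smooth_fun f ==> smooth_fun (%x. cnj (f x))"
 by (simp add: smooth_fun_iff_kdiff kdiff_cnj)

lemma smooth_fun_minus: "smooth_fun f ==> smooth_fun (%x. - f x)"
 using smooth_fun_mult[of "%x. -1" f] by simp

lemma smooth_fun_diff: "smooth_fun f ==> smooth_fun g ==> smooth_fun (%x. f x - g x)"
 using smooth_fun_add[of f "%x. - g x"] by (simp add: smooth_fun_minus)

lemma smooth_fun_sum: "(!!i. i \<in> I ==> smooth_fun (f i)) ==> smooth_fun (%x. \<Sum>i\<in>I. f i x)"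
 by (induction I rule: infinite_finite_induct) (auto simp: smooth_fun_add)

lemma smooth_fun_local:
 assumes "!!x. \<exists>U g. open U \<and> x \<in> U \<and> (\<forall>y\<in>U. f y = g y) \<and> smooth_fun g"
 shows "smooth_fun f"
 unfolding smooth_fun_iff_kdiff
proof (intro allI kdiff_local)
 fix k x show "\<exists>U g. open U \<and> x \<in> U \<and> (\<forall>y\<in>U. f y = g y) \<and> kdiff k g"
  using assms[of x] unfolding smooth_fun_iff_kdiff by blast
qed

lemma smooth_fun_linear:
 assumes "bounded_linear l"
 shows "smooth_fun (%x. complex_of_real (l x))"
proof -
 have d: "((%x. complex_of_real (l x)) has_derivative (%x. complex_of_real (l x))) (at x)" for x
  using assms by (intro has_derivative_of_real bounded_linear_imp_has_derivative)
 have "pd j (%x. complex_of_real (l x)) = (%x. complex_of_real (l (axis j 1)))" for j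
  by (rule ext, rule pd_eq[OF d])
 then have "kdiff k (%x. complex_of_real (l x))" for k
  using d by (cases k) (auto simp: kdiff_const differentiable_def)
 then show ?thesis by (simp add: smooth_fun_iff_kdiff)
qed

lemma smooth_fun_coord: "smooth_fun (%x. complex_of_real (x $ i))"
 by (intro smooth_fun_linear bounded_linear_vec_nth)

lemma pd_compose_real:
 assumes G: "(G has_real_derivative G') (at (r x))"
  and r: "(%x. complex_of_real (r x)) differentiable (at x)"
 shows "(%x. complex_of_real (G (r x))) differentiable (at x)"
  "pd j (%x. complex_of_real (G (r x))) x = complex_of_real G' * pd j (%x. complex_of_real (r x)) x"
proof -
 obtain D where "((%x. complex_of_real (r x)) has_derivative D) (at x)"
  using r by (auto simp: differentiable_def)
 then have "((%x. Re (complex_of_real (r x))) has_derivative (%h. Re (D h))) (at x)"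
  by (rule has_derivative_Re)
 then have R: "(r has_derivative (%h. Re (D h))) (at x)" by simp
 from has_derivative_of_real[OF this]
 have 1: "pd j (%x. complex_of_real (r x)) x = complex_of_real (Re (D (axis j 1)))"
  by (rule pd_eq)
 have "((%x. G (r x)) has_derivative (%h. Re (D h) * G')) (at x)"
  using has_derivative_compose[OF R] G unfolding has_field_derivative_def
  by (fastforce simp: mult.commute)
 from has_derivative_of_real[OF this]
 have 2: "((%x. complex_of_real (G (r x))) has_derivative (%h. complex_of_real (Re (D h) * G'))) (at x)" .
 then show "(%x. complex_of_real (G (r x))) differentiable (at x)" by (auto simp: differentiable_def)
 show "pd j (%x. complex_of_real (G (r x))) x = complex_of_real G' * pd j (%x. complex_of_real (r x)) x"
  using pd_eq[OF 2] 1 by simp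
qed

text \<open>A family closed under differentiation replaces the formula for higher derivatives of a
  composition: the chain rule produces another member of \<open>\<G>\<close>, covered by the
  induction, times a derivative of \<open>r\<close>, which is smooth. \<open>D\<close> confines
  \<open>r\<close> to the set where the members are differentiable, such as the positive reals for
  powers.\<close>

lemma smooth_fun_compose_real:
 assumes fam: "!!G. G \<in> \<G> ==> \<exists>G'\<in>\<G>. \<forall>t\<in>D. (G has_real_derivative G' t) (at t)"
  and r: "smooth_fun (%x. complex_of_real (r x))" "!!x. r x \<in> D" and "G \<in> \<G>"
 shows "smooth_fun (%x. complex_of_real (G (r x)))"
proof -
 have "kdiff k (%x. complex_of_real (G (r x)))" if "G \<in> \<G>" for k G
  using that
 proof (induction k arbitrary: G)
  case 0
  obtain G' where "G' \<in> \<G>" and G': "\<forall>t\<in>D. (G has_real_derivative G' t) (at t)" using fam[OF 0] by blast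
  then show ?case
   using pd_compose_real(1)[OF bspec[OF G' r(2)] smooth_fun_diffb[OF r(1)]] by simp
 next
  case (Suc k)
  obtain G' where "G' \<in> \<G>" and G': "\<forall>t\<in>D. (G has_real_derivative G' t) (at t)" using fam[OF Suc.prems] by blast
  have "pd j (%x. complex_of_real (G (r x))) =
    (%x. complex_of_real (G' (r x)) * pd j (%x. complex_of_real (r x)) x)" for j
   by (rule ext, rule pd_compose_real(2)[OF _ smooth_fun_diffb[OF r(1)]]) (use r(2) G' in auto)
  moreover have "kdiff k (pd j (%x. complex_of_real (r x)))" for j
   using smooth_fun_pd[OF r(1)] smooth_fun_iff_kdiff by blast
  moreover have "(%x. complex_of_real (G (r x))) differentiable (at x)" for x
   by (rule pd_compose_real(1)[OF bspec[OF G' r(2)] smooth_fun_diffb[OF r(1)]])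
  ultimately show ?case
   using Suc.IH[OF \<open>G' \<in> \<G>\<close>] by (auto intro!: kdiff_mult)
 qed
 then show ?thesis using assms(4) by (simp add: smooth_fun_iff_kdiff)
qed

lemma smooth_fun_powr:
 assumes "smooth_fun (%x. complex_of_real (r x))" "!!x. r x > 0"
 shows "smooth_fun (%x. complex_of_real (r x powr a))"
proof -
 let ?\<G> = "{%t. c * t powr a | c a :: real. True}"
 have "smooth_fun (%x. complex_of_real ((%t. 1 * t powr a) (r x)))"
 proof (rule smooth_fun_compose_real[where \<G> = ?\<G> and D = "{0<..}" and G = "%t. 1 * t powr a"])
  fix G assume "G \<in> ?\<G>"
  then obtain c b where G: "G = (%t. c * t powr b)" by blast
  have "\<forall>t\<in>{0<..}. (G has_real_derivative (%t. (c * b) * t powr (b - 1)) t) (at t)"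
   unfolding G by (auto intro!: derivative_eq_intros)
  then show "\<exists>G'\<in>?\<G>. \<forall>t\<in>{0<..}. (G has_real_derivative G' t) (at t)"
   by (rule bexI[where x = "%t. (c * b) * t powr (b - 1)"]) blast+
 next
  show "(%t. 1 * t powr a) \<in> ?\<G>" by blast
 qed (use assms in auto)
 then show ?thesis by simp
qed

section \<open>A smooth step function built from the flat function exp(-1/t)\<close>

definition flat :: "real poly => real => real" where
 "flat p t = (if t > 0 then poly p (1 / t) * exp (- 1 / t) else 0)"

lemma poly_div_exp_tendsto_0: "((%s::real. poly p s * exp (- s)) \<longlongrightarrow> 0) at_top"
proof -
 have "((%s::real. \<Sum>i\<le>degree p. coeff p i * (s ^ i / exp s)) \<longlongrightarrow> (\<Sum>i\<le>degree p. coeff p i * 0)) at_top"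
  by (intro tendsto_intros tendsto_power_div_exp_0)
 moreover have "poly p s * exp (- s) = (\<Sum>i\<le>degree p. coeff p i * (s ^ i / exp s))" for s
  by (simp add: poly_altdef sum_distrib_right exp_minus divide_inverse mult.assoc)
 ultimately show ?thesis by simp
qed

text \<open>The polynomial factor is there to make the family closed under differentiation: the
  derivative of \<open>p (1/t) exp (- 1/t)\<close> has the factor \<open>1 / t\<^sup>2\<close> and
  \<open>p - p'\<close> in place of \<open>p\<close>. At 0 the difference quotient from the right is
  \<open>s p(s) exp (- s)\<close> with \<open>s = 1/t\<close>, which tends to 0; so one formula
  covers all \<open>t\<close>.\<close>

lemma flat_deriv: "(flat p has_real_derivative flat (monom 1 2 * (p - pderiv p)) t) (at t)"
proof -
 consider "t > 0" | "t < 0" | "t = 0" by linarith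
 then show ?thesis
 proof cases
  case 1
  have "((%t. poly p (1 / t) * exp (- 1 / t)) has_real_derivative
    poly (monom 1 2 * (p - pderiv p)) (1 / t) * exp (- 1 / t)) (at t)"
  proof -
   have i: "((%t. 1 / t) has_real_derivative - 1 / t\<^sup>2) (at t)"
    using 1 by (auto intro!: derivative_eq_intros simp: power2_eq_square)
   have e: "((%t. exp (- 1 / t)) has_real_derivative exp (- 1 / t) * (1 / t\<^sup>2)) (at t)"
    using 1 by (auto intro!: derivative_eq_intros simp: power2_eq_square)
   show ?thesis
    using DERIV_mult[OF DERIV_chain2[OF poly_DERIV i] e]
    by (rule DERIV_cong) (simp add: poly_monom power_divide algebra_simps)
  qed
  then have "(flat p has_real_derivative poly (monom 1 2 * (p - pderiv p)) (1 / t) * exp (- 1 / t)) (at t)"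
   by (rule has_field_derivative_transform_within_open[where S = "{0<..}"]) (use 1 in \<open>auto simp: flat_def\<close>)
  then show ?thesis using 1 by (simp add: flat_def)
 next
  case 2
  have "((%t. 0) has_real_derivative 0) (at t)" by simp
  then have "(flat p has_real_derivative 0) (at t)"
   by (rule has_field_derivative_transform_within_open[where S = "{..<0}"]) (use 2 in \<open>auto simp: flat_def\<close>)
  then show ?thesis using 2 by (simp add: flat_def)
 next
  case 3
  have "((%h. poly (monom 1 1 * p) (inverse h) * exp (- inverse h)) \<longlongrightarrow> 0) (at_right 0)"
   by (rule filterlim_compose[OF poly_div_exp_tendsto_0 filterlim_inverse_at_top_right])
  then have "((%h. (flat p h - flat p 0) / (h - 0)) \<longlongrightarrow> 0) (at_right 0)"
   by (rule Lim_transform_eventually)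
    (auto simp: eventually_at_right_less flat_def poly_monom field_simps intro!: eventually_at_rightI[of 0 1])
  moreover have "((%h. (flat p h - flat p 0) / (h - 0)) \<longlongrightarrow> 0) (at_left 0)"
   by (rule Lim_transform_eventually[OF tendsto_const])
    (auto simp: flat_def intro!: eventually_at_leftI[of "-1" 0])
  ultimately have "(flat p has_real_derivative 0) (at 0)"
   unfolding has_field_derivative_iff by (rule filterlim_split_at[rotated])
  then show ?thesis using 3 by (simp add: flat_def)
 qed
qed

lemma smooth_fun_flat:
 assumes "smooth_fun (%x. complex_of_real (r x))"
 shows "smooth_fun (%x. complex_of_real (flat p (r x)))"
 by (rule smooth_fun_compose_real[where \<G> = "range flat" and D = UNIV])
  (use assms in \<open>auto intro!: flat_deriv\<close>)

lemma flat_1_pos: "flat 1 t > 0 \<longleftrightarrow> t > 0" and flat_1_nonneg: "flat 1 t \<ge> 0"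
 by (auto simp: flat_def)

text \<open>\<open>rstep t = step t / t\<close> for \<open>t \<noteq> 0\<close>; being smooth, it serves to normalise partitions of unity.\<close>

definition step :: "real => real" where
 "step t = flat 1 t / (flat 1 t + flat 1 (1 - t))"

definition rstep :: "real => real" where
 "rstep t = flat [:0, 1:] t / (flat 1 t + flat 1 (1 - t))"

lemma step_denominator_pos: "flat 1 t + flat 1 (1 - t) > 0"
proof (cases "t > 0")
 case False
 then have "flat 1 (1 - t) > 0" by (simp add: flat_1_pos)
 then show ?thesis using flat_1_nonneg[of t] by linarith
qed (use flat_1_pos[of t] flat_1_nonneg[of "1 - t"] in linarith)

lemma step_nonpos: "t \<le> 0 ==> step t = 0"
 by (simp add: step_def flat_def)

lemma step_ge_1: "t \<ge> 1 ==> step t = 1"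
 using flat_1_pos[of t] by (simp add: step_def flat_def[of _ "1 - t"])

lemma step_nonneg: "step t \<ge> 0" and step_le_1: "step t \<le> 1"
 using step_denominator_pos[of t] flat_1_nonneg[of t] flat_1_nonneg[of "1 - t"]
 by (auto simp: step_def divide_le_eq_1)

lemma rstep_step: "t * rstep t = step t"
 by (auto simp: rstep_def step_def flat_def)

lemma smooth_fun_step_denominator:
 assumes "smooth_fun (%x. complex_of_real (r x))"
 shows "smooth_fun (%x. complex_of_real (flat p (r x) / (flat 1 (r x) + flat 1 (1 - r x))))"
proof -
 have "smooth_fun (%x. complex_of_real (1 - r x))"
  using smooth_fun_diff[OF smooth_fun_const assms, of 1] by simp
 from smooth_fun_add[OF smooth_fun_flat[OF assms, of 1] smooth_fun_flat[OF this, of 1]]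
 have "smooth_fun (%x. complex_of_real ((flat 1 (r x) + flat 1 (1 - r x)) powr (-1)))"
  using step_denominator_pos by (intro smooth_fun_powr) auto
 from smooth_fun_mult[OF smooth_fun_flat[OF assms, of p] this] show ?thesis
  using step_denominator_pos by (simp add: powr_minus divide_inverse order_less_imp_le)
qed

lemma smooth_fun_step: "smooth_fun (%x. complex_of_real (r x)) ==> smooth_fun (%x. complex_of_real (step (r x)))"
 and smooth_fun_rstep: "smooth_fun (%x. complex_of_real (r x)) ==> smooth_fun (%x. complex_of_real (rstep (r x)))"
 unfolding step_def rstep_def by (rule smooth_fun_step_denominator, assumption)+

section \<open>Test functions\<close>

lemma test_funI:
 assumes "smooth_fun phi" "compact K" "K \<subseteq> \<Omega>" "!!x. x \<notin> K ==> phi x = 0"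
 shows "test_fun \<Omega> phi"
proof -
 have "closure {x. phi x \<noteq> 0} \<subseteq> K"
  using assms by (intro closure_minimal) (auto intro: compact_imp_closed)
 moreover from this have "compact (closure {x. phi x \<noteq> 0})"
  using assms(2) bounded_subset compact_eq_bounded_closed by blast
 ultimately show ?thesis
  using assms by (auto simp: test_fun_def)
qed

lemma test_funE:
 assumes "test_fun \<Omega> phi"
 obtains K where "compact K" "K \<subseteq> \<Omega>" "!!x. x \<notin> K ==> phi x = 0" "smooth_fun phi"
proof (rule that[of "closure {x. phi x \<noteq> 0}"])
 show "phi x = 0" if "x \<notin> closure {x. phi x \<noteq> 0}" for x
  using subsetD[OF closure_subset, of x "{x. phi x \<noteq> 0}"] that by blast
qed (use assms(1) in \<open>simp_all add: test_fun_def\<close>)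

lemma test_fun_smooth: "test_fun \<Omega> phi ==> smooth_fun phi"
 by (simp add: test_fun_def)

lemma test_fun_mono: "test_fun \<Omega> phi ==> \<Omega> \<subseteq> \<Omega>' ==> test_fun \<Omega>' phi"
 by (auto simp: test_fun_def)

lemma test_fun_add: assumes "test_fun \<Omega> phi" "test_fun \<Omega> psi" shows "test_fun \<Omega> (%x. phi x + psi x)"
proof -
 obtain K where K: "compact K" "K \<subseteq> \<Omega>" "!!x. x \<notin> K ==> phi x = 0" "smooth_fun phi" by (rule test_funE[OF assms(1)]) blast
 obtain L where L: "compact L" "L \<subseteq> \<Omega>" "!!x. x \<notin> L ==> psi x = 0" "smooth_fun psi" by (rule test_funE[OF assms(2)]) blast
 show ?thesis by (rule test_funI[of _ "K \<union> L"]) (use K L in \<open>auto intro: smooth_fun_add\<close>)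
qed

lemma test_fun_mult: assumes "test_fun \<Omega> phi" "smooth_fun m" shows "test_fun \<Omega> (%x. m x * phi x)"
proof -
 obtain K where K: "compact K" "K \<subseteq> \<Omega>" "!!x. x \<notin> K ==> phi x = 0" "smooth_fun phi" by (rule test_funE[OF assms(1)]) blast
 show ?thesis by (rule test_funI[of _ K]) (use K assms in \<open>auto intro: smooth_fun_mult\<close>)
qed

lemma test_fun_cnj: assumes "test_fun \<Omega> phi" shows "test_fun \<Omega> (%x. cnj (phi x))"
proof -
 obtain K where K: "compact K" "K \<subseteq> \<Omega>" "!!x. x \<notin> K ==> phi x = 0" "smooth_fun phi" by (rule test_funE[OF assms(1)]) blast
 show ?thesis by (rule test_funI[of _ K]) (use K in \<open>auto intro: smooth_fun_cnj\<close>)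
qed

lemma test_fun_minus: "test_fun \<Omega> phi ==> test_fun \<Omega> (%x. - phi x)"
 using test_fun_mult[of \<Omega> phi "%x. -1"] by simp

lemma test_fun_diff: "test_fun \<Omega> phi ==> test_fun \<Omega> psi ==> test_fun \<Omega> (%x. phi x - psi x)"
 using test_fun_add[of \<Omega> phi "%x. - psi x"] by (simp add: test_fun_minus)

lemma test_fun_zero [simp]: "test_fun \<Omega> (%x. 0)"
 by (rule test_funI[of _ "{}"]) auto

lemma test_fun_sum: "(!!i. i \<in> I ==> test_fun \<Omega> (f i)) ==> test_fun \<Omega> (%x. \<Sum>i\<in>I. f i x)"
 by (induction I rule: infinite_finite_induct) (auto simp: test_fun_add)

lemma pd_zero_outside:
 assumes "compact K" "!!x. x \<notin> K ==> phi x = 0" "x \<notin> K"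
 shows "pd j phi x = 0"
 using pd_local(2)[of "- K" x phi "%x. 0" j] assms compact_imp_closed by auto

lemma test_fun_pd: assumes "test_fun \<Omega> phi" shows "test_fun \<Omega> (pd j phi)"
proof -
 obtain K where K: "compact K" "K \<subseteq> \<Omega>" "!!x. x \<notin> K ==> phi x = 0" "smooth_fun phi" by (rule test_funE[OF assms]) blast
 show ?thesis by (rule test_funI[of _ K]) (use K pd_zero_outside[OF K(1,3)] in \<open>auto intro: smooth_fun_pd\<close>)
qed

lemma test_fun_bounded: assumes "test_fun \<Omega> phi" shows "\<exists>B>0. \<forall>x. cmod (phi x) \<le> B"
proof -
 obtain K where K: "compact K" "K \<subseteq> \<Omega>" "!!x. x \<notin> K ==> phi x = 0" "smooth_fun phi" by (rule test_funE[OF assms]) blast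
 have "bounded (phi ` K)"
  by (rule compact_imp_bounded[OF compact_continuous_image[OF smooth_fun_continuous[OF K(4)] K(1)]])
 then obtain B where B: "B > 0" "!!x. x \<in> K ==> cmod (phi x) \<le> B" unfolding bounded_pos by auto
 have "cmod (phi x) \<le> B" for x
  using B K(3) by (cases "x \<in> K") auto
 with B(1) show ?thesis by blast
qed

lemma
 assumes "test_fun \<Omega> phi"
 shows test_fun_sq: "square_integrable lborel phi"
  and test_fun_integrable: "integrable lborel phi"
proof -
 obtain K where K: "compact K" "K \<subseteq> \<Omega>" "!!x. x \<notin> K ==> phi x = 0" "smooth_fun phi" by (rule test_funE[OF assms]) blast
 have [measurable]: "phi \<in> borel_measurable borel" by (rule smooth_fun_measurable) fact
 have 1: "continuous_on K phi" "continuous_on K (%x. (cmod (phi x))\<^sup>2)"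
  by (intro continuous_intros smooth_fun_continuous K)+
 have "integrable lborel (%x. indicator K x *\<^sub>R (cmod (phi x))\<^sup>2)"
  by (rule borel_integrable_compact) fact+
 moreover have "(%x. indicator K x *\<^sub>R (cmod (phi x))\<^sup>2) = (%x. (cmod (phi x))\<^sup>2)"
  using K(3) by (auto simp: indicator_def fun_eq_iff)
 ultimately show "square_integrable lborel phi"
  by (auto simp: square_integrable_def)
 have "integrable lborel (%x. indicator K x *\<^sub>R phi x)"
  by (rule borel_integrable_compact) fact+
 moreover have "(%x. indicator K x *\<^sub>R phi x) = phi"
  using K(3) by (auto simp: indicator_def fun_eq_iff)
 ultimately show "integrable lborel phi" by simp
qed

section \<open>Completeness and the Lax-Milgram theorem\<close>

text \<open>The argument of Riesz and Fischer, for an arbitrary measure because it serves both the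
  plane and the boundary. Along a subsequence with squared distances below
  \<open>(1 / 8) ^ k\<close> the sum of the squared increments with weights \<open>2 ^ k\<close> has
  finite integral, so almost everywhere the increments decay geometrically; Fatou's lemma identifies
  the pointwise limit as the limit in mean.\<close>

lemma square_integrable_complete:
 fixes u :: "nat => 'a => complex"
 assumes sq: "!!n. square_integrable M (u n)"
  and cauchy: "!!e. e > 0 ==> \<exists>N. \<forall>m\<ge>N. \<forall>n\<ge>N. (\<integral>x. (cmod (u m x - u n x))\<^sup>2 \<partial>M) < e"
 shows "\<exists>g. square_integrable M g \<and> (%n. \<integral>x. (cmod (u n x - g x))\<^sup>2 \<partial>M) \<longlonglongrightarrow> 0"
proof -
 have [measurable]: "u n \<in> borel_measurable M" for n
  using sq by (simp add: square_integrable_def)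
 have int: "integrable M (%x. (cmod (u m x - u n x))\<^sup>2)" for m n
  using square_integrable_diff[OF sq sq, of m n] by (simp add: square_integrable_def)
 have "\<exists>N. \<forall>k. \<forall>m\<ge>N k. \<forall>n\<ge>N k. (\<integral>x. (cmod (u m x - u n x))\<^sup>2 \<partial>M) < (1 / 8) ^ k"
  using cauchy[of "(1 / 8) ^ k" for k] by (intro choice) auto
 then obtain N where N: "!!k m n. m \<ge> N k ==> n \<ge> N k ==> (\<integral>x. (cmod (u m x - u n x))\<^sup>2 \<partial>M) < (1 / 8) ^ k"
  by blast
 \<comment> \<open>Summing makes \<open>r l\<close> exceed \<open>N k\<close> for every
   \<open>k\<close> up to \<open>l\<close>, although \<open>N\<close> need not be monotone.\<close>
 define r where "r k = (\<Sum>i\<le>k. N i)" for k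
 have r_ge: "N k \<le> r l" if "k \<le> l" for k l
  unfolding r_def using that by (intro member_le_sum) auto
 define d where "d k x = cmod (u (r (Suc k)) x - u (r k) x)" for k x
 have [measurable]: "d k \<in> borel_measurable M" for k unfolding d_def by measurable
 have "(\<integral>\<^sup>+x. (\<Sum>k. ennreal (2 ^ k * (d k x)\<^sup>2)) \<partial>M) = (\<Sum>k. \<integral>\<^sup>+x. ennreal (2 ^ k * (d k x)\<^sup>2) \<partial>M)"
  by (rule nn_integral_suminf) measurable
 also have "... \<le> (\<Sum>k. ennreal ((1 / 4) ^ k))"
 proof (rule suminf_le)
  fix k
  have "(\<integral>\<^sup>+x. ennreal (2 ^ k * (d k x)\<^sup>2) \<partial>M) = ennreal (2 ^ k * (\<integral>x. (d k x)\<^sup>2 \<partial>M))"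
   using int[of "r (Suc k)" "r k"] by (subst nn_integral_eq_integral) (auto simp: d_def)
  also have "2 ^ k * (\<integral>x. (d k x)\<^sup>2 \<partial>M) \<le> 2 ^ k * (1 / 8) ^ k"
   unfolding d_def by (intro mult_left_mono less_imp_le[OF N] r_ge) auto
  also have "2 ^ k * (1 / 8) ^ k = (1 / 4 :: real) ^ k"
   by (simp flip: power_mult_distrib)
  finally show "(\<integral>\<^sup>+x. ennreal (2 ^ k * (d k x)\<^sup>2) \<partial>M) \<le> ennreal ((1 / 4) ^ k)"
   by (simp add: ennreal_leI)
 qed auto
 also have "... = ennreal (\<Sum>k. (1 / 4) ^ k)"
  by (intro suminf_ennreal2) auto
 finally have "(\<integral>\<^sup>+x. (\<Sum>k. ennreal (2 ^ k * (d k x)\<^sup>2)) \<partial>M) \<le> ennreal (\<Sum>k. (1 / 4) ^ k)" .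
 from neq_top_trans[OF ennreal_neq_top this]
 have "(\<integral>\<^sup>+x. (\<Sum>k. ennreal (2 ^ k * (d k x)\<^sup>2)) \<partial>M) \<noteq> \<infinity>"
  by (simp only: infinity_ennreal_def not_False_eq_True)
 then have "AE x in M. (\<Sum>k. ennreal (2 ^ k * (d k x)\<^sup>2)) \<noteq> \<infinity>"
  by (rule nn_integral_PInf_AE[rotated]) measurable
 then have conv: "AE x in M. convergent (%k. u (r k) x)"
 proof eventually_elim
  case (elim x)
  define C where "C = enn2real (\<Sum>k. ennreal (2 ^ k * (d k x)\<^sup>2))"
  have C: "(\<Sum>k. ennreal (2 ^ k * (d k x)\<^sup>2)) = ennreal C" "C \<ge> 0"
   unfolding C_def using elim
   by (rule_tac ennreal_enn2real[symmetric], simp only: less_top infinity_ennreal_def) (rule enn2real_nonneg)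
  have b: "d k x \<le> sqrt C * (sqrt (1 / 2)) ^ k" for k
  proof -
   have "ennreal (2 ^ k * (d k x)\<^sup>2) \<le> ennreal C"
   proof -
    have "(\<Sum>i\<in>{k}. ennreal (2 ^ i * (d i x)\<^sup>2)) \<le> (\<Sum>i. ennreal (2 ^ i * (d i x)\<^sup>2))"
     by (rule sum_le_suminf) simp_all
    then show ?thesis unfolding C(1) by simp
   qed
   then have "2 ^ k * (d k x)\<^sup>2 \<le> C"
    using C(2) by simp
   then have "(d k x)\<^sup>2 \<le> C * (1 / 2) ^ k"
    by (simp add: power_one_over field_simps)
   then have "sqrt ((d k x)\<^sup>2) \<le> sqrt (C * (1 / 2) ^ k)"
    by (rule real_sqrt_le_mono)
   then show ?thesis
    by (simp add: d_def real_sqrt_mult real_sqrt_power real_sqrt_divide power_divide)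
  qed
  have "summable (%k. u (r (Suc k)) x - u (r k) x)"
  proof (rule summable_comparison_test')
   show "summable (%k. sqrt C * (sqrt (1 / 2)) ^ k)"
    by (intro summable_mult summable_geometric) (simp add: real_sqrt_divide)
   show "norm (u (r (Suc k)) x - u (r k) x) \<le> sqrt C * sqrt (1 / 2) ^ k" for k
    using b[of k] by (simp add: d_def)
  qed
  then have "convergent (%n. \<Sum>k<n. u (r (Suc k)) x - u (r k) x)"
   by (simp add: summable_iff_convergent)
  then have "convergent (%n. (u (r n) x - u (r 0) x) + u (r 0) x)"
   unfolding sum_lessThan_telescope[where f = "%k. u (r k) x"] by (rule convergent_add[OF _ convergent_const])
  then show ?case by simp
 qed
 define g where "g x = lim (%k. u (r k) x)" for x
 have [measurable]: "g \<in> borel_measurable M" unfolding g_def by measurable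
 have g: "AE x in M. (%k. u (r k) x) \<longlonglongrightarrow> g x"
  using conv by eventually_elim (simp add: g_def convergent_LIMSEQ_iff)
 have est: "(\<integral>\<^sup>+x. ennreal ((cmod (u n x - g x))\<^sup>2) \<partial>M) \<le> ennreal ((1 / 8) ^ k)" if "n \<ge> N k" for n k
 proof -
  have "(\<integral>\<^sup>+x. ennreal ((cmod (u n x - g x))\<^sup>2) \<partial>M) =
    (\<integral>\<^sup>+x. liminf (%l. ennreal ((cmod (u n x - u (r l) x))\<^sup>2)) \<partial>M)"
  proof (rule nn_integral_cong_AE)
   show "AE x in M. ennreal ((cmod (u n x - g x))\<^sup>2) = liminf (%l. ennreal ((cmod (u n x - u (r l) x))\<^sup>2))"
    using g
   proof eventually_elim
    case (elim x)
    have "(%l. ennreal ((cmod (u n x - u (r l) x))\<^sup>2)) \<longlonglongrightarrow> ennreal ((cmod (u n x - g x))\<^sup>2)"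
     by (intro tendsto_intros tendsto_ennrealI elim)
    from lim_imp_Liminf[OF trivial_limit_sequentially this] show ?case by (rule sym)
   qed
  qed
  also have "... \<le> liminf (%l. \<integral>\<^sup>+x. ennreal ((cmod (u n x - u (r l) x))\<^sup>2) \<partial>M)"
   by (rule nn_integral_liminf) measurable
  also have "... \<le> ennreal ((1 / 8) ^ k)"
  proof (rule Liminf_le)
   show "\<forall>\<^sub>F l in sequentially. (\<integral>\<^sup>+x. ennreal ((cmod (u n x - u (r l) x))\<^sup>2) \<partial>M) \<le> ennreal ((1 / 8) ^ k)"
    using eventually_ge_at_top[of k]
   proof eventually_elim
    case (elim l)
    then show ?case
     using N[OF that r_ge[OF elim]] int by (subst nn_integral_eq_integral) (auto intro!: ennreal_leI)
   qed
  qed (rule trivial_limit_sequentially)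
  finally show ?thesis .
 qed
 have intg: "integrable M (%x. (cmod (u n x - g x))\<^sup>2)" if "n \<ge> N k" for n k
  by (rule integrableI_nonneg) (use le_less_trans[OF est[OF that]] in simp_all)
 have "square_integrable M (%x. u (N 0) x - g x)"
  using intg[OF order_refl, of 0] by (simp add: square_integrable_def)
 from square_integrable_diff[OF sq this, of "N 0"] have "square_integrable M g" by simp
 moreover have "(%n. \<integral>x. (cmod (u n x - g x))\<^sup>2 \<partial>M) \<longlonglongrightarrow> 0"
 proof (rule LIMSEQ_I)
  fix e :: real assume "e > 0"
  then obtain k where k: "(1 / 8) ^ k < e" using real_arch_pow_inv[of e "1 / 8"] by auto
  have "(\<integral>x. (cmod (u n x - g x))\<^sup>2 \<partial>M) \<le> (1 / 8) ^ k" if "n \<ge> N k" for n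
   using est[OF that] intg[OF that] by (subst (asm) nn_integral_eq_integral) auto
  from le_less_trans[OF this k]
  have "norm ((\<integral>x. (cmod (u n x - g x))\<^sup>2 \<partial>M) - 0) < e" if "n \<ge> N k" for n
   using that by simp
  then show "\<exists>no. \<forall>n\<ge>no. norm ((\<integral>x. (cmod (u n x - g x))\<^sup>2 \<partial>M) - 0) < e"
   by blast
 qed
 ultimately show ?thesis by blast
qed

section \<open>Representatives of classes in \<open>L2\<close> and completeness\<close>

lemma square_integrable_rep [simp]: "square_integrable lborel (rep_L2 F)"
 using Quotient3_rep_reflp[OF Quotient3_L2, of F] by (simp add: L2_eq_def)

lemma abs_rep_L2 [simp]: "abs_L2 (rep_L2 F) = F"
 using Quotient3_abs_rep[OF Quotient3_L2] by simp

lemma abs_L2_eq_iff: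
 assumes "square_integrable lborel f" "square_integrable lborel g"
 shows "abs_L2 f = abs_L2 g \<longleftrightarrow> (AE x in lborel. f x = g x)"
 using Quotient3_rel[OF Quotient3_L2, of f g] assms by (auto simp: L2_eq_def)

lemma rep_abs_L2:
 assumes "square_integrable lborel f" shows "AE x in lborel. rep_L2 (abs_L2 f) x = f x"
 using abs_L2_eq_iff[OF square_integrable_rep assms, of "abs_L2 f"] by simp

lemma abs_L2_add:
 "square_integrable lborel f ==> square_integrable lborel g ==> abs_L2 f + abs_L2 g = abs_L2 (%x. f x + g x)"
 by (rule plus_L2.abs_eq) (auto simp: L2_eq_def)

lemma abs_L2_diff:
 "square_integrable lborel f ==> square_integrable lborel g ==> abs_L2 f - abs_L2 g = abs_L2 (%x. f x - g x)"
 by (rule minus_L2.abs_eq) (auto simp: L2_eq_def)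

lemma abs_L2_scaleC:
 "square_integrable lborel f ==> a *\<^sub>C abs_L2 f = abs_L2 (%x. a * f x)"
 by (rule scaleC_L2.abs_eq) (auto simp: L2_eq_def)

lemma abs_L2_scaleR:
 "square_integrable lborel f ==> a *\<^sub>R abs_L2 f = abs_L2 (%x. a *\<^sub>R f x)"
 by (rule scaleR_L2.abs_eq) (auto simp: L2_eq_def)

lemma abs_L2_zero: "abs_L2 (%x. 0) = 0"
 by (simp add: zero_L2_def)

lemma inner_abs_L2:
 "square_integrable lborel f ==> square_integrable lborel g ==> abs_L2 f \<bullet> abs_L2 g = (LBINT x. f x \<bullet> g x)"
 by (rule inner_L2.abs_eq) (auto simp: L2_eq_def)

lemma L2_cases:
 obtains f where "square_integrable lborel f" "F = abs_L2 f"
 by (rule that[of "rep_L2 F"]) auto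

lemma norm_L2_rep: "(norm F)\<^sup>2 = (LBINT x. (cmod (rep_L2 F x))\<^sup>2)"
 using norm_L2_abs[OF square_integrable_rep[of F]] by simp

lemma norm_diff_L2_rep: "(norm (F - G))\<^sup>2 = (LBINT x. (cmod (rep_L2 F x - rep_L2 G x))\<^sup>2)"
 using norm_L2_abs[OF square_integrable_diff[OF square_integrable_rep square_integrable_rep], of F G]
 by (simp flip: abs_L2_diff)

instance L2 :: complete_space
proof
 fix X :: "nat => L2" assume X: "Cauchy X"
 have "\<exists>g. square_integrable lborel g \<and> (%n. \<integral>x. (cmod (rep_L2 (X n) x - g x))\<^sup>2 \<partial>lborel) \<longlonglongrightarrow> 0"
 proof (rule square_integrable_complete)
  fix e :: real assume "e > 0"
  then obtain N where N: "\<forall>m\<ge>N. \<forall>n\<ge>N. dist (X m) (X n) < sqrt e"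
   using X unfolding Cauchy_def by (meson real_sqrt_gt_zero)
  have "(norm (X m - X n))\<^sup>2 < e" if "m \<ge> N" "n \<ge> N" for m n
  proof -
   have "norm (X m - X n) < sqrt e" using N that by (simp add: dist_norm)
   then have "(norm (X m - X n))\<^sup>2 < (sqrt e)\<^sup>2" by (intro power_strict_mono) auto
   then show ?thesis using \<open>e > 0\<close> by simp
  qed
  then show "\<exists>N. \<forall>m\<ge>N. \<forall>n\<ge>N. (LBINT x. (cmod (rep_L2 (X m) x - rep_L2 (X n) x))\<^sup>2) < e"
   by (auto simp: norm_diff_L2_rep)
 qed simp
 then obtain g where g: "square_integrable lborel g"
  "(%n. \<integral>x. (cmod (rep_L2 (X n) x - g x))\<^sup>2 \<partial>lborel) \<longlonglongrightarrow> 0" by blast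
 have "norm (X n - abs_L2 g) = sqrt (LBINT x. (cmod (rep_L2 (X n) x - g x))\<^sup>2)" for n
  using norm_L2_abs[OF square_integrable_diff[OF square_integrable_rep g(1)], of "X n"]
  by (simp add: g flip: abs_L2_diff)
 then have "(%n. norm (X n - abs_L2 g)) \<longlonglongrightarrow> 0"
  using tendsto_real_sqrt[OF g(2)] by simp
 then have "X \<longlonglongrightarrow> abs_L2 g"
  by (simp add: LIM_zero_iff tendsto_norm_zero_iff)
 then show "convergent X" by (auto simp: convergent_def)
qed

text \<open>A minimising sequence is Cauchy by the parallelogram law, because midpoints stay in
  \<open>V\<close>; at the minimiser the first variation vanishes in every direction of
  \<open>V\<close>.\<close>

lemma orthogonal_projection_exists:
 fixes V :: "'a::{real_inner, complete_space} set"
 assumes V: "closed V" "subspace V"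
 shows "\<exists>p\<in>V. \<forall>v\<in>V. (x - p) \<bullet> v = 0"
proof -
 define D where "D = Inf ((%v. (norm (x - v))\<^sup>2) ` V)"
 have V0: "0 \<in> V" using V by (simp add: subspace_0)
 have bdd: "bdd_below ((%v. (norm (x - v))\<^sup>2) ` V)" by (intro bdd_belowI2[of _ 0]) auto
 have D_le: "D \<le> (norm (x - v))\<^sup>2" if "v \<in> V" for v
  unfolding D_def by (rule cInf_lower[OF imageI[OF that] bdd])
 have "\<exists>v\<in>V. (norm (x - v))\<^sup>2 < D + e" if "e > 0" for e
 proof -
  have "\<exists>t\<in>(%v. (norm (x - v))\<^sup>2) ` V. t < D + e"
   using that V0 bdd cInf_less_iff[of "(%v. (norm (x - v))\<^sup>2) ` V" "D + e"] unfolding D_def by auto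
  then show ?thesis by auto
 qed
 then have "\<exists>v\<in>V. (norm (x - v))\<^sup>2 < D + 1 / (real n + 1)" for n by simp
 then obtain y where y: "!!n. y n \<in> V" "!!n. (norm (x - y n))\<^sup>2 < D + 1 / (real n + 1)" by metis
 have par: "(norm (y m - y n))\<^sup>2 \<le> 2 / (real m + 1) + 2 / (real n + 1)" for m n
 proof -
  have "(1/2) *\<^sub>R (y m + y n) \<in> V" using V y by (simp add: subspace_add subspace_scale)
  from D_le[OF this] have "4 * D \<le> 4 * (norm (x - (1/2) *\<^sub>R (y m + y n)))\<^sup>2" by simp
  also have "... = (norm (2 *\<^sub>R (x - (1/2) *\<^sub>R (y m + y n))))\<^sup>2" by (simp add: power_mult_distrib)
  also have "2 *\<^sub>R (x - (1/2) *\<^sub>R (y m + y n)) = (x - y m) + (x - y n)"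
   by (simp add: algebra_simps scaleR_2)
  finally have a: "4 * D \<le> (norm ((x - y m) + (x - y n)))\<^sup>2" .
  have "(norm (y m - y n))\<^sup>2 = 2 * (norm (x - y m))\<^sup>2 + 2 * (norm (x - y n))\<^sup>2 - (norm ((x - y m) + (x - y n)))\<^sup>2"
   unfolding power2_norm_eq_inner by (simp add: inner_add_left inner_add_right inner_diff_left inner_diff_right inner_commute)
  moreover have "2 / (real k + 1) = 2 * (1 / (real k + 1))" for k by simp
  ultimately show ?thesis using a y(2)[of m] y(2)[of n] by linarith
 qed
 have "Cauchy y"
 proof (rule metric_CauchyI)
  fix e :: real assume "e > 0"
  obtain N :: nat where N: "4 / e\<^sup>2 < real N" using reals_Archimedean2 by blast
  have "dist (y m) (y n) < e" if "m \<ge> N" "n \<ge> N" for m n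
  proof -
   have "2 / (real m + 1) + 2 / (real n + 1) \<le> 4 / (real N + 1)"
   proof -
    have "2 / (real m + 1) \<le> 2 / (real N + 1)" "2 / (real n + 1) \<le> 2 / (real N + 1)"
     using that by (auto intro!: divide_left_mono)
    then show ?thesis by simp
   qed
   also have "... < e\<^sup>2"
   proof -
    have "4 < real N * e\<^sup>2" using N \<open>e > 0\<close> by (simp add: field_simps)
    also have "... \<le> e\<^sup>2 * (real N + 1)" by (simp add: algebra_simps)
    finally show ?thesis by (simp add: field_simps)
   qed
   finally have "(norm (y m - y n))\<^sup>2 < e\<^sup>2" using par[of m n] by simp
   then show ?thesis using \<open>e > 0\<close> power2_less_imp_less[of "norm (y m - y n)" e] by (simp add: dist_norm)
  qed
  then show "\<exists>M. \<forall>m\<ge>M. \<forall>n\<ge>M. dist (y m) (y n) < e" by blast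
 qed
 then obtain p where p: "y \<longlonglongrightarrow> p" using Cauchy_convergent_iff convergent_def by blast
 have pV: "p \<in> V" using closed_sequentially[OF V(1)] y(1) p by blast
 have "(%n. (norm (x - y n))\<^sup>2) \<longlonglongrightarrow> (norm (x - p))\<^sup>2" by (intro tendsto_intros p)
 moreover have "(%n. D + 1 / (real n + 1)) \<longlonglongrightarrow> D + 0"
  by (intro tendsto_intros) real_asymp
 ultimately have min: "(norm (x - p))\<^sup>2 \<le> D"
  using LIMSEQ_le[of "%n. (norm (x - y n))\<^sup>2" "(norm (x - p))\<^sup>2" "%n. D + 1 / (real n + 1)" D]
   y(2)[THEN less_imp_le] by simp
 have "(x - p) \<bullet> v = 0" if v: "v \<in> V" for v
 proof (cases "v = 0")
  case False
  \<comment> \<open>The multiple of \<open>v\<close> nearest to \<open>x - p\<close>. Moving there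
    would lower the squared distance by the square of the inner product divided by
    \<open>v \<bullet> v\<close>, which minimality forbids unless it is 0.\<close>
  define t where "t = ((x - p) \<bullet> v) / (v \<bullet> v)"
  have "p + t *\<^sub>R v \<in> V" using V v pV by (simp add: subspace_add subspace_scale)
  from D_le[OF this] min have "(norm (x - p))\<^sup>2 \<le> (norm ((x - p) - t *\<^sub>R v))\<^sup>2"
   unfolding diff_diff_eq by linarith
  also have "... = (norm (x - p))\<^sup>2 - 2 * t * ((x - p) \<bullet> v) + t\<^sup>2 * (v \<bullet> v)"
   unfolding power2_norm_eq_inner
   by (simp add: inner_diff_left[of "x - p"] inner_diff_right[of _ "x - p"] inner_commute power2_eq_square algebra_simps)
  also have "... = (norm (x - p))\<^sup>2 - ((x - p) \<bullet> v)\<^sup>2 / (v \<bullet> v)"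
   using False by (simp add: t_def power2_eq_square field_simps)
  finally have "((x - p) \<bullet> v)\<^sup>2 / (v \<bullet> v) \<le> 0" by simp
  moreover have "v \<bullet> v > 0" using False by simp
  ultimately have "((x - p) \<bullet> v)\<^sup>2 \<le> 0" by (simp only: pos_divide_le_eq mult_zero_left)
  then show ?thesis by simp
 qed simp
 with pV show ?thesis by blast
qed

text \<open>For a coercive operator, \<open>u \<mapsto> u - rho P (L u - r)\<close>, with \<open>P\<close> the orthogonal projection onto \<open>V\<close>,
 is a contraction for small \<open>rho\<close>.\<close>

lemma lax_milgram_exists:
 fixes V :: "'a::{real_inner, complete_space} set" and L :: "'a => 'a"
 assumes V: "closed V" "subspace V" and L: "bounded_linear L" and \<kappa>: "\<kappa> > 0"
  and coercive: "!!v. v \<in> V ==> \<kappa> * (norm v)\<^sup>2 \<le> L v \<bullet> v"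
 shows "\<exists>u\<in>V. \<forall>v\<in>V. L u \<bullet> v = r \<bullet> v"
proof -
 have "\<forall>x. \<exists>p. p \<in> V \<and> (\<forall>v\<in>V. (x - p) \<bullet> v = 0)"
  using orthogonal_projection_exists[OF V] by blast
 then obtain P where "\<forall>x. P x \<in> V \<and> (\<forall>v\<in>V. (x - P x) \<bullet> v = 0)"
  using choice[of "%x p. p \<in> V \<and> (\<forall>v\<in>V. (x - p) \<bullet> v = 0)"] by blast
 then have P0: "P x \<in> V" "v \<in> V ==> (x - P x) \<bullet> v = 0" for x v by blast+
 have P: "P x \<in> V" "v \<in> V ==> P x \<bullet> v = x \<bullet> v" for x v
  using P0(1)[of x] P0(2)[of v x] by (simp_all add: inner_diff_left)
 obtain B0 where B0: "!!x. norm (L x) \<le> norm x * B0" using bounded_linear.bounded[OF L] by blast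
 \<comment> \<open>Enlarging the bound to at least \<kappa> makes it positive and keeps
   \<open>1 - \<kappa>\<^sup>2 / B\<^sup>2\<close> nonnegative.\<close>
 define B where "B = max B0 \<kappa>"
 have B: "norm (L x) \<le> B * norm x" "B > 0" "B \<ge> \<kappa>" for x
 proof -
  have "norm x * B0 \<le> norm x * B" by (intro mult_left_mono) (auto simp: B_def)
  then show "norm (L x) \<le> B * norm x" using B0[of x] by (simp add: mult.commute)
 qed (use \<kappa> in \<open>auto simp: B_def\<close>)
 \<comment> \<open>The minimiser of \<open>1 - 2 * rho * \<kappa> + rho\<^sup>2 * B\<^sup>2\<close>,
   the bound for the squared contraction factor; its minimum is \<open>c\<^sup>2\<close>.\<close>
 define rho where "rho = \<kappa> / B\<^sup>2"
 define c where "c = sqrt (1 - \<kappa>\<^sup>2 / B\<^sup>2)"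
 have q: "\<kappa>\<^sup>2 / B\<^sup>2 \<le> 1" using B \<kappa> by (simp add: power_mono)
 have c: "0 \<le> c" "c < 1" "c\<^sup>2 = 1 - \<kappa>\<^sup>2 / B\<^sup>2" using q \<kappa> B by (auto simp: c_def)
 define f where "f u = u - rho *\<^sub>R P (L u - r)" for u
 have contr: "dist (f u) (f w) \<le> c * dist u w" if "u \<in> V" "w \<in> V" for u w
 proof -
  define e where "e = u - w"
  have e: "e \<in> V" using that V by (simp add: e_def subspace_diff)
  define h where "h = P (L u - r) - P (L w - r)"
  have hV: "h \<in> V" using P V by (simp add: h_def subspace_diff)
  have h: "h \<bullet> v = L e \<bullet> v" if "v \<in> V" for v
   using that P(2) linear_diff[OF bounded_linear.linear[OF L], of u w]
   by (simp add: h_def e_def inner_diff_left)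
  have "h \<bullet> h = L e \<bullet> h" using h hV by blast
  also have "... \<le> norm (L e) * norm h" by (rule norm_cauchy_schwarz)
  finally have "norm h * norm h \<le> norm (L e) * norm h" by (simp add: power2_norm_eq_inner flip: power2_eq_square)
  then have "h \<noteq> 0 ==> norm h \<le> norm (L e)" by simp
  then have "norm h \<le> B * norm e" using B(1)[of e] B(2) by (cases "h = 0") simp_all
  then have hh: "(norm h)\<^sup>2 \<le> B\<^sup>2 * (norm e)\<^sup>2" by (simp add: power_mono flip: power_mult_distrib)
  have "(norm (f u - f w))\<^sup>2 = (norm (e - rho *\<^sub>R h))\<^sup>2"
   by (simp add: f_def e_def h_def algebra_simps)
  also have "... = (norm e)\<^sup>2 - 2 * rho * (h \<bullet> e) + rho\<^sup>2 * (norm h)\<^sup>2"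
   unfolding power2_norm_eq_inner
   by (simp add: inner_diff_left inner_diff_right inner_commute power2_eq_square algebra_simps)
  also have "... \<le> (norm e)\<^sup>2 - 2 * rho * (\<kappa> * (norm e)\<^sup>2) + rho\<^sup>2 * (B\<^sup>2 * (norm e)\<^sup>2)"
   using coercive[OF e] hh h[OF e] \<kappa> B by (intro add_mono diff_mono mult_left_mono) (auto simp: rho_def)
  also have "... = (norm e)\<^sup>2 - 2 * ((rho * \<kappa>) * (norm e)\<^sup>2) + (rho\<^sup>2 * B\<^sup>2) * (norm e)\<^sup>2"
   by (simp add: mult.assoc)
  also have "... = (c * norm e)\<^sup>2"
  proof -
   have r: "rho * \<kappa> = \<kappa>\<^sup>2 / B\<^sup>2" "rho\<^sup>2 * B\<^sup>2 = \<kappa>\<^sup>2 / B\<^sup>2"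
    using B(2) by (simp_all add: rho_def field_simps power2_eq_square)
   show ?thesis unfolding r power_mult_distrib c(3) by (simp add: algebra_simps)
  qed
  finally have "norm (f u - f w) \<le> c * norm e" using c(1) by (simp add: power2_le_iff_abs_le)
  then show ?thesis by (simp add: dist_norm e_def)
 qed
 have "\<exists>!u\<in>V. f u = u"
 proof (rule Banach_fix)
  show "complete V" using V complete_eq_closed by blast
  show "V \<noteq> {}" using V subspace_0 by blast
  show "f ` V \<subseteq> V" using V P by (auto simp: f_def intro!: subspace_diff subspace_scale)
 qed (use c contr in auto)
 then obtain u where u: "u \<in> V" "f u = u" by blast
 then have "P (L u - r) = 0" using \<kappa> B by (simp add: f_def rho_def)
 then have "(L u - r) \<bullet> v = 0" if "v \<in> V" for v using P(2)[OF that, of "L u - r"] by simp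
 with u(1) show ?thesis by (auto simp: inner_diff_left)
qed

section \<open>Integration by parts and the fundamental lemma\<close>

lemma real_plane_pos_between:
 fixes c d t :: real
 assumes "c < d" shows "0 < (t - c) * (d - t) \<longleftrightarrow> c < t \<and> t < d"
 using assms by (auto simp: zero_less_mult_iff)

text \<open>For a nonempty box the products are positive exactly inside the intervals, so with
  growing \<open>n\<close> the steps become 1 at every point of the open box, while the cutoff stays
  0 off it. Indicators of boxes thus are bounded limits of test functions.\<close>

definition box_cutoff :: "real^2 => real^2 => nat => real^2 => real" where
 "box_cutoff c d n x = step (real n * ((x $ 1 - c $ 1) * (d $ 1 - x $ 1)))
   * step (real n * ((x $ 2 - c $ 2) * (d $ 2 - x $ 2)))"

lemma box_vec2: "x \<in> box c d \<longleftrightarrow> c $ 1 < x $ 1 \<and> x $ 1 < d $ 1 \<and> c $ 2 < x $ 2 \<and> x $ 2 < d $ 2"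
 for x :: "real^2"
 by (auto simp: mem_box_cart forall_2)

lemma cbox_vec2: "x \<in> cbox c d \<longleftrightarrow> c $ 1 \<le> x $ 1 \<and> x $ 1 \<le> d $ 1 \<and> c $ 2 \<le> x $ 2 \<and> x $ 2 \<le> d $ 2"
 for x :: "real^2"
 by (auto simp: mem_box_cart forall_2)

lemma box_cutoff_bounds: "0 \<le> box_cutoff c d n x" "box_cutoff c d n x \<le> 1"
 by (auto simp: box_cutoff_def step_nonneg step_le_1 mult_le_one)

lemma box_cutoff_outside:
 assumes "box c d \<noteq> {}" "x \<notin> box c d" shows "box_cutoff c d n x = 0"
proof -
 have "c $ 1 < d $ 1" "c $ 2 < d $ 2"
  using assms(1) by (auto simp: box_vec2 ex_in_conv[symmetric])
 then have "(x $ 1 - c $ 1) * (d $ 1 - x $ 1) \<le> 0 \<or> (x $ 2 - c $ 2) * (d $ 2 - x $ 2) \<le> 0"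
  using assms(2) real_plane_pos_between by (meson box_vec2 not_le)
 then have "real n * ((x $ 1 - c $ 1) * (d $ 1 - x $ 1)) \<le> 0 \<or> real n * ((x $ 2 - c $ 2) * (d $ 2 - x $ 2)) \<le> 0"
  by (auto intro: mult_nonneg_nonpos)
 then show ?thesis by (auto simp: box_cutoff_def step_nonpos)
qed

lemma box_cutoff_tendsto:
 assumes "box c d \<noteq> {}"
 shows "(%n. box_cutoff c d n x) \<longlonglongrightarrow> indicator (box c d) x"
proof (cases "x \<in> box c d")
 case True
 have *: "\<forall>\<^sub>F n in sequentially. step (real n * e) = 1" if "e > 0" for e
 proof -
  obtain N :: nat where N: "1 / e < real N" using reals_Archimedean2 by blast
  show ?thesis
   using eventually_ge_at_top[of N]
  proof eventually_elim
   case (elim n)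
   have "1 \<le> real N * e" using N that by (simp add: field_simps)
   also have "... \<le> real n * e" using elim that by (intro mult_right_mono) auto
   finally show ?case by (rule step_ge_1)
  qed
 qed
 have pos: "(x $ 1 - c $ 1) * (d $ 1 - x $ 1) > 0" "(x $ 2 - c $ 2) * (d $ 2 - x $ 2) > 0"
  using True by (auto simp: box_vec2)
 have "\<forall>\<^sub>F n in sequentially. indicator (box c d) x = box_cutoff c d n x"
  using *[OF pos(1)] *[OF pos(2)] by eventually_elim (simp add: box_cutoff_def True)
 then show ?thesis by (rule Lim_transform_eventually[OF tendsto_const])
qed (use assms in \<open>simp add: box_cutoff_outside\<close>)

lemma test_fun_box_cutoff:
 assumes "box c d \<noteq> {}" "cbox c d \<subseteq> \<Omega>"
 shows "test_fun \<Omega> (%x. complex_of_real (box_cutoff c d n x))"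
proof (rule test_funI[of _ "cbox c d"])
 have l: "smooth_fun (%x. complex_of_real (step (real n * ((x $ i - c $ i) * (d $ i - x $ i)))))" for i
  by (rule smooth_fun_step) (simp add: smooth_fun_mult smooth_fun_diff smooth_fun_coord)
 show "smooth_fun (%x. complex_of_real (box_cutoff c d n x))"
  using smooth_fun_mult[OF l[of 1] l[of 2]] by (simp add: box_cutoff_def)
 show "complex_of_real (box_cutoff c d n x) = 0" if "x \<notin> cbox c d" for x
  using box_cutoff_outside[OF assms(1), of x] that box_subset_cbox by auto
qed (use assms in auto)

text \<open>Dominated convergence along the cutoffs gives integral 0 over every smaller box. Boxes
  are stable under intersection and generate the Borel sets, so the integral vanishes over all Borel
  sets, and this determines the integrand almost everywhere.\<close>

lemma fundamental_lemma_box: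
 fixes f :: "real^2 => real"
 assumes int: "integrable lborel (%x. indicator (cbox a b) x * f x)"
  and test: "!!c d n. box c d \<noteq> {} ==> cbox c d \<subseteq> cbox a b ==> (LBINT x. f x * box_cutoff c d n x) = 0"
 shows "AE x in lborel. x \<in> box a b --> f x = 0"
proof -
 have Z: "(LBINT x. indicator (box c d) x * f x) = 0" if sub: "cbox c d \<subseteq> cbox a b" for c d
 proof (cases "box c d = {}")
  case False
  have m: "(%x. indicator (cbox a b) x * f x) \<in> borel_measurable borel" using int by auto
  have eq: "indicator (box c d) x * f x = indicator (box c d) x * (indicator (cbox a b) x * f x)"
   "f x * box_cutoff c d n x = (indicator (cbox a b) x * f x) * box_cutoff c d n x" for x n
   using sub box_subset_cbox[of c d] box_cutoff_outside[OF False, of x n]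
   by (auto simp: indicator_def)
  have bm: "box_cutoff c d n \<in> borel_measurable borel" for n
  proof -
   have "(%x. complex_of_real (box_cutoff c d n x)) \<in> borel_measurable borel"
    by (rule smooth_fun_measurable[OF test_fun_smooth[OF test_fun_box_cutoff[OF False order_refl]]])
   from measurable_compose[OF this borel_measurable_Re] show ?thesis by simp
  qed
  have "(%n. \<integral>x. f x * box_cutoff c d n x \<partial>lborel) \<longlonglongrightarrow> (LBINT x. indicator (box c d) x * f x)"
  proof (rule integral_dominated_convergence[where w = "%x. \<bar>indicator (cbox a b) x * f x\<bar>"])
   show "(%x. indicator (box c d) x * f x) \<in> borel_measurable lborel"
    unfolding eq(1) using m by simp
   show "(%x. f x * box_cutoff c d n x) \<in> borel_measurable lborel" for n
    unfolding eq(2) using m bm by simp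
   show "integrable lborel (%x. \<bar>indicator (cbox a b) x * f x\<bar>)" using int by (rule integrable_abs)
   show "AE x in lborel. (%n. f x * box_cutoff c d n x) \<longlonglongrightarrow> indicator (box c d) x * f x"
    by (intro AE_I2, subst (2) mult.commute) (intro tendsto_intros box_cutoff_tendsto False)
   show "AE x in lborel. norm (f x * box_cutoff c d n x) \<le> \<bar>indicator (cbox a b) x * f x\<bar>" for n
    unfolding eq(2) by (intro AE_I2) (simp add: abs_mult box_cutoff_bounds mult_left_le)
  qed
  then show ?thesis using test[OF False sub] by (simp add: LIMSEQ_const_iff)
 qed simp
 define g where "g x = indicator (box a b) x * f x" for x
 have geq: "g x = indicator (box a b) x *\<^sub>R (indicator (cbox a b) x * f x)" for x
  using box_subset_cbox[of a b] by (auto simp: g_def indicator_def)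
 have gint: "integrable lborel g"
  unfolding geq[abs_def] by (rule integrable_mult_indicator[OF _ int]) simp
 have gbox: "(LINT x:box c d|lborel. g x) = 0" for c d
 proof -
  define c' d' :: "real^2" where "c' = (\<chi> i. max (c $ i) (a $ i))" and "d' = (\<chi> i. min (d $ i) (b $ i))"
  have i: "box c d \<inter> box a b = box c' d'" by (auto simp: c'_def d'_def box_vec2)
  have "indicator (box c d) x *\<^sub>R g x = indicator (box c' d') x * f x" for x
   by (auto simp: g_def indicator_def simp flip: i)
  moreover have "(LBINT x. indicator (box c' d') x * f x) = 0"
   by (rule Z) (auto simp: c'_def d'_def cbox_vec2)
  ultimately show ?thesis by (simp add: set_lebesgue_integral_def)
 qed
 have "(LINT x:A|lborel. g x) = 0" if "A \<in> sets borel" for A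
 proof -
  have "Int_stable (range (%(a, b). box a b :: (real^2) set))"
   by (auto simp: Int_stable_def box_Int_box)
  moreover have "range (%(a, b). box a b :: (real^2) set) \<subseteq> Pow UNIV" by simp
  moreover have "A \<in> sigma_sets UNIV (range (%(a, b). box a b :: (real^2) set))"
   using that by (simp add: borel_eq_box)
  ultimately show ?thesis
  proof (induction rule: sigma_sets_induct_disjoint)
   case (basic A) then show ?case using gbox by auto
  next
   case empty then show ?case by (simp add: set_lebesgue_integral_def)
  next
   case (compl A)
   then have A: "A \<in> sets lborel" by (simp add: borel_eq_box)
   \<comment> \<open>Complements need the total integral; as \<open>g\<close> vanishes off
     \<open>box a b\<close>, it is the integral over one of the generating boxes.\<close>
   have "(LINT x:box a b|lborel. g x) = (LBINT x. g x)"
    unfolding set_lebesgue_integral_def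
    by (rule lint_cong) (auto simp: g_def indicator_def)
   then have 0: "(LBINT x. g x) = 0" using gbox by simp
   have "(LINT x:UNIV - A|lborel. g x) = (LBINT x. g x - indicator A x *\<^sub>R g x)"
    unfolding set_lebesgue_integral_def
    by (rule lint_cong) (auto simp: indicator_def)
   also have "... = (LBINT x. g x) - (LINT x:A|lborel. g x)"
    unfolding set_lebesgue_integral_def
    by (rule Bochner_Integration.integral_diff[OF gint integrable_mult_indicator[OF A gint]])
   finally show ?case using compl 0 by simp
  next
   case (union A)
   then have A: "!!i. A i \<in> sets lborel" by (auto simp: borel_eq_box)
   then have "(\<Union>i. A i) \<in> sets lborel" by auto
   have "(LINT x:(\<Union>i. A i)|lborel. g x) = (\<Sum>i. (LINT x:A i|lborel. g x))"
   proof (rule lebesgue_integral_countable_add)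
    show "set_integrable lborel (\<Union>i. A i) g"
     unfolding set_integrable_def by (rule integrable_mult_indicator) fact+
   qed (use A union in \<open>auto simp: disjoint_family_on_def\<close>)
   then show ?case using union by simp
  qed
 qed
 then have "AE x in lborel. g x = 0"
  using density_unique_real[OF gint, of "%x. 0"] by (simp add: set_lebesgue_integral_def)
 then show ?thesis by eventually_elim (auto simp: g_def)
qed

text \<open>Exceptional null sets may be united only countably often: the boxes inside \<Omega>
  cover it, and by Lindelof's theorem countably many of them suffice.\<close>

lemma fundamental_lemma_real:
 fixes f :: "real^2 => real"
 assumes "open \<Omega>"
  and int: "!!a b. cbox a b \<subseteq> \<Omega> ==> integrable lborel (%x. indicator (cbox a b) x * f x)"
  and test: "!!rho. test_fun \<Omega> (%x. complex_of_real (rho x)) ==> (LBINT x. f x * rho x) = 0"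
 shows "AE x in lborel. x \<in> \<Omega> --> f x = 0"
proof -
 define \<F> where "\<F> = {box a b | a b. cbox a b \<subseteq> \<Omega>}"
 have AE: "AE x in lborel. x \<in> U --> f x = 0" if "U \<in> \<F>" for U
 proof -
  obtain a b where U: "U = box a b" "cbox a b \<subseteq> \<Omega>" using \<open>U \<in> \<F>\<close> \<F>_def by auto
  show ?thesis unfolding U(1)
  proof (rule fundamental_lemma_box[OF int[OF U(2)]])
   fix c d :: "real^2" and n
   assume "box c d \<noteq> {}" "cbox c d \<subseteq> cbox a b"
   then show "(LBINT x. f x * box_cutoff c d n x) = 0"
    using U(2) by (intro test test_fun_box_cutoff) blast+
  qed
 qed
 have "\<Union>\<F> = \<Omega>"
 proof
  show "\<Union>\<F> \<subseteq> \<Omega>" using box_subset_cbox by (force simp: \<F>_def)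
  show "\<Omega> \<subseteq> \<Union>\<F>"
  proof
   fix x assume "x \<in> \<Omega>"
   with assms(1) obtain a b where "x \<in> box a b" "cbox a b \<subseteq> \<Omega>"
    by (rule open_contains_cbox)
   then show "x \<in> \<Union>\<F>" unfolding \<F>_def by blast
  qed
 qed
 moreover obtain \<F>' where "\<F>' \<subseteq> \<F>" "countable \<F>'" "\<Union>\<F>' = \<Union>\<F>"
  using Lindelof[of \<F>] by (auto simp: \<F>_def)
 moreover have "AE x in lborel. \<forall>U\<in>\<F>'. x \<in> U --> f x = 0"
  using AE calculation by (subst AE_ball_countable) auto
 ultimately show ?thesis by (auto elim!: eventually_mono)
qed

section \<open>Derivatives along lines, exchange of derivatives, integration by parts\<close>

abbreviation unit_vec :: "2 => real^2" where "unit_vec j \<equiv> axis j 1"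

lemma line_derivative:
 assumes "smooth_fun phi"
 shows "((%t. phi (x + t *\<^sub>R unit_vec j)) has_vector_derivative pd j phi (x + t *\<^sub>R unit_vec j)) (at t)"
proof -
 let ?D = "frechet_derivative phi (at (x + t *\<^sub>R unit_vec j))"
 have D: "(phi has_derivative ?D) (at (x + t *\<^sub>R unit_vec j))"
  by (rule has_derivative_frechet[OF smooth_fun_diffb[OF assms]])
 have "((%t. x + t *\<^sub>R unit_vec j) has_derivative (%h. h *\<^sub>R unit_vec j)) (at t)"
  by (auto intro!: derivative_eq_intros)
 from has_derivative_compose[OF this D]
 have "((%t. phi (x + t *\<^sub>R unit_vec j)) has_derivative (%h. ?D (h *\<^sub>R unit_vec j))) (at t)" .
 then show ?thesis
  by (simp add: has_vector_derivative_def pd_def linear_scale[OF has_derivative_linear[OF D]])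
qed

lemma line_derivative_Re:
 assumes "smooth_fun phi"
 shows "((%t. Re (phi (x + t *\<^sub>R unit_vec j))) has_real_derivative Re (pd j phi (x + t *\<^sub>R unit_vec j))) (at t)"
 using bounded_linear.has_vector_derivative[OF bounded_linear_Re line_derivative[OF assms]]
 by (simp add: has_real_derivative_iff_has_vector_derivative)

lemma pd_translate:
 assumes "smooth_fun phi"
 shows "pd j (%y. phi (y - x)) y = pd j phi (y - x)" "(%y. phi (y - x)) differentiable (at y)"
proof -
 let ?D = "frechet_derivative phi (at (y - x))"
 have "((%y. y - x) has_derivative (%h. h)) (at y)" by (auto intro!: derivative_eq_intros)
 from has_derivative_compose[OF this has_derivative_frechet[OF smooth_fun_diffb[OF assms]]]
 have *: "((%y. phi (y - x)) has_derivative ?D) (at y)" .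
 show "pd j (%y. phi (y - x)) y = pd j phi (y - x)" using pd_eq[OF *] by (simp add: pd_def)
 show "(%y. phi (y - x)) differentiable (at y)" using * by (auto simp: differentiable_def)
qed

lemma smooth_fun_translate:
 assumes "smooth_fun phi" shows "smooth_fun (%y. phi (y - x))"
proof -
 have "kdiff k (%y. phi (y - x))" if "smooth_fun phi" for k phi
  using that
 proof (induction k arbitrary: phi)
  case (Suc k)
  have "pd j (%y. phi (y - x)) = (%y. pd j phi (y - x))" for j
   by (rule ext) (rule pd_translate(1)[OF Suc.prems])
  then show ?case using Suc.IH[OF smooth_fun_pd[OF Suc.prems]] pd_translate(2)[OF Suc.prems] by simp
 qed (simp add: pd_translate(2))
 then show ?thesis using assms by (simp add: smooth_fun_iff_kdiff)
qed

lemma test_fun_translate: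
 assumes "test_fun UNIV phi" shows "test_fun UNIV (%y. phi (y - x))"
proof -
 obtain K where K: "compact K" "K \<subseteq> UNIV" "!!x. x \<notin> K ==> phi x = 0" "smooth_fun phi"
  by (rule test_funE[OF assms]) blast
 show ?thesis
 proof (rule test_funI[of _ "(%k. x + k) ` K"])
  show "compact ((%k. x + k) ` K)" by (rule compact_translation[OF K(1)])
  show "phi (y - x) = 0" if "y \<notin> (%k. x + k) ` K" for y
  proof (rule K(3), rule notI)
   assume "y - x \<in> K"
   then have "x + (y - x) \<in> (%k. x + k) ` K" by (rule imageI)
   with that show False by simp
  qed
 qed (use smooth_fun_translate[OF K(4)] in simp_all)
qed

lemma test_fun_support_cball:
 assumes "test_fun \<Omega> phi" shows "\<exists>R>0. \<forall>x. norm x > R --> phi x = 0"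
proof -
 obtain K where K: "compact K" "K \<subseteq> \<Omega>" "!!x. x \<notin> K ==> phi x = 0" "smooth_fun phi"
  by (rule test_funE[OF assms]) blast
 obtain R where "R > 0" "!!x. x \<in> K ==> norm x \<le> R"
  using compact_imp_bounded[OF K(1)] unfolding bounded_pos by blast
 then have "\<forall>x. norm x > R --> phi x = 0" using K(3) by (meson not_le)
 with \<open>R > 0\<close> show ?thesis by blast
qed

text \<open>Over a square of side \<open>t\<close> the second difference equals \<open>t * t\<close>
  times the mixed derivative at some inner point, for either order of the two directions; continuity
  lets both points shrink to \<open>x\<close>. The real part is taken because the mean value theorem
  is one for real functions; \<open>pd_commute\<close> gets the imaginary part from
  \<open>- \<i> * phi x\<close>.\<close>

lemma pd_commute_Re:
 assumes s: "smooth_fun phi"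
 shows "Re (pd i (pd j phi) x) = Re (pd j (pd i phi) x)"
proof (rule ccontr)
 let ?ei = "unit_vec i" and ?ej = "unit_vec j"
 have key: "\<exists>\<xi> \<eta>. 0 < \<xi> \<and> \<xi> < t \<and> 0 < \<eta> \<and> \<eta> < t \<and>
   Re (phi (x + t *\<^sub>R unit_vec i + t *\<^sub>R unit_vec j)) - Re (phi (x + t *\<^sub>R unit_vec j)) - Re (phi (x + t *\<^sub>R unit_vec i)) + Re (phi x)
   = t * t * Re (pd i (pd j phi) (x + \<xi> *\<^sub>R unit_vec i + \<eta> *\<^sub>R unit_vec j))" if "t > 0" for t and i j :: 2
 proof -
  \<comment> \<open>The increment in direction \<open>i\<close> as a function of the shift in
    direction \<open>j\<close>: the mean value theorem is applied to \<open>u\<close> first, then to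
    \<open>pd j phi\<close> in direction \<open>i\<close>.\<close>
  define u where "u r = Re (phi (x + t *\<^sub>R unit_vec i + r *\<^sub>R unit_vec j)) - Re (phi (x + r *\<^sub>R unit_vec j))" for r
  have "(u has_real_derivative Re (pd j phi (x + t *\<^sub>R unit_vec i + r *\<^sub>R unit_vec j)) - Re (pd j phi (x + r *\<^sub>R unit_vec j))) (at r)" for r
   unfolding u_def by (intro DERIV_diff line_derivative_Re s)
  from MVT2[OF that this] obtain \<eta> where \<eta>: "0 < \<eta>" "\<eta> < t"
   "u t - u 0 = (t - 0) * (Re (pd j phi (x + t *\<^sub>R unit_vec i + \<eta> *\<^sub>R unit_vec j)) - Re (pd j phi (x + \<eta> *\<^sub>R unit_vec j)))" by blast
  have "\<exists>\<xi>>0. \<xi> < t \<and> Re (pd j phi ((x + \<eta> *\<^sub>R unit_vec j) + t *\<^sub>R unit_vec i)) - Re (pd j phi ((x + \<eta> *\<^sub>R unit_vec j) + 0 *\<^sub>R unit_vec i))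
    = (t - 0) * Re (pd i (pd j phi) ((x + \<eta> *\<^sub>R unit_vec j) + \<xi> *\<^sub>R unit_vec i))"
   by (rule MVT2[OF that]) (rule line_derivative_Re[OF smooth_fun_pd[OF s]])
  then obtain \<xi> where \<xi>: "0 < \<xi>" "\<xi> < t" "Re (pd j phi (x + t *\<^sub>R unit_vec i + \<eta> *\<^sub>R unit_vec j)) - Re (pd j phi (x + \<eta> *\<^sub>R unit_vec j))
    = t * Re (pd i (pd j phi) (x + \<xi> *\<^sub>R unit_vec i + \<eta> *\<^sub>R unit_vec j))"
   by (auto simp: add.commute add.left_commute)
  have "u t - u 0 = t * t * Re (pd i (pd j phi) (x + \<xi> *\<^sub>R unit_vec i + \<eta> *\<^sub>R unit_vec j))"
   using \<eta>(3) \<xi>(3) by simp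
  then show ?thesis using \<xi>(1,2) \<eta>(1,2) by (intro exI[of _ \<xi>] exI[of _ \<eta>]) (simp add: u_def)
 qed
 define e where "e = \<bar>Re (pd i (pd j phi) x) - Re (pd j (pd i phi) x)\<bar> / 2"
 assume "Re (pd i (pd j phi) x) \<noteq> Re (pd j (pd i phi) x)"
 then have "e > 0" by (simp add: e_def)
 have cont: "\<exists>d>0. \<forall>y. dist y x < d --> \<bar>Re (pd i (pd j phi) y) - Re (pd i (pd j phi) x)\<bar> < e" for i j
 proof -
  have "continuous_on UNIV (%y. Re (pd i (pd j phi) y))"
   by (intro continuous_intros smooth_fun_continuous smooth_fun_pd s)
  then show ?thesis using \<open>e > 0\<close> unfolding continuous_on_iff by (auto simp: dist_real_def)
 qed
 obtain d1 where d1: "d1 > 0" "!!y. dist y x < d1 ==> \<bar>Re (pd i (pd j phi) y) - Re (pd i (pd j phi) x)\<bar> < e"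
  using cont[of i j] by blast
 obtain d2 where d2: "d2 > 0" "!!y. dist y x < d2 ==> \<bar>Re (pd j (pd i phi) y) - Re (pd j (pd i phi) x)\<bar> < e"
  using cont[of j i] by blast
 define t where "t = min d1 d2 / 2"
 have t: "t > 0" "2 * t \<le> d1" "2 * t \<le> d2" using d1 d2 by (auto simp: t_def)
 obtain a b where ab: "0 < a" "a < t" "0 < b" "b < t"
   "Re (phi (x + t *\<^sub>R ?ei + t *\<^sub>R ?ej)) - Re (phi (x + t *\<^sub>R ?ej)) - Re (phi (x + t *\<^sub>R ?ei)) + Re (phi x)
   = t * t * Re (pd i (pd j phi) (x + a *\<^sub>R ?ei + b *\<^sub>R ?ej))" using key[OF t(1), of i j] by blast
 obtain a' b' where ab': "0 < a'" "a' < t" "0 < b'" "b' < t"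
   "Re (phi (x + t *\<^sub>R ?ej + t *\<^sub>R ?ei)) - Re (phi (x + t *\<^sub>R ?ei)) - Re (phi (x + t *\<^sub>R ?ej)) + Re (phi x)
   = t * t * Re (pd j (pd i phi) (x + a' *\<^sub>R ?ej + b' *\<^sub>R ?ei))" using key[OF t(1), of j i] by blast
 have "t * t * Re (pd i (pd j phi) (x + a *\<^sub>R ?ei + b *\<^sub>R ?ej)) = t * t * Re (pd j (pd i phi) (x + a' *\<^sub>R ?ej + b' *\<^sub>R ?ei))"
 proof -
  have "x + t *\<^sub>R ?ej + t *\<^sub>R ?ei = x + t *\<^sub>R ?ei + t *\<^sub>R ?ej" by (simp add: algebra_simps)
  from ab(5) ab'(5)[unfolded this] show ?thesis by linarith
 qed
 then have eq: "Re (pd i (pd j phi) (x + a *\<^sub>R ?ei + b *\<^sub>R ?ej)) = Re (pd j (pd i phi) (x + a' *\<^sub>R ?ej + b' *\<^sub>R ?ei))"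
  using t(1) by simp
 have near: "dist (x + r *\<^sub>R unit_vec k + s *\<^sub>R unit_vec l) x < 2 * t" if "0 < r" "r < t" "0 < s" "s < t" for r s k l
 proof -
  have "dist (x + r *\<^sub>R unit_vec k + s *\<^sub>R unit_vec l) x = norm (r *\<^sub>R unit_vec k + s *\<^sub>R unit_vec l)"
   by (simp add: dist_norm add.assoc)
  also have "... \<le> norm (r *\<^sub>R unit_vec k) + norm (s *\<^sub>R unit_vec l)" by (rule norm_triangle_ineq)
  also have "... < 2 * t" using that by (simp add: norm_axis_1)
  finally show ?thesis .
 qed
 have "\<bar>Re (pd i (pd j phi) (x + a *\<^sub>R ?ei + b *\<^sub>R ?ej)) - Re (pd i (pd j phi) x)\<bar> < e"
  by (rule d1(2)) (use near[OF ab(1-4), of i j] t in linarith)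
 moreover have "\<bar>Re (pd j (pd i phi) (x + a' *\<^sub>R ?ej + b' *\<^sub>R ?ei)) - Re (pd j (pd i phi) x)\<bar> < e"
  by (rule d2(2)) (use near[OF ab'(1-4), of j i] t in linarith)
 ultimately have "\<bar>Re (pd i (pd j phi) x) - Re (pd j (pd i phi) x)\<bar> < 2 * e" using eq by linarith
 then show False by (simp add: e_def)
qed

lemma pd_cmult: "f differentiable (at x) ==> pd j (%x. c * f x) x = c * pd j f x"
 by (subst pd_mult) auto

lemma pd_commute:
 assumes "smooth_fun phi" shows "pd i (pd j phi) x = pd j (pd i phi) x"
proof (rule complex_eqI)
 show "Re (pd i (pd j phi) x) = Re (pd j (pd i phi) x)" by (rule pd_commute_Re[OF assms])
 have *: "pd k (pd l (%x. - \<i> * phi x)) x = - \<i> * pd k (pd l phi) x" for k l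
 proof -
  have "pd l (%x. - \<i> * phi x) = (%x. - \<i> * pd l phi x)"
   by (rule ext, rule pd_cmult, rule smooth_fun_diffb, fact)
  then show ?thesis
   by (simp only: pd_cmult[OF smooth_fun_diffb[OF smooth_fun_pd[OF assms]]])
 qed
 have "smooth_fun (%x. - \<i> * phi x)" by (rule smooth_fun_mult[OF smooth_fun_const assms])
 from pd_commute_Re[OF this, of i j x] show "Im (pd i (pd j phi) x) = Im (pd j (pd i phi) x)"
  unfolding * by simp
qed

lemma integral_translate:
 fixes f :: "real^2 => 'a::{banach, second_countable_topology}"
 assumes "f \<in> borel_measurable borel"
 shows "(LBINT x. f (x + a)) = (LBINT x. f x)"
proof -
 have "(LBINT x. f x) = (\<integral>x. f x \<partial>distr lborel borel ((+) a))" by (simp only: lborel_distr_plus)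
 also have "... = (LBINT x. f (a + x))" by (rule integral_distr) (use assms in simp_all)
 finally show ?thesis by (simp add: add.commute)
qed

text \<open>By translation invariance every difference quotient has integral 0, and the quotients
  converge boundedly to the derivative. All steps \<open>h n\<close> are at most 1, so the supports
  stay in the ball of radius \<open>R + 1\<close>, which gives an integrable majorant.\<close>

lemma integral_pd:
 assumes t: "test_fun \<Omega> phi" shows "(LBINT x. pd j phi x) = 0"
proof -
 note s = test_fun_smooth[OF t]
 obtain R where R: "R > 0" "!!x. norm x > R ==> phi x = 0" using test_fun_support_cball[OF t] by blast
 obtain B where B: "B > 0" "!!x. cmod (pd j phi x) \<le> B" using test_fun_bounded[OF test_fun_pd[OF t]] by blast
 define h where "h n = inverse (real (Suc n))" for n
 have h: "0 < h n" "h n \<le> 1" for n by (auto simp: h_def field_simps)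
 have bnd: "norm ((phi (x + h n *\<^sub>R unit_vec j) - phi x) / of_real (h n)) \<le> B * indicator (cball 0 (R + 1)) x" for x n
 proof (cases "norm x \<le> R + 1")
  case True
  have "\<exists>y\<in>{0<..<h n}. norm (phi (x + h n *\<^sub>R unit_vec j) - phi (x + 0 *\<^sub>R unit_vec j))
    \<le> norm ((h n - 0) *\<^sub>R pd j phi (x + y *\<^sub>R unit_vec j))"
   by (rule mvt_general[OF h(1)])
    (auto intro!: continuous_intros continuous_on_compose2[OF smooth_fun_continuous[OF s, of UNIV]]
     line_derivative[OF s, unfolded has_vector_derivative_def])
  then obtain y where "norm (phi (x + h n *\<^sub>R unit_vec j) - phi x) \<le> h n * norm (pd j phi (x + y *\<^sub>R unit_vec j))"
   using h[of n] by auto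
  also have "... \<le> h n * B" using h[of n] B(2) by (intro mult_left_mono) auto
  finally show ?thesis using h(1)[of n] True by (simp add: norm_divide divide_le_eq mult.commute)
 next
  case False
  have "norm x - norm (h n *\<^sub>R unit_vec j) \<le> norm (x + h n *\<^sub>R unit_vec j)"
   using norm_diff_ineq[of x "h n *\<^sub>R unit_vec j"] by simp
  then have "norm (x + h n *\<^sub>R unit_vec j) > R" using False h[of n] by (simp add: norm_axis_1)
  then show ?thesis using R False by simp
 qed
 have [measurable]: "phi \<in> borel_measurable borel" "pd j phi \<in> borel_measurable borel"
  using s smooth_fun_pd[OF s] by (auto intro: smooth_fun_measurable)
 have lim: "(%n. \<integral>x. (phi (x + h n *\<^sub>R unit_vec j) - phi x) / of_real (h n) \<partial>lborel) \<longlonglongrightarrow> (LBINT x. pd j phi x)"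
 proof (rule integral_dominated_convergence[where w = "%x. B * indicator (cball 0 (R + 1)) x"])
  show "integrable lborel (%x. B * indicator (cball 0 (R + 1)) x :: real)"
   by (intro integrable_mult_right integrable_real_indicator emeasure_bounded_finite) auto
  show "AE x in lborel. (%n. (phi (x + h n *\<^sub>R unit_vec j) - phi x) / of_real (h n)) \<longlonglongrightarrow> pd j phi x"
  proof (rule AE_I2)
   fix x
   have "((%t. phi (x + t *\<^sub>R unit_vec j)) has_vector_derivative pd j phi x) (at 0)"
    using line_derivative[OF s, of x j 0] by simp
   then have lim: "((%t. norm (phi (x + t *\<^sub>R unit_vec j) - phi x - t *\<^sub>R pd j phi x) / norm t) \<longlongrightarrow> 0) (at 0)"
    unfolding has_vector_derivative_def has_derivative_at by simp
   have eq: "norm (phi (x + t *\<^sub>R unit_vec j) - phi x - t *\<^sub>R pd j phi x) / norm t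
     = norm ((phi (x + t *\<^sub>R unit_vec j) - phi x) /\<^sub>R t - pd j phi x)" if "t \<noteq> 0" for t :: real
   proof -
    have "(phi (x + t *\<^sub>R unit_vec j) - phi x) /\<^sub>R t - pd j phi x
      = (phi (x + t *\<^sub>R unit_vec j) - phi x - t *\<^sub>R pd j phi x) /\<^sub>R t"
     using that by (simp add: scaleR_diff_right)
    then show ?thesis by (simp add: divide_inverse mult.commute)
   qed
   have "((%t. norm ((phi (x + t *\<^sub>R unit_vec j) - phi x) /\<^sub>R t - pd j phi x)) \<longlongrightarrow> 0) (at 0)"
    by (rule Lim_transform_eventually[OF lim])
     (use eq in \<open>auto simp: eventually_at_filter simp del: norm_scaleR\<close>)
   then have quot: "((%t. (phi (x + t *\<^sub>R unit_vec j) - phi x) /\<^sub>R t) \<longlongrightarrow> pd j phi x) (at 0)"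
    by (simp only: tendsto_norm_zero_iff LIM_zero_iff)
   have h0: "filterlim h (at 0) sequentially"
    unfolding filterlim_at h_def using LIMSEQ_inverse_real_of_nat by simp
   from filterlim_compose[OF quot h0] have "(%n. (phi (x + h n *\<^sub>R unit_vec j) - phi x) /\<^sub>R h n) \<longlonglongrightarrow> pd j phi x" .
   then show "(%n. (phi (x + h n *\<^sub>R unit_vec j) - phi x) / of_real (h n)) \<longlonglongrightarrow> pd j phi x"
    by (simp add: scaleR_conv_of_real divide_inverse mult.commute)
  qed
 qed (use bnd in auto)
 have zero: "(LBINT x. (phi (x + h n *\<^sub>R unit_vec j) - phi x) / of_real (h n)) = 0" for n
 proof -
  have i: "integrable lborel (%x. phi (x + h n *\<^sub>R unit_vec j))"
  proof -
   have "test_fun UNIV (%x. phi (x - (- h n) *\<^sub>R unit_vec j))"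
    by (rule test_fun_translate[OF test_fun_mono[OF t subset_UNIV]])
   from test_fun_integrable[OF this] show ?thesis by simp
  qed
  have "(LBINT x. (phi (x + h n *\<^sub>R unit_vec j) - phi x)) = 0"
   by (subst Bochner_Integration.integral_diff[OF i test_fun_integrable[OF t]]) (simp add: integral_translate[OF smooth_fun_measurable[OF s]])
  then show ?thesis by simp
 qed
 from lim[unfolded zero] show ?thesis by (simp only: LIMSEQ_const_iff)
qed

lemma integration_by_parts:
 assumes t: "test_fun \<Omega> phi" and s: "smooth_fun psi"
 shows "(LBINT x. pd j phi x * psi x) = - (LBINT x. phi x * pd j psi x)"
proof -
 have t2: "test_fun \<Omega> (%x. phi x * psi x)" using test_fun_mult[OF t s] by (simp add: mult.commute)
 have i: "integrable lborel (%x. pd j phi x * psi x)" "integrable lborel (%x. phi x * pd j psi x)"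
  using test_fun_integrable[OF test_fun_mult[OF test_fun_pd[OF t] s]]
   test_fun_integrable[OF test_fun_mult[OF t smooth_fun_pd[OF s]]] by (simp_all add: mult.commute)
 have "pd j (%x. phi x * psi x) = (%x. pd j phi x * psi x + phi x * pd j psi x)"
  by (rule ext) (intro pd_mult smooth_fun_diffb s test_fun_smooth[OF t])
 then have "(LBINT x. pd j phi x * psi x + phi x * pd j psi x) = 0"
  using integral_pd[OF t2, of j] by simp
 then show ?thesis using lint_add[OF i] by (simp add: eq_neg_iff_add_eq_0)
qed

section \<open>The weak Wirtinger derivative\<close>

lemma inner_scaleC_left_L2: "(a *\<^sub>C F) \<bullet> G = F \<bullet> (cnj a *\<^sub>C G)" for F G :: L2
proof -
 obtain f g where fg: "square_integrable lborel f" "F = abs_L2 f" "square_integrable lborel g" "G = abs_L2 g"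
  by (metis L2_cases)
 have "(a * x) \<bullet> y = x \<bullet> (cnj a * y)" for x y :: complex
  by (simp add: inner_complex_def algebra_simps)
 then show ?thesis
  using fg by (simp add: abs_L2_scaleC inner_abs_L2 square_integrable_mult)
qed

lemma scaleC_minus_one: "(- 1) *\<^sub>C x = - (x :: 'a::complex_normed_space)"
 using scaleC_of_real[of "-1" x] by simp

lemma scaleC_one: "1 *\<^sub>C x = (x :: 'a::complex_normed_space)"
 using scaleC_of_real[of 1 x] by simp

lemma inner_iC_antisym: "(\<i> *\<^sub>C F) \<bullet> G = - (F \<bullet> (\<i> *\<^sub>C G))" for F G :: L2
 using scaleC_scaleC[of "-1" \<i> G] by (simp add: inner_scaleC_left_L2 scaleC_minus_one inner_minus_right[symmetric])

text \<open>The inner product of \<open>L2\<close> is real: real test functions see the real part of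
  \<open>F\<close>, and \<open>\<i>\<close> times real test functions see its imaginary
  part.\<close>

lemma fundamental_lemma_L2:
 assumes "open \<Omega>" and orth: "!!phi. test_fun \<Omega> phi ==> F \<bullet> abs_L2 phi = 0"
 shows "AE x in lborel. x \<in> \<Omega> --> rep_L2 F x = 0"
proof -
 have F: "square_integrable lborel (rep_L2 F)" by simp
 then have m[measurable]: "rep_L2 F \<in> borel_measurable borel" and i: "integrable lborel (%x. (cmod (rep_L2 F x))\<^sup>2)"
  by (auto simp: square_integrable_def)
 have loc: "integrable lborel (%x. indicator (cbox a b) x * r (rep_L2 F x))"
  if r: "!!z. \<bar>r z\<bar> \<le> cmod z" and [measurable]: "r \<in> borel_measurable borel" for a b :: "real^2" and r :: "complex => real"
 proof (rule Bochner_Integration.integrable_bound)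
  show "integrable lborel (%x. (cmod (rep_L2 F x))\<^sup>2 + indicator (cbox a b) x)"
   by (intro Bochner_Integration.integrable_add i integrable_real_indicator emeasure_bounded_finite) auto
  have "y \<le> y\<^sup>2 + 1" for y :: real using sum_power2_ge_zero[of "y - 1" "y"] by (simp add: power2_eq_square algebra_simps)
  then have "\<bar>r (rep_L2 F x)\<bar> \<le> (cmod (rep_L2 F x))\<^sup>2 + 1" for x using r order_trans by blast
  then show "AE x in lborel. norm (indicator (cbox a b) x * r (rep_L2 F x))
    \<le> norm ((cmod (rep_L2 F x))\<^sup>2 + indicator (cbox a b) x)"
   by (auto simp: indicator_def)
 qed simp
 have "AE x in lborel. x \<in> \<Omega> --> Re (rep_L2 F x) = 0"
 proof (rule fundamental_lemma_real[OF assms(1)])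
  show "integrable lborel (%x. indicator (cbox a b) x * Re (rep_L2 F x))" for a b :: "real^2"
   by (rule loc) (auto simp: abs_Re_le_cmod)
  fix rho assume t: "test_fun \<Omega> (%x. complex_of_real (rho x))"
  have "F \<bullet> abs_L2 (%x. complex_of_real (rho x)) = (LBINT x. Re (rep_L2 F x) * rho x)"
   using inner_abs_L2[OF F test_fun_sq[OF t]] by (simp add: inner_complex_def)
  then show "(LBINT x. Re (rep_L2 F x) * rho x) = 0" using orth[OF t] by simp
 qed
 moreover have "AE x in lborel. x \<in> \<Omega> --> Im (rep_L2 F x) = 0"
 proof (rule fundamental_lemma_real[OF assms(1)])
  show "integrable lborel (%x. indicator (cbox a b) x * Im (rep_L2 F x))" for a b :: "real^2"
   by (rule loc) (auto simp: abs_Im_le_cmod)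
  fix rho assume t: "test_fun \<Omega> (%x. complex_of_real (rho x))"
  have t': "test_fun \<Omega> (%x. \<i> * complex_of_real (rho x))" by (rule test_fun_mult[OF t smooth_fun_const])
  have "F \<bullet> abs_L2 (%x. \<i> * complex_of_real (rho x)) = (LBINT x. Im (rep_L2 F x) * rho x)"
   using inner_abs_L2[OF F test_fun_sq[OF t']] by (simp add: inner_complex_def)
  then show "(LBINT x. Im (rep_L2 F x) * rho x) = 0" using orth[OF t'] by simp
 qed
 ultimately show ?thesis by eventually_elim (auto simp: complex_eq_iff)
qed

lemma orthogonal_test_fun_zero:
 assumes "!!phi. test_fun UNIV phi ==> F \<bullet> abs_L2 phi = 0"
 shows "F = 0"
proof -
 have "AE x in lborel. rep_L2 F x = 0"
  using fundamental_lemma_L2[of UNIV F] assms by simp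
 then have "abs_L2 (rep_L2 F) = abs_L2 (%x. 0)"
  using abs_L2_eq_iff[OF square_integrable_rep square_integrable_zero] by blast
 then show ?thesis by (simp add: abs_L2_zero)
qed

lemma inner_pd_L2:
 assumes "test_fun UNIV phi" "test_fun UNIV psi"
 shows "abs_L2 (pd j phi) \<bullet> abs_L2 psi = - (abs_L2 phi \<bullet> abs_L2 (pd j psi))"
proof -
 note sq = test_fun_sq[OF assms(1)] test_fun_sq[OF assms(2)]
  test_fun_sq[OF test_fun_pd[OF assms(1)], of j] test_fun_sq[OF test_fun_pd[OF assms(2)], of j]
 have c: "test_fun UNIV (%x. cnj (psi x))" by (rule test_fun_cnj) fact
 have i: "integrable lborel (%x. pd j phi x * cnj (psi x))" "integrable lborel (%x. phi x * pd j (%x. cnj (psi x)) x)"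
  by (rule test_fun_integrable[OF test_fun_mult[OF c smooth_fun_pd[OF test_fun_smooth[OF assms(1)]]]],
   rule test_fun_integrable[OF test_fun_mult[OF test_fun_pd[OF c] test_fun_smooth[OF assms(1)]]])
 have pc: "pd j (%x. cnj (psi x)) x = cnj (pd j psi x)" for x
  by (rule pd_cnj[OF smooth_fun_diffb[OF test_fun_smooth[OF assms(2)]]])
 have re: "x \<bullet> y = Re (x * cnj y)" for x y :: complex by (simp add: inner_complex_def)
 have "abs_L2 (pd j phi) \<bullet> abs_L2 psi = Re (LBINT x. pd j phi x * cnj (psi x))"
  unfolding inner_abs_L2[OF sq(3,2)] re by (rule integral_Re[OF i(1)])
 also have "... = - Re (LBINT x. phi x * pd j (%x. cnj (psi x)) x)"
  by (simp add: integration_by_parts[OF assms(1) test_fun_smooth[OF c]])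
 also have "... = - (abs_L2 phi \<bullet> abs_L2 (pd j psi))"
  unfolding inner_abs_L2[OF sq(1,4)] re pc[symmetric] integral_Re[OF i(2)] ..
 finally show ?thesis .
qed

section \<open>Wirtinger derivatives and the norm of the gradient\<close>

definition dbar :: "(real^2 => complex) => real^2 => complex" where
 "dbar phi x = (pd 1 phi x + \<i> * pd 2 phi x) / 2"

definition dz :: "(real^2 => complex) => real^2 => complex" where
 "dz phi x = (pd 1 phi x - \<i> * pd 2 phi x) / 2"

text \<open>Acting on triples whose last two entries stand for the partial derivatives,
  \<open>DB\<close> and \<open>DZ\<close> are bounded linear maps, unlike the Wirtinger derivatives
  that they represent on jets.\<close>

definition DB :: "L2 \<times> L2 \<times> L2 => L2" where
 "DB u = (1 / 2) *\<^sub>C (fst (snd u) + \<i> *\<^sub>C snd (snd u))"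

definition DZ :: "L2 \<times> L2 \<times> L2 => L2" where
 "DZ u = (1 / 2) *\<^sub>C (fst (snd u) - \<i> *\<^sub>C snd (snd u))"

definition jet :: "(real^2 => complex) => L2 \<times> L2 \<times> L2" where
 "jet phi = (abs_L2 phi, abs_L2 (pd 1 phi), abs_L2 (pd 2 phi))"

lemma test_fun_cmult: "test_fun \<Omega> phi ==> test_fun \<Omega> (%x. c * phi x)"
 by (rule test_fun_mult[OF _ smooth_fun_const])

lemma test_fun_dbar: "test_fun \<Omega> phi ==> test_fun \<Omega> (dbar phi)"
 unfolding dbar_def[abs_def] using test_fun_cmult[of \<Omega> "%x. pd 1 phi x + \<i> * pd 2 phi x" "1/2"]
 by (simp add: test_fun_add test_fun_cmult test_fun_pd)

lemma test_fun_dz: "test_fun \<Omega> phi ==> test_fun \<Omega> (dz phi)"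
 unfolding dz_def[abs_def] using test_fun_cmult[of \<Omega> "%x. pd 1 phi x - \<i> * pd 2 phi x" "1/2"]
 by (simp add: test_fun_diff test_fun_cmult test_fun_pd)

lemma DB_jet: "test_fun UNIV phi ==> DB (jet phi) = abs_L2 (dbar phi)"
 and DZ_jet: "test_fun UNIV phi ==> DZ (jet phi) = abs_L2 (dz phi)"
 using test_fun_sq[OF test_fun_pd[of UNIV phi 1]] test_fun_sq[OF test_fun_pd[of UNIV phi 2]]
 by (simp_all add: DB_def DZ_def jet_def dbar_def[abs_def] dz_def[abs_def] abs_L2_add abs_L2_diff abs_L2_scaleC
   square_integrable_mult square_integrable_add square_integrable_diff)

lemma jet_add: "test_fun UNIV phi ==> test_fun UNIV psi ==> jet phi + jet psi = jet (%x. phi x + psi x)"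
 and jet_diff: "test_fun UNIV phi ==> test_fun UNIV psi ==> jet phi - jet psi = jet (%x. phi x - psi x)"
 and jet_scaleC: "test_fun UNIV phi ==> c *\<^sub>C jet phi = jet (%x. c * phi x)"
proof -
 assume t: "test_fun UNIV phi"
 have p: "pd j (%x. c * phi x) = (%x. c * pd j phi x)" for j c
  by (rule ext) (simp add: pd_cmult smooth_fun_diffb test_fun_smooth[OF t])
 then show "c *\<^sub>C jet phi = jet (%x. c * phi x)"
  by (simp add: jet_def scaleC_prod_def abs_L2_scaleC test_fun_sq[OF t]
    test_fun_sq[OF test_fun_pd[OF t]])
 assume t': "test_fun UNIV psi"
 have "pd j (%x. phi x + psi x) = (%x. pd j phi x + pd j psi x)" for j
  by (rule ext) (simp add: pd_add smooth_fun_diffb test_fun_smooth[OF t] test_fun_smooth[OF t'])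
 then show "jet phi + jet psi = jet (%x. phi x + psi x)"
  by (simp add: jet_def abs_L2_add test_fun_sq[OF t] test_fun_sq[OF t']
    test_fun_sq[OF test_fun_pd[OF t]] test_fun_sq[OF test_fun_pd[OF t']])
 have "pd j (%x. phi x - psi x) = (%x. pd j phi x - pd j psi x)" for j
  by (rule ext) (simp add: pd_diff smooth_fun_diffb test_fun_smooth[OF t] test_fun_smooth[OF t'])
 then show "jet phi - jet psi = jet (%x. phi x - psi x)"
  by (simp add: jet_def abs_L2_diff test_fun_sq[OF t] test_fun_sq[OF t']
    test_fun_sq[OF test_fun_pd[OF t]] test_fun_sq[OF test_fun_pd[OF t']])
qed

text \<open>One integration by parts leaves \<open>phi\<close> against \<open>\<i>\<close> times the
  mixed second derivative, which is symmetric in the two directions; but moving \<open>\<i>\<close>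
  across the real inner product changes the sign. Hence the term is its own negative.\<close>

lemma jet_cross_term:
 assumes t: "test_fun UNIV phi"
 shows "abs_L2 (pd 1 phi) \<bullet> (\<i> *\<^sub>C abs_L2 (pd 2 phi)) = 0"
proof -
 have p: "pd k (%x. \<i> * pd j phi x) = (%x. \<i> * pd k (pd j phi) x)" for j k
  by (rule ext) (simp add: pd_cmult smooth_fun_diffb smooth_fun_pd test_fun_smooth[OF t])
 have e: "abs_L2 (pd k phi) \<bullet> (\<i> *\<^sub>C abs_L2 (pd j phi)) = - (abs_L2 phi \<bullet> abs_L2 (%x. \<i> * pd k (pd j phi) x))" for j k
  using inner_pd_L2[OF t test_fun_cmult[OF test_fun_pd[OF t]], of k \<i> j] p
  by (simp add: abs_L2_scaleC test_fun_sq[OF test_fun_pd[OF t]])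
 have c: "pd 1 (pd 2 phi) = pd 2 (pd 1 phi)" by (rule ext) (rule pd_commute[OF test_fun_smooth[OF t]])
 have "abs_L2 (pd 1 phi) \<bullet> (\<i> *\<^sub>C abs_L2 (pd 2 phi)) = abs_L2 (pd 2 phi) \<bullet> (\<i> *\<^sub>C abs_L2 (pd 1 phi))"
  unfolding e c by simp
 also have "... = - (abs_L2 (pd 1 phi) \<bullet> (\<i> *\<^sub>C abs_L2 (pd 2 phi)))"
  by (subst inner_commute) (simp add: inner_iC_antisym)
 finally show ?thesis by simp
qed

lemma norm_half_scaleC: "(norm ((1 / 2) *\<^sub>C F))\<^sup>2 = (norm F)\<^sup>2 / 4" for F :: L2
 by (simp add: norm_scaleC power_divide)

lemma norm_iC: "norm (\<i> *\<^sub>C F) = norm F" for F :: L2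
 by (simp add: norm_scaleC)

text \<open>As the cross term vanishes, a single Wirtinger derivative carries the whole gradient
  norm. Both the passage from the Wirtinger derivative to \<open>H\<^sup>1\<close> and the
  coercivity of the form rest on this.\<close>

lemma norm_DZ_jet:
 assumes "test_fun UNIV phi"
 shows "4 * (norm (DZ (jet phi)))\<^sup>2 = (norm (fst (snd (jet phi))))\<^sup>2 + (norm (snd (snd (jet phi))))\<^sup>2"
  and "4 * (norm (DB (jet phi)))\<^sup>2 = (norm (fst (snd (jet phi))))\<^sup>2 + (norm (snd (snd (jet phi))))\<^sup>2"
proof -
 have *: "(norm (X - Y))\<^sup>2 = (norm X)\<^sup>2 + (norm Y)\<^sup>2" "(norm (X + Y))\<^sup>2 = (norm X)\<^sup>2 + (norm Y)\<^sup>2"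
  if "X \<bullet> Y = 0" for X Y :: L2
  using that unfolding power2_norm_eq_inner
  by (simp_all add: inner_add_left inner_add_right inner_diff_left inner_diff_right inner_commute)
 note c = *[OF jet_cross_term[OF assms]]
 show "4 * (norm (DZ (jet phi)))\<^sup>2 = (norm (fst (snd (jet phi))))\<^sup>2 + (norm (snd (snd (jet phi))))\<^sup>2"
  and "4 * (norm (DB (jet phi)))\<^sup>2 = (norm (fst (snd (jet phi))))\<^sup>2 + (norm (snd (snd (jet phi))))\<^sup>2"
  unfolding DZ_def DB_def norm_half_scaleC using c by (simp_all add: jet_def norm_iC)
qed

section \<open>Uniqueness for \<open>\<Delta> a = 4 a\<close> by a maximum principle\<close>

lemma second_difference:
 assumes s: "smooth_fun rho" and t: "t > 0"
 shows "\<exists>\<eta> \<eta>'. \<bar>\<eta>\<bar> < t \<and> \<bar>\<eta>'\<bar> < t \<and>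
  Re (rho (y + t *\<^sub>R unit_vec j)) + Re (rho (y - t *\<^sub>R unit_vec j)) - 2 * Re (rho y)
   = t\<^sup>2 / 2 * (Re (pd j (pd j rho) (y + \<eta> *\<^sub>R unit_vec j)) + Re (pd j (pd j rho) (y + \<eta>' *\<^sub>R unit_vec j)))"
proof -
 define g where "g k r = Re (((pd j ^^ k) rho) (y + r *\<^sub>R unit_vec j))" for k r
 have sk: "smooth_fun ((pd j ^^ k) rho)" for k
  by (induction k) (use s smooth_fun_pd in auto)
 have d: "(g k has_real_derivative g (Suc k) r) (at r)" for k r
  using line_derivative_Re[OF sk[of k], of y j r] unfolding g_def[abs_def] by simp
 have "\<exists>r. 0 < r \<and> r < t \<and> g 0 t = (\<Sum>m<2. g m 0 / fact m * t ^ m) + g 2 r / fact 2 * t ^ 2"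
  by (rule Maclaurin[OF t]) (use d in auto)
 then obtain r where r: "0 < r" "r < t" "g 0 t = g 0 0 + g 1 0 * t + g 2 r / 2 * t\<^sup>2"
  by (auto simp: numeral_2_eq_2)
 have d': "((%r. (-1) ^ k * g k (- r)) has_real_derivative (-1) ^ Suc k * g (Suc k) (- r)) (at r)" for k r
  by (rule derivative_eq_intros DERIV_chain2[OF d] refl)+ simp
 have "\<exists>r. 0 < r \<and> r < t \<and> g 0 (- t) = (\<Sum>m<2. ((-1) ^ m * g m (- 0)) / fact m * t ^ m) + ((-1) ^ 2 * g 2 (- r)) / fact 2 * t ^ 2"
  by (rule Maclaurin[OF t, where diff = "%k r. (-1) ^ k * g k (- r)" and f = "%r. g 0 (- r)"]) (use d' in auto)
 then obtain r' where r': "0 < r'" "r' < t" "g 0 (- t) = g 0 0 - g 1 0 * t + g 2 (- r') / 2 * t\<^sup>2"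
  by (auto simp: numeral_2_eq_2)
 have "g 0 t + g 0 (- t) - 2 * g 0 0 = t\<^sup>2 / 2 * (g 2 r + g 2 (- r'))"
  using r(3) r'(3) by (simp add: algebra_simps)
 then show ?thesis
  using r r' by (intro exI[of _ r] exI[of _ "- r'"]) (simp add: g_def numeral_2_eq_2)
qed

lemma integrable_mult_test_fun:
 fixes \<alpha> :: "real^2 => real"
 assumes [measurable]: "\<alpha> \<in> borel_measurable borel" and i: "integrable lborel (%x. (\<alpha> x)\<^sup>2)"
  and t: "test_fun UNIV rho"
 shows "integrable lborel (%x. \<alpha> x * Re (rho x))"
  "\<bar>\<integral>x. \<alpha> x * Re (rho x) \<partial>lborel\<bar> \<le> (LBINT x. (\<alpha> x)\<^sup>2) + (LBINT x. (cmod (rho x))\<^sup>2)"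
proof -
 have [measurable]: "rho \<in> borel_measurable borel" by (rule smooth_fun_measurable[OF test_fun_smooth[OF t]])
 have i2: "integrable lborel (%x. (cmod (rho x))\<^sup>2)"
  using test_fun_sq[OF t] by (simp add: square_integrable_def)
 have b: "\<bar>a * Re z\<bar> \<le> a\<^sup>2 + (cmod z)\<^sup>2" for a z
 proof -
  have "\<bar>a * Re z\<bar> \<le> \<bar>a\<bar> * cmod z" by (simp add: abs_mult mult_left_mono abs_Re_le_cmod)
  also have "... \<le> 2 * \<bar>a\<bar> * cmod z" by simp
  also have "... \<le> \<bar>a\<bar>\<^sup>2 + (cmod z)\<^sup>2" by (rule sum_squares_bound)
  finally show ?thesis by simp
 qed
 show int: "integrable lborel (%x. \<alpha> x * Re (rho x))"
  by (rule Bochner_Integration.integrable_bound[OF Bochner_Integration.integrable_add[OF i i2]]) (auto intro!: AE_I2 b)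
 have "\<bar>\<integral>x. \<alpha> x * Re (rho x) \<partial>lborel\<bar> \<le> (LBINT x. \<bar>\<alpha> x * Re (rho x)\<bar>)"
  using integral_norm_bound[of lborel "%x. \<alpha> x * Re (rho x)"] by simp
 also have "... \<le> (LBINT x. (\<alpha> x)\<^sup>2 + (cmod (rho x))\<^sup>2)"
  by (rule integral_mono[OF integrable_abs[OF int] Bochner_Integration.integrable_add[OF i i2]]) (rule b)
 also have "... = (LBINT x. (\<alpha> x)\<^sup>2) + (LBINT x. (cmod (rho x))\<^sup>2)"
  by (rule lint_add[OF i i2])
 finally show "\<bar>\<integral>x. \<alpha> x * Re (rho x) \<partial>lborel\<bar> \<le> (LBINT x. (\<alpha> x)\<^sup>2) + (LBINT x. (cmod (rho x))\<^sup>2)" .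
qed

lemma integrable_abs_indicator_cball:
 fixes \<alpha> :: "real^2 => real"
 assumes [measurable]: "\<alpha> \<in> borel_measurable borel" and i: "integrable lborel (%x. (\<alpha> x)\<^sup>2)"
 shows "integrable lborel (%x. \<bar>\<alpha> x\<bar> * (B * indicator (cball 0 R) x))"
proof -
 have "integrable lborel (%x. \<bar>\<alpha> x\<bar> * indicator (cball 0 R) x)"
 proof (rule Bochner_Integration.integrable_bound)
  show "integrable lborel (%x. (\<alpha> x)\<^sup>2 + indicator (cball 0 R) x)"
   by (intro Bochner_Integration.integrable_add i integrable_real_indicator emeasure_bounded_finite) auto
  have "\<bar>y\<bar> \<le> y\<^sup>2 + 1" for y :: real
   using sum_power2_ge_zero[of "\<bar>y\<bar> - 1" "y"] by (simp add: power2_eq_square algebra_simps)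
  then show "AE x in lborel. norm (\<bar>\<alpha> x\<bar> * indicator (cball 0 R) x) \<le> norm ((\<alpha> x)\<^sup>2 + indicator (cball 0 R) x)"
   by (auto simp: indicator_def)
  show "(%x. \<bar>\<alpha> x\<bar> * indicator (cball 0 R) x) \<in> borel_measurable lborel"
   by (intro borel_measurable_times borel_measurable_indicator) auto
 qed
 then show ?thesis using integrable_mult_right[of B lborel "%x. \<bar>\<alpha> x\<bar> * indicator (cball 0 R) x"] by (simp add: mult_ac)
qed

text \<open>At a maximum of the convolution its second differences are easily bounded; this limit
  carries the bound over to the integral against the second derivative of
  \<open>rho\<close>.\<close>

lemma second_difference_integral:
 fixes \<alpha> :: "real^2 => real"
 assumes [measurable]: "\<alpha> \<in> borel_measurable borel" and i: "integrable lborel (%x. (\<alpha> x)\<^sup>2)"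
  and t: "test_fun UNIV rho"
 defines "h \<equiv> %n. inverse (real (Suc n))"
 shows "(%n. \<integral>y. \<alpha> y * ((Re (rho (y + h n *\<^sub>R unit_vec j)) + Re (rho (y - h n *\<^sub>R unit_vec j)) - 2 * Re (rho y)) / (h n)\<^sup>2) \<partial>lborel)
  \<longlonglongrightarrow> (LBINT y. \<alpha> y * Re (pd j (pd j rho) y))"
proof -
 note s = test_fun_smooth[OF t]
 note t2 = test_fun_pd[OF test_fun_pd[OF t]]
 have [measurable]: "rho \<in> borel_measurable borel" "pd j (pd j rho) \<in> borel_measurable borel"
  by (rule smooth_fun_measurable[OF s], rule smooth_fun_measurable[OF test_fun_smooth[OF t2]])
 obtain R where R: "R > 0" "!!x. norm x > R ==> rho x = 0" using test_fun_support_cball[OF t] by blast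
 obtain B where B: "B > 0" "!!x. cmod (pd j (pd j rho) x) \<le> B" using test_fun_bounded[OF t2] by blast
 have h: "0 < h n" "h n \<le> 1" for n by (auto simp: h_def field_simps)
 define q where "q n y = (Re (rho (y + h n *\<^sub>R unit_vec j)) + Re (rho (y - h n *\<^sub>R unit_vec j)) - 2 * Re (rho y)) / (h n)\<^sup>2" for n y
 have "\<exists>\<eta> \<eta>'. \<forall>n. \<bar>\<eta> n\<bar> < h n \<and> \<bar>\<eta>' n\<bar> < h n \<and>
   q n y = (Re (pd j (pd j rho) (y + \<eta> n *\<^sub>R unit_vec j)) + Re (pd j (pd j rho) (y + \<eta>' n *\<^sub>R unit_vec j))) / 2" for y
 proof -
  have "\<forall>n. \<exists>\<eta> \<eta>'. \<bar>\<eta>\<bar> < h n \<and> \<bar>\<eta>'\<bar> < h n \<and>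
   q n y = (Re (pd j (pd j rho) (y + \<eta> *\<^sub>R unit_vec j)) + Re (pd j (pd j rho) (y + \<eta>' *\<^sub>R unit_vec j))) / 2"
  proof
   fix n
   have "(h n)\<^sup>2 \<noteq> 0" using h(1)[of n] by simp
   then show "\<exists>\<eta> \<eta>'. \<bar>\<eta>\<bar> < h n \<and> \<bar>\<eta>'\<bar> < h n \<and>
   q n y = (Re (pd j (pd j rho) (y + \<eta> *\<^sub>R unit_vec j)) + Re (pd j (pd j rho) (y + \<eta>' *\<^sub>R unit_vec j))) / 2"
    using second_difference[OF s h(1)[of n], of y j] unfolding q_def by (elim exE conjE, intro exI conjI) auto
  qed
  then show ?thesis by metis
 qed
 then obtain \<eta> \<eta>' where eta: "!!y n. \<bar>\<eta> y n\<bar> < h n" "!!y n. \<bar>\<eta>' y n\<bar> < h n"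
   "!!y n. q n y = (Re (pd j (pd j rho) (y + \<eta> y n *\<^sub>R unit_vec j)) + Re (pd j (pd j rho) (y + \<eta>' y n *\<^sub>R unit_vec j))) / 2"
  by metis
 have h0: "h \<longlonglongrightarrow> 0" unfolding h_def by (rule LIMSEQ_inverse_real_of_nat)
 have lim: "(%n. q n y) \<longlonglongrightarrow> Re (pd j (pd j rho) y)" for y
 proof -
  have c: "(%n. Re (pd j (pd j rho) (y + e n *\<^sub>R unit_vec j))) \<longlonglongrightarrow> Re (pd j (pd j rho) y)" if "!!n. \<bar>e n\<bar> < h n" for e
  proof -
   have "e \<longlonglongrightarrow> 0"
    by (rule Lim_null_comparison[OF _ h0]) (use that in \<open>auto intro: less_imp_le always_eventually\<close>)
   then have "(%n. y + e n *\<^sub>R unit_vec j) \<longlonglongrightarrow> y + 0 *\<^sub>R unit_vec j" by (intro tendsto_intros)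
   then have "(%n. pd j (pd j rho) (y + e n *\<^sub>R unit_vec j)) \<longlonglongrightarrow> pd j (pd j rho) (y + 0 *\<^sub>R unit_vec j)"
    by (rule continuous_on_tendsto_compose[OF smooth_fun_continuous[OF test_fun_smooth[OF t2], of UNIV]]) auto
   then show ?thesis by (simp add: tendsto_Re)
  qed
  have "(%n. q n y) \<longlonglongrightarrow> (Re (pd j (pd j rho) y) + Re (pd j (pd j rho) y)) / 2"
   unfolding eta(3) by (rule tendsto_divide[OF tendsto_add[OF c[OF eta(1)] c[OF eta(2)]] tendsto_const]) simp
  then show ?thesis by simp
 qed
 have bnd: "\<bar>q n y\<bar> \<le> B * indicator (cball 0 (R + 1)) y" for n y
 proof (cases "norm y \<le> R + 1")
  case True
  have "\<bar>Re (pd j (pd j rho) x)\<bar> \<le> B" for x using B(2)[of x] abs_Re_le_cmod order_trans by blast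
  from this[of "y + \<eta> y n *\<^sub>R unit_vec j"] this[of "y + \<eta>' y n *\<^sub>R unit_vec j"] True
  show ?thesis unfolding eta(3) by (simp add: abs_le_iff)
 next
  case False
  have "norm y - norm (h n *\<^sub>R unit_vec j) \<le> norm (y + h n *\<^sub>R unit_vec j)"
   "norm y - norm (h n *\<^sub>R unit_vec j) \<le> norm (y - h n *\<^sub>R unit_vec j)"
   using norm_diff_ineq[of y "h n *\<^sub>R unit_vec j"] norm_triangle_ineq2[of y "h n *\<^sub>R unit_vec j"] by simp_all
  then have "norm (y + h n *\<^sub>R unit_vec j) > R" "norm (y - h n *\<^sub>R unit_vec j) > R"
   using False h[of n] by (simp_all add: norm_axis_1)
  then show ?thesis using R False by (simp add: q_def)
 qed
 have "(%n. \<integral>y. \<alpha> y * q n y \<partial>lborel) \<longlonglongrightarrow> (LBINT y. \<alpha> y * Re (pd j (pd j rho) y))"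
 proof (rule integral_dominated_convergence[where w = "%x. \<bar>\<alpha> x\<bar> * (B * indicator (cball 0 (R + 1)) x)"])
  show "(%y. \<alpha> y * q n y) \<in> borel_measurable lborel" for n unfolding q_def by measurable
  show "AE x in lborel. (%n. \<alpha> x * q n x) \<longlonglongrightarrow> \<alpha> x * Re (pd j (pd j rho) x)"
   by (intro AE_I2 tendsto_intros lim)
  show "AE x in lborel. norm (\<alpha> x * q n x) \<le> \<bar>\<alpha> x\<bar> * (B * indicator (cball 0 (R + 1)) x)" for n
   using bnd by (intro AE_I2) (simp add: abs_mult mult_left_mono)
 qed (use integrable_abs_indicator_cball[OF assms(1) i] in auto)
 then show ?thesis unfolding q_def .
qed

lemma continuous_on_convolution:
 fixes \<alpha> :: "real^2 => real"
 assumes [measurable]: "\<alpha> \<in> borel_measurable borel" and i: "integrable lborel (%x. (\<alpha> x)\<^sup>2)"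
  and t: "test_fun UNIV rho"
 shows "continuous_on UNIV (%x. \<integral>y. \<alpha> y * Re (rho (y - x)) \<partial>lborel)"
 unfolding continuous_on_sequentially
proof (intro ballI allI impI, elim conjE)
 fix x X assume X: "X \<longlonglongrightarrow> (x :: real^2)"
 have [measurable]: "rho \<in> borel_measurable borel" by (rule smooth_fun_measurable[OF test_fun_smooth[OF t]])
 obtain R where R: "R > 0" "!!x. norm x > R ==> rho x = 0" using test_fun_support_cball[OF t] by blast
 obtain B where B: "B > 0" "!!x. cmod (rho x) \<le> B" using test_fun_bounded[OF t] by blast
 obtain S where S: "!!n. norm (X n) \<le> S"
  using convergent_imp_Bseq[of X] X unfolding convergent_def Bseq_def by blast
 have "(%n. \<integral>y. \<alpha> y * Re (rho (y - X n)) \<partial>lborel) \<longlonglongrightarrow> (LBINT y. \<alpha> y * Re (rho (y - x)))"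
 proof (rule integral_dominated_convergence[where w = "%x. \<bar>\<alpha> x\<bar> * (B * indicator (cball 0 (R + S)) x)"])
  show "AE y in lborel. (%n. \<alpha> y * Re (rho (y - X n))) \<longlonglongrightarrow> \<alpha> y * Re (rho (y - x))"
  proof (intro AE_I2 tendsto_mult tendsto_const tendsto_Re)
   fix y
   have "(%n. y - X n) \<longlonglongrightarrow> y - x" by (intro tendsto_intros X)
   then show "(%n. rho (y - X n)) \<longlonglongrightarrow> rho (y - x)"
    by (rule continuous_on_tendsto_compose[OF smooth_fun_continuous[OF test_fun_smooth[OF t], of UNIV]]) auto
  qed
  have "\<bar>Re (rho (y - X n))\<bar> \<le> B * indicator (cball 0 (R + S)) y" for y n
  proof (cases "norm y \<le> R + S")
   case True
   then show ?thesis using B(2)[of "y - X n"] abs_Re_le_cmod[of "rho (y - X n)"] by simp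
  next
   case False
   then have "norm (y - X n) > R" using S[of n] norm_triangle_ineq2[of y "X n"] by linarith
   then show ?thesis using R False by simp
  qed
  then show "AE y in lborel. norm (\<alpha> y * Re (rho (y - X n))) \<le> \<bar>\<alpha> y\<bar> * (B * indicator (cball 0 (R + S)) y)" for n
   by (intro AE_I2) (simp add: abs_mult mult_left_mono)
 qed (use integrable_abs_indicator_cball[OF assms(1) i] in auto)
 then show "((%x. \<integral>y. \<alpha> y * Re (rho (y - x)) \<partial>lborel) \<circ> X) \<longlonglongrightarrow> (LBINT y. \<alpha> y * Re (rho (y - x)))"
  by (simp add: o_def)
qed

text \<open>A maximum principle for the bounded continuous function \<open>m\<close>, which solves
  \<open>\<Delta> m = 4 m\<close>. Subtracting \<open>eps * (norm x)\<^sup>2\<close> forces a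
  maximum at some \<open>x0\<close>; there the second difference quotients of \<open>m\<close> are
  at most \<open>2 * eps\<close> in both directions, so \<open>4 * m x0 \<le> 4 * eps\<close>. The
  integral in question is \<open>m 0\<close>, and \<open>m 0 \<le> m x0\<close>.\<close>

lemma helmholtz_le:
 fixes \<alpha> :: "real^2 => real"
 assumes m: "\<alpha> \<in> borel_measurable borel" and i: "integrable lborel (%x. (\<alpha> x)\<^sup>2)"
  and eq: "!!rho. test_fun UNIV rho ==> 4 * (LBINT x. \<alpha> x * Re (rho x))
   = (LBINT x. \<alpha> x * Re (pd 1 (pd 1 rho) x)) + (LBINT x. \<alpha> x * Re (pd 2 (pd 2 rho) x))"
  and t: "test_fun UNIV rho"
 shows "(LBINT x. \<alpha> x * Re (rho x)) \<le> 0"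
proof -
 define m where "m x = (LBINT y. \<alpha> y * Re (rho (y - x)))" for x
 define B where "B = (LBINT x. (\<alpha> x)\<^sup>2) + (LBINT x. (cmod (rho x))\<^sup>2)"
 have Bm: "\<bar>m x\<bar> \<le> B" for x
 proof -
  have "(LBINT y. (cmod (rho (y - x)))\<^sup>2) = (LBINT y. (cmod (rho y))\<^sup>2)"
   using integral_translate[of "%y. (cmod (rho y))\<^sup>2" "- x"] smooth_fun_measurable[OF test_fun_smooth[OF t]] by simp
  then show ?thesis
   using integrable_mult_test_fun(2)[OF assms(1) i test_fun_translate[OF t], of x] by (simp add: m_def B_def)
 qed
 have B0: "B \<ge> 0" using Bm[of 0] by linarith
 have "m 0 \<le> eps" if e: "eps > 0" for eps
 proof -
  define v where "v x = m x - eps * (norm x)\<^sup>2" for x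
  \<comment> \<open>Outside this ball the quadratic term is at least \<open>2 * B\<close>, so
    \<open>v\<close> is at most \<open>- B\<close> there and cannot exceed
    \<open>v 0\<close>.\<close>
  define r where "r = sqrt (2 * B / eps)"
  have r: "r \<ge> 0" "eps * r\<^sup>2 = 2 * B" using B0 e by (auto simp: r_def)
  have "continuous_on UNIV v"
   unfolding v_def m_def by (intro continuous_intros continuous_on_convolution assms(1) i t)
  then have "continuous_on (cball 0 r) v" by (rule continuous_on_subset) simp
  then obtain x0 where x0: "x0 \<in> cball 0 r" "!!x. x \<in> cball 0 r ==> v x \<le> v x0"
   using continuous_attains_sup[of "cball 0 r :: (real^2) set" v] r by auto
  have max: "v x \<le> v x0" for x
  proof (cases "x \<in> cball 0 r")
   case False
   then have "r\<^sup>2 \<le> (norm x)\<^sup>2" using r by (intro power_mono) auto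
   then have "eps * r\<^sup>2 \<le> eps * (norm x)\<^sup>2" using e by simp
   then have "v x \<le> B - 2 * B" using Bm[of x] r by (simp add: v_def abs_le_iff)
   also have "... \<le> v 0" using Bm[of 0] by (simp add: v_def abs_le_iff)
   also have "... \<le> v x0" using x0(2)[of 0] r by simp
   finally show ?thesis .
  qed (rule x0)
  define rho0 where "rho0 y = rho (y - x0)" for y
  have t0: "test_fun UNIV rho0" unfolding rho0_def by (rule test_fun_translate[OF t])
  have le: "(LBINT y. \<alpha> y * Re (pd j (pd j rho0) y)) \<le> 2 * eps" for j
  proof (rule LIMSEQ_le_const2[OF second_difference_integral[OF assms(1) i t0]], intro exI allI impI)
   fix n :: nat
   define h where "h = inverse (real (Suc n))"
   have h: "h > 0" by (simp add: h_def)
   have tr: "rho0 (y + h *\<^sub>R unit_vec j) = rho (y - (x0 - h *\<^sub>R unit_vec j))"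
    "rho0 (y - h *\<^sub>R unit_vec j) = rho (y - (x0 + h *\<^sub>R unit_vec j))" for y
    by (simp_all add: rho0_def algebra_simps)
   note ii = integrable_mult_test_fun(1)[OF assms(1) i test_fun_translate[OF t]]
   have "(LBINT y. \<alpha> y * ((Re (rho0 (y + h *\<^sub>R unit_vec j)) + Re (rho0 (y - h *\<^sub>R unit_vec j)) - 2 * Re (rho0 y)) / h\<^sup>2))
    = (LBINT y. (\<alpha> y * Re (rho (y - (x0 - h *\<^sub>R unit_vec j))) + \<alpha> y * Re (rho (y - (x0 + h *\<^sub>R unit_vec j))) - 2 * (\<alpha> y * Re (rho (y - x0)))) / h\<^sup>2)"
    unfolding tr by (rule lint_cong) (simp_all add: rho0_def algebra_simps)
   also have "... = (m (x0 - h *\<^sub>R unit_vec j) + m (x0 + h *\<^sub>R unit_vec j) - 2 * m x0) / h\<^sup>2"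
    unfolding m_def integral_divide_zero using ii by (simp del: diff_add_eq diff_diff_eq2)
   also have "... \<le> (2 * eps * h\<^sup>2) / h\<^sup>2"
   proof (rule divide_right_mono)
    have n: "(norm (x0 - h *\<^sub>R unit_vec j))\<^sup>2 + (norm (x0 + h *\<^sub>R unit_vec j))\<^sup>2 = 2 * (norm x0)\<^sup>2 + 2 * h\<^sup>2"
     unfolding power2_norm_eq_inner
     by (simp add: inner_add_left inner_add_right inner_diff_left inner_diff_right inner_axis_axis power2_eq_square)
      (simp add: algebra_simps)
    have "m (x0 - h *\<^sub>R unit_vec j) + m (x0 + h *\<^sub>R unit_vec j) - 2 * m x0
      \<le> eps * ((norm (x0 - h *\<^sub>R unit_vec j))\<^sup>2 + (norm (x0 + h *\<^sub>R unit_vec j))\<^sup>2) - 2 * (eps * (norm x0)\<^sup>2)"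
     using max[of "x0 - h *\<^sub>R unit_vec j"] max[of "x0 + h *\<^sub>R unit_vec j"] by (simp add: v_def distrib_left)
    also have "... = 2 * eps * h\<^sup>2" unfolding n by (simp add: algebra_simps)
    finally show "m (x0 - h *\<^sub>R unit_vec j) + m (x0 + h *\<^sub>R unit_vec j) - 2 * m x0 \<le> 2 * eps * h\<^sup>2" .
   qed simp
   also have "... = 2 * eps" using h by simp
   finally show "(LBINT y. \<alpha> y * ((Re (rho0 (y + inverse (real (Suc n)) *\<^sub>R unit_vec j)) + Re (rho0 (y - inverse (real (Suc n)) *\<^sub>R unit_vec j)) - 2 * Re (rho0 y)) / (inverse (real (Suc n)))\<^sup>2)) \<le> 2 * eps"
    unfolding h_def .
  qed
  have "4 * m x0 \<le> 4 * eps"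
   using eq[OF t0] le[of 1] le[of 2] by (simp add: m_def rho0_def)
  moreover have "m 0 \<le> m x0"
   using max[of 0] e by (simp add: v_def) (smt (verit) mult_nonneg_nonneg zero_le_power2)
  ultimately show ?thesis by simp
 qed
 then have "m 0 \<le> 0" by (rule field_le_epsilon[of "m 0" 0, simplified])
 then show ?thesis by (simp add: m_def)
qed

lemma helmholtz_uniqueness:
 fixes \<alpha> :: "real^2 => real"
 assumes m: "\<alpha> \<in> borel_measurable borel" and i: "integrable lborel (%x. (\<alpha> x)\<^sup>2)"
  and eq: "!!rho. test_fun UNIV rho ==> 4 * (LBINT x. \<alpha> x * Re (rho x))
   = (LBINT x. \<alpha> x * Re (pd 1 (pd 1 rho) x)) + (LBINT x. \<alpha> x * Re (pd 2 (pd 2 rho) x))"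
  and t: "test_fun UNIV rho"
 shows "(LBINT x. \<alpha> x * Re (rho x)) = 0"
 using helmholtz_le[OF m i eq t] helmholtz_le[OF m i eq test_fun_minus[OF t]] by simp

section \<open>Density of test functions in the graph norm of the weak Wirtinger derivative\<close>

lemma pd_Re:
 assumes "smooth_fun phi"
 shows "pd j (%x. complex_of_real (Re (phi x))) = (%x. complex_of_real (Re (pd j phi x)))"
 by (rule ext, rule pd_eq[OF has_derivative_of_real[OF has_derivative_Re[OF has_derivative_frechet[OF
   smooth_fun_diffb[OF assms]]]], folded pd_def])

lemma test_fun_Re:
 assumes "test_fun \<Omega> phi" shows "test_fun \<Omega> (%x. complex_of_real (Re (phi x)))"
proof -
 have "complex_of_real (Re z) = (1 / 2) * (z + cnj z)" for z by (simp add: complex_add_cnj)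
 then show ?thesis using test_fun_cmult[OF test_fun_add[OF assms test_fun_cnj[OF assms]], of "1/2"] by (simp only:)
qed

lemma dz_dbar:
 assumes s: "smooth_fun phi" shows "dz (dbar phi) x = (pd 1 (pd 1 phi) x + pd 2 (pd 2 phi) x) / 4"
proof -
 have "pd j (dbar phi) x = (pd j (pd 1 phi) x + \<i> * pd j (pd 2 phi) x) / 2" for j
 proof -
  have d: "dbar phi = (%x. (1 / 2) * (pd 1 phi x + \<i> * pd 2 phi x))" by (simp add: dbar_def[abs_def])
  have s': "smooth_fun (%x. \<i> * pd 2 phi x)" by (intro smooth_fun_mult smooth_fun_const smooth_fun_pd s)
  have "pd j (dbar phi) x = (1 / 2) * (pd j (pd 1 phi) x + \<i> * pd j (pd 2 phi) x)"
   unfolding d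
    pd_cmult[OF smooth_fun_diffb[OF smooth_fun_add[OF smooth_fun_pd[OF s] s']]]
    pd_add[OF smooth_fun_diffb[OF smooth_fun_pd[OF s]] smooth_fun_diffb[OF s']]
    pd_cmult[OF smooth_fun_diffb[OF smooth_fun_pd[OF s]]] ..
  then show ?thesis by simp
 qed
 note d = this
 have c: "pd 1 (pd 2 phi) x = pd 2 (pd 1 phi) x" by (rule pd_commute[OF s])
 show ?thesis unfolding dz_def d c by (simp add: field_simps)
qed

lemma inner_dz_L2:
 assumes "test_fun UNIV phi" "test_fun UNIV psi"
 shows "abs_L2 phi \<bullet> abs_L2 (dz psi) = - (abs_L2 (dbar phi) \<bullet> abs_L2 psi)"
proof -
 note a = inner_pd_L2[OF assms, of 1]
 have b: "(\<i> *\<^sub>C abs_L2 (pd 2 phi)) \<bullet> abs_L2 psi = abs_L2 phi \<bullet> (\<i> *\<^sub>C abs_L2 (pd 2 psi))"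
 proof -
  have "pd 2 (%x. \<i> * phi x) = (%x. \<i> * pd 2 phi x)"
   by (rule ext) (rule pd_cmult[OF smooth_fun_diffb[OF test_fun_smooth[OF assms(1)]]])
  then have "(\<i> *\<^sub>C abs_L2 (pd 2 phi)) \<bullet> abs_L2 psi = - ((\<i> *\<^sub>C abs_L2 phi) \<bullet> abs_L2 (pd 2 psi))"
   using inner_pd_L2[OF test_fun_cmult[OF assms(1)] assms(2), of 2 \<i>]
   by (simp only: abs_L2_scaleC[OF test_fun_sq[OF assms(1)]]
     abs_L2_scaleC[OF test_fun_sq[OF test_fun_pd[OF assms(1)]]])
  then show ?thesis by (simp only: inner_iC_antisym minus_minus)
 qed
 have h: "((1 / 2) *\<^sub>C F) \<bullet> G = (F \<bullet> G) / 2" "G \<bullet> ((1 / 2) *\<^sub>C F) = (G \<bullet> F) / 2" for F G :: L2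
  using scaleC_of_real[of "1/2" F] by simp_all
 show ?thesis
  using a b by (simp add: DB_jet[symmetric] DZ_jet[symmetric] assms DB_def DZ_def jet_def h inner_add_left inner_diff_right)
   (simp add: field_simps)
qed

lemma subspace_closure:
 fixes S :: "'a::real_normed_vector set"
 assumes "subspace S" shows "subspace (closure S)"
proof (rule subspaceI)
 show "0 \<in> closure S" using closure_subset subspace_0[OF assms] by blast
 fix x y c assume "x \<in> closure S" "y \<in> closure S"
 then obtain X Y where XY: "!!n. X n \<in> S" "X \<longlonglongrightarrow> x" "!!n. Y n \<in> S" "Y \<longlonglongrightarrow> y"
  unfolding closure_sequential by blast
 have "(%n. X n + Y n) \<longlonglongrightarrow> x + y" "(%n. c *\<^sub>R X n) \<longlonglongrightarrow> c *\<^sub>R x"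
  by (intro tendsto_intros XY)+
 moreover have "X n + Y n \<in> S" "c *\<^sub>R X n \<in> S" for n
  using XY assms by (auto intro: subspace_add subspace_scale)
 ultimately show "x + y \<in> closure S" and "c *\<^sub>R x \<in> closure S"
  unfolding closure_sequential by meson+
qed

text \<open>The component of \<open>(F, K)\<close> orthogonal to the closure is again of the form \<open>(a, b)\<close> with \<open>b\<close> the
 weak derivative of \<open>a\<close>, and orthogonality turns this into \<open>\<Delta> a = 4 a\<close>.\<close>

theorem dbar_graph_closure:
 assumes weak: "!!phi. test_fun UNIV phi ==> F \<bullet> abs_L2 (dz phi) = - (K \<bullet> abs_L2 phi)"
 shows "(F, K) \<in> closure {(abs_L2 phi, abs_L2 (dbar phi)) | phi. test_fun UNIV phi}"
proof -
 define G0 where "G0 = {(abs_L2 phi, abs_L2 (dbar phi)) | phi. test_fun UNIV phi}"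
 have lin: "abs_L2 (dbar (%x. phi x + psi x)) = abs_L2 (dbar phi) + abs_L2 (dbar psi)"
  "abs_L2 (dbar (%x. c *\<^sub>R phi x)) = c *\<^sub>R abs_L2 (dbar phi)"
  if t: "test_fun UNIV phi" "test_fun UNIV psi" for phi psi and c :: real
 proof -
  have tc: "test_fun UNIV (%x. c *\<^sub>R phi x)" unfolding scaleR_conv_of_real by (rule test_fun_cmult[OF t(1)])
  show "abs_L2 (dbar (%x. phi x + psi x)) = abs_L2 (dbar phi) + abs_L2 (dbar psi)"
   using t jet_add[OF t] by (simp add: DB_jet[symmetric] test_fun_add) (simp add: DB_def scaleC_add_right flip: jet_add)
  have "jet (%x. c *\<^sub>R phi x) = of_real c *\<^sub>C jet phi"
   unfolding scaleR_conv_of_real by (rule jet_scaleC[OF t(1), symmetric])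
  then show "abs_L2 (dbar (%x. c *\<^sub>R phi x)) = c *\<^sub>R abs_L2 (dbar phi)"
   using t tc by (simp add: DB_jet[symmetric]) (simp add: DB_def scaleC_prod_def scaleC_scaleC scaleC_add_right mult.commute flip: scaleC_of_real)
 qed
 have "subspace G0"
 proof (rule subspaceI)
  show "0 \<in> G0"
  proof -
   have "dbar (%x. 0) = (%x. 0)" by (rule ext) (simp add: dbar_def)
   then have "0 = (abs_L2 (%x. 0), abs_L2 (dbar (%x. 0)))" by (simp add: abs_L2_zero zero_prod_def)
   then show ?thesis unfolding G0_def using test_fun_zero by blast
  qed
  fix x y c assume "x \<in> G0" "y \<in> G0"
  then obtain phi psi where t: "test_fun UNIV phi" "test_fun UNIV psi" and xy: "x = (abs_L2 phi, abs_L2 (dbar phi))" "y = (abs_L2 psi, abs_L2 (dbar psi))"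
   by (auto simp: G0_def)
  have "x + y = (abs_L2 (%x. phi x + psi x), abs_L2 (dbar (%x. phi x + psi x)))"
   using t by (simp add: xy lin abs_L2_add test_fun_sq)
  then show "x + y \<in> G0" unfolding G0_def using test_fun_add[OF t] by blast
  have "c *\<^sub>R x = (abs_L2 (%x. c *\<^sub>R phi x), abs_L2 (dbar (%x. c *\<^sub>R phi x)))"
   using t by (simp add: xy lin abs_L2_scaleR test_fun_sq)
  moreover have "test_fun UNIV (%x. c *\<^sub>R phi x)" unfolding scaleR_conv_of_real by (rule test_fun_cmult[OF t(1)])
  ultimately show "c *\<^sub>R x \<in> G0" unfolding G0_def by blast
 qed
 then have "subspace (closure G0)" by (rule subspace_closure)
 then obtain g where g: "g \<in> closure G0" "!!v. v \<in> closure G0 ==> ((F, K) - g) \<bullet> v = 0"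
  using orthogonal_projection_exists[of "closure G0" "(F, K)"] by auto
 define a b where "a = F - fst g" and "b = K - snd g"
 \<comment> \<open>On the graph the weak identity is an integration by parts, and it is a closed
   condition; so it holds for the projection \<open>g\<close>, hence for the remainder.\<close>
 have closed: "closure G0 \<subseteq> {p. fst p \<bullet> abs_L2 (dz phi) = - (snd p \<bullet> abs_L2 phi)}" if "test_fun UNIV phi" for phi
  by (rule closure_minimal) (auto simp: G0_def inner_dz_L2 that intro!: closed_Collect_eq continuous_intros)
 have ab1: "a \<bullet> abs_L2 (dz phi) = - (b \<bullet> abs_L2 phi)" if "test_fun UNIV phi" for phi
 proof -
  have "fst g \<bullet> abs_L2 (dz phi) = - (snd g \<bullet> abs_L2 phi)" using closed[OF that] g(1) by blast
  then show ?thesis using weak[OF that] by (simp add: a_def b_def inner_diff_left)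
 qed
 have ab2: "a \<bullet> abs_L2 phi + b \<bullet> abs_L2 (dbar phi) = 0" if "test_fun UNIV phi" for phi
 proof -
  have "(abs_L2 phi, abs_L2 (dbar phi)) \<in> closure G0" using closure_subset[of G0] that by (auto simp: G0_def)
  from g(2)[OF this] show ?thesis by (cases g) (simp add: a_def b_def inner_prod_def)
 qed
 \<comment> \<open>Testing \<open>ab1\<close> with \<open>dbar phi\<close> and \<open>ab2\<close>
   with \<open>phi\<close> eliminates \<open>b\<close>; \<open>dz (dbar phi)\<close> is a quarter of
   the Laplacian.\<close>
 have lap: "a \<bullet> abs_L2 phi = a \<bullet> abs_L2 (%x. (pd 1 (pd 1 phi) x + pd 2 (pd 2 phi) x) / 4)" if "test_fun UNIV phi" for phi
 proof -
  have "dz (dbar phi) = (%x. (pd 1 (pd 1 phi) x + pd 2 (pd 2 phi) x) / 4)"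
   by (rule ext) (rule dz_dbar[OF test_fun_smooth[OF that]])
  with ab2[OF that] ab1[OF test_fun_dbar[OF that]] show ?thesis by simp
 qed
 have "a \<bullet> abs_L2 phi = 0" if t: "test_fun UNIV phi" for phi
 proof -
  have sq: "square_integrable lborel (rep_L2 a)" by simp
  \<comment> \<open>Reduction to real functions: \<open>c = 1\<close> is used with the real part of
    \<open>a\<close>, and \<open>c = \<i>\<close> with its imaginary part.\<close>
  have part: "(LBINT x. r x * Re (rho x)) = 0"
   if t: "test_fun UNIV rho" and m: "r \<in> borel_measurable borel" and i: "integrable lborel (%x. (r x)\<^sup>2)"
    and r: "!!rho. test_fun UNIV (%x. complex_of_real (rho x)) ==> a \<bullet> abs_L2 (%x. c * complex_of_real (rho x)) = (LBINT x. r x * rho x)"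
   for rho r c
  proof (rule helmholtz_uniqueness[OF m i _ t])
   fix rho assume t: "test_fun UNIV rho"
   note tt = test_fun_pd[OF test_fun_pd[OF t]]
   have p2: "pd j (pd j (%x. c * complex_of_real (Re (rho x)))) = (%x. c * complex_of_real (Re (pd j (pd j rho) x)))" for j
   proof -
    have "pd j (%x. c * complex_of_real (Re (psi x))) = (%x. c * complex_of_real (Re (pd j psi x)))" if "test_fun UNIV psi" for psi
     by (rule ext) (simp add: pd_cmult smooth_fun_diffb test_fun_smooth[OF test_fun_Re[OF that]] pd_Re test_fun_smooth[OF that])
    from this[OF t] this[OF test_fun_pd[OF t]] show ?thesis by simp
   qed
   have A: "a \<bullet> abs_L2 (%x. c * complex_of_real (Re (rho x)))
     = a \<bullet> abs_L2 (%x. c * complex_of_real ((Re (pd 1 (pd 1 rho) x) + Re (pd 2 (pd 2 rho) x)) / 4))"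
    using lap[OF test_fun_cmult[OF test_fun_Re[OF t]], of c] unfolding p2 by (simp add: algebra_simps add_divide_distrib)
   have B: "test_fun UNIV (%x. complex_of_real ((Re (pd 1 (pd 1 rho) x) + Re (pd 2 (pd 2 rho) x)) / 4))"
    using test_fun_cmult[OF test_fun_add[OF test_fun_Re[OF tt, of 1] test_fun_Re[OF tt, of 2]], of "1/4"] by simp
   have "(LBINT x. r x * Re (rho x)) = (LBINT x. r x * ((Re (pd 1 (pd 1 rho) x) + Re (pd 2 (pd 2 rho) x)) / 4))"
    by (rule trans[OF r[OF test_fun_Re[OF t], symmetric] trans[OF A r[OF B]]])
   also have "... = (LBINT x. r x * Re (pd 1 (pd 1 rho) x) + r x * Re (pd 2 (pd 2 rho) x)) / 4"
    unfolding integral_divide_zero[symmetric] by (simp add: distrib_left)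
   also have "... = ((LBINT x. r x * Re (pd 1 (pd 1 rho) x)) + (LBINT x. r x * Re (pd 2 (pd 2 rho) x))) / 4"
    by (subst lint_add) (use integrable_mult_test_fun(1)[OF m i tt] in auto)
   finally show "4 * (LBINT x. r x * Re (rho x)) = (LBINT x. r x * Re (pd 1 (pd 1 rho) x)) + (LBINT x. r x * Re (pd 2 (pd 2 rho) x))"
    by simp
  qed
  have m[measurable]: "rep_L2 a \<in> borel_measurable borel" and i: "integrable lborel (%x. (cmod (rep_L2 a x))\<^sup>2)"
   using sq by (auto simp: square_integrable_def)
  have ir: "integrable lborel (%x. (Re (rep_L2 a x))\<^sup>2)" "integrable lborel (%x. (Im (rep_L2 a x))\<^sup>2)"
   by (rule Bochner_Integration.integrable_bound[OF i]; simp add: cmod_power2)+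
  have Re0: "(LBINT x. Re (rep_L2 a x) * Re (rho x)) = 0" if "test_fun UNIV rho" for rho
   by (rule part[OF that _ ir(1), where c = 1])
    (auto simp: inner_abs_L2[OF sq test_fun_sq, simplified] inner_complex_def)
  have Im0: "(LBINT x. Im (rep_L2 a x) * Re (rho x)) = 0" if "test_fun UNIV rho" for rho
   by (rule part[OF that _ ir(2), where c = \<i>])
    (auto simp: inner_abs_L2[OF sq test_fun_sq[OF test_fun_cmult], simplified] inner_complex_def)
  have "a \<bullet> abs_L2 phi = (LBINT x. Re (rep_L2 a x) * Re (phi x) + Im (rep_L2 a x) * Re (- \<i> * phi x))"
   using inner_abs_L2[OF sq test_fun_sq[OF t]] by (simp add: inner_complex_def)
  also have "... = (LBINT x. Re (rep_L2 a x) * Re (phi x)) + (LBINT x. Im (rep_L2 a x) * Re (- \<i> * phi x))"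
   by (rule lint_add)
    (rule integrable_mult_test_fun(1)[OF _ ir(1) t] integrable_mult_test_fun(1)[OF _ ir(2) test_fun_cmult[OF t]]; simp)+
  also have "... = 0" using Re0[OF t] Im0[OF test_fun_cmult[OF t, of "- \<i>"]] by simp
  finally show ?thesis .
 qed
 then have "a = 0" by (rule orthogonal_test_fun_zero)
 then have "b = 0" using ab1 by (intro orthogonal_test_fun_zero) auto
 with \<open>a = 0\<close> have "(F, K) = g" by (cases g) (simp add: a_def b_def)
 then show ?thesis using g(1) by (simp add: G0_def)
qed

section \<open>One-dimensional Hausdorff measure\<close>

definition h1_outer :: "(real^2) set => ennreal" where
 "h1_outer S = (SUP \<delta>\<in>{0<..}. hausdorff1_pre \<delta> S)"

lemma hausdorff1_pre_le:
 assumes "S \<subseteq> (\<Union>n. U n)" "!!n. bounded (U n)" "!!n. diameter (U n) \<le> \<delta>"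
 shows "hausdorff1_pre \<delta> S \<le> (\<Sum>n. ennreal (diameter (U n)))"
 unfolding hausdorff1_pre_def by (rule INF_lower2[of U]) (use assms in auto)

lemma hausdorff1_pre_mono: "S \<subseteq> T ==> hausdorff1_pre \<delta> S \<le> hausdorff1_pre \<delta> T"
 unfolding hausdorff1_pre_def by (rule INF_superset_mono) auto

lemma hausdorff1_pre_antimono: "\<delta> \<le> \<delta>' ==> hausdorff1_pre \<delta>' S \<le> hausdorff1_pre \<delta> S"
 unfolding hausdorff1_pre_def by (rule INF_superset_mono) (auto intro: order_trans)

lemma hausdorff1_pre_le_outer: "\<delta> > 0 ==> hausdorff1_pre \<delta> S \<le> h1_outer S"
 unfolding h1_outer_def by (rule SUP_upper) auto

lemma hausdorff1_outer_mono: "S \<subseteq> T ==> h1_outer S \<le> h1_outer T"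
 unfolding h1_outer_def by (rule SUP_mono) (use hausdorff1_pre_mono in blast)

lemma hausdorff1_outer_empty: "h1_outer {} = 0"
proof -
 have "hausdorff1_pre \<delta> {} \<le> 0" if "\<delta> > 0" for \<delta>
  using hausdorff1_pre_le[of "{}" "%_. {}" \<delta>] that by simp
 then have "h1_outer {} \<le> 0" unfolding h1_outer_def by (intro SUP_least) auto
 then show ?thesis by simp
qed

lemma hausdorff1_pre_countable_subadditive:
 "hausdorff1_pre \<delta> (\<Union>i. A i) \<le> (\<Sum>i. hausdorff1_pre \<delta> (A i))"
proof (rule ennreal_le_epsilon)
 fix e :: real assume fin: "(\<Sum>i. hausdorff1_pre \<delta> (A i)) < top" and e: "e > 0"
 have "\<exists>U. A i \<subseteq> (\<Union>n. U n) \<and> (\<forall>n. bounded (U n) \<and> diameter (U n) \<le> \<delta>) \<and>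
   (\<Sum>n. ennreal (diameter (U n))) \<le> hausdorff1_pre \<delta> (A i) + ennreal (e * (1 / 2) ^ Suc i)" for i
 proof -
  have "hausdorff1_pre \<delta> (A i) \<le> (\<Sum>i. hausdorff1_pre \<delta> (A i))"
   using sum_le_suminf[of "%i. hausdorff1_pre \<delta> (A i)" "{i}"] by simp
  then have f: "hausdorff1_pre \<delta> (A i) < top" using fin by (rule le_less_trans)
  have "0 < ennreal (e * (1 / 2) ^ Suc i)" using e by simp
  then have "hausdorff1_pre \<delta> (A i) < hausdorff1_pre \<delta> (A i) + ennreal (e * (1 / 2) ^ Suc i)"
   using f by (simp add: ennreal_add_left_cancel_less[of _ 0, simplified])
  then show ?thesis
   unfolding hausdorff1_pre_def by (subst (asm) (1) INF_less_iff) (auto intro: less_imp_le)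
 qed
 then obtain U where U: "!!i. A i \<subseteq> (\<Union>n. U i n)" "!!i n. bounded (U i n)" "!!i n. diameter (U i n) \<le> \<delta>"
  "!!i. (\<Sum>n. ennreal (diameter (U i n))) \<le> hausdorff1_pre \<delta> (A i) + ennreal (e * (1 / 2) ^ Suc i)"
  by metis
 define W where "W k = (case prod_decode k of (i, n) => U i n)" for k
 have W: "W (prod_encode (i, n)) = U i n" for i n by (simp add: W_def)
 have "hausdorff1_pre \<delta> (\<Union>i. A i) \<le> (\<Sum>k. ennreal (diameter (W k)))"
 proof (rule hausdorff1_pre_le)
  show "(\<Union>i. A i) \<subseteq> (\<Union>n. W n)"
  proof
   fix x assume "x \<in> (\<Union>i. A i)"
   then obtain i n where "x \<in> U i n" using U(1) by blast
   then show "x \<in> (\<Union>n. W n)" using W[of i n] by blast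
  qed
 qed (use U in \<open>auto simp: W_def split: prod.split\<close>)
 also have "... = (\<Sum>i. \<Sum>n. ennreal (diameter (U i n)))"
  using suminf_ennreal_2dimen[of "%i. \<Sum>n. ennreal (diameter (U i n))" "%(i, n). ennreal (diameter (U i n))"]
  by (simp add: W_def case_prod_beta)
 also have "... \<le> (\<Sum>i. hausdorff1_pre \<delta> (A i) + ennreal (e * (1 / 2) ^ Suc i))"
  by (intro suminf_le U) auto
 also have "... = (\<Sum>i. hausdorff1_pre \<delta> (A i)) + (\<Sum>i. ennreal (e * (1 / 2) ^ Suc i))"
  by (rule suminf_add[symmetric]) auto
 also have "(\<Sum>i. ennreal (e * (1 / 2) ^ Suc i)) = ennreal e"
 proof -
  have "(%i. e * (1 / 2) ^ Suc i) sums (e * 1)" by (intro sums_mult power_half_series)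
  then show ?thesis using e by (subst suminf_ennreal2) (auto simp: sums_iff)
 qed
 finally show "hausdorff1_pre \<delta> (\<Union>i. A i) \<le> (\<Sum>i. hausdorff1_pre \<delta> (A i)) + ennreal e" .
qed

lemma hausdorff1_outer_countable_subadditive:
 "h1_outer (\<Union>i. A i) \<le> (\<Sum>i. h1_outer (A i))"
 unfolding h1_outer_def[of "\<Union>i. A i"]
proof (rule SUP_least)
 fix \<delta> :: real assume "\<delta> \<in> {0<..}"
 then have "(\<Sum>i. hausdorff1_pre \<delta> (A i)) \<le> (\<Sum>i. h1_outer (A i))"
  by (intro suminf_le hausdorff1_pre_le_outer) auto
 with hausdorff1_pre_countable_subadditive show "hausdorff1_pre \<delta> (\<Union>i. A i) \<le> (\<Sum>i. h1_outer (A i))"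
  by (rule order_trans)
qed

lemma hausdorff1_outer_Un: "h1_outer (A \<union> B) \<le> h1_outer A + h1_outer B"
proof -
 define C where "C i = (if i = 0 then A else if i = 1 then B else {})" for i :: nat
 have "A \<union> B = (\<Union>i. C i)" by (auto simp: C_def split: if_splits)
 then have "h1_outer (A \<union> B) \<le> (\<Sum>i. h1_outer (C i))"
  using hausdorff1_outer_countable_subadditive[of C] by simp
 also have "... = (\<Sum>i\<in>{0, 1}. h1_outer (C i))"
  by (rule suminf_finite) (auto simp: C_def hausdorff1_outer_empty)
 also have "... = h1_outer A + h1_outer B" by (simp add: C_def)
 finally show ?thesis .
qed

text \<open>In a cover by sets of diameter below \<open>d\<close> no set meets both \<open>A\<close>
  and \<open>B\<close>, so it splits into a cover of \<open>A\<close> and one of \<open>B\<close>.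
  Monotonicity in the scale then allows the two suprema to be taken independently.\<close>

lemma hausdorff1_outer_separated:
 assumes d: "d > 0" "!!x y. x \<in> A ==> y \<in> B ==> d \<le> dist x y"
 shows "h1_outer A + h1_outer B \<le> h1_outer (A \<union> B)"
proof -
 have small: "hausdorff1_pre \<delta> A + hausdorff1_pre \<delta> B \<le> hausdorff1_pre \<delta> (A \<union> B)" if \<delta>: "\<delta> > 0" "\<delta> < d" for \<delta>
  unfolding hausdorff1_pre_def[of \<delta> "A \<union> B"]
 proof (rule INF_greatest)
  fix U assume "U \<in> {U :: nat => (real^2) set. A \<union> B \<subseteq> (\<Union>n. U n) \<and> (\<forall>n. bounded (U n) \<and> diameter (U n) \<le> \<delta>)}"
  then have U: "A \<union> B \<subseteq> (\<Union>n. U n)" "!!n. bounded (U n)" "!!n. diameter (U n) \<le> \<delta>" by auto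
  define UA where "UA n = (if U n \<inter> A \<noteq> {} then U n else {})" for n
  define UB where "UB n = (if U n \<inter> A \<noteq> {} then {} else U n)" for n
  have B: "U n \<inter> A = {}" if "y \<in> U n" "y \<in> B" for y n
  proof (rule ccontr)
   assume "U n \<inter> A \<noteq> {}"
   then obtain x where "x \<in> U n" "x \<in> A" by blast
   then have "d \<le> diameter (U n)"
    using d(2)[of x y] that diameter_bounded_bound[OF U(2)[of n], of x y] by simp
   then show False using U(3)[of n] \<delta> by linarith
  qed
  have "hausdorff1_pre \<delta> A \<le> (\<Sum>n. ennreal (diameter (UA n)))"
   by (rule hausdorff1_pre_le) (use U \<delta> in \<open>force simp: UA_def\<close>)+
  moreover have "hausdorff1_pre \<delta> B \<le> (\<Sum>n. ennreal (diameter (UB n)))"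
  proof (rule hausdorff1_pre_le)
   show "B \<subseteq> (\<Union>n. UB n)"
   proof
    fix y assume "y \<in> B"
    then obtain n where "y \<in> U n" using U(1) by blast
    then show "y \<in> (\<Union>n. UB n)" using B[OF _ \<open>y \<in> B\<close>] by (auto simp: UB_def)
   qed
  qed (use U \<delta> in \<open>auto simp: UB_def\<close>)
  ultimately have "hausdorff1_pre \<delta> A + hausdorff1_pre \<delta> B
    \<le> (\<Sum>n. ennreal (diameter (UA n))) + (\<Sum>n. ennreal (diameter (UB n)))" by (rule add_mono)
  also have "... = (\<Sum>n. ennreal (diameter (UA n)) + ennreal (diameter (UB n)))"
   by (rule suminf_add) auto
  also have "... = (\<Sum>n. ennreal (diameter (U n)))"
   by (rule suminf_cong) (simp add: UA_def UB_def)
  finally show "hausdorff1_pre \<delta> A + hausdorff1_pre \<delta> B \<le> (\<Sum>n. ennreal (diameter (U n)))" .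
 qed
 have "hausdorff1_pre \<delta>1 A + hausdorff1_pre \<delta>2 B \<le> h1_outer (A \<union> B)" if "\<delta>1 > 0" "\<delta>2 > 0" for \<delta>1 \<delta>2
 proof -
  define \<delta> where "\<delta> = min (min \<delta>1 \<delta>2) (d / 2)"
  have \<delta>: "\<delta> > 0" "\<delta> < d" "\<delta> \<le> \<delta>1" "\<delta> \<le> \<delta>2" using that d by (auto simp: \<delta>_def)
  have "hausdorff1_pre \<delta>1 A + hausdorff1_pre \<delta>2 B \<le> hausdorff1_pre \<delta> A + hausdorff1_pre \<delta> B"
   by (intro add_mono hausdorff1_pre_antimono \<delta>)
  also have "... \<le> hausdorff1_pre \<delta> (A \<union> B)" by (rule small[OF \<delta>(1,2)])
  also have "... \<le> h1_outer (A \<union> B)" by (rule hausdorff1_pre_le_outer[OF \<delta>(1)])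
  finally show ?thesis .
 qed
 then have "(SUP \<delta>1\<in>{0<..}. hausdorff1_pre \<delta>1 A + hausdorff1_pre \<delta>2 B) \<le> h1_outer (A \<union> B)" if "\<delta>2 > 0" for \<delta>2
  using that by (intro SUP_least) auto
 then have "h1_outer A + hausdorff1_pre \<delta>2 B \<le> h1_outer (A \<union> B)" if "\<delta>2 > 0" for \<delta>2
  using that by (subst (asm) ennreal_SUP_add_left) (auto simp: h1_outer_def)
 then have "(SUP \<delta>2\<in>{0<..}. hausdorff1_pre \<delta>2 B + h1_outer A) \<le> h1_outer (A \<union> B)"
  by (intro SUP_least) (auto simp: add.commute)
 then show ?thesis
  by (subst (asm) ennreal_SUP_add_left) (auto simp: h1_outer_def[of B] add.commute)
qed

text \<open>Caratheodory's criterion for metric outer measures. Points just outside the half-plane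
  are not separated from it, so the outside is exhausted by the sets \<open>B n\<close> at positive
  distance. The slices \<open>R n\<close> between them have summable measure, because slices of
  equal parity are separated from each other; hence a far tail costs at most
  \<open>e\<close>.\<close>

lemma hausdorff1_outer_halfspace:
 fixes b :: "real^2"
 assumes b: "norm b = 1"
 shows "h1_outer (X \<inter> {x. x \<bullet> b \<le> a}) + h1_outer (X - {x. x \<bullet> b \<le> a}) \<le> h1_outer X"
proof (rule ennreal_le_epsilon)
 fix e :: real assume fin: "h1_outer X < top" and e: "e > 0"
 let ?H = "{x. x \<bullet> b \<le> a}"
 define t where "t n = a + 1 / (real n + 1)" for n
 have t_less: "t n < t m" if "m < n" for m n using that by (simp add: t_def frac_less2)
 define B where "B n = {x \<in> X. t n \<le> x \<bullet> b}" for n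
 define R where "R n = B (Suc n) - B n" for n
 have sep: "h1_outer P + h1_outer Q \<le> h1_outer (P \<union> Q)"
  if "!!x. x \<in> P ==> x \<bullet> b \<le> s" "!!y. y \<in> Q ==> s' \<le> y \<bullet> b" "s < s'" for P Q s s'
 proof (rule hausdorff1_outer_separated[where d = "s' - s"])
  fix x y assume "x \<in> P" "y \<in> Q"
  then have "s' - s \<le> (y - x) \<bullet> b" using that(1)[of x] that(2)[of y] by (simp add: inner_diff_left)
  also have "... \<le> norm (y - x) * norm b" by (rule norm_cauchy_schwarz)
  finally show "s' - s \<le> dist x y" using b by (simp add: dist_norm norm_minus_commute)
 qed (use that in simp)
 have Bmono: "B m \<subseteq> B n" if "m \<le> n" for m n
  using that t_less[of m n] by (cases "m = n") (auto simp: B_def)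
 have Rfin: "h1_outer (R n) < top" for n
  by (rule le_less_trans[OF hausdorff1_outer_mono fin]) (auto simp: R_def B_def)
 have step: "h1_outer (B n) + h1_outer (R (Suc n)) \<le> h1_outer (B (Suc (Suc n)))" for n
 proof -
  have "h1_outer (R (Suc n)) + h1_outer (B n) \<le> h1_outer (R (Suc n) \<union> B n)"
   by (rule sep[where s = "t (Suc n)" and s' = "t n"]) (auto simp: R_def B_def intro: t_less)
  also have "... \<le> h1_outer (B (Suc (Suc n)))"
   by (rule hausdorff1_outer_mono) (use Bmono[of n "Suc (Suc n)"] in \<open>auto simp: R_def\<close>)
  finally show ?thesis by (simp add: add.commute)
 qed
 \<comment> \<open>The slices of one parity are collected in the first term on the right, those of
   the other parity in the second; each term is at most the measure of \<open>X\<close>.\<close>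
 have "(\<Sum>k<2 * n. h1_outer (R (Suc k))) \<le> h1_outer (B (2 * n)) + h1_outer (B (Suc (2 * n)))" for n
 proof (induction n)
  case (Suc n)
  have "(\<Sum>k<2 * Suc n. h1_outer (R (Suc k)))
    = (\<Sum>k<2 * n. h1_outer (R (Suc k))) + (h1_outer (R (Suc (2 * n))) + h1_outer (R (Suc (Suc (2 * n)))))"
   by (simp add: add.assoc)
  also have "... \<le> (h1_outer (B (2 * n)) + h1_outer (B (Suc (2 * n)))) + (h1_outer (R (Suc (2 * n))) + h1_outer (R (Suc (Suc (2 * n)))))"
   by (rule add_right_mono[OF Suc])
  also have "... = (h1_outer (B (2 * n)) + h1_outer (R (Suc (2 * n)))) + (h1_outer (B (Suc (2 * n))) + h1_outer (R (Suc (Suc (2 * n)))))"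
   by (simp add: add_ac)
  also have "... \<le> h1_outer (B (2 * Suc n)) + h1_outer (B (Suc (2 * Suc n)))"
   using add_mono[OF step[of "2 * n"] step[of "Suc (2 * n)"]] by simp
  finally show ?case .
 qed simp
 moreover have "h1_outer (B n) \<le> h1_outer X" for n
  by (rule hausdorff1_outer_mono) (auto simp: B_def)
 ultimately have bound: "(\<Sum>k<2 * n. h1_outer (R (Suc k))) \<le> h1_outer X + h1_outer X" for n
  by (meson add_mono order_trans)
 define g where "g k = enn2real (h1_outer (R (Suc k)))" for k
 have g: "h1_outer (R (Suc k)) = ennreal (g k)" "g k \<ge> 0" for k
  using Rfin[of "Suc k"] by (simp_all add: g_def)
 obtain C where C: "h1_outer X = ennreal C" "C \<ge> 0"
  using fin by (cases "h1_outer X") auto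
 have "summable g"
 proof (rule bounded_imp_summable[OF g(2), where B = "C + C"])
  fix n
  have "ennreal (\<Sum>k<2 * Suc n. g k) \<le> ennreal (C + C)"
   using bound[of "Suc n"] C g(2) unfolding g(1) C(1) by (simp only: sum_ennreal ennreal_plus)
  then have "(\<Sum>k<2 * Suc n. g k) \<le> C + C" using C(2) by (subst (asm) ennreal_le_iff) auto
  moreover have "(\<Sum>k\<le>n. g k) \<le> (\<Sum>k<2 * Suc n. g k)"
   by (rule sum_mono2) (use g(2) in auto)
  ultimately show "sum g {..n} \<le> C + C" by simp
 qed
 then obtain N where N: "norm (\<Sum>i. g (i + N)) < e" using suminf_exist_split[OF e, of g] by blast
 have tail: "(\<Sum>k. h1_outer (R (Suc (k + N)))) \<le> ennreal e"
 proof -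
  have s: "summable (%i. g (i + N))" using \<open>summable g\<close> by (rule summable_ignore_initial_segment)
  have "(\<Sum>k. h1_outer (R (Suc (k + N)))) = ennreal (\<Sum>i. g (i + N))"
   unfolding g(1) by (rule suminf_ennreal2[OF _ s]) (rule g(2))
  also have "... \<le> ennreal e" using N by (intro ennreal_leI) auto
  finally show ?thesis .
 qed
 have cover: "X - ?H \<subseteq> B (Suc N) \<union> (\<Union>k. R (Suc (k + N)))"
 proof
  fix x assume x: "x \<in> X - ?H"
  then have "0 < x \<bullet> b - a" by simp
  then obtain m where "inverse (real (Suc m)) < x \<bullet> b - a" using reals_Archimedean by blast
  then have xm: "x \<in> B m" using x by (auto simp: B_def t_def divide_inverse add.commute)
  have "\<exists>n. x \<in> B n" using xm by blast
  define l where "l = (LEAST n. x \<in> B n)"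
  have l: "x \<in> B l" unfolding l_def by (rule LeastI[of _ m]) (rule xm)
  show "x \<in> B (Suc N) \<union> (\<Union>k. R (Suc (k + N)))"
  proof (cases "l \<le> Suc N")
   case True then show ?thesis using Bmono[OF True] l by blast
  next
   case False
   then obtain k where k: "l = Suc (Suc (k + N))" by (metis add.commute less_natE not_less_eq_eq add_Suc not_le less_eq_Suc_le)
   have "x \<notin> B (Suc (k + N))" using not_less_Least[of "Suc (k + N)" "%n. x \<in> B n"] k by (simp add: l_def)
   then have "x \<in> R (Suc (k + N))" using l k by (simp add: R_def)
   then show ?thesis by blast
  qed
 qed
 have "h1_outer (X - ?H) \<le> h1_outer (B (Suc N)) + h1_outer (\<Union>k. R (Suc (k + N)))"
  by (rule order_trans[OF hausdorff1_outer_mono[OF cover] hausdorff1_outer_Un])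
 also have "h1_outer (\<Union>k. R (Suc (k + N))) \<le> ennreal e"
  by (rule order_trans[OF hausdorff1_outer_countable_subadditive tail])
 finally have "h1_outer (X \<inter> ?H) + h1_outer (X - ?H)
   \<le> h1_outer (X \<inter> ?H) + (h1_outer (B (Suc N)) + ennreal e)"
  by (simp add: add_left_mono)
 also have "... = (h1_outer (X \<inter> ?H) + h1_outer (B (Suc N))) + ennreal e" by (simp add: add.assoc)
 also have "h1_outer (X \<inter> ?H) + h1_outer (B (Suc N)) \<le> h1_outer ((X \<inter> ?H) \<union> B (Suc N))"
  by (rule sep[where s = a and s' = "t (Suc N)"]) (auto simp: B_def t_def)
 also have "... \<le> h1_outer X" by (rule hausdorff1_outer_mono) (auto simp: B_def)
 finally show "h1_outer (X \<inter> ?H) + h1_outer (X - ?H) \<le> h1_outer X + ennreal e"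
  by (simp add: add_right_mono)
qed

text \<open>\<open>measure_of\<close> reproduces the given set function only if it is countably
  additive on the sigma-algebra. The sets that split every set additively form a sigma-algebra with
  this property, and half-planes, which generate the Borel sets, belong to it.\<close>

lemma measure_space_hausdorff1_outer: "measure_space UNIV (sets borel) h1_outer"
proof -
 interpret P: sigma_algebra UNIV "Pow (UNIV :: (real^2) set)" by (rule sigma_algebra_Pow)
 define L where "L = lambda_system UNIV (Pow UNIV) h1_outer"
 have "outer_measure_space (Pow UNIV) h1_outer"
  unfolding outer_measure_space_def positive_def increasing_def countably_subadditive_def
  using hausdorff1_outer_empty hausdorff1_outer_mono hausdorff1_outer_countable_subadditive by auto
 then have ms: "measure_space UNIV L h1_outer"
  unfolding L_def by (rule P.caratheodory_lemma)
 then have sa: "sigma_algebra UNIV L" by (simp add: measure_space_def)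
 have "{x :: real^2. x \<bullet> b \<le> a} \<in> L" if "b \<in> Basis" for a b
  unfolding L_def P.lambda_system_eq
 proof (intro CollectI conjI ballI)
  fix X :: "(real^2) set"
  have "h1_outer X \<le> h1_outer (X \<inter> {x. x \<bullet> b \<le> a}) + h1_outer (X - {x. x \<bullet> b \<le> a})"
   by (rule order_trans[OF hausdorff1_outer_mono hausdorff1_outer_Un]) auto
  then show "h1_outer (X \<inter> {x. x \<bullet> b \<le> a}) + h1_outer (X - {x. x \<bullet> b \<le> a}) = h1_outer X"
   using hausdorff1_outer_halfspace[OF norm_Basis[OF that], of X a] by (rule antisym[rotated])
 qed simp
 then have "sigma_sets UNIV ((%(a, i). {x :: real^2. x \<bullet> i \<le> a}) ` (UNIV \<times> Basis)) \<subseteq> L"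
  by (intro sigma_algebra.sigma_sets_subset[OF sa]) auto
 moreover have "sets borel = sigma_sets UNIV ((%(a, i). {x :: real^2. x \<bullet> i \<le> a}) ` (UNIV \<times> Basis))"
  by (subst borel_eq_halfspace_le) simp
 ultimately have "sets (borel :: (real^2) measure) \<subseteq> L" by simp
 then show ?thesis
  using measure_down[OF ms _] sets.sigma_algebra_axioms[of "borel :: (real^2) measure"] by simp
qed

section \<open>Hausdorff measure of a smooth arc\<close>

lemma sets_hausdorff1 [measurable_cong, simp]: "sets hausdorff1 = sets borel"
 by (simp add: hausdorff1_def sets_measure_of_conv sets.sigma_sets_eq[of borel, simplified])

lemma space_hausdorff1 [simp]: "space hausdorff1 = UNIV"
 by (simp add: hausdorff1_def space_measure_of_conv)

lemma emeasure_hausdorff1: "S \<in> sets borel ==> emeasure hausdorff1 S = h1_outer S"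
 using measure_space_hausdorff1_outer unfolding hausdorff1_def h1_outer_def[abs_def, symmetric] measure_space_def
 by (intro emeasure_measure_of_sigma) auto

text \<open>A map that does not increase distances turns a cover of \<open>S\<close> into a cover of
  \<open>{c..d}\<close> by sets inside intervals no longer than the diameters; subadditivity of
  Lebesgue measure does the rest.\<close>

lemma hausdorff1_outer_lower:
 fixes p :: "real^2 => real"
 assumes lip: "!!x y. \<bar>p x - p y\<bar> \<le> dist x y" and sub: "{c..d} \<subseteq> p ` S" and cd: "c \<le> d"
 shows "ennreal (d - c) \<le> h1_outer S"
proof -
 have "ennreal (d - c) \<le> hausdorff1_pre 1 S"
  unfolding hausdorff1_pre_def
 proof (rule INF_greatest)
  fix U assume "U \<in> {U :: nat => (real^2) set. S \<subseteq> (\<Union>n. U n) \<and> (\<forall>n. bounded (U n) \<and> diameter (U n) \<le> 1)}"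
  then have U: "S \<subseteq> (\<Union>n. U n)" "!!n. bounded (U n)" by auto
  define J where "J n = (if U n = {} then {} else {Inf (p ` U n)..Sup (p ` U n)})" for n
  have bd: "p x - p y \<le> diameter (U n)" if "x \<in> U n" "y \<in> U n" for x y n
   using lip[of x y] diameter_bounded_bound[OF U(2)[of n] that] by linarith
  have bdd: "bdd_above (p ` U n)" "bdd_below (p ` U n)" for n
  proof -
   have "p x \<le> p y + diameter (U n)" "p y - diameter (U n) \<le> p x" if "x \<in> U n" "y \<in> U n" for x y
    using bd[OF that] bd[OF that(2,1)] by linarith+
   then show "bdd_above (p ` U n)" "bdd_below (p ` U n)"
    using bdd_aboveI2[of "U n" p] bdd_belowI2[of "U n" _ p] by (metis equals0I)+
  qed
  have J_sub: "p x \<in> J n" if "x \<in> U n" for x n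
   using that bdd[of n] by (auto simp: J_def intro: cInf_lower cSup_upper)
  have J_le: "emeasure lborel (J n) \<le> ennreal (diameter (U n))" for n
  proof (cases "U n = {}")
   case False
   have "p x \<le> Inf (p ` U n) + diameter (U n)" if "x \<in> U n" for x
   proof -
    have "p x - diameter (U n) \<le> Inf (p ` U n)"
     using False by (intro cInf_greatest) (use bd[OF that] in force)+
    then show ?thesis by simp
   qed
   then have "Sup (p ` U n) \<le> Inf (p ` U n) + diameter (U n)" using False by (intro cSup_least) auto
   moreover obtain x where "x \<in> U n" using False by blast
   then have "Inf (p ` U n) \<le> Sup (p ` U n)" using J_sub[of x n] False by (simp add: J_def)
   ultimately show ?thesis using False by (auto simp: J_def intro: ennreal_leI)
  qed (simp add: J_def)
  have "ennreal (d - c) = emeasure lborel {c..d}" using cd by simp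
  also have "... \<le> emeasure lborel (\<Union>n. J n)"
  proof (rule emeasure_mono)
   show "{c..d} \<subseteq> (\<Union>n. J n)"
   proof
    fix t assume "t \<in> {c..d}"
    then obtain x where "x \<in> S" "t = p x" using sub by blast
    then show "t \<in> (\<Union>n. J n)" using U(1) J_sub by blast
   qed
  qed (auto simp: J_def)
  also have "... \<le> (\<Sum>n. emeasure lborel (J n))"
   by (rule emeasure_subadditive_countably) (auto simp: J_def)
  also have "... \<le> (\<Sum>n. ennreal (diameter (U n)))" by (intro suminf_le J_le) auto
  finally show "ennreal (d - c) \<le> (\<Sum>n. ennreal (diameter (U n)))" .
 qed
 also have "... \<le> h1_outer S" by (rule hausdorff1_pre_le_outer) simp
 finally show ?thesis .
qed

text \<open>\<open>N\<close> pieces of equal parameter length have images of diameter at most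
  \<open>K * (b - a) / N\<close>, which is below the scale for large \<open>N\<close>, and these
  bounds add up to \<open>K * (b - a)\<close> at every scale.\<close>

lemma hausdorff1_outer_upper:
 fixes gam :: "real => real^2"
 assumes ab: "a \<le> b" and K: "K \<ge> 0"
  and lip: "!!s t. s \<in> {a..b} ==> t \<in> {a..b} ==> dist (gam s) (gam t) \<le> K * \<bar>s - t\<bar>"
 shows "h1_outer (gam ` {a..b}) \<le> ennreal (K * (b - a))"
 unfolding h1_outer_def
proof (rule SUP_least)
 fix \<delta> :: real assume "\<delta> \<in> {0<..}"
 then have "\<delta> > 0" by simp
 obtain N :: nat where N0: "K * (b - a) / \<delta> < real N" using reals_Archimedean2 by blast
 have N: "N > 0"
 proof (rule ccontr)
  assume "\<not> N > 0"
  then have "K * (b - a) / \<delta> < 0" using N0 by simp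
  then show False using K ab \<open>\<delta> > 0\<close> by (simp add: divide_less_0_iff mult_less_0_iff)
 qed
 define l where "l = (b - a) / real N"
 have l: "l \<ge> 0" "K * l \<le> \<delta>" "real N * l = b - a"
  using ab N N0 \<open>\<delta> > 0\<close> by (auto simp: l_def field_simps)
 define U where "U n = (if n < N then gam ` {a + real n * l..a + (real n + 1) * l} else {})" for n
 have in_ab: "{a + real n * l..a + (real n + 1) * l} \<subseteq> {a..b}" if "n < N" for n
 proof -
  have "(real n + 1) * l \<le> real N * l" using that l by (intro mult_right_mono) auto
  then show ?thesis using l by auto
 qed
 have dist_le: "dist x y \<le> K * l" if xy: "x \<in> U n" "y \<in> U n" and n: "n < N" for x y n
 proof -
  obtain s t where st: "s \<in> {a + real n * l..a + (real n + 1) * l}" "t \<in> {a + real n * l..a + (real n + 1) * l}" "x = gam s" "y = gam t"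
   using xy n by (auto simp: U_def)
  have "dist x y \<le> K * \<bar>s - t\<bar>" using lip in_ab[OF n] st by blast
  also have "... \<le> K * l" using st K by (intro mult_left_mono) (auto simp: algebra_simps abs_le_iff)
  finally show ?thesis .
 qed
 have bdd: "bounded (U n)" for n
 proof (cases "n < N")
  case True
  then show ?thesis using dist_le[OF _ _ True] bounded_two_points[of "U n"] by blast
 qed (simp add: U_def)
 have diam: "diameter (U n) \<le> (if n < N then K * l else 0)" for n
  using dist_le l K by (auto intro!: diameter_le simp: dist_norm) (simp add: U_def)
 have "hausdorff1_pre \<delta> (gam ` {a..b}) \<le> (\<Sum>n. ennreal (diameter (U n)))"
 proof (rule hausdorff1_pre_le[OF _ bdd])
  show "gam ` {a..b} \<subseteq> (\<Union>n. U n)"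
  proof (rule image_subsetI)
   fix t assume t: "t \<in> {a..b}"
   show "gam t \<in> (\<Union>n. U n)"
   \<comment> \<open>At \<open>t = b\<close> the floor used below would return the index
     \<open>N\<close>, one past the last piece; \<open>l = 0\<close> is the case
     \<open>a = b\<close>.\<close>
   proof (cases "t = b \<or> l = 0")
    case True
    have "t \<in> {a + real (N - 1) * l..a + (real (N - 1) + 1) * l}"
     using True t l N by (auto simp: of_nat_diff algebra_simps)
    then show ?thesis using N by (intro UN_I[of "N - 1"]) (auto simp: U_def)
   next
    case False
    define n where "n = nat \<lfloor>(t - a) / l\<rfloor>"
    have l0: "l > 0" using False l by simp
    have r: "(t - a) / l \<ge> 0" using t l0 by simp
    have n: "real n \<le> (t - a) / l" "(t - a) / l < real n + 1" using r by (auto simp: n_def)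
    have "(t - a) / l < real N" using l False t l0 by (simp add: divide_less_eq)
    then have "n < N" using n by linarith
    moreover have "t \<in> {a + real n * l..a + (real n + 1) * l}" using n l0 by (auto simp: field_simps)
    ultimately show ?thesis by (intro UN_I[of n]) (auto simp: U_def)
   qed
  qed
  show "diameter (U n) \<le> \<delta>" for n using diam[of n] l \<open>\<delta> > 0\<close> by (auto split: if_splits)
 qed
 also have "... \<le> (\<Sum>n. ennreal (if n < N then K * l else 0))"
  by (intro suminf_le ennreal_leI diam) auto
 also have "... = (\<Sum>n<N. ennreal (if n < N then K * l else 0))"
  by (rule suminf_finite) auto
 also have "... = ennreal (\<Sum>n<N. K * l)"
  using K l by (subst sum_ennreal[symmetric]) auto
 also have "(\<Sum>n<N. K * l) = K * (b - a)"
  unfolding l(3)[symmetric] by simp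
 finally show "hausdorff1_pre \<delta> (gam ` {a..b}) \<le> ennreal (K * (b - a))" .
qed

text \<open>Projection onto the direction of the chord does not increase distances, and by the
  intermediate value theorem the image of the arc contains the whole interval between the projected
  end points.\<close>

lemma hausdorff1_outer_chord:
 fixes gam :: "real => real^2"
 assumes "s \<le> t" and cont: "continuous_on {s..t} gam"
 shows "ennreal (norm (gam t - gam s)) \<le> h1_outer (gam ` {s..t})"
proof (cases "gam t = gam s")
 case False
 define \<tau> where "\<tau> = (gam t - gam s) /\<^sub>R norm (gam t - gam s)"
 have \<tau>: "norm \<tau> = 1" using False by (simp add: \<tau>_def)
 have chord: "gam t \<bullet> \<tau> - gam s \<bullet> \<tau> = norm (gam t - gam s)"
 proof -
  have "gam t \<bullet> \<tau> - gam s \<bullet> \<tau> = (gam t - gam s) \<bullet> \<tau>" by (simp only: inner_diff_left)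
  also have "... = norm (gam t - gam s)"
   using False by (simp add: \<tau>_def power2_norm_eq_inner[symmetric] power2_eq_square)
  finally show ?thesis .
 qed
 have "ennreal (gam t \<bullet> \<tau> - gam s \<bullet> \<tau>) \<le> h1_outer (gam ` {s..t})"
 proof (rule hausdorff1_outer_lower[where p = "%x. x \<bullet> \<tau>"])
  show "\<bar>x \<bullet> \<tau> - y \<bullet> \<tau>\<bar> \<le> dist x y" for x y
   using Cauchy_Schwarz_ineq2[of "x - y" \<tau>] \<tau> by (simp add: inner_diff_left dist_norm)
  show "{gam s \<bullet> \<tau>..gam t \<bullet> \<tau>} \<subseteq> (%x. x \<bullet> \<tau>) ` gam ` {s..t}"
  proof
   fix y assume y: "y \<in> {gam s \<bullet> \<tau>..gam t \<bullet> \<tau>}"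
   have "continuous_on {s..t} (%r. gam r \<bullet> \<tau>)" by (intro continuous_intros cont)
   then have "\<exists>r. s \<le> r \<and> r \<le> t \<and> gam r \<bullet> \<tau> = y" using y assms(1) by (intro IVT') auto
   then show "y \<in> (%x. x \<bullet> \<tau>) ` gam ` {s..t}" by auto
  qed
  show "gam s \<bullet> \<tau> \<le> gam t \<bullet> \<tau>" using chord norm_ge_zero[of "gam t - gam s"] by linarith
 qed
 then show ?thesis by (simp add: chord)
qed simp

text \<open>Let \<open>M\<close> be the measure transported to the parameter and \<open>F\<close>
  its distribution function. Over a short interval the increment of \<open>F\<close> lies between
  the length of the chord and the Lipschitz bound, and both are close to
  \<open>norm (gam' s)\<close> times the length; so \<open>F\<close> has this derivative, and the
  fundamental theorem of calculus gives the density. The global left inverse \<open>p\<close> makes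
  the arc injective and the transport measurable.\<close>

lemma hausdorff1_arc:
 fixes gam gam' :: "real => real^2" and p :: "real^2 => real"
 assumes der: "!!t. (gam has_vector_derivative gam' t) (at t)" and cont: "continuous_on UNIV gam'"
  and inv: "!!t. p (gam t) = t" and p: "continuous_on UNIV p" and ab: "a \<le> b"
 shows "distr (restrict_space hausdorff1 (gam ` {a..b})) borel p
   = density lborel (%t. ennreal (indicator {a..b} t * norm (gam' t)))"
  and "emeasure hausdorff1 (gam ` {a..b}) < \<infinity>"
proof -
 let ?G = "gam ` {a..b}"
 have cg: "continuous_on S gam" for S
  using der by (meson continuous_at_imp_continuous_on has_vector_derivative_continuous)
 have G: "compact (gam ` {s..t})" for s t by (rule compact_continuous_image[OF cg compact_Icc])
 have Gb: "gam ` {s..t} \<in> sets borel" for s t by (rule borel_compact[OF G])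
 have lip: "dist (gam u) (gam v) \<le> K * \<bar>u - v\<bar>"
  if "!!w. w \<in> {s..t} ==> norm (gam' w) \<le> K" "u \<in> {s..t}" "v \<in> {s..t}" for s t K u v
 proof -
  have *: "norm (gam v - gam u) \<le> K * (v - u)" if uv: "u < v" "u \<in> {s..t}" "v \<in> {s..t}" for u v
  proof -
   have "\<exists>x\<in>{u<..<v}. norm (gam v - gam u) \<le> norm ((v - u) *\<^sub>R gam' x)"
    by (rule mvt_general[OF uv(1) cg]) (rule der[unfolded has_vector_derivative_def])
   then obtain x where x: "x \<in> {u<..<v}" "norm (gam v - gam u) \<le> (v - u) * norm (gam' x)" using uv(1) by auto
   have "(v - u) * norm (gam' x) \<le> (v - u) * K"
    using \<open>!!w. w \<in> {s..t} ==> norm (gam' w) \<le> K\<close>[of x] x uv by (intro mult_left_mono) auto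
   with x(2) have "norm (gam v - gam u) \<le> (v - u) * K" by (rule order_trans)
   then show ?thesis by (simp only: mult.commute)
  qed
  consider "u < v" | "v < u" | "u = v" by linarith
  then show ?thesis
   by cases (use *[of u v] *[of v u] that in \<open>auto simp: dist_norm norm_minus_commute\<close>)
 qed
 have upper: "h1_outer (gam ` {s..t}) \<le> ennreal (K * (t - s))"
  if "!!w. w \<in> {s..t} ==> norm (gam' w) \<le> K" "s \<le> t" for s t K
 proof (rule hausdorff1_outer_upper[OF that(2)])
  show "K \<ge> 0" using that(1)[of s] that(2) norm_ge_zero[of "gam' s"] by (simp del: norm_ge_zero)
 qed (use lip that in blast)
 have "bounded (gam' ` {a..b})"
  by (rule compact_imp_bounded[OF compact_continuous_image[OF continuous_on_subset[OF cont] compact_Icc]]) simp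
 then obtain K where "!!w. w \<in> {a..b} ==> norm (gam' w) \<le> K" unfolding bounded_iff by blast
 from upper[OF this ab] have finG: "h1_outer ?G < \<infinity>"
  using ennreal_less_top le_less_trans infinity_ennreal_def by metis
 show "emeasure hausdorff1 ?G < \<infinity>" using finG by (simp add: emeasure_hausdorff1 Gb)
 define M where "M = distr (restrict_space hausdorff1 ?G) borel p"
 have pm [measurable]: "p \<in> borel_measurable borel" by (rule borel_measurable_continuous_onI[OF p])
 have pm': "p \<in> measurable (restrict_space hausdorff1 ?G) borel"
  by (rule measurable_restrict_space1) (simp cong: measurable_cong_sets)
 have setsM [simp]: "sets M = sets borel" "space M = UNIV" by (simp_all add: M_def)
 have M: "emeasure M E = emeasure hausdorff1 (p -` E \<inter> ?G)" if "E \<in> sets borel" for E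
 proof -
  have "p -` E \<inter> ?G \<in> sets borel" using measurable_sets[OF pm that] Gb[of a b] by auto
  then show ?thesis unfolding M_def using that pm' Gb[of a b]
   by (simp add: emeasure_distr space_restrict_space emeasure_restrict_space)
 qed
 have Mseg: "emeasure M {s..t} = h1_outer (gam ` {s..t})" if "a \<le> s" "t \<le> b" for s t
 proof -
  have "p -` {s..t} \<inter> ?G = gam ` {s..t}" using that inv by (auto simp: image_iff)
  then show ?thesis by (simp add: M emeasure_hausdorff1 Gb)
 qed
 have MU: "emeasure M UNIV = h1_outer ?G" by (simp add: M emeasure_hausdorff1 Gb)
 interpret M: finite_measure M
  by (rule finite_measureI) (use finG MU in auto)
 define F where "F t = measure M {..t}" for t
 have pt: "measure M {s} = 0" if "s \<in> {a..b}" for s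
 proof -
  have "h1_outer (gam ` {s..s}) \<le> ennreal (norm (gam' s) * (s - s))" by (rule upper) auto
  then have "emeasure M {s..s} = 0" using that by (subst Mseg) auto
  then show ?thesis by (simp add: measure_def)
 qed
 have Fdiff: "F t - F s = measure M {s..t}" if "a \<le> s" "s \<le> t" "t \<le> b" for s t
 proof -
  have "F t = measure M ({..s} \<union> {s<..t})" unfolding F_def using that by (intro arg_cong[where f = "measure M"]) auto
  also have "... = F s + measure M {s<..t}" unfolding F_def by (rule M.finite_measure_Union) auto
  finally have "F t - F s = measure M {s<..t}" by simp
  moreover have "measure M {s..t} = measure M ({s} \<union> {s<..t})" using that by (intro arg_cong[where f = "measure M"]) auto
  moreover have "measure M ({s} \<union> {s<..t}) = measure M {s} + measure M {s<..t}" by (rule M.finite_measure_Union) auto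
  ultimately show ?thesis using pt[of s] that by simp
 qed
 have Fder: "(F has_real_derivative norm (gam' s)) (at s within {a..b})" if s: "s \<in> {a..b}" for s
  unfolding has_field_derivative_iff Lim_within
 proof (intro allI impI)
  fix e :: real assume "e > 0"
  have "\<exists>d>0. \<forall>u\<in>UNIV. dist u s < d --> dist (gam' u) (gam' s) < e / 2"
   using cont \<open>e > 0\<close> unfolding continuous_on_iff by (meson UNIV_I half_gt_zero)
  then obtain d where d: "d > 0" "!!u. \<bar>u - s\<bar> < d ==> norm (gam' u - gam' s) < e / 2"
   unfolding dist_norm real_norm_def by blast
  have est: "\<bar>F hi - F lo - (hi - lo) * norm (gam' s)\<bar> \<le> e / 2 * (hi - lo)"
   if lh: "a \<le> lo" "lo \<le> hi" "hi \<le> b" "s \<in> {lo..hi}" "\<bar>lo - s\<bar> < d" "\<bar>hi - s\<bar> < d" for lo hi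
  proof -
   have near: "norm (gam' u - gam' s) \<le> e / 2" if "u \<in> {lo..hi}" for u
    by (rule less_imp_le, rule d(2)) (use lh that in auto)
   have "norm (gam' u) \<le> norm (gam' s) + e / 2" if "u \<in> {lo..hi}" for u
    using near[OF that] norm_triangle_ineq2[of "gam' u" "gam' s"] by linarith
   from upper[OF this lh(2)] have up: "emeasure M {lo..hi} \<le> ennreal ((norm (gam' s) + e / 2) * (hi - lo))"
    using Mseg lh by simp
   have 1: "F hi - F lo \<le> (norm (gam' s) + e / 2) * (hi - lo)"
    using up Fdiff[OF lh(1-3)] \<open>e > 0\<close> lh by (simp add: M.emeasure_eq_measure)
   have "norm (gam hi - gam lo - (hi - lo) *\<^sub>R gam' s) \<le> norm (hi - lo) * (e / 2)"
    by (rule vector_differentiable_bound_linearization[where S = "{lo..hi}" and f' = gam'])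
     (use der near lh in \<open>auto intro: has_vector_derivative_at_within simp: closed_segment_eq_real_ivl\<close>)
   then have "(hi - lo) * norm (gam' s) - (hi - lo) * (e / 2) \<le> norm (gam hi - gam lo)"
    using norm_triangle_ineq2[of "(hi - lo) *\<^sub>R gam' s" "gam hi - gam lo"] lh(2) by (simp add: norm_minus_commute)
   also have "ennreal (norm (gam hi - gam lo)) \<le> emeasure M {lo..hi}"
    using hausdorff1_outer_chord[OF lh(2) cg] Mseg lh by simp
   then have "norm (gam hi - gam lo) \<le> F hi - F lo"
    using Fdiff[OF lh(1-3)] by (simp add: M.emeasure_eq_measure)
   finally have 2: "(hi - lo) * norm (gam' s) - (hi - lo) * (e / 2) \<le> F hi - F lo" .
   have r: "(norm (gam' s) + e / 2) * (hi - lo) = (hi - lo) * norm (gam' s) + e / 2 * (hi - lo)"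
    "(hi - lo) * (e / 2) = e / 2 * (hi - lo)" by algebra+
   show ?thesis using 1 2 unfolding r abs_le_iff by linarith
  qed
  have "norm ((F t - F s) / (t - s) - norm (gam' s)) < e" if t: "t \<in> {a..b}" "t \<noteq> s" "norm (t - s) < d" for t
  proof -
   have "\<bar>F t - F s - (t - s) * norm (gam' s)\<bar> \<le> e / 2 * \<bar>t - s\<bar>"
   proof (cases "s \<le> t")
    case True then show ?thesis using est[of s t] s t d(1) by auto
   next
    case False
    then have "\<bar>F s - F t - (s - t) * norm (gam' s)\<bar> \<le> e / 2 * (s - t)" using est[of t s] s t d(1) by auto
    moreover have "F t - F s - (t - s) * norm (gam' s) = - (F s - F t - (s - t) * norm (gam' s))" by (simp add: algebra_simps)
    moreover have "\<bar>t - s\<bar> = s - t" using False by simp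
    ultimately show ?thesis by (simp only: abs_minus_cancel)
   qed
   then have "\<bar>(F t - F s - (t - s) * norm (gam' s)) / (t - s)\<bar> \<le> e / 2"
    using t(2) by (simp add: abs_divide divide_le_eq)
   moreover have "(F t - F s - (t - s) * norm (gam' s)) / (t - s) = (F t - F s) / (t - s) - norm (gam' s)"
    using t(2) by (simp add: diff_divide_distrib)
   ultimately show ?thesis using \<open>e > 0\<close> by simp
  qed
  with d(1) show "\<exists>d>0. \<forall>t\<in>{a..b}. 0 < dist t s \<and> dist t s < d --> dist ((F t - F s) / (t - s)) (norm (gam' s)) < e"
   by (auto simp: dist_norm intro!: exI[of _ d])
 qed
 define N where "N = density lborel (%t. ennreal (indicator {a..b} t * norm (gam' t)))"
 have cn: "continuous_on S (%t. norm (gam' t))" for S by (intro continuous_intros continuous_on_subset[OF cont]) simp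
 have [measurable]: "(%t. norm (gam' t)) \<in> borel_measurable borel" by (rule borel_measurable_continuous_onI[OF cn])
 have N: "(\<integral>\<^sup>+t. ennreal (indicator {s..b} t * norm (gam' t)) \<partial>lborel) = ennreal (F b - F s)" if "a \<le> s" "s \<le> b" for s
 proof -
  have "has_bochner_integral lborel (%t. indicator {s..b} t *\<^sub>R norm (gam' t)) (F b - F s)"
  proof (rule has_bochner_integral_FTC_Icc[OF that(2) _ cn])
   fix t assume "s \<le> t" "t \<le> b"
   then have "(F has_real_derivative norm (gam' t)) (at t within {s..b})"
    using that by (intro DERIV_subset[OF Fder]) auto
   then show "(F has_vector_derivative norm (gam' t)) (at t within {s..b})"
    by (simp add: has_real_derivative_iff_has_vector_derivative)
  qed
  then show ?thesis
   by (subst nn_integral_eq_integral) (auto simp: has_bochner_integral_iff)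
 qed
 have "M = N"
 proof (rule measure_eqI_lessThan)
  show "emeasure M {x<..} < \<infinity>" for x by (simp add: less_top[symmetric])
  show "emeasure M {x<..} = emeasure N {x<..}" for x
  proof -
   have Nx: "emeasure N {x<..} = (\<integral>\<^sup>+t. ennreal (indicator {a..b} t * norm (gam' t)) * indicator {x<..} t \<partial>lborel)"
    unfolding N_def by (subst emeasure_density) auto
   have all: "emeasure M UNIV = ennreal (F b - F a)"
    using Mseg[of a b] MU Fdiff[of a b] ab by (simp add: M.emeasure_eq_measure)
   have outside: "emeasure M E = 0" if "E \<in> sets borel" "E \<inter> {a..b} = {}" for E
   proof -
    have "p -` E \<inter> ?G = {}" using that(2) inv by auto
    then show ?thesis by (simp add: M that(1))
   qed
   consider "x < a" | "a \<le> x" "x \<le> b" | "b < x" by linarith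
   then show ?thesis
   proof cases
    case 1
    have "emeasure M {x<..} = emeasure M UNIV - emeasure M {..x}"
     by (subst emeasure_Diff[symmetric]) (auto intro!: arg_cong[where f = "emeasure M"])
    also have "... = ennreal (F b - F a)" using all outside[of "{..x}"] 1 by auto
    also have "... = (\<integral>\<^sup>+t. ennreal (indicator {a..b} t * norm (gam' t)) \<partial>lborel)" using N[of a] ab by simp
    also have "... = emeasure N {x<..}"
     unfolding Nx by (rule nn_integral_cong) (use 1 in \<open>auto simp: indicator_def\<close>)
    finally show ?thesis .
   next
    case 2
    have "emeasure M {x<..} = emeasure M ({x<..b} \<union> {b<..})"
     using 2 by (intro arg_cong[where f = "emeasure M"]) auto
    also have "... = emeasure M {x<..b} + emeasure M {b<..}" by (rule plus_emeasure[symmetric]) auto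
    also have "emeasure M {b<..} = 0" by (rule outside) auto
    also have "emeasure M {x<..b} = emeasure M {x..b}"
    proof -
     have "measure M {x..b} = measure M ({x} \<union> {x<..b})" using 2 by (intro arg_cong[where f = "measure M"]) auto
     also have "... = measure M {x} + measure M {x<..b}" by (rule M.finite_measure_Union) auto
     finally show ?thesis using pt[of x] 2 by (simp add: M.emeasure_eq_measure)
    qed
    also have "... = ennreal (F b - F x)" using Fdiff[of x b] 2 by (simp add: M.emeasure_eq_measure)
    also have "... = (\<integral>\<^sup>+t. ennreal (indicator {x..b} t * norm (gam' t)) \<partial>lborel)" using N[of x] 2 by simp
    also have "... = emeasure N {x<..}"
     unfolding Nx
    proof (rule nn_integral_cong_AE)
     show "AE t in lborel. ennreal (indicator {x..b} t * norm (gam' t)) = ennreal (indicator {a..b} t * norm (gam' t)) * indicator {x<..} t"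
      using AE_lborel_singleton[of x] by eventually_elim (use 2 in \<open>auto simp: indicator_def\<close>)
    qed
    finally show ?thesis by simp
   next
    case 3
    have "emeasure N {x<..} = (\<integral>\<^sup>+(t :: real). 0 \<partial>lborel)"
     unfolding Nx by (rule nn_integral_cong) (use 3 in \<open>auto simp: indicator_def\<close>)
    moreover have "{x<..} \<inter> {a..b} = {}" using 3 by auto
    ultimately show ?thesis using outside[of "{x<..}"] by simp
   qed
  qed
 qed (simp_all add: N_def)
 then show "distr (restrict_space hausdorff1 ?G) borel p = density lborel (%t. ennreal (indicator {a..b} t * norm (gam' t)))"
  by (simp add: M_def N_def)
qed

lemma integral_arc:
 fixes gam gam' :: "real => real^2" and p :: "real^2 => real" and f :: "real^2 => 'a::{banach, second_countable_topology}"
 assumes der: "!!t. (gam has_vector_derivative gam' t) (at t)" and cont: "continuous_on UNIV gam'"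
  and inv: "!!t. p (gam t) = t" and p: "continuous_on UNIV p" and ab: "a \<le> b"
  and f: "f \<in> borel_measurable borel"
 shows "(\<integral>x. f x \<partial>restrict_space hausdorff1 (gam ` {a..b})) = (LBINT t. (indicator {a..b} t * norm (gam' t)) *\<^sub>R f (gam t))"
proof -
 let ?R = "restrict_space hausdorff1 (gam ` {a..b})"
 have cg: "continuous_on UNIV gam"
  using der by (meson continuous_at_imp_continuous_on has_vector_derivative_continuous)
 have [measurable]: "gam \<in> borel_measurable borel" "p \<in> borel_measurable borel" "(%t. norm (gam' t)) \<in> borel_measurable borel" "f \<in> borel_measurable borel"
  by (intro borel_measurable_continuous_onI cg p continuous_intros cont f)+
 have pm': "p \<in> measurable ?R borel"
  by (rule measurable_restrict_space1) (simp cong: measurable_cong_sets)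
 have "(\<integral>x. f x \<partial>?R) = (\<integral>x. f (gam (p x)) \<partial>?R)"
  by (rule lint_cong) (auto simp: space_restrict_space inv)
 also have "... = (\<integral>t. f (gam t) \<partial>distr ?R borel p)"
  by (rule integral_distr[symmetric, OF pm']) measurable
 also have "... = (LBINT t. (indicator {a..b} t * norm (gam' t)) *\<^sub>R f (gam t))"
  unfolding hausdorff1_arc(1)[OF der cont inv p ab] by (rule integral_density) auto
 finally show ?thesis .
qed

section \<open>Green's formula on smooth domains\<close>

lemma lborel_distr_orthogonal:
 fixes T :: "real^2 => real^2"
 assumes T: "orthogonal_transformation T"
 shows "distr lborel borel T = lborel"
proof (rule lborel_eqI[symmetric])
 fix l u :: "real^2" assume lu: "!!b. b \<in> Basis ==> l \<bullet> b \<le> u \<bullet> b"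
 note iT = orthogonal_transformation_inv[OF T]
 have bij: "bij T" by (rule orthogonal_transformation_bij[OF T])
 have [measurable]: "T \<in> borel_measurable borel"
  by (intro borel_measurable_continuous_onI linear_continuous_on linear_conv_bounded_linear[THEN iffD1] orthogonal_transformation_linear T)
 have pre: "T -` box l u = inv T ` box l u" by (rule bij_vimage_eq_inv_image[OF bij])
 have "T -` box l u \<in> sets borel" using measurable_sets[OF \<open>T \<in> borel_measurable borel\<close>, of "box l u"] by simp
 then have m: "measure lborel (T -` box l u) = measure lborel (box l u)"
  using measure_orthogonal_image[OF iT lmeasurable_box[of l u]] pre by (simp add: measure_completion)
 have "bounded (inv T ` box l u)"
  by (rule bounded_linear_image[OF bounded_box]) (use orthogonal_transformation_linear[OF iT] linear_conv_bounded_linear in blast)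
 then have "emeasure lborel (T -` box l u) < \<infinity>" unfolding pre by (rule emeasure_bounded_finite)
 then have "emeasure lborel (T -` box l u) = ennreal (measure lborel (T -` box l u))"
  by (intro emeasure_eq_ennreal_measure) auto
 also have "... = emeasure lborel (box l u)"
  unfolding m by (rule emeasure_eq_ennreal_measure[symmetric]) (use emeasure_bounded_finite[OF bounded_box, of l u] in auto)
 also have "... = (\<Prod>b\<in>Basis. (u - l) \<bullet> b)" by (rule emeasure_lborel_box[OF lu])
 finally show "emeasure (distr lborel borel T) (box l u) = (\<Prod>b\<in>Basis. (u - l) \<bullet> b)"
  by (simp add: emeasure_distr)
qed simp

lemma lborel_distr_axes:
 "distr (lborel :: (real \<times> real) measure) borel (%z. fst z *\<^sub>R axis 1 1 + snd z *\<^sub>R axis 2 1) = (lborel :: (real^2) measure)"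
 (is "distr _ _ ?V = _")
proof (rule lborel_eqI[symmetric])
 fix l u :: "real^2" assume lu: "!!b. b \<in> Basis ==> l \<bullet> b \<le> u \<bullet> b"
 have V: "?V z $ 1 = fst z" "?V z $ 2 = snd z" for z by (simp_all add: axis_def)
 have le: "l $ i \<le> u $ i" for i using lu[of "axis i 1"] by (simp add: inner_axis)
 have "?V -` box l u = {l $ 1<..<u $ 1} \<times> {l $ 2<..<u $ 2}"
  by (auto simp: mem_box_cart forall_2 axis_def)
 moreover have "?V \<in> borel_measurable borel" by (intro borel_measurable_continuous_onI continuous_intros)
 ultimately have "emeasure (distr lborel borel ?V) (box l u) = emeasure (lborel \<Otimes>\<^sub>M lborel) ({l $ 1<..<u $ 1} \<times> {l $ 2<..<u $ 2})"
  by (simp add: emeasure_distr lborel_prod)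
 also have "... = ennreal (u $ 1 - l $ 1) * ennreal (u $ 2 - l $ 2)"
  using le by (subst lborel.emeasure_pair_measure_Times) auto
 also have "... = (\<Prod>b\<in>Basis. (u - l) \<bullet> b)"
 proof -
  have B: "(Basis :: (real^2) set) = {axis 1 1, axis 2 1}" by (auto simp: Basis_vec_def exhaust_2) (metis exhaust_2)
  have "axis 1 1 \<noteq> (axis 2 1 :: real^2)" by (simp add: axis_eq_axis)
  then show ?thesis unfolding B using le by (simp add: inner_axis ennreal_mult[symmetric])
 qed
 finally show "emeasure (distr lborel borel ?V) (box l u) = (\<Prod>b\<in>Basis. (u - l) \<bullet> b)" .
qed simp

text \<open>By Fubini it is enough to look at vertical sections, and the shear translates each of
  them.\<close>

lemma lborel_distr_shear:
 fixes h :: "real => real"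
 assumes h: "continuous_on UNIV h"
 shows "distr (lborel :: (real \<times> real) measure) borel (%z. (fst z, snd z + h (fst z))) = lborel"
  (is "distr _ _ ?S = _")
proof (rule measure_eqI)
 fix A assume "A \<in> sets (distr (lborel :: (real \<times> real) measure) borel ?S)"
 then have A: "A \<in> sets borel" by simp
 have c: "continuous_on UNIV ?S" by (intro continuous_intros continuous_on_compose2[OF h]) auto
 have S: "?S \<in> borel_measurable borel" by (rule borel_measurable_continuous_onI[OF c])
 have SA: "?S -` A \<in> sets borel" using measurable_sets[OF S A] by simp
 have p: "sets (lborel \<Otimes>\<^sub>M lborel :: (real \<times> real) measure) = sets borel" by (subst lborel_prod) simp
 have sec: "Pair t -` A \<in> sets borel" for t using sets_Pair1[of A lborel lborel t] A by (simp only: p sets_lborel)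
 have "emeasure (distr lborel borel ?S) A = emeasure (lborel \<Otimes>\<^sub>M lborel) (?S -` A)"
  using A S by (simp add: emeasure_distr lborel_prod)
 also have "... = (\<integral>\<^sup>+t. emeasure lborel (Pair t -` (?S -` A)) \<partial>lborel)"
  by (rule lborel.emeasure_pair_measure_alt) (use SA p in simp)
 also have "... = (\<integral>\<^sup>+t. emeasure lborel (Pair t -` A) \<partial>lborel)"
 proof (rule nn_integral_cong)
  fix t
  have "Pair t -` (?S -` A) = (+) (h t) -` (Pair t -` A)" by (auto simp: add.commute)
  then have "emeasure lborel (Pair t -` (?S -` A)) = emeasure (distr lborel borel ((+) (h t))) (Pair t -` A)"
   using sec[of t] by (simp add: emeasure_distr)
  then show "emeasure lborel (Pair t -` (?S -` A)) = emeasure lborel (Pair t -` A)" by (simp only: lborel_distr_plus)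
 qed
 also have "... = emeasure (lborel \<Otimes>\<^sub>M lborel) A"
  by (rule lborel.emeasure_pair_measure_alt[symmetric]) (use A p in simp)
 finally show "emeasure (distr lborel borel ?S) A = emeasure lborel A" by (simp add: lborel_prod)
qed simp

text \<open>\<open>f\<^sub>1\<close> and \<open>f\<^sub>2\<close> are the orthonormal axes of the coordinates in which the domain is a subgraph.\<close>

locale graph_chart =
 fixes \<Omega> W :: "(real^2) set" and f1 f2 :: "real^2" and h :: "real => real"
 assumes openW: "open W"
  and f11: "f1 \<bullet> f1 = 1" and f22: "f2 \<bullet> f2 = 1" and f12: "f1 \<bullet> f2 = 0"
  and expand: "!!x. x = (x \<bullet> f1) *\<^sub>R f1 + (x \<bullet> f2) *\<^sub>R f2"
  and h_smooth: "!!n t. ((deriv ^^ n) h) differentiable (at t)"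
  and subgraph: "\<Omega> \<inter> W = {x \<in> W. x \<bullet> f2 < h (x \<bullet> f1)}"
begin

lemma h_deriv: "((deriv ^^ n) h has_real_derivative (deriv ^^ Suc n) h t) (at t)"
 using h_smooth[of n t] by (simp add: DERIV_deriv_iff_real_differentiable)

lemma h_cont: "continuous_on S ((deriv ^^ n) h)"
 using h_deriv[of n] by (meson DERIV_isCont continuous_at_imp_continuous_on)

text \<open>Coordinates that flatten the boundary: over \<open>W\<close>, \<open>snd z < 0\<close>
  describes \<Omega> and \<open>snd z = 0\<close> the boundary curve \<open>gam\<close>. As a shear
  followed by an isometry the map preserves area, so no Jacobian appears.\<close>

definition \<Phi> :: "real \<times> real => real^2" where
 "\<Phi> z = fst z *\<^sub>R f1 + (snd z + h (fst z)) *\<^sub>R f2"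

definition gam :: "real => real^2" where "gam t = t *\<^sub>R f1 + h t *\<^sub>R f2"

definition gam' :: "real => real^2" where "gam' t = f1 + deriv h t *\<^sub>R f2"

lemma coords [simp]: "(a *\<^sub>R f1 + b *\<^sub>R f2) \<bullet> f1 = a" "(a *\<^sub>R f1 + b *\<^sub>R f2) \<bullet> f2 = b"
 using f11 f22 f12 by (simp_all add: inner_add_left inner_commute[of f2 f1])

lemma gam_coords [simp]: "gam t \<bullet> f1 = t" "gam t \<bullet> f2 = h t"
 by (simp_all add: gam_def)

lemma \<Phi>_coords [simp]: "\<Phi> z \<bullet> f1 = fst z" "\<Phi> z \<bullet> f2 = snd z + h (fst z)"
 by (simp_all add: \<Phi>_def)

lemma gam_deriv: "(gam has_vector_derivative gam' t) (at t)"
proof -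
 show ?thesis unfolding gam_def gam'_def using h_deriv[of 0 t] by (auto intro!: derivative_eq_intros)
qed

lemma gam'_cont: "continuous_on S gam'"
 unfolding gam'_def using h_cont[of S 1] by (intro continuous_intros) simp

lemma norm_gam': "(norm (gam' t))\<^sup>2 = 1 + (deriv h t)\<^sup>2"
 unfolding power2_norm_eq_inner gam'_def
 using f11 f22 f12 by (simp add: inner_add_left inner_add_right inner_commute[of f2 f1] power2_eq_square)

lemma lborel_distr_\<Phi>: "distr (lborel :: (real \<times> real) measure) borel \<Phi> = lborel"
proof -
 define T :: "real^2 => real^2" where "T x = x $ 1 *\<^sub>R f1 + x $ 2 *\<^sub>R f2" for x
 have "linear T" by (rule linearI) (simp_all add: T_def algebra_simps)
 moreover have "norm (T x) = norm x" for x
 proof -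
  have "(norm (T x))\<^sup>2 = (norm x)\<^sup>2"
  proof -
   have "T x \<bullet> T x = x $ 1 * x $ 1 + x $ 2 * x $ 2"
    unfolding T_def using f11 f22 f12
    by (simp add: inner_add_left inner_add_right inner_commute[of f2 f1])
   then show ?thesis unfolding power2_norm_eq_inner by (simp add: inner_vec_def sum_2)
  qed
  then show ?thesis by simp
 qed
 ultimately have T: "orthogonal_transformation T" by (simp add: orthogonal_transformation)
 have Tc: "continuous_on UNIV T" unfolding T_def by (intro continuous_intros)
 let ?V = "%z :: real \<times> real. fst z *\<^sub>R axis 1 1 + snd z *\<^sub>R axis 2 1 :: real^2"
 let ?S = "%z :: real \<times> real. (fst z, snd z + h (fst z))"
 have hc: "continuous_on UNIV h" using h_cont[of UNIV 0] by simp
 have "continuous_on UNIV ?V" by (intro continuous_intros)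
 moreover have "continuous_on UNIV ?S" by (intro continuous_intros continuous_on_compose2[OF hc]) auto
 ultimately have [measurable]: "T \<in> borel_measurable borel" "?V \<in> borel_measurable borel" "?S \<in> borel_measurable borel"
  using Tc by (simp_all only: borel_measurable_continuous_onI)
 have eq: "\<Phi> = T \<circ> (?V \<circ> ?S)" by (rule ext) (simp add: \<Phi>_def T_def axis_def)
 have "distr lborel borel \<Phi> = distr (distr (distr lborel borel ?S) borel ?V) borel T"
  unfolding eq by (simp add: distr_distr)
 also have "... = lborel"
  by (simp only: lborel_distr_shear[OF hc] lborel_distr_axes lborel_distr_orthogonal[OF T])
 finally show ?thesis .
qed

lemma \<Phi>_cont: "continuous_on S \<Phi>"
proof -
 have hc: "continuous_on UNIV h" using h_cont[of UNIV 0] by simp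
 show ?thesis unfolding \<Phi>_def by (intro continuous_intros continuous_on_compose2[OF hc]) auto
qed

lemma \<Phi>_bounded_support:
 assumes "compact K"
 shows "\<exists>R>0. \<forall>t s. \<Phi> (t, s) \<in> K --> \<bar>t\<bar> < R \<and> \<bar>s\<bar> < R"
proof -
 have hc: "continuous_on UNIV h" using h_cont[of UNIV 0] by simp
 have "continuous_on K (%x. (x \<bullet> f1, x \<bullet> f2 - h (x \<bullet> f1)))"
  by (intro continuous_intros continuous_on_compose2[OF hc]) auto
 then have "compact ((%x. (x \<bullet> f1, x \<bullet> f2 - h (x \<bullet> f1))) ` K)"
  using assms by (rule compact_continuous_image)
 from compact_imp_bounded[OF this] obtain R where R: "R > 0"
  "\<forall>y\<in>(%x. (x \<bullet> f1, x \<bullet> f2 - h (x \<bullet> f1))) ` K. norm y \<le> R"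
  unfolding bounded_pos by blast
 have "\<bar>t\<bar> < R + 1 \<and> \<bar>s\<bar> < R + 1" if K: "\<Phi> (t, s) \<in> K" for t s
 proof -
  have "norm (\<Phi> (t, s) \<bullet> f1, \<Phi> (t, s) \<bullet> f2 - h (\<Phi> (t, s) \<bullet> f1)) \<le> R"
   using R(2) K by blast
  then have "norm (t, s) \<le> R" by (simp only: \<Phi>_coords fst_conv snd_conv add_diff_cancel_right')
  then show ?thesis using norm_fst_le[of t s] norm_snd_le[of s t] unfolding real_norm_def by linarith
 qed
 moreover have "R + 1 > 0" using R(1) by simp
 ultimately show ?thesis by blast
qed

text \<open>\<open>W\<close> is merely open, so everything is decided by moving \<open>x\<close>
  along \<open>f2\<close> by amounts small enough to remain in \<open>W\<close>. The last
  equivalence shows that the exterior has the same boundary, that is, \<Omega> lies on one side of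
  it only.\<close>

lemma frontier_iff:
 assumes "x \<in> W"
 shows "x \<in> frontier \<Omega> \<longleftrightarrow> x \<bullet> f2 = h (x \<bullet> f1)" "x \<in> exterior \<Omega> \<longleftrightarrow> x \<bullet> f2 > h (x \<bullet> f1)"
  "x \<in> frontier (exterior \<Omega>) \<longleftrightarrow> x \<bullet> f2 = h (x \<bullet> f1)"
proof -
 have hc: "continuous_on UNIV h" using h_cont[of UNIV 0] by simp
 have c: "continuous_on UNIV (%x. h (x \<bullet> f1))"
  by (intro continuous_on_compose2[OF hc] continuous_intros) auto
 have o1: "open {x \<in> W. x \<bullet> f2 < h (x \<bullet> f1)}" "open {x \<in> W. x \<bullet> f2 > h (x \<bullet> f1)}"
 proof -
  have "continuous_on UNIV (%x. x \<bullet> f2)" by (intro continuous_intros)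
  from open_Int[OF openW open_Collect_less[OF this c]] open_Int[OF openW open_Collect_less[OF c this]]
  show "open {x \<in> W. x \<bullet> f2 < h (x \<bullet> f1)}" "open {x \<in> W. x \<bullet> f2 > h (x \<bullet> f1)}"
   by (simp_all add: Collect_conj_eq)
 qed
 have in_iff: "y \<in> \<Omega> \<longleftrightarrow> y \<bullet> f2 < h (y \<bullet> f1)" if "y \<in> W" for y using subgraph that by blast
 have approx: "\<exists>eps>0. \<forall>r. \<bar>r\<bar> < eps --> x + r *\<^sub>R f2 \<in> W \<inter> S" if S: "open S" "x \<in> S" for S
 proof -
  have "x \<in> W \<inter> S" using S assms by blast
  then obtain eps where e: "eps > 0" "ball x eps \<subseteq> W \<inter> S"
   by (rule openE[OF open_Int[OF openW S(1)]])
  have "norm f2 = 1" using f22 by (simp add: norm_eq_sqrt_inner)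
  then have "x + r *\<^sub>R f2 \<in> ball x eps" if "\<bar>r\<bar> < eps" for r using that by (simp add: dist_norm)
  with e show ?thesis by blast
 qed
 have sh: "(x + r *\<^sub>R f2) \<bullet> f2 = x \<bullet> f2 + r" "(x + r *\<^sub>R f2) \<bullet> f1 = x \<bullet> f1" for r
  using f22 f12 by (simp_all add: inner_add_left inner_commute[of f2 f1])
 have cl: "x \<in> closure \<Omega> \<longleftrightarrow> x \<bullet> f2 \<le> h (x \<bullet> f1)"
 proof
  assume "x \<in> closure \<Omega>"
  show "x \<bullet> f2 \<le> h (x \<bullet> f1)"
  proof (rule ccontr)
   assume "\<not> x \<bullet> f2 \<le> h (x \<bullet> f1)"
   then have "x \<in> {x \<in> W. x \<bullet> f2 > h (x \<bullet> f1)}" using assms by simp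
   then obtain y where "y \<in> \<Omega>" "y \<in> {x \<in> W. x \<bullet> f2 > h (x \<bullet> f1)}"
    using \<open>x \<in> closure \<Omega>\<close> o1(2) unfolding closure_iff_nhds_not_empty by blast
   then show False using in_iff[of y] by auto
  qed
 next
  assume le: "x \<bullet> f2 \<le> h (x \<bullet> f1)"
  show "x \<in> closure \<Omega>"
   unfolding closure_iff_nhds_not_empty
  proof (intro allI impI)
   fix A V assume V: "V \<subseteq> A" "open V" "x \<in> V"
   obtain eps where e: "eps > 0" "!!r. \<bar>r\<bar> < eps ==> x + r *\<^sub>R f2 \<in> W \<inter> V" using approx[OF V(2,3)] by blast
   have w: "x + (- eps / 2) *\<^sub>R f2 \<in> W \<inter> V" by (rule e(2)) (use e(1) in simp)
   have "x \<bullet> f2 + (- eps / 2) < h (x \<bullet> f1)" using le e(1) by linarith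
   then have "x + (- eps / 2) *\<^sub>R f2 \<in> \<Omega>" using in_iff[of "x + (- eps / 2) *\<^sub>R f2"] w unfolding sh by blast
   then show "\<Omega> \<inter> A \<noteq> {}" using w V(1) by blast
  qed
 qed
 then show ext: "x \<in> exterior \<Omega> \<longleftrightarrow> x \<bullet> f2 > h (x \<bullet> f1)" by auto
 have int1: "x \<in> interior \<Omega> \<longleftrightarrow> x \<bullet> f2 < h (x \<bullet> f1)"
 proof
  assume "x \<in> interior \<Omega>" then show "x \<bullet> f2 < h (x \<bullet> f1)" using interior_subset in_iff[OF assms] by blast
 next
  assume "x \<bullet> f2 < h (x \<bullet> f1)"
  then show "x \<in> interior \<Omega>" using o1(1) assms in_iff
   by (intro interiorI[OF o1(1)]) auto
 qed
 with cl show "x \<in> frontier \<Omega> \<longleftrightarrow> x \<bullet> f2 = h (x \<bullet> f1)" by (auto simp: frontier_def)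
 have "x \<in> interior (closure \<Omega>) \<longleftrightarrow> x \<bullet> f2 < h (x \<bullet> f1)"
 proof
  assume a: "x \<in> interior (closure \<Omega>)"
  obtain eps where e: "eps > 0" "!!r. \<bar>r\<bar> < eps ==> x + r *\<^sub>R f2 \<in> W \<inter> interior (closure \<Omega>)"
   using approx[OF open_interior a] by blast
  have w: "x + (eps / 2) *\<^sub>R f2 \<in> W \<inter> interior (closure \<Omega>)" by (rule e(2)) (use e(1) in simp)
  show "x \<bullet> f2 < h (x \<bullet> f1)"
  proof (rule ccontr)
   assume n: "\<not> x \<bullet> f2 < h (x \<bullet> f1)"
   have "x + (eps / 2) *\<^sub>R f2 \<in> {x \<in> W. x \<bullet> f2 > h (x \<bullet> f1)}" using w n e(1) sh by simp
   moreover have "x + (eps / 2) *\<^sub>R f2 \<in> closure \<Omega>" using w interior_subset by blast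
   ultimately obtain y where "y \<in> \<Omega>" "y \<in> {x \<in> W. x \<bullet> f2 > h (x \<bullet> f1)}"
    using o1(2) unfolding closure_iff_nhds_not_empty by blast
   then show False using in_iff[of y] by auto
  qed
 next
  assume "x \<bullet> f2 < h (x \<bullet> f1)"
  then have "x \<in> interior \<Omega>" using int1 by simp
  then show "x \<in> interior (closure \<Omega>)" using interior_mono[OF closure_subset] by blast
 qed
 with cl show "x \<in> frontier (exterior \<Omega>) \<longleftrightarrow> x \<bullet> f2 = h (x \<bullet> f1)"
  unfolding frontier_complement by (auto simp: frontier_def)
qed

end

section \<open>Green's formula in a single chart\<close>

lemma
 fixes f f' :: "real => complex"
 assumes d: "!!t. (f has_vector_derivative f' t) (at t)" and c: "continuous_on UNIV f'"
  and R: "!!t. \<bar>t\<bar> \<ge> R ==> f t = 0 \<and> f' t = 0" "R > 0"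
 shows integral_derivative_compact_support: "(LBINT t. f' t) = 0"
  and integral_derivative_half_line: "(LBINT t. indicator {..<0} t *\<^sub>R f' t) = f 0"
proof -
 have cs: "continuous_on S f'" for S by (rule continuous_on_subset[OF c]) simp
 have F: "(LBINT t. indicator {a..b} t *\<^sub>R f' t) = f b - f a" if "a \<le> b" for a b
  by (rule integral_FTC_Icc[OF that _ cs]) (rule has_vector_derivative_at_within[OF d])
 have "(LBINT t. f' t) = (LBINT t. indicator {-R..R} t *\<^sub>R f' t)"
  by (rule lint_cong) (use R in \<open>auto simp: indicator_def\<close>)
 then show "(LBINT t. f' t) = 0" using F[of "-R" R] R(1)[of R] R(1)[of "-R"] R(2) by simp
 have [measurable]: "f' \<in> borel_measurable borel" by (rule borel_measurable_continuous_onI[OF c])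
 have "(LBINT t. indicator {..<0} t *\<^sub>R f' t) = (LBINT t. indicator {-R..0} t *\<^sub>R f' t)"
 proof (rule integral_cong_AE)
  show "AE t in lborel. indicator {..<0} t *\<^sub>R f' t = indicator {-R..0} t *\<^sub>R f' t"
   using AE_lborel_singleton[of 0] by eventually_elim (use R in \<open>auto simp: indicator_def\<close>)
 qed measurable
 then show "(LBINT t. indicator {..<0} t *\<^sub>R f' t) = f 0" using F[of "-R" 0] R(1)[of "-R"] R(2) by simp
qed

lemma axis_expand: "v = v $ 1 *\<^sub>R axis 1 1 + v $ 2 *\<^sub>R (axis 2 1 :: real^2)" for v :: "real^2"
 by (simp add: vec_eq_iff forall_2 axis_def)

lemma has_derivative_pd:
 assumes "smooth_fun phi"
 shows "(phi has_derivative (%v. v $ 1 *\<^sub>R pd 1 phi x + v $ 2 *\<^sub>R pd 2 phi x)) (at x)"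
proof -
 have D: "(phi has_derivative frechet_derivative phi (at x)) (at x)"
  by (rule has_derivative_frechet[OF smooth_fun_diffb[OF assms]])
 have "frechet_derivative phi (at x) v = v $ 1 *\<^sub>R pd 1 phi x + v $ 2 *\<^sub>R pd 2 phi x" for v
  by (subst axis_expand[of v]) (simp add: pd_def linear_add[OF has_derivative_linear[OF D]] linear_scale[OF has_derivative_linear[OF D]])
 with D show ?thesis by (metis (no_types, lifting) ext)
qed

context graph_chart
begin

text \<open>\<open>gam' t\<close> and \<open>f2\<close> are the coordinate vector fields of
  \<open>\<Phi>\<close>. The coefficient of \<open>f2\<close> is \<open>norm (gam' t)\<close> times
  a component of the normal, and it is what remains on the boundary.\<close>

lemma axis_coords: "axis j 1 = f1 $ j *\<^sub>R gam' t + (f2 $ j - deriv h t * f1 $ j) *\<^sub>R f2"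
proof -
 have "axis j 1 = (axis j 1 \<bullet> f1) *\<^sub>R f1 + (axis j 1 \<bullet> f2) *\<^sub>R f2" by (rule expand)
 then have "axis j 1 = f1 $ j *\<^sub>R f1 + f2 $ j *\<^sub>R f2" by (simp add: inner_axis inner_commute[of "axis j 1"])
 then show ?thesis by (simp add: gam'_def algebra_simps)
qed

text \<open>In the coordinates \<open>\<Phi>\<close> the derivative is a tangential term with the
  constant factor \<open>f1 $ j\<close> plus a transversal term whose factor depends on
  \<open>t\<close> alone. By Fubini the first integrates to 0 along each line of constant
  \<open>s\<close>, and the second yields the value at \<open>s = 0\<close> by the fundamental
  theorem of calculus.\<close>

lemma chart_green:
 assumes t: "test_fun W phi"
 shows "(LBINT x. indicator \<Omega> x *\<^sub>R pd j phi x)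
  = (LBINT t. (f2 $ j - deriv h t * f1 $ j) *\<^sub>R phi (gam t))"
proof -
 obtain K where K: "compact K" "K \<subseteq> W" "!!x. x \<notin> K ==> phi x = 0" "smooth_fun phi" by (rule test_funE[OF t]) blast
 have pd0: "pd i phi x = 0" if "x \<notin> K" for i x by (rule pd_zero_outside[OF K(1,3) that])
 define G where "G v x = v $ 1 *\<^sub>R pd 1 phi x + v $ 2 *\<^sub>R pd 2 phi x" for v :: "real^2" and x
 have G: "(phi has_derivative (%v. G v x)) (at x)" for x unfolding G_def by (rule has_derivative_pd[OF K(4)])
 have G_lin: "G (a *\<^sub>R v + b *\<^sub>R w) x = a *\<^sub>R G v x + b *\<^sub>R G w x" for a b v w x
  by (simp add: G_def algebra_simps)
 have pdG: "pd j phi x = f1 $ j *\<^sub>R G (gam' t) x + (f2 $ j - deriv h t * f1 $ j) *\<^sub>R G f2 x" for x t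
 proof -
  have "pd j phi x = G (axis j 1) x" by (rule pd_eq[OF G])
  then show ?thesis unfolding axis_coords[of j t] G_lin .
 qed
 obtain R where R: "R > 0" "!!t s. \<Phi> (t, s) \<in> K ==> \<bar>t\<bar> < R \<and> \<bar>s\<bar> < R"
  using \<Phi>_bounded_support[OF K(1)] by blast
 have out: "\<Phi> (t, s) \<notin> K" if "\<bar>t\<bar> \<ge> R \<or> \<bar>s\<bar> \<ge> R" for t s using R(2)[of t s] that by auto
 have G0: "G v x = 0" if "x \<notin> K" for v x using pd0[OF that] by (simp add: G_def)
 define T where "T z = G (gam' (fst z)) (\<Phi> z)" for z
 define S where "S z = G f2 (\<Phi> z)" for z
 define B where "B t = f2 $ j - deriv h t * f1 $ j" for t
 have ds: "((%s. phi (\<Phi> (t, s))) has_vector_derivative S (t, s)) (at s)" for t s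
 proof -
  have "((%s. \<Phi> (t, s)) has_derivative (%r. r *\<^sub>R f2)) (at s)"
   unfolding \<Phi>_def by (auto intro!: derivative_eq_intros simp: algebra_simps)
  from has_derivative_compose[OF this G]
  show ?thesis by (simp add: has_vector_derivative_def S_def G_def algebra_simps)
 qed
 have dt: "((%t. phi (\<Phi> (t, s))) has_vector_derivative T (t, s)) (at t)" for t s
 proof -
  have "((%t. \<Phi> (t, s)) has_vector_derivative gam' t) (at t)"
   unfolding \<Phi>_def gam'_def using h_deriv[of 0 t] by (auto intro!: derivative_eq_intros)
  then have "((%t. \<Phi> (t, s)) has_derivative (%r. r *\<^sub>R gam' t)) (at t)" by (simp add: has_vector_derivative_def)
  from has_derivative_compose[OF this G]
  show ?thesis by (simp add: has_vector_derivative_def T_def G_def algebra_simps)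
 qed
 have cpd: "continuous_on UNIV (%z. pd i phi (\<Phi> z))" for i
  by (rule continuous_on_compose2[OF smooth_fun_continuous[OF smooth_fun_pd[OF K(4)], of UNIV] \<Phi>_cont]) simp
 have cgam': "continuous_on UNIV (%z :: real \<times> real. gam' (fst z))"
  by (rule continuous_on_compose2[OF gam'_cont[of UNIV]]) (auto intro!: continuous_intros)
 have cT: "continuous_on UNIV T" unfolding T_def G_def by (intro continuous_intros cpd cgam')
 have cS: "continuous_on UNIV S" unfolding S_def G_def by (intro continuous_intros cpd)
 have cB: "continuous_on UNIV B" unfolding B_def using h_cont[of UNIV 1] by (intro continuous_intros) simp
 have cBS: "continuous_on UNIV (%z. B (fst z) *\<^sub>R S z)"
  by (intro continuous_intros cS continuous_on_compose2[OF cB]) auto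
 let ?L = "{-R..R} \<times> {-R..R}"
 have int: "integrable (lborel \<Otimes>\<^sub>M lborel) (%z. indicator {..<0} (snd z) *\<^sub>R F z)"
  if c: "continuous_on UNIV F" and z: "!!z. \<Phi> z \<notin> K ==> F z = 0" for F :: "real \<times> real => complex"
 proof -
  have "integrable lborel (%z. indicator ?L z *\<^sub>R F z)"
   by (rule borel_integrable_compact[OF compact_Times[OF compact_Icc compact_Icc] continuous_on_subset[OF c]]) simp
  moreover have "(%z. indicator ?L z *\<^sub>R F z) = F"
  proof
   fix z :: "real \<times> real"
   show "indicator ?L z *\<^sub>R F z = F z"
   proof (cases "z \<in> ?L")
    case False
    then have "R \<le> \<bar>fst z\<bar> \<or> R \<le> \<bar>snd z\<bar>" by (cases z) (simp, linarith)
    then have "F z = 0" using z[of z] out[of "fst z" "snd z"] by simp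
    then show ?thesis by simp
   qed simp
  qed
  ultimately have i: "integrable lborel F" by simp
  have "{z :: real \<times> real. snd z < 0} \<in> sets borel"
   by (rule borel_open) (intro open_Collect_less continuous_intros)
  from integrable_mult_indicator[OF _ i, of "{z. snd z < 0}"] this
  have "integrable lborel (%z. indicator {z. snd z < 0} z *\<^sub>R F z)" by simp
  then show ?thesis by (simp add: lborel_prod indicator_def)
 qed
 have T0: "\<Phi> z \<notin> K ==> T z = 0" "\<Phi> z \<notin> K ==> B (fst z) *\<^sub>R S z = 0" for z by (simp_all add: T_def S_def G0)
 have iT: "integrable (lborel \<Otimes>\<^sub>M lborel) (%z. indicator {..<0} (snd z) *\<^sub>R T z)"
  by (rule int[OF cT]) (rule T0(1))
 have iS: "integrable (lborel \<Otimes>\<^sub>M lborel) (%z. indicator {..<0} (snd z) *\<^sub>R (B (fst z) *\<^sub>R S z))"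
  by (rule int[OF cBS]) (rule T0(2))
 have iT': "integrable (lborel \<Otimes>\<^sub>M lborel) (case_prod (%t s. indicator {..<0} s *\<^sub>R T (t, s)))"
  and iS': "integrable (lborel \<Otimes>\<^sub>M lborel) (case_prod (%t s. indicator {..<0} s *\<^sub>R (B t *\<^sub>R S (t, s))))"
  unfolding case_prod_beta' prod.collapse by - (rule iT, rule iS)
 have cslice: "continuous_on UNIV (%t. T (t, s))" "continuous_on UNIV (%s. S (t, s))" for t s
  by (rule continuous_on_compose2[OF cT] continuous_on_compose2[OF cS]; auto intro!: continuous_intros)+
 have ITzero: "(\<integral>z. indicator {..<0} (snd z) *\<^sub>R T z \<partial>(lborel \<Otimes>\<^sub>M lborel)) = 0"
 proof -
  have "(\<integral>z. indicator {..<0} (snd z) *\<^sub>R T z \<partial>(lborel \<Otimes>\<^sub>M lborel)) = (\<integral>s. (LBINT t. indicator {..<0} s *\<^sub>R T (t, s)) \<partial>lborel)"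
   using lborel_pair.integral_snd[OF iT'] unfolding case_prod_beta' prod.collapse by (rule sym)
  also have "... = (\<integral>s. 0 \<partial>(lborel :: real measure))"
  proof (rule lint_cong[OF refl])
   fix s
   have "(LBINT t. T (t, s)) = 0"
    by (rule integral_derivative_compact_support[OF dt cslice(1) _ R(1)])
     (use K(3)[OF out] T0(1)[OF out] in auto)
   then show "(LBINT t. indicator {..<0} s *\<^sub>R T (t, s)) = 0" by simp
  qed
  finally show ?thesis by simp
 qed
 have IS: "(\<integral>z. indicator {..<0} (snd z) *\<^sub>R (B (fst z) *\<^sub>R S z) \<partial>(lborel \<Otimes>\<^sub>M lborel)) = (LBINT t. B t *\<^sub>R phi (gam t))"
 proof -
  have "(\<integral>z. indicator {..<0} (snd z) *\<^sub>R (B (fst z) *\<^sub>R S z) \<partial>(lborel \<Otimes>\<^sub>M lborel))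
   = (\<integral>t. (LBINT s. indicator {..<0} s *\<^sub>R (B t *\<^sub>R S (t, s))) \<partial>lborel)"
   using lborel_pair.integral_fst[OF iS'] unfolding case_prod_beta' prod.collapse by (rule sym)
  also have "... = (LBINT t. B t *\<^sub>R phi (gam t))"
  proof (rule lint_cong[OF refl])
   fix t
   have "(LBINT s. indicator {..<0} s *\<^sub>R S (t, s)) = phi (\<Phi> (t, 0))"
    by (rule integral_derivative_half_line[OF ds cslice(2) _ R(1)])
     (use K(3)[OF out] G0[OF out] in \<open>auto simp: S_def\<close>)
   moreover have "\<Phi> (t, 0) = gam t" by (simp add: \<Phi>_def gam_def)
   moreover have "indicator {..<0} s *\<^sub>R (B t *\<^sub>R S (t, s)) = B t *\<^sub>R (indicator {..<0} s *\<^sub>R S (t, s))" for s by simp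
   ultimately show "(LBINT s. indicator {..<0} s *\<^sub>R (B t *\<^sub>R S (t, s))) = B t *\<^sub>R phi (gam t)"
    by (simp only: integral_scaleR_right)
  qed
  finally show ?thesis .
 qed
 have [measurable]: "\<Phi> \<in> borel_measurable borel" by (rule borel_measurable_continuous_onI[OF \<Phi>_cont])
 have meas: "(%x. indicator \<Omega> x *\<^sub>R pd j phi x) \<in> borel_measurable borel"
 proof -
  have o: "open (\<Omega> \<inter> W)"
  proof -
   have hc: "continuous_on UNIV h" using h_cont[of UNIV 0] by simp
   have "open {x. x \<bullet> f2 < h (x \<bullet> f1)}"
    by (intro open_Collect_less continuous_intros continuous_on_compose2[OF hc]) auto
   from open_Int[OF openW this] show ?thesis unfolding subgraph by (simp add: Collect_conj_eq)
  qed
  have eq: "(%x. indicator \<Omega> x *\<^sub>R pd j phi x) = (%x. indicator (\<Omega> \<inter> W) x *\<^sub>R pd j phi x)"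
   using pd0 K(2) by (auto simp: fun_eq_iff indicator_def)
  have "pd j phi \<in> borel_measurable borel" by (rule smooth_fun_measurable[OF smooth_fun_pd[OF K(4)]])
  then show ?thesis
   unfolding eq by (intro borel_measurable_scaleR borel_measurable_indicator borel_open[OF o])
 qed
 have "(LBINT x. indicator \<Omega> x *\<^sub>R pd j phi x) = (\<integral>x. indicator \<Omega> x *\<^sub>R pd j phi x \<partial>distr (lborel :: (real \<times> real) measure) borel \<Phi>)"
  by (simp only: lborel_distr_\<Phi>)
 also have "... = (LBINT z. indicator \<Omega> (\<Phi> z) *\<^sub>R pd j phi (\<Phi> z))"
  by (rule integral_distr) (use meas in simp_all)
 also have "... = (\<integral>z. f1 $ j *\<^sub>R (indicator {..<0} (snd z) *\<^sub>R T z) + indicator {..<0} (snd z) *\<^sub>R (B (fst z) *\<^sub>R S z) \<partial>(lborel \<Otimes>\<^sub>M lborel))"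
  unfolding lborel_prod
 proof (rule lint_cong[OF refl])
  fix z :: "real \<times> real"
  have e: "pd j phi (\<Phi> z) = f1 $ j *\<^sub>R T z + B (fst z) *\<^sub>R S z" unfolding T_def S_def B_def by (rule pdG)
  show "indicator \<Omega> (\<Phi> z) *\<^sub>R pd j phi (\<Phi> z) = f1 $ j *\<^sub>R (indicator {..<0} (snd z) *\<^sub>R T z) + indicator {..<0} (snd z) *\<^sub>R (B (fst z) *\<^sub>R S z)"
  proof (cases "\<Phi> z \<in> K")
   case True
   then have "\<Phi> z \<in> \<Omega> \<longleftrightarrow> \<Phi> z \<bullet> f2 < h (\<Phi> z \<bullet> f1)" using K(2) subgraph by blast
   then have "\<Phi> z \<in> \<Omega> \<longleftrightarrow> snd z < 0" by simp
   then show ?thesis unfolding e by (simp add: indicator_def)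
  qed (simp add: pd0 T0)
 qed
 also have "... = f1 $ j *\<^sub>R (\<integral>z. indicator {..<0} (snd z) *\<^sub>R T z \<partial>(lborel \<Otimes>\<^sub>M lborel)) + (\<integral>z. indicator {..<0} (snd z) *\<^sub>R (B (fst z) *\<^sub>R S z) \<partial>(lborel \<Otimes>\<^sub>M lborel))"
  by (subst lint_add[OF integrable_scaleR_right[OF iT] iS]) (simp only: integral_scaleR_right)
 finally show ?thesis unfolding ITzero IS scaleR_zero_right add_0 unfolding B_def .
qed

lemma chart_surface_integral:
 fixes g :: "real^2 => complex"
 assumes g: "g \<in> borel_measurable borel" and K: "compact K" "K \<subseteq> W" "!!x. x \<notin> K ==> g x = 0"
  and Sb: "frontier \<Omega> \<in> sets borel"
 shows "(\<integral>x. g x \<partial>surface_measure (frontier \<Omega>)) = (LBINT t. norm (gam' t) *\<^sub>R g (gam t))"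
proof -
 obtain R where R: "R > 0" "!!t s. \<Phi> (t, s) \<in> K ==> \<bar>t\<bar> < R \<and> \<bar>s\<bar> < R"
  using \<Phi>_bounded_support[OF K(1)] by blast
 have gam\<Phi>: "gam t = \<Phi> (t, 0)" for t by (simp add: \<Phi>_def gam_def)
 have cg: "continuous_on S gam" for S
  using gam_deriv by (meson continuous_at_imp_continuous_on has_vector_derivative_continuous)
 have Gb: "gam ` {-R..R} \<in> sets borel" by (rule borel_compact[OF compact_continuous_image[OF cg compact_Icc]])
 have mem: "x \<in> frontier \<Omega> \<longleftrightarrow> x \<in> gam ` {-R..R}" if "x \<in> K" for x
 proof
  assume "x \<in> frontier \<Omega>"
  then have e: "x \<bullet> f2 = h (x \<bullet> f1)" using frontier_iff(1) that K(2) by blast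
  have x: "x = gam (x \<bullet> f1)" unfolding gam_def e[symmetric] by (rule expand)
  then have "\<bar>x \<bullet> f1\<bar> < R" using R(2)[of "x \<bullet> f1" 0] that by (simp add: gam\<Phi>[symmetric])
  then show "x \<in> gam ` {-R..R}" using x by (intro image_eqI[of _ _ "x \<bullet> f1"]) auto
 next
  assume "x \<in> gam ` {-R..R}"
  then show "x \<in> frontier \<Omega>" using frontier_iff(1)[of x] that K(2) by auto
 qed
 have "(\<integral>x. g x \<partial>surface_measure (frontier \<Omega>)) = (\<integral>x. indicator (frontier \<Omega>) x *\<^sub>R g x \<partial>hausdorff1)"
  unfolding surface_measure_def by (rule integral_restrict_space) (use Sb in simp)
 also have "... = (\<integral>x. indicator (gam ` {-R..R}) x *\<^sub>R g x \<partial>hausdorff1)"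
  by (rule lint_cong) (use mem K(3) in \<open>auto simp: indicator_def\<close>)
 also have "... = (\<integral>x. g x \<partial>restrict_space hausdorff1 (gam ` {-R..R}))"
  by (rule integral_restrict_space[symmetric]) (use Gb in simp)
 also have "... = (LBINT t. (indicator {-R..R} t * norm (gam' t)) *\<^sub>R g (gam t))"
  by (rule integral_arc[where p = "%x. x \<bullet> f1"]) (use gam_deriv gam'_cont R(1) g in \<open>auto intro!: continuous_intros\<close>)
 also have "... = (LBINT t. norm (gam' t) *\<^sub>R g (gam t))"
 proof (rule lint_cong[OF refl])
  fix t
  show "(indicator {-R..R} t * norm (gam' t)) *\<^sub>R g (gam t) = norm (gam' t) *\<^sub>R g (gam t)"
  proof (cases "t \<in> {-R..R}")
   case False
   then have "gam t \<notin> K" using R(2)[of t 0] by (auto simp: gam\<Phi>)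
   then show ?thesis by (simp add: K(3))
  qed simp
 qed
 finally show ?thesis .
qed

text \<open>The formula makes sense in the whole plane and is constant along \<open>f2\<close>, so
  it extends the normal of the curve smoothly; with the power written by \<open>powr\<close>, the
  lemma \<open>smooth_fun_powr\<close> applies.\<close>

definition chart_normal :: "real^2 => real^2" where
 "chart_normal x = (1 + (deriv h (x \<bullet> f1))\<^sup>2) powr (- 1 / 2) *\<^sub>R (f2 - deriv h (x \<bullet> f1) *\<^sub>R f1)"

lemma chart_normal_gam: "norm (gam' t) * (chart_normal (gam t) $ j) = f2 $ j - deriv h t * f1 $ j"
proof -
 define q where "q = 1 + (deriv h t)\<^sup>2"
 have q: "q > 0" unfolding q_def by (rule add_pos_nonneg) auto
 have "norm (gam' t) = sqrt ((norm (gam' t))\<^sup>2)" by simp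
 then have n: "norm (gam' t) = sqrt q" unfolding norm_gam' q_def .
 have "q powr (- 1 / 2) = inverse (sqrt q)"
  using powr_minus[of q "1 / 2"] powr_half_sqrt[of q] q by simp
 then have r: "sqrt q * q powr (- 1 / 2) = 1" using q by simp
 have "chart_normal (gam t) $ j = q powr (- 1 / 2) * (f2 $ j - deriv h t * f1 $ j)"
  by (simp add: chart_normal_def q_def)
 then have "norm (gam' t) * (chart_normal (gam t) $ j) = (sqrt q * q powr (- 1 / 2)) * (f2 $ j - deriv h t * f1 $ j)"
  by (simp only: n mult.assoc)
 then show ?thesis unfolding r by simp
qed

lemma chart_green_surface:
 assumes t: "test_fun W phi" and Sb: "frontier \<Omega> \<in> sets borel"
  and N: "N \<in> borel_measurable borel" "!!x. x \<in> frontier \<Omega> ==> x \<in> W ==> N x = chart_normal x $ j"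
 shows "(LBINT x. indicator \<Omega> x *\<^sub>R pd j phi x) = (\<integral>x. N x *\<^sub>R phi x \<partial>surface_measure (frontier \<Omega>))"
proof -
 obtain K where K: "compact K" "K \<subseteq> W" "!!x. x \<notin> K ==> phi x = 0" "smooth_fun phi" by (rule test_funE[OF t]) blast
 have "(\<integral>x. N x *\<^sub>R phi x \<partial>surface_measure (frontier \<Omega>)) = (LBINT t. norm (gam' t) *\<^sub>R (N (gam t) *\<^sub>R phi (gam t)))"
  by (rule chart_surface_integral[OF _ K(1,2) _ Sb]) (use K(3) N(1) smooth_fun_measurable[OF K(4)] in auto)
 also have "... = (LBINT t. (f2 $ j - deriv h t * f1 $ j) *\<^sub>R phi (gam t))"
 proof (rule lint_cong[OF refl])
  fix t
  show "norm (gam' t) *\<^sub>R (N (gam t) *\<^sub>R phi (gam t)) = (f2 $ j - deriv h t * f1 $ j) *\<^sub>R phi (gam t)"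
  proof (cases "gam t \<in> K")
   case True
   then have W: "gam t \<in> W" using K(2) by blast
   then have "gam t \<in> frontier \<Omega>" using frontier_iff(1) by simp
   from N(2)[OF this W] show ?thesis using chart_normal_gam[of t j] by simp
  qed (simp add: K(3))
 qed
 finally show ?thesis unfolding chart_green[OF t] ..
qed

end

section \<open>The outward normal in a chart\<close>

context graph_chart
begin

lemma chart_normal_inner:
 "chart_normal x \<bullet> f2 = (1 + (deriv h (x \<bullet> f1))\<^sup>2) powr (- 1 / 2)"
 "chart_normal x \<bullet> f1 = - deriv h (x \<bullet> f1) * (1 + (deriv h (x \<bullet> f1))\<^sup>2) powr (- 1 / 2)"
 unfolding chart_normal_def using f11 f22 f12 by (simp_all add: inner_diff_left inner_commute[of f2 f1])

lemma chart_slope_pos: "1 + (deriv h t)\<^sup>2 > 0" "(1 + (deriv h t)\<^sup>2) powr a > 0"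
proof -
 show "1 + (deriv h t)\<^sup>2 > 0" by (rule add_pos_nonneg) auto
 then show "(1 + (deriv h t)\<^sup>2) powr a > 0" by simp
qed

lemma norm_chart_normal: "norm (chart_normal x) = 1"
proof -
 define q where "q = 1 + (deriv h (x \<bullet> f1))\<^sup>2"
 have q: "q > 0" unfolding q_def by (rule chart_slope_pos)
 have "(norm (f2 - deriv h (x \<bullet> f1) *\<^sub>R f1))\<^sup>2 = q"
  unfolding power2_norm_eq_inner q_def using f11 f22 f12
  by (simp add: inner_diff_left inner_diff_right inner_commute[of f2 f1] power2_eq_square)
 then have n: "norm (f2 - deriv h (x \<bullet> f1) *\<^sub>R f1) = sqrt q" by (metis norm_ge_zero real_sqrt_unique)
 have "q powr (- 1 / 2) = inverse (sqrt q)"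
  using powr_minus[of q "1 / 2"] powr_half_sqrt[of q] q by simp
 then show ?thesis using q by (simp add: chart_normal_def q_def[symmetric] n)
qed

lemma height_deriv:
 "((%t. (x + t *\<^sub>R v) \<bullet> f2 - h ((x + t *\<^sub>R v) \<bullet> f1)) has_real_derivative (v \<bullet> f2 - deriv h (x \<bullet> f1) * (v \<bullet> f1))) (at 0)"
proof -
 have "((%t. x \<bullet> f1 + t * (v \<bullet> f1)) has_real_derivative (v \<bullet> f1)) (at 0)" by (auto intro!: derivative_eq_intros)
 moreover have "(h has_real_derivative deriv h (x \<bullet> f1)) (at (x \<bullet> f1 + 0 * (v \<bullet> f1)))" using h_deriv[of 0] by simp
 ultimately have "((%t. h (x \<bullet> f1 + t * (v \<bullet> f1))) has_real_derivative (deriv h (x \<bullet> f1) * (v \<bullet> f1))) (at 0)"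
  by (rule DERIV_chain2[rotated])
 moreover have "((%t. x \<bullet> f2 + t * (v \<bullet> f2)) has_real_derivative (v \<bullet> f2)) (at 0)" by (auto intro!: derivative_eq_intros)
 ultimately show ?thesis unfolding inner_add_left inner_scaleR_left by (intro DERIV_diff)
qed

text \<open>Along the chart normal the height over the graph has positive slope, so one leaves the
  closure of the domain. Conversely, a unit vector orthogonal to the tangent is the chart normal up
  to sign, and the negative sign would lead into \<Omega>.\<close>

lemma normal_on_chart:
 assumes x: "x \<in> frontier \<Omega>" "x \<in> W"
 shows "outward_normal \<Omega> x = chart_normal x"
 unfolding outward_normal_def
proof (rule the_equality)
 let ?d = "deriv h (x \<bullet> f1)" and ?n = "chart_normal x"
 have xg: "x \<bullet> f2 = h (x \<bullet> f1)" using frontier_iff(1)[OF x(2)] x(1) by blast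
 have xgam: "x = gam (x \<bullet> f1)" unfolding gam_def xg[symmetric] by (rule expand)
 have slope: "?n \<bullet> f2 - ?d * (?n \<bullet> f1) > 0"
 proof -
  have "?n \<bullet> f2 - ?d * (?n \<bullet> f1) = (1 + ?d\<^sup>2) * (1 + ?d\<^sup>2) powr (- 1 / 2)"
   unfolding chart_normal_inner by (simp add: algebra_simps power2_eq_square)
  then show ?thesis using chart_slope_pos[of "x \<bullet> f1"] by simp
 qed
 have stay: "\<exists>eps>0. \<forall>t. \<bar>t\<bar> < eps --> x + t *\<^sub>R v \<in> W" if "norm v = 1" for v
 proof -
  obtain eps where "eps > 0" "ball x eps \<subseteq> W" by (rule openE[OF openW x(2)])
  moreover have "x + t *\<^sub>R v \<in> ball x eps" if "\<bar>t\<bar> < eps" for t using that \<open>norm v = 1\<close> by (simp add: dist_norm)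
  ultimately show ?thesis by blast
 qed
 show "is_outward_normal \<Omega> x ?n"
  unfolding is_outward_normal_def
 proof (intro conjI allI impI, rule norm_chart_normal, elim conjE)
  fix c v assume c: "c 0 = x" "\<forall>t. c t \<in> frontier \<Omega>" "(c has_vector_derivative v) (at (0::real))"
  have cd: "((%t. c t \<bullet> f) has_real_derivative (v \<bullet> f)) (at 0)" for f
   using bounded_linear.has_vector_derivative[OF bounded_linear_inner_left c(3)]
   by (simp add: has_real_derivative_iff_has_vector_derivative)
  have "((%t. h (c t \<bullet> f1)) has_real_derivative (?d * (v \<bullet> f1))) (at 0)"
   by (rule DERIV_chain2[OF _ cd]) (use h_deriv[of 0 "x \<bullet> f1"] c(1) in simp)
  moreover have "isCont c 0" using c(3) by (rule has_vector_derivative_continuous)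
  then have "\<forall>\<^sub>F t in nhds 0. c t \<in> W"
   using openW x(2) c(1) by (metis continuous_at_open eventually_nhds tendsto_at_iff_tendsto_nhds topological_tendstoD isCont_def)
  then have "\<forall>\<^sub>F t in nhds 0. h (c t \<bullet> f1) = c t \<bullet> f2"
   by eventually_elim (use c(2) frontier_iff(1) in metis)
  ultimately have "((%t. c t \<bullet> f2) has_real_derivative (?d * (v \<bullet> f1))) (at 0)"
   using DERIV_cong_ev[OF refl _ refl, of "%t. h (c t \<bullet> f1)" "%t. c t \<bullet> f2" 0] by blast
  from DERIV_unique[OF this cd] have "v \<bullet> f2 = ?d * (v \<bullet> f1)" by simp
  then show "v \<bullet> ?n = 0" unfolding chart_normal_def by (simp add: inner_diff_right)
 next
  obtain eps where e: "eps > 0" "!!t. \<bar>t\<bar> < eps ==> x + t *\<^sub>R ?n \<in> W" using stay[OF norm_chart_normal] by blast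
  obtain d where d: "d > 0" "!!t. 0 < t ==> t < d ==> 0 < (x + t *\<^sub>R ?n) \<bullet> f2 - h ((x + t *\<^sub>R ?n) \<bullet> f1)"
   using DERIV_pos_inc_right[OF height_deriv slope] xg by auto
  have "x + t *\<^sub>R ?n \<notin> closure \<Omega>" if "0 < t" "t < min eps d" for t
   using frontier_iff(2)[OF e(2)[of t]] d(2)[of t] that by auto
  then show "\<exists>eps>0. \<forall>t. 0 < t \<and> t < eps --> x + t *\<^sub>R ?n \<notin> closure \<Omega>"
   using e(1) d(1) by (intro exI[of _ "min eps d"]) auto
 qed
 fix n assume n: "is_outward_normal \<Omega> x n"
 have n1: "norm n = 1" using n by (simp add: is_outward_normal_def)
 define t0 where "t0 = x \<bullet> f1"
 have cg: "continuous_on UNIV gam"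
  using gam_deriv by (meson continuous_at_imp_continuous_on has_vector_derivative_continuous)
 have "open (gam -` W)" using open_vimage[OF openW] cg by blast
 moreover have "t0 \<in> gam -` W" using xgam x(2) by (simp add: t0_def)
 ultimately obtain \<delta> where \<delta>: "\<delta> > 0" "ball t0 \<delta> \<subseteq> gam -` W" by (rule openE)
 \<comment> \<open>Curves in \<open>is_outward_normal\<close> have to stay on the boundary for all
   times; the parameter is therefore frozen outside a short interval, which does not affect the
   derivative at 0.\<close>
 define c where "c t = gam (t0 + max (- \<delta> / 2) (min (\<delta> / 2) t))" for t
 have "c 0 = x" using \<delta>(1) xgam by (simp add: c_def t0_def)
 moreover have "c t \<in> frontier \<Omega>" for t
 proof -
  have "t0 + max (- \<delta> / 2) (min (\<delta> / 2) t) \<in> ball t0 \<delta>" using \<delta>(1) by (auto simp: dist_real_def abs_le_iff)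
  then have "c t \<in> W" using \<delta>(2) by (auto simp: c_def)
  then show ?thesis using frontier_iff(1)[of "c t"] by (simp add: c_def)
 qed
 moreover have "(c has_vector_derivative gam' t0) (at 0)"
 proof -
  have "((%t. gam (t0 + t)) has_vector_derivative gam' t0) (at 0)"
  proof -
   have "((%t. t0 + t) has_vector_derivative 0 + 1) (at 0)"
    by (intro has_vector_derivative_add has_vector_derivative_const has_vector_derivative_id)
   then show ?thesis
    using vector_diff_chain_at[of "%t. t0 + t" 1 0 gam "gam' t0"] gam_deriv[of t0] by (simp add: o_def)
  qed
  then show ?thesis
   by (rule has_vector_derivative_transform_within_open[where S = "{-\<delta>/2<..<\<delta>/2}"]) (use \<delta>(1) in \<open>auto simp: c_def\<close>)
 qed
 ultimately have "gam' t0 \<bullet> n = 0" using n by (auto simp: is_outward_normal_def)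
 then have tang: "n \<bullet> f1 = - ?d * (n \<bullet> f2)"
  by (simp add: gam'_def t0_def inner_add_left inner_commute[of f1 n] inner_commute[of f2 n])
 define s where "s = (n \<bullet> f2) * (1 + ?d\<^sup>2) powr (1 / 2)"
 have "n = s *\<^sub>R ?n"
 proof -
  have "n = (n \<bullet> f1) *\<^sub>R f1 + (n \<bullet> f2) *\<^sub>R f2" by (rule expand)
  also have "... = (n \<bullet> f2) *\<^sub>R (f2 - ?d *\<^sub>R f1)" unfolding tang by (simp add: algebra_simps)
  also have "... = s *\<^sub>R ?n"
  proof -
   have "(1 + ?d\<^sup>2) powr (1 / 2) * (1 + ?d\<^sup>2) powr (- 1 / 2) = 1"
    using chart_slope_pos(1)[of "x \<bullet> f1"] by (simp add: powr_add[symmetric])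
   then show ?thesis by (simp add: s_def chart_normal_def mult.assoc)
  qed
  finally show ?thesis .
 qed
 moreover have "\<bar>s\<bar> = 1" using n1 norm_chart_normal[of x] calculation by (metis mult.right_neutral norm_scaleR)
 moreover have "s \<noteq> -1"
 proof
  assume "s = -1"
  then have nm: "n = - ?n" using calculation by simp
  obtain eps0 where e0: "eps0 > 0" "!!t. 0 < t ==> t < eps0 ==> x + t *\<^sub>R n \<notin> closure \<Omega>"
   using n unfolding is_outward_normal_def by blast
  obtain eps where e: "eps > 0" "!!t. \<bar>t\<bar> < eps ==> x + t *\<^sub>R n \<in> W" using stay[OF n1] by blast
  have "n \<bullet> f2 - ?d * (n \<bullet> f1) < 0" using slope unfolding nm by simp
  then obtain d where d: "d > 0" "!!t. 0 < t ==> t < d ==> (x + t *\<^sub>R n) \<bullet> f2 - h ((x + t *\<^sub>R n) \<bullet> f1) < 0"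
   using DERIV_neg_dec_right[OF height_deriv] xg by force
  define t where "t = min (min eps0 eps) d / 2"
  have t: "0 < t" "t < eps0" "\<bar>t\<bar> < eps" "t < d" using e0(1) e(1) d(1) by (auto simp: t_def)
  have "x + t *\<^sub>R n \<in> \<Omega>" using subgraph e(2)[OF t(3)] d(2)[OF t(1,4)] by auto
  then show False using e0(2)[OF t(1,2)] closure_subset by blast
 qed
 ultimately show "n = ?n" by (auto simp: abs_if split: if_splits)
qed

lemma smooth_fun_chart_normal: "smooth_fun (%x. complex_of_real (chart_normal x $ j))"
proof -
 have d: "smooth_fun (%x. complex_of_real (deriv h (x \<bullet> f1)))"
 proof (rule smooth_fun_compose_real[where \<G> = "range (%n. (deriv ^^ n) h)" and D = UNIV and G = "deriv h"])
  show "\<exists>G'\<in>range (%n. (deriv ^^ n) h). \<forall>t\<in>UNIV. (G has_real_derivative G' t) (at t)"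
   if "G \<in> range (%n. (deriv ^^ n) h)" for G
   using that h_deriv by blast
  show "deriv h \<in> range (%n. (deriv ^^ n) h)" by (rule image_eqI[of _ _ 1]) auto
 qed (auto intro: smooth_fun_linear bounded_linear_inner_left)
 have "smooth_fun (%x. complex_of_real (1 + (deriv h (x \<bullet> f1))\<^sup>2))"
  using smooth_fun_add[OF smooth_fun_const smooth_fun_mult[OF d d], of 1] by (simp add: power2_eq_square)
 from smooth_fun_powr[OF this chart_slope_pos(1), of "- 1 / 2"]
 have p: "smooth_fun (%x. complex_of_real ((1 + (deriv h (x \<bullet> f1))\<^sup>2) powr (- 1 / 2)))" .
 have "smooth_fun (%x. complex_of_real (f2 $ j) - complex_of_real (deriv h (x \<bullet> f1)) * complex_of_real (f1 $ j))"
  by (intro smooth_fun_diff smooth_fun_mult smooth_fun_const d)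
 from smooth_fun_mult[OF p this] show ?thesis by (simp add: chart_normal_def)
qed

lemma graph_null: "{x. x \<bullet> f2 = h (x \<bullet> f1)} \<in> null_sets lborel"
proof -
 have hc: "continuous_on UNIV h" using h_cont[of UNIV 0] by simp
 have cl: "closed {x. x \<bullet> f2 = h (x \<bullet> f1)}"
  by (intro closed_Collect_eq continuous_intros continuous_on_compose2[OF hc]) auto
 have m: "\<Phi> \<in> borel_measurable borel" by (rule borel_measurable_continuous_onI[OF \<Phi>_cont])
 have "emeasure lborel {x. x \<bullet> f2 = h (x \<bullet> f1)} = emeasure (distr lborel borel \<Phi>) {x. x \<bullet> f2 = h (x \<bullet> f1)}"
  by (simp only: lborel_distr_\<Phi>)
 also have "... = emeasure lborel (\<Phi> -` {x. x \<bullet> f2 = h (x \<bullet> f1)})"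
  using m cl by (simp add: emeasure_distr)
 also have "\<Phi> -` {x. x \<bullet> f2 = h (x \<bullet> f1)} = UNIV \<times> {0}" by auto
 also have "emeasure lborel (UNIV \<times> {0} :: (real \<times> real) set) = emeasure (lborel \<Otimes>\<^sub>M lborel) (UNIV \<times> {0} :: (real \<times> real) set)"
  by (simp only: lborel_prod)
 also have "... = 0" by (subst lborel.emeasure_pair_measure_Times) auto
 finally show ?thesis using cl by (simp add: null_sets_def)
qed

lemma emeasure_chart_finite:
 assumes "compact K" "K \<subseteq> W" "frontier \<Omega> \<in> sets borel"
 shows "emeasure hausdorff1 (frontier \<Omega> \<inter> K) < \<infinity>"
proof -
 obtain R where R: "R > 0" "!!t s. \<Phi> (t, s) \<in> K ==> \<bar>t\<bar> < R \<and> \<bar>s\<bar> < R"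
  using \<Phi>_bounded_support[OF assms(1)] by blast
 have "frontier \<Omega> \<inter> K \<subseteq> gam ` {-R..R}"
 proof
  fix x assume x: "x \<in> frontier \<Omega> \<inter> K"
  then have e: "x \<bullet> f2 = h (x \<bullet> f1)" using frontier_iff(1)[of x] assms(2) by blast
  have xgam: "x = gam (x \<bullet> f1)" unfolding gam_def e[symmetric] by (rule expand)
  moreover have "gam (x \<bullet> f1) = \<Phi> (x \<bullet> f1, 0)" by (simp add: \<Phi>_def gam_def)
  ultimately have "\<bar>x \<bullet> f1\<bar> < R" using R(2)[of "x \<bullet> f1" 0] x by simp
  then show "x \<in> gam ` {-R..R}" using xgam by (intro image_eqI[of _ _ "x \<bullet> f1"]) auto
 qed
 moreover have cg: "continuous_on S gam" for S
  using gam_deriv by (meson continuous_at_imp_continuous_on has_vector_derivative_continuous)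
 have "gam ` {-R..R} \<in> sets borel" by (rule borel_compact[OF compact_continuous_image[OF cg compact_Icc]])
 ultimately have "emeasure hausdorff1 (frontier \<Omega> \<inter> K) \<le> emeasure hausdorff1 (gam ` {-R..R})"
  by (intro emeasure_mono) auto
 also have "... < \<infinity>"
  by (rule hausdorff1_arc(2)[where p = "%x. x \<bullet> f1"]) (use gam_deriv gam'_cont R(1) in \<open>auto intro!: continuous_intros\<close>)
 finally show ?thesis .
qed

end

lemma smooth_domain_chart:
 assumes "smooth_domain \<Omega>" "p \<in> frontier \<Omega>"
 shows "\<exists>W f1 f2 h. graph_chart \<Omega> W f1 f2 h \<and> p \<in> W"
proof -
 obtain W Q h where W: "open W" "p \<in> W" and Q: "orthogonal_transformation (Q :: real^2 => real^2)"
  and h: "!!n t. ((deriv ^^ n) (h :: real => real)) differentiable (at t)"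
  and sub: "\<Omega> \<inter> W = {x \<in> W. Q x $ 2 < h (Q x $ 1)}"
  using assms unfolding smooth_domain_def by meson
 define f where "f i = inv Q (axis i 1)" for i :: 2
 have Qf: "Q (f i) = axis i 1" for i
  unfolding f_def using orthogonal_transformation_surj[OF Q] by (rule surj_f_inv_f)
 have inner: "x \<bullet> f i = Q x $ i" for x i
 proof -
  have "x \<bullet> f i = Q x \<bullet> Q (f i)" using Q by (simp add: orthogonal_transformation_def)
  then show ?thesis by (simp add: Qf inner_axis)
 qed
 have "graph_chart \<Omega> W (f 1) (f 2) h"
 proof
  show "x = (x \<bullet> f 1) *\<^sub>R f 1 + (x \<bullet> f 2) *\<^sub>R f 2" for x
  proof -
   have lin: "linear Q" by (rule orthogonal_transformation_linear[OF Q])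
   have "Q ((x \<bullet> f 1) *\<^sub>R f 1 + (x \<bullet> f 2) *\<^sub>R f 2) = Q x"
    unfolding linear_add[OF lin] linear_scale[OF lin] Qf inner by (rule axis_expand[symmetric])
   then show ?thesis using orthogonal_transformation_inj[OF Q] by (metis injD)
  qed
 qed (use W h sub in \<open>simp_all add: inner Qf axis_def\<close>)
 with W(2) show ?thesis by blast
qed

text \<open>\<open>N\<close> is a smooth extension of the normal to the whole plane.\<close>

locale green_domain =
 fixes \<Omega> :: "(real^2) set" and N :: "2 => real^2 => real"
 assumes open_dom: "open \<Omega>" and bounded_dom: "bounded \<Omega>"
  and null_frontier: "frontier \<Omega> \<in> null_sets lborel"
  and frontier_exterior: "frontier (exterior \<Omega>) = frontier \<Omega>"
  and finite_surface: "finite_measure (surface_measure (frontier \<Omega>))"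
  and N_test: "!!j. test_fun UNIV (%x. complex_of_real (N j x))"
  and N_normal: "!!j x. x \<in> frontier \<Omega> ==> N j x = outward_normal \<Omega> x $ j"
  and N_unit: "!!x. x \<in> frontier \<Omega> ==> (N 1 x)\<^sup>2 + (N 2 x)\<^sup>2 = 1"
  and green: "!!phi j. test_fun UNIV phi ==> (LBINT x. indicator \<Omega> x *\<^sub>R pd j phi x)
    = (\<integral>x. N j x *\<^sub>R phi x \<partial>surface_measure (frontier \<Omega>))"

section \<open>Bump functions and the partition of unity along the boundary\<close>

definition bump :: "real^2 => real => real^2 => real" where
 "bump p \<delta> x = flat 1 (\<delta>\<^sup>2 - ((x $ 1 - p $ 1)\<^sup>2 + (x $ 2 - p $ 2)\<^sup>2))"

lemma dist_vec2: "(dist x p)\<^sup>2 = (x $ 1 - p $ 1)\<^sup>2 + (x $ 2 - p $ 2)\<^sup>2" for x p :: "real^2"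
 unfolding dist_norm power2_norm_eq_inner by (simp add: inner_vec_def sum_2 power2_eq_square)

lemma bump_pos: "\<delta> > 0 ==> bump p \<delta> x > 0 \<longleftrightarrow> dist x p < \<delta>" and bump_nonneg: "bump p \<delta> x \<ge> 0"
proof -
 show "bump p \<delta> x \<ge> 0" by (simp add: bump_def flat_1_nonneg)
 assume "\<delta> > 0"
 then have "dist x p < \<delta> \<longleftrightarrow> (dist x p)\<^sup>2 < \<delta>\<^sup>2"
  using power_strict_mono[of "dist x p" \<delta> 2] power2_less_imp_less[of "dist x p" \<delta>] by auto
 then show "bump p \<delta> x > 0 \<longleftrightarrow> dist x p < \<delta>" by (simp add: bump_def flat_1_pos dist_vec2)
qed

lemma test_fun_bump:
 assumes "\<delta> > 0" "cball p \<delta> \<subseteq> W"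
 shows "test_fun W (%x. complex_of_real (bump p \<delta> x))"
proof (rule test_funI[OF _ compact_cball assms(2)])
 have c: "smooth_fun (%x. complex_of_real (x $ i - p $ i))" for i
  using smooth_fun_diff[OF smooth_fun_coord smooth_fun_const, of i "complex_of_real (p $ i)"] by simp
 have "smooth_fun (%x. complex_of_real (\<delta>\<^sup>2 - ((x $ 1 - p $ 1)\<^sup>2 + (x $ 2 - p $ 2)\<^sup>2)))"
  using smooth_fun_diff[OF smooth_fun_const smooth_fun_add[OF smooth_fun_mult[OF c c] smooth_fun_mult[OF c c]], of "complex_of_real (\<delta>\<^sup>2)" 1 1 2 2]
  by (simp add: power2_eq_square)
 from smooth_fun_flat[OF this] show "smooth_fun (%x. complex_of_real (bump p \<delta> x))" by (simp add: bump_def)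
 show "complex_of_real (bump p \<delta> x) = 0" if "x \<notin> cball p \<delta>" for x
  using bump_pos[OF assms(1), of p x] bump_nonneg[of p \<delta> x] that by (simp add: dist_commute)
qed

text \<open>As \<open>psi\<close> vanishes near the boundary, its product with the indicator of
  \<Omega> is still smooth, hence a test function, and the derivative of a test function has
  integral 0.\<close>

lemma integral_pd_interior:
 assumes t: "test_fun UNIV psi" and "open \<Omega>" and U: "open U" "frontier \<Omega> \<subseteq> U" "!!x. x \<in> U ==> psi x = 0"
 shows "(LBINT x. indicator \<Omega> x *\<^sub>R pd j psi x) = 0"
proof -
 define psi' where "psi' x = indicator \<Omega> x * psi x" for x
 have loc: "\<exists>V g. open V \<and> x \<in> V \<and> (\<forall>y\<in>V. psi' y = g y) \<and> smooth_fun g \<and> (\<forall>y\<in>V. indicator \<Omega> y *\<^sub>R pd j psi y = pd j g y)" for x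
 proof -
  consider "x \<in> \<Omega>" | "x \<in> U" | "x \<in> - closure \<Omega>"
   using U(2) assms(2) by (auto simp: frontier_def interior_open)
  then show ?thesis
  proof cases
   case 1
   then show ?thesis using assms(2) test_fun_smooth[OF t]
    by (intro exI[of _ \<Omega>] exI[of _ psi]) (auto simp: psi'_def)
  next
   case 2
   have "pd j psi y = 0" if "y \<in> U" for y using pd_local(2)[OF U(1) that U(3)] by simp
   then show ?thesis using 2 U
    by (intro exI[of _ U] exI[of _ "%x. 0"]) (auto simp: psi'_def)
  next
   case 3
   then show ?thesis using closure_subset[of \<Omega>]
    by (intro exI[of _ "- closure \<Omega>"] exI[of _ "%x. 0"]) (auto simp: psi'_def indicator_def)
  qed
 qed
 have s: "smooth_fun psi'" by (rule smooth_fun_local) (use loc in blast)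
 obtain K where K: "compact K" "K \<subseteq> UNIV" "!!x. x \<notin> K ==> psi x = 0" "smooth_fun psi" by (rule test_funE[OF t]) blast
 have "test_fun UNIV psi'" by (rule test_funI[OF s K(1,2)]) (simp add: psi'_def K(3))
 then have "(LBINT x. pd j psi' x) = 0" by (rule integral_pd)
 moreover have "pd j psi' x = indicator \<Omega> x *\<^sub>R pd j psi x" for x
 proof -
  obtain V g where V: "open V" "x \<in> V" "\<forall>y\<in>V. psi' y = g y" "smooth_fun g" "\<forall>y\<in>V. indicator \<Omega> y *\<^sub>R pd j psi y = pd j g y"
   using loc[of x] by blast
  then have "pd j psi' x = pd j g x" by (intro pd_local(2)[of V]) (auto intro: smooth_fun_diffb)
  with V show ?thesis by simp
 qed
 ultimately show ?thesis by simp
qed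

text \<open>Finitely many charts cover the compact boundary. A partition of unity splits a test
  function into pieces supported in single charts, where Green's formula holds, and a rest that
  vanishes near the boundary and contributes nothing.\<close>

theorem smooth_domain_green:
 assumes dom: "smooth_domain \<Omega>" and bdd: "bounded \<Omega>"
 shows "\<exists>N. green_domain \<Omega> N"
proof -
 let ?\<Sigma> = "frontier \<Omega>"
 have op: "open \<Omega>" using dom by (simp add: smooth_domain_def)
 have cS: "compact ?\<Sigma>" by (rule compact_frontier_bounded[OF bdd])
 have Sb: "?\<Sigma> \<in> sets borel" by simp
 have "\<forall>p\<in>?\<Sigma>. \<exists>W f1 f2 h. graph_chart \<Omega> W f1 f2 h \<and> p \<in> W" using smooth_domain_chart[OF dom] by blast
 then obtain W f1 f2 h where ch: "!!p. p \<in> ?\<Sigma> ==> graph_chart \<Omega> (W p) (f1 p) (f2 p) (h p)" "!!p. p \<in> ?\<Sigma> ==> p \<in> W p"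
  by metis
 have "\<forall>p\<in>?\<Sigma>. \<exists>\<delta>>0. cball p \<delta> \<subseteq> W p"
  using ch graph_chart.openW open_contains_cball by metis
 then obtain \<delta> where \<delta>: "!!p. p \<in> ?\<Sigma> ==> \<delta> p > 0" "!!p. p \<in> ?\<Sigma> ==> cball p (\<delta> p) \<subseteq> W p" by metis
 have "?\<Sigma> \<subseteq> (\<Union>p\<in>?\<Sigma>. ball p (\<delta> p))" using \<delta>(1) by force
 then obtain P where P: "P \<subseteq> ?\<Sigma>" "finite P" "?\<Sigma> \<subseteq> (\<Union>p\<in>P. ball p (\<delta> p))"
  using compactE_image[OF cS, of ?\<Sigma> "%p. ball p (\<delta> p)"] by auto
 have cov: "?\<Sigma> \<subseteq> (\<Union>p\<in>P. cball p (\<delta> p))" using P(3) ball_subset_cball by blast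
 define nor where "nor p = graph_chart.chart_normal (f1 p) (f2 p) (h p)" for p
 define T where "T x = (\<Sum>p\<in>P. bump p (\<delta> p) x)" for x
 have bt: "test_fun (W p) (%x. complex_of_real (bump p (\<delta> p) x))" if "p \<in> P" for p
  using P(1) that \<delta> by (intro test_fun_bump) auto
 have Ts: "smooth_fun (%x. complex_of_real (T x))"
  unfolding T_def of_real_sum by (intro smooth_fun_sum test_fun_smooth[OF bt])
 have Tpos: "T x > 0" if xS: "x \<in> ?\<Sigma>" for x
 proof -
  obtain p where p: "p \<in> P" "x \<in> ball p (\<delta> p)" using P(3) xS by blast
  then have "bump p (\<delta> p) x > 0" using bump_pos[of "\<delta> p" p x] \<delta>(1)[of p] P(1) by (auto simp: dist_commute)
  moreover have "bump p (\<delta> p) x \<le> T x"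
   unfolding T_def using P(2) p(1) bump_nonneg by (intro member_le_sum) auto
  ultimately show ?thesis by linarith
 qed
 \<comment> \<open>A positive lower bound of the sum of the bumps on the compact boundary; after
   division by it the sum exceeds 1 on a neighbourhood \<open>U\<close> of the boundary.\<close>
 obtain m where m: "m > 0" "!!x. x \<in> ?\<Sigma> ==> m < T x"
 proof (cases "?\<Sigma> = {}")
  case True then show ?thesis using that[of 1] by simp
 next
  case False
  have "continuous_on ?\<Sigma> (%x. Re (complex_of_real (T x)))"
   by (intro continuous_intros smooth_fun_continuous[OF Ts])
  from continuous_attains_inf[OF cS False this]
  obtain x0 where x0: "x0 \<in> ?\<Sigma>" "!!x. x \<in> ?\<Sigma> ==> T x0 \<le> T x" by auto
  have "T x0 > 0" by (rule Tpos[OF x0(1)])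
  then have "T x0 / 2 > 0" "T x0 / 2 < T x" if "x \<in> ?\<Sigma>" for x using x0(2)[OF that] by linarith+
  with \<open>T x0 > 0\<close> show ?thesis using that[of "T x0 / 2"] by simp
 qed
 define T' where "T' x = T x / m" for x
 have T's: "smooth_fun (%x. complex_of_real (T' x))"
  using smooth_fun_mult[OF smooth_fun_const Ts, of "complex_of_real (1 / m)"] by (simp add: T'_def)
 define U where "U = {x. 1 < T' x}"
 have oU: "open U"
 proof -
  have "continuous_on UNIV (%x. Re (complex_of_real (T' x)))"
   by (intro continuous_intros smooth_fun_continuous[OF T's])
  from open_Collect_less[OF continuous_on_const this, of 1] show ?thesis by (simp add: U_def)
 qed
 have SU: "?\<Sigma> \<subseteq> U" using m by (auto simp: U_def T'_def)
 \<comment> \<open>Dividing by the sum of the bumps would fail where it vanishes. The factor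
   \<open>rstep (T' x)\<close> is smooth everywhere and equals \<open>1 / T' x\<close> where
   \<open>T' x \<ge> 1\<close>; the total is \<open>step (T' x)\<close>, hence 1 on
   \<open>U\<close>.\<close>
 define \<theta> where "\<theta> p x = (bump p (\<delta> p) x / m) * rstep (T' x)" for p x
 have \<theta>_sum: "(\<Sum>p\<in>P. \<theta> p x) = step (T' x)" for x
  unfolding \<theta>_def sum_distrib_right[symmetric] sum_divide_distrib[symmetric] T_def[symmetric] T'_def[symmetric]
  by (rule rstep_step)
 have \<theta>_one: "(\<Sum>p\<in>P. \<theta> p x) = 1" if "x \<in> U" for x
  unfolding \<theta>_sum using that by (intro step_ge_1) (simp add: U_def)
 have \<theta>_test: "test_fun (W p) (%x. complex_of_real (\<theta> p x))" if "p \<in> P" for p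
 proof -
  have "test_fun (W p) (%x. (complex_of_real (1 / m) * complex_of_real (rstep (T' x))) * complex_of_real (bump p (\<delta> p) x))"
   by (rule test_fun_mult[OF bt[OF that]]) (intro smooth_fun_mult smooth_fun_const smooth_fun_rstep T's)
  then show ?thesis by (simp add: \<theta>_def mult_ac)
 qed
 have \<theta>_supp: "x \<in> W p" if p: "p \<in> P" "\<theta> p x \<noteq> 0" for p x
 proof -
  obtain K where K: "compact K" "K \<subseteq> W p" "!!x. x \<notin> K ==> complex_of_real (\<theta> p x) = 0"
   by (rule test_funE[OF \<theta>_test[OF p(1)]]) blast
  then show ?thesis using p(2) by auto
 qed
 \<comment> \<open>On the boundary every chart yields the same outward normal, so the weighted sum
   is that normal; elsewhere it is just some smooth function with compact support.\<close>
 define N where "N j x = (\<Sum>p\<in>P. \<theta> p x * nor p x $ j)" for j x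
 have nor: "nor p x = outward_normal \<Omega> x" if "p \<in> P" "x \<in> ?\<Sigma>" "x \<in> W p" for p x
  unfolding nor_def using graph_chart.normal_on_chart[OF ch(1)] that P(1) by (metis subsetD)
 have N_normal: "N j x = outward_normal \<Omega> x $ j" if x: "x \<in> ?\<Sigma>" for j x
 proof -
  have "N j x = (\<Sum>p\<in>P. \<theta> p x * (outward_normal \<Omega> x $ j))"
   unfolding N_def by (rule sum.cong[OF refl]) (use nor[OF _ x] \<theta>_supp in force)
  also have "... = outward_normal \<Omega> x $ j"
   unfolding sum_distrib_right[symmetric] using \<theta>_one SU x by auto
  finally show ?thesis .
 qed
 have N_test: "test_fun UNIV (%x. complex_of_real (N j x))" for j
  unfolding N_def of_real_sum
 proof (rule test_fun_sum)
  fix p assume p: "p \<in> P"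
  have "smooth_fun (%x. complex_of_real (nor p x $ j))"
   unfolding nor_def using ch(1) P(1) p by (intro graph_chart.smooth_fun_chart_normal) auto
  from test_fun_mult[OF test_fun_mono[OF \<theta>_test[OF p] subset_UNIV] this]
  show "test_fun UNIV (%x. complex_of_real (\<theta> p x * nor p x $ j))" by (simp add: mult.commute)
 qed
 have Nm: "N j \<in> borel_measurable borel" for j
  using borel_measurable_Re[THEN measurable_compose[OF smooth_fun_measurable[OF test_fun_smooth[OF N_test[of j]]]]] by simp
 have N_unit: "(N 1 x)\<^sup>2 + (N 2 x)\<^sup>2 = 1" if x: "x \<in> ?\<Sigma>" for x
 proof -
  have "graph_chart \<Omega> (W x) (f1 x) (f2 x) (h x)" "x \<in> W x" using ch x by auto
  then have "outward_normal \<Omega> x = graph_chart.chart_normal (f1 x) (f2 x) (h x) x" "norm (graph_chart.chart_normal (f1 x) (f2 x) (h x) x) = 1"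
   using graph_chart.normal_on_chart graph_chart.norm_chart_normal x by blast+
  then have "norm (outward_normal \<Omega> x) = 1" by simp
  then have "(outward_normal \<Omega> x) \<bullet> (outward_normal \<Omega> x) = 1" by (simp add: norm_eq_sqrt_inner)
  then show ?thesis using N_normal[OF x] by (simp add: inner_vec_def sum_2 power2_eq_square)
 qed
 have fin: "emeasure hausdorff1 ?\<Sigma> < \<infinity>"
 proof -
  have "emeasure hausdorff1 ?\<Sigma> \<le> emeasure hausdorff1 (\<Union>p\<in>P. ?\<Sigma> \<inter> cball p (\<delta> p))"
  proof (rule emeasure_mono)
   show "?\<Sigma> \<subseteq> (\<Union>p\<in>P. ?\<Sigma> \<inter> cball p (\<delta> p))" using cov by blast
   show "(\<Union>p\<in>P. ?\<Sigma> \<inter> cball p (\<delta> p)) \<in> sets hausdorff1"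
    unfolding sets_hausdorff1 by (intro sets.finite_UN P(2) sets.Int Sb borel_closed closed_cball)
  qed
  also have "... \<le> (\<Sum>p\<in>P. emeasure hausdorff1 (?\<Sigma> \<inter> cball p (\<delta> p)))"
   by (rule emeasure_subadditive_finite[OF P(2)]) auto
  also have "... < \<infinity>"
  proof -
   have "emeasure hausdorff1 (?\<Sigma> \<inter> cball p (\<delta> p)) < \<infinity>" if "p \<in> P" for p
    using graph_chart.emeasure_chart_finite[OF ch(1) compact_cball \<delta>(2) Sb] that P(1) by blast
   then show ?thesis using P(2) by (simp add: less_top)
  qed
  finally show ?thesis .
 qed
 have fm: "finite_measure (surface_measure ?\<Sigma>)"
  unfolding surface_measure_def
  by (rule finite_measureI) (use fin Sb in \<open>simp add: space_restrict_space emeasure_restrict_space\<close>)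
 have null: "?\<Sigma> \<in> null_sets lborel"
 proof -
  have "{x. x \<bullet> f2 p = h p (x \<bullet> f1 p)} \<in> null_sets lborel" if "p \<in> P" for p
   using graph_chart.graph_null[OF ch(1)] that P(1) by blast
  then have n: "(\<Union>p\<in>P. {x. x \<bullet> f2 p = h p (x \<bullet> f1 p)}) \<in> null_sets lborel"
   using P(2) by (intro null_sets.finite_UN) auto
  have s: "?\<Sigma> \<subseteq> (\<Union>p\<in>P. {x. x \<bullet> f2 p = h p (x \<bullet> f1 p)})"
  proof
   fix x assume x: "x \<in> ?\<Sigma>"
   then obtain p where p: "p \<in> P" "x \<in> cball p (\<delta> p)" using cov by blast
   then have "x \<in> W p" using \<delta>(2) P(1) by blast
   then have "x \<bullet> f2 p = h p (x \<bullet> f1 p)" using graph_chart.frontier_iff(1)[OF ch(1)] p P(1) x by blast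
   then show "x \<in> (\<Union>p\<in>P. {x. x \<bullet> f2 p = h p (x \<bullet> f1 p)})" using p by blast
  qed
  show ?thesis by (rule null_sets_subset[OF n _ s]) simp
 qed
 have front: "frontier (exterior \<Omega>) = ?\<Sigma>"
 proof
  show "frontier (exterior \<Omega>) \<subseteq> ?\<Sigma>"
  proof -
   have "frontier (exterior \<Omega>) = frontier (closure \<Omega>)" by (rule frontier_complement)
   then show ?thesis using interior_mono[OF closure_subset[of \<Omega>]] by (auto simp: frontier_def)
  qed
  show "?\<Sigma> \<subseteq> frontier (exterior \<Omega>)"
   using graph_chart.frontier_iff(1,3)[OF ch(1)] ch(2) by blast
 qed
 have green: "(LBINT x. indicator \<Omega> x *\<^sub>R pd j phi x) = (\<integral>x. N j x *\<^sub>R phi x \<partial>surface_measure ?\<Sigma>)"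
  if t: "test_fun UNIV phi" for phi j
 proof -
  interpret F: finite_measure "surface_measure ?\<Sigma>" by (rule fm)
  define psi where "psi x = complex_of_real (1 - step (T' x)) * phi x" for x
  have phip: "test_fun (W p) (%x. complex_of_real (\<theta> p x) * phi x)" if "p \<in> P" for p
   using test_fun_mult[OF \<theta>_test[OF that] test_fun_smooth[OF t]] by (simp add: mult.commute)
  have phip': "test_fun UNIV (%x. complex_of_real (\<theta> p x) * phi x)" if "p \<in> P" for p
   by (rule test_fun_mono[OF phip[OF that] subset_UNIV])
  have tpsi: "test_fun UNIV psi"
   unfolding psi_def of_real_diff
   by (rule test_fun_mult[OF t]) (intro smooth_fun_diff smooth_fun_step T's smooth_fun_const)
  have dec: "phi x = (\<Sum>p\<in>P. complex_of_real (\<theta> p x) * phi x) + psi x" for x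
  proof -
   have "(\<Sum>p\<in>P. complex_of_real (\<theta> p x) * phi x) = complex_of_real (step (T' x)) * phi x"
    unfolding \<theta>_sum[symmetric] of_real_sum sum_distrib_right ..
   then show ?thesis by (simp add: psi_def algebra_simps)
  qed
  have psiU: "psi x = 0" if "x \<in> U" for x using \<theta>_one[OF that] by (simp add: psi_def \<theta>_sum)
  have pd_sum: "pd j (%x. \<Sum>p\<in>Q. complex_of_real (\<theta> p x) * phi x) x = (\<Sum>p\<in>Q. pd j (%x. complex_of_real (\<theta> p x) * phi x) x)" if "Q \<subseteq> P" for Q x
   using finite_subset[OF that P(2)] that
  proof (induction Q rule: finite_induct)
   case (insert p Q)
   have "smooth_fun (%x. \<Sum>p\<in>Q. complex_of_real (\<theta> p x) * phi x)"
    using insert by (intro smooth_fun_sum test_fun_smooth[OF phip']) auto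
   then show ?case using insert pd_add[OF smooth_fun_diffb[OF test_fun_smooth[OF phip']] smooth_fun_diffb, of p "%x. \<Sum>p\<in>Q. complex_of_real (\<theta> p x) * phi x" j x]
    by simp
  qed simp
  have "pd j phi x = (\<Sum>p\<in>P. pd j (%x. complex_of_real (\<theta> p x) * phi x) x) + pd j psi x" for x
  proof -
   have "phi = (%x. (\<Sum>p\<in>P. complex_of_real (\<theta> p x) * phi x) + psi x)" by (rule ext) (rule dec)
   from arg_cong[OF this, of "%f. pd j f x"]
   have "pd j phi x = pd j (%x. (\<Sum>p\<in>P. complex_of_real (\<theta> p x) * phi x) + psi x) x" .
   also have "... = pd j (%x. \<Sum>p\<in>P. complex_of_real (\<theta> p x) * phi x) x + pd j psi x"
    by (rule pd_add) (intro smooth_fun_diffb smooth_fun_sum test_fun_smooth[OF phip'] test_fun_smooth[OF tpsi]; assumption)+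
   finally show ?thesis using pd_sum[OF order_refl, of x] by simp
  qed
  then have L: "indicator \<Omega> x *\<^sub>R pd j phi x = (\<Sum>p\<in>P. indicator \<Omega> x *\<^sub>R pd j (%x. complex_of_real (\<theta> p x) * phi x) x) + indicator \<Omega> x *\<^sub>R pd j psi x" for x
   by (simp add: scaleR_add_right scaleR_sum_right)
  have iL: "integrable lborel (%x. indicator \<Omega> x *\<^sub>R pd j phi x)" if "test_fun UNIV phi" for phi
   by (rule integrable_mult_indicator[OF _ test_fun_integrable[OF test_fun_pd[OF that]]]) (use op in simp)
  have iR: "integrable (surface_measure ?\<Sigma>) (%x. N j x *\<^sub>R phi x)" if t: "test_fun UNIV phi" for phi
  proof -
   have "test_fun UNIV (%x. phi x * complex_of_real (N j x))" by (rule test_fun_mult[OF N_test test_fun_smooth[OF t]])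
   then obtain B where B: "!!x. cmod (phi x * complex_of_real (N j x)) \<le> B" using test_fun_bounded by blast
   have "(%x. N j x *\<^sub>R phi x) \<in> borel_measurable borel"
    using Nm smooth_fun_measurable[OF test_fun_smooth[OF t]] by simp
   then have "(%x. N j x *\<^sub>R phi x) \<in> borel_measurable (surface_measure ?\<Sigma>)"
    unfolding surface_measure_def by (intro measurable_restrict_space1) (simp cong: measurable_cong_sets)
   then show ?thesis
    by (rule F.integrable_const_bound[of _ B, rotated]) (use B in \<open>auto simp: norm_mult mult.commute\<close>)
  qed
  have "(LBINT x. indicator \<Omega> x *\<^sub>R pd j phi x) = (\<Sum>p\<in>P. \<integral>x. indicator \<Omega> x *\<^sub>R pd j (%x. complex_of_real (\<theta> p x) * phi x) x \<partial>lborel) + (LBINT x. indicator \<Omega> x *\<^sub>R pd j psi x)"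
   unfolding L using iL[OF phip'] iL[OF tpsi] by (subst lint_add) (auto simp: Bochner_Integration.integral_sum)
  also have "(LBINT x. indicator \<Omega> x *\<^sub>R pd j psi x) = 0"
   by (rule integral_pd_interior[OF tpsi op oU SU psiU])
  also have "(\<Sum>p\<in>P. \<integral>x. indicator \<Omega> x *\<^sub>R pd j (%x. complex_of_real (\<theta> p x) * phi x) x \<partial>lborel) = (\<Sum>p\<in>P. \<integral>x. N j x *\<^sub>R (complex_of_real (\<theta> p x) * phi x) \<partial>surface_measure ?\<Sigma>)"
  proof (rule sum.cong[OF refl])
   fix p assume p: "p \<in> P"
   then have c: "graph_chart \<Omega> (W p) (f1 p) (f2 p) (h p)" using ch(1) P(1) by blast
   show "(LBINT x. indicator \<Omega> x *\<^sub>R pd j (%x. complex_of_real (\<theta> p x) * phi x) x) = (\<integral>x. N j x *\<^sub>R (complex_of_real (\<theta> p x) * phi x) \<partial>surface_measure ?\<Sigma>)"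
   proof (rule graph_chart.chart_green_surface[OF c phip[OF p] Sb Nm])
    show "N j x = graph_chart.chart_normal (f1 p) (f2 p) (h p) x $ j" if "x \<in> ?\<Sigma>" "x \<in> W p" for x
     using nor[OF p that] N_normal[OF that(1)] by (simp add: nor_def)
   qed
  qed
  also have "... = (\<integral>x. (\<Sum>p\<in>P. N j x *\<^sub>R (complex_of_real (\<theta> p x) * phi x)) \<partial>surface_measure ?\<Sigma>)"
   by (rule Bochner_Integration.integral_sum[symmetric]) (rule iR[OF phip'])
  also have "... = (\<integral>x. N j x *\<^sub>R phi x \<partial>surface_measure ?\<Sigma>)"
  proof (rule lint_cong[OF refl])
   fix x assume "x \<in> space (surface_measure ?\<Sigma>)"
   then have "x \<in> U" using SU by (auto simp: surface_measure_def space_restrict_space)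
   then have "(\<Sum>p\<in>P. complex_of_real (\<theta> p x) * phi x) = phi x" using dec[of x] psiU[of x] by simp
   then show "(\<Sum>p\<in>P. N j x *\<^sub>R (complex_of_real (\<theta> p x) * phi x)) = N j x *\<^sub>R phi x"
    by (simp only: scaleR_sum_right[symmetric])
  qed
  finally show ?thesis by simp
 qed
 have "green_domain \<Omega> N"
  by (rule green_domain.intro[OF op bdd null front fm N_test N_normal N_unit green])
 then show ?thesis by blast
qed

section \<open>Sobolev functions and traces\<close>

lemma scaleC_scaleR_commute: "a *\<^sub>C (r *\<^sub>R x) = r *\<^sub>R (a *\<^sub>C x)" for x :: "'a::complex_normed_space"
 by (simp add: scaleC_of_real[symmetric] scaleC_scaleC mult.commute)

lemma bounded_linear_scaleC: "bounded_linear (%x :: 'a::complex_normed_space. a *\<^sub>C x)"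
 by (rule bounded_linear_intro[where K = "cmod a"])
  (simp_all add: scaleC_add_right scaleC_scaleR_commute norm_scaleC mult.commute)

lemmas continuous_on_scaleC [continuous_intros] = bounded_linear.continuous_on[OF bounded_linear_scaleC]
lemmas tendsto_scaleC [tendsto_intros] = bounded_linear.tendsto[OF bounded_linear_scaleC]

lemma scaleC_diff_right: "a *\<^sub>C (x - y) = a *\<^sub>C x - a *\<^sub>C y" for x y :: "'a::complex_normed_space"
 using linear_diff[OF bounded_linear.linear[OF bounded_linear_scaleC]] .

lemma scaleC_minus_right: "a *\<^sub>C (- x) = - (a *\<^sub>C x)" for x :: "'a::complex_normed_space"
 using linear_neg[OF bounded_linear.linear[OF bounded_linear_scaleC]] .

lemma scaleC_zero_right [simp]: "a *\<^sub>C 0 = (0 :: 'a::complex_normed_space)"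
 using linear_0[OF bounded_linear.linear[OF bounded_linear_scaleC]] .

lemma scaleC_minus_left: "(- a) *\<^sub>C x = - (a *\<^sub>C x)" for x :: "'a::complex_normed_space"
 using scaleC_scaleC[of "-1" a x] by (simp add: scaleC_minus_one)

lemma scaleC_zero_left [simp]: "0 *\<^sub>C x = (0 :: 'a::complex_normed_space)"
 using scaleC_of_real[of 0 x] by simp

lemma inner_scaleC_right_L2: "F \<bullet> (a *\<^sub>C G) = (cnj a *\<^sub>C F) \<bullet> G" for F G :: L2
 by (simp add: inner_scaleC_left_L2)

lemma scaleC_fst_snd [simp]: "fst (a *\<^sub>C p) = a *\<^sub>C fst p" "snd (a *\<^sub>C p) = a *\<^sub>C snd p"
 by (simp_all add: scaleC_prod_def)

lemma bounded_linear_DZ: "bounded_linear DZ" and bounded_linear_DB: "bounded_linear DB"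
 unfolding DZ_def[abs_def] DB_def[abs_def]
 by (intro bl_comp[OF bounded_linear_scaleC] bounded_linear_sub bounded_linear_add
   bl_comp[OF bounded_linear_fst] bl_comp[OF bounded_linear_snd] bounded_linear_snd)+

lemmas continuous_on_DZ [continuous_intros] = bounded_linear.continuous_on[OF bounded_linear_DZ]
lemmas continuous_on_DB [continuous_intros] = bounded_linear.continuous_on[OF bounded_linear_DB]

lemma DZ_diff: "DZ (u - v) = DZ u - DZ v" and DZ_add: "DZ (u + v) = DZ u + DZ v"
 using bounded_linear_DZ by (simp_all add: bounded_linear.linear linear_diff linear_add)

lemma DB_diff: "DB (u - v) = DB u - DB v"
 using bounded_linear_DB by (simp add: bounded_linear.linear linear_diff)

lemma DZ_scaleC: "DZ (a *\<^sub>C u) = a *\<^sub>C DZ u" and DB_scaleC: "DB (a *\<^sub>C u) = a *\<^sub>C DB u"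
 by (simp_all add: DZ_def DB_def scaleC_scaleC scaleC_diff_right scaleC_add_right mult.commute mult.left_commute)

text \<open>\<open>H\<^sup>1(\<real>\<^sup>2)\<close> as a closed subspace of the space of triples \<open>(u, \<partial>\<^sub>1u, \<partial>\<^sub>2u)\<close>.\<close>

definition H1_plane :: "(L2 \<times> L2 \<times> L2) set" where
 "H1_plane = closure (jet ` {phi. test_fun UNIV phi})"

lemma closed_H1_plane: "closed H1_plane"
 by (simp add: H1_plane_def)

lemma jet_in_H1_plane: "test_fun UNIV phi ==> jet phi \<in> H1_plane"
 unfolding H1_plane_def by (rule subsetD[OF closure_subset]) blast

lemma subspace_H1_plane: "subspace H1_plane"
 unfolding H1_plane_def
proof (intro subspace_closure subspaceI)
 have "jet (%x. 0) = 0 *\<^sub>C jet (%x. 0)" using jet_scaleC[of "%x. 0" 0] by simp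
 then have "jet (%x. 0) = 0" by simp
 then show "0 \<in> jet ` {phi. test_fun UNIV phi}" by (intro image_eqI[of _ _ "%x. 0"]) auto
next
 fix x y assume "x \<in> jet ` {phi. test_fun UNIV phi}" "y \<in> jet ` {phi. test_fun UNIV phi}"
 then show "x + y \<in> jet ` {phi. test_fun UNIV phi}" by (auto simp: jet_add intro: test_fun_add)
next
 fix x and c :: real assume "x \<in> jet ` {phi. test_fun UNIV phi}"
 then obtain phi where phi: "test_fun UNIV phi" "x = jet phi" by blast
 then have "c *\<^sub>R x = jet (%x. of_real c * phi x)" by (simp add: jet_scaleC[symmetric] scaleC_of_real)
 then show "c *\<^sub>R x \<in> jet ` {phi. test_fun UNIV phi}" using test_fun_cmult[OF phi(1), of "of_real c"] by blast
qed

lemma H1_plane_sequence: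
 assumes "u \<in> H1_plane"
 obtains phi where "!!n. test_fun UNIV (phi n)" "(%n. jet (phi n)) \<longlonglongrightarrow> u"
proof -
 obtain X where X: "\<forall>n. X n \<in> jet ` {phi. test_fun UNIV phi}" "X \<longlonglongrightarrow> u"
  using assms unfolding H1_plane_def closure_sequential by blast
 then have "\<forall>n. \<exists>phi. test_fun UNIV phi \<and> X n = jet phi" by blast
 then obtain phi where phi: "\<forall>n. test_fun UNIV (phi n) \<and> X n = jet (phi n)" by metis
 then have "X = (%n. jet (phi n))" by auto
 with X(2) have "(%n. jet (phi n)) \<longlonglongrightarrow> u" by simp
 with phi that show ?thesis by blast
qed

lemma H1_plane_induct:
 assumes "u \<in> H1_plane" "closed {u. P u}" "!!phi. test_fun UNIV phi ==> P (jet phi)"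
 shows "P u"
proof -
 have "H1_plane \<subseteq> {u. P u}" unfolding H1_plane_def by (rule closure_minimal) (use assms in auto)
 with assms(1) show ?thesis by blast
qed

lemma H1_plane_scaleC: assumes "u \<in> H1_plane" shows "a *\<^sub>C u \<in> H1_plane"
 using assms
proof (rule H1_plane_induct)
 have "{u. a *\<^sub>C u \<in> H1_plane} = (%u. a *\<^sub>C u) -` H1_plane" by auto
 also have "closed ..." by (intro continuous_closed_vimage closed_H1_plane linear_continuous_at bounded_linear_scaleC)
 finally show "closed {u. a *\<^sub>C u \<in> H1_plane}" .
 show "a *\<^sub>C jet phi \<in> H1_plane" if "test_fun UNIV phi" for phi
  using that by (simp add: jet_scaleC jet_in_H1_plane test_fun_cmult)
qed

lemma norm_triple: "(norm u)\<^sup>2 = (norm (fst u))\<^sup>2 + ((norm (fst (snd u)))\<^sup>2 + (norm (snd (snd u)))\<^sup>2)"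
 by (cases u) (simp add: norm_prod_def)

lemma inner_triple: "u \<bullet> v = fst u \<bullet> fst v + (fst (snd u) \<bullet> fst (snd v) + snd (snd u) \<bullet> snd (snd v))"
 by (cases u; cases v) (simp add: inner_prod_def)

lemma norm_H1_plane:
 assumes "u \<in> H1_plane"
 shows "4 * (norm (DZ u))\<^sup>2 = (norm (fst (snd u)))\<^sup>2 + (norm (snd (snd u)))\<^sup>2"
 using assms by (rule H1_plane_induct) (auto intro!: closed_Collect_eq continuous_intros norm_DZ_jet)

lemma H1_plane_weak_pd:
 assumes "u \<in> H1_plane" and t: "test_fun UNIV phi"
 shows "fst u \<bullet> abs_L2 (pd 1 phi) = - (fst (snd u) \<bullet> abs_L2 phi)" "fst u \<bullet> abs_L2 (pd 2 phi) = - (snd (snd u) \<bullet> abs_L2 phi)"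
 using assms(1) by (rule H1_plane_induct; auto intro!: closed_Collect_eq continuous_intros simp: jet_def inner_pd_L2[OF _ t])+

text \<open>\<open>dbar_graph_closure\<close> gives convergence of the functions and of one
  Wirtinger derivative. Since that derivative controls the gradient, the approximating jets are
  Cauchy, and their limit is the wanted triple.\<close>

lemma H1_plane_of_dbar:
 assumes weak: "!!phi. test_fun UNIV phi ==> F \<bullet> DZ (jet phi) = - (K \<bullet> abs_L2 phi)"
 shows "\<exists>u\<in>H1_plane. fst u = F \<and> DB u = K"
proof -
 have "(F, K) \<in> closure {(abs_L2 phi, abs_L2 (dbar phi)) | phi. test_fun UNIV phi}"
  by (rule dbar_graph_closure) (use weak DZ_jet in simp)
 then obtain X where X: "\<forall>n. X n \<in> {(abs_L2 phi, abs_L2 (dbar phi)) | phi. test_fun UNIV phi}" "X \<longlonglongrightarrow> (F, K)"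
  unfolding closure_sequential by blast
 then have "\<forall>n. \<exists>phi. test_fun UNIV phi \<and> X n = (abs_L2 phi, abs_L2 (dbar phi))" by blast
 then obtain phi where phi: "!!n. test_fun UNIV (phi n)" "!!n. X n = (abs_L2 (phi n), abs_L2 (dbar (phi n)))" by metis
 have bound: "norm (jet (phi m) - jet (phi n)) \<le> 2 * norm (X m - X n)" for m n
 proof -
  have t: "test_fun UNIV (%x. phi m x - phi n x)" by (rule test_fun_diff[OF phi(1) phi(1)])
  define w where "w = jet (%x. phi m x - phi n x)"
  have w: "w = jet (phi m) - jet (phi n)" by (simp add: w_def jet_diff phi)
  have X: "X m - X n = (fst w, DB w)"
   unfolding w by (simp add: phi(2) DB_diff DB_jet phi(1)) (simp add: jet_def)
  have "(norm w)\<^sup>2 = (norm (fst w))\<^sup>2 + 4 * (norm (DB w))\<^sup>2"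
   unfolding norm_triple norm_DZ_jet(2)[OF t, folded w_def] ..
  also have "... \<le> (2 * norm (X m - X n))\<^sup>2"
   unfolding X by (simp add: norm_prod_def power_mult_distrib)
  finally show ?thesis unfolding w[symmetric] by (rule power2_le_imp_le) simp
 qed
 have "Cauchy (%n. jet (phi n))"
 proof (rule metric_CauchyI)
  fix e :: real assume "e > 0"
  then obtain N where "\<forall>m\<ge>N. \<forall>n\<ge>N. dist (X m) (X n) < e / 2"
   using LIMSEQ_imp_Cauchy[OF X(2)] unfolding Cauchy_def by (meson half_gt_zero)
  then have "dist (jet (phi m)) (jet (phi n)) < e" if "m \<ge> N" "n \<ge> N" for m n
   using bound[of m n] that unfolding dist_norm by (smt (verit) field_sum_of_halves)
  then show "\<exists>N. \<forall>m\<ge>N. \<forall>n\<ge>N. dist (jet (phi m)) (jet (phi n)) < e" by blast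
 qed
 then obtain u where u: "(%n. jet (phi n)) \<longlonglongrightarrow> u" using Cauchy_convergent_iff convergent_def by blast
 have "u \<in> H1_plane" by (rule closed_sequentially[OF closed_H1_plane jet_in_H1_plane[OF phi(1)] u])
 moreover have "(%n. (fst (jet (phi n)), DB (jet (phi n)))) \<longlonglongrightarrow> (fst u, DB u)"
  by (intro tendsto_intros u bounded_linear.tendsto[OF bounded_linear_DB])
 then have "X \<longlonglongrightarrow> (fst u, DB u)"
  by (simp add: DB_jet phi) (simp add: jet_def flip: phi(2))
 then have "(fst u, DB u) = (F, K)" using X(2) LIMSEQ_unique by blast
 ultimately show ?thesis by auto
qed

section \<open>Multiplication operators on \<open>L2\<close>\<close>

definition bounded_multiplier :: "(real^2 => complex) => bool" where
 "bounded_multiplier m \<longleftrightarrow> m \<in> borel_measurable borel \<and> (\<exists>B. \<forall>x. cmod (m x) \<le> B)"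

definition mul :: "(real^2 => complex) => L2 => L2" where
 "mul m F = abs_L2 (%x. m x * rep_L2 F x)"

lemma square_integrable_multiplier:
 assumes m: "m \<in> borel_measurable borel" "!!x. cmod (m x) \<le> B" and f: "square_integrable lborel f"
 shows "square_integrable lborel (%x. m x * f x)"
  "(LBINT x. (cmod (m x * f x))\<^sup>2) \<le> B\<^sup>2 * (LBINT x. (cmod (f x))\<^sup>2)"
proof -
 have fm [measurable]: "f \<in> borel_measurable borel" and fi: "integrable lborel (%x. (cmod (f x))\<^sup>2)"
  using f by (auto simp: square_integrable_def)
 have b: "(cmod (m x * f x))\<^sup>2 \<le> B\<^sup>2 * (cmod (f x))\<^sup>2" for x
  unfolding norm_mult power_mult_distrib by (intro mult_right_mono power_mono m) auto
 have mm [measurable]: "(%x. m x * f x) \<in> borel_measurable borel" using m(1) fm by simp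
 have i: "integrable lborel (%x. (cmod (m x * f x))\<^sup>2)"
  by (rule Bochner_Integration.integrable_bound[OF integrable_mult_right[OF fi, of "B\<^sup>2"]]) (use b in auto)
 then show "square_integrable lborel (%x. m x * f x)" by (simp add: square_integrable_def mm)
 have "(LBINT x. (cmod (m x * f x))\<^sup>2) \<le> (LBINT x. B\<^sup>2 * (cmod (f x))\<^sup>2)"
  by (rule integral_mono[OF i integrable_mult_right[OF fi]]) (rule b)
 then show "(LBINT x. (cmod (m x * f x))\<^sup>2) \<le> B\<^sup>2 * (LBINT x. (cmod (f x))\<^sup>2)" by simp
qed

lemma mul_sq:
 "bounded_multiplier m ==> square_integrable lborel f ==> square_integrable lborel (%x. m x * f x)"
 unfolding bounded_multiplier_def using square_integrable_multiplier(1) by blast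

lemma mul_abs:
 assumes "bounded_multiplier m" "square_integrable lborel f"
 shows "mul m (abs_L2 f) = abs_L2 (%x. m x * f x)"
 unfolding mul_def
proof (subst abs_L2_eq_iff)
 show "AE x in lborel. m x * rep_L2 (abs_L2 f) x = m x * f x"
  using rep_abs_L2[OF assms(2)] by eventually_elim simp
qed (use mul_sq assms in auto)

lemma mul_bounded:
 assumes "bounded_multiplier m" shows "\<exists>B\<ge>0. \<forall>F. norm (mul m F) \<le> B * norm F"
proof -
 obtain B where B: "!!x. cmod (m x) \<le> B" and m: "m \<in> borel_measurable borel"
  using assms by (auto simp: bounded_multiplier_def)
 have B0: "B \<ge> 0" using B[of 0] norm_ge_zero order_trans by blast
 have "norm (mul m F) \<le> B * norm F" for F
 proof -
  have "(norm (mul m F))\<^sup>2 = (LBINT x. (cmod (m x * rep_L2 F x))\<^sup>2)"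
   unfolding mul_def using norm_L2_abs[OF mul_sq[OF assms square_integrable_rep]] by simp
  also have "... \<le> (B * norm F)\<^sup>2"
   unfolding power_mult_distrib norm_L2_rep by (rule square_integrable_multiplier(2)[OF m B square_integrable_rep])
  finally show ?thesis by (rule power2_le_imp_le) (simp add: B0)
 qed
 with B0 show ?thesis by blast
qed

lemma mul_add: assumes m: "bounded_multiplier m" shows "mul m (F + G) = mul m F + mul m G"
proof -
 have s: "square_integrable lborel (rep_L2 F)" "square_integrable lborel (rep_L2 G)" by simp_all
 have "mul m (F + G) = mul m (abs_L2 (%x. rep_L2 F x + rep_L2 G x))"
  using abs_L2_add[OF s] by simp
 also have "... = abs_L2 (%x. m x * rep_L2 F x + m x * rep_L2 G x)"
  unfolding mul_abs[OF m square_integrable_add[OF s]] distrib_left ..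
 finally show ?thesis
  unfolding mul_def[of m F] mul_def[of m G] abs_L2_add[OF s[THEN mul_sq[OF m]]] .
qed

lemma mul_scaleC: assumes m: "bounded_multiplier m" shows "mul m (a *\<^sub>C F) = a *\<^sub>C mul m F"
proof -
 have s: "square_integrable lborel (rep_L2 F)" by simp
 have "mul m (a *\<^sub>C F) = mul m (abs_L2 (%x. a * rep_L2 F x))"
  using abs_L2_scaleC[OF s] by simp
 also have "... = abs_L2 (%x. a * (m x * rep_L2 F x))"
  unfolding mul_abs[OF m square_integrable_mult[OF s]] mult.left_commute[of a] ..
 finally show ?thesis
  unfolding mul_def[of m F] abs_L2_scaleC[OF s[THEN mul_sq[OF m]]] .
qed

lemma bounded_linear_mul: assumes "bounded_multiplier m" shows "bounded_linear (mul m)"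
proof -
 obtain B where B: "!!F. norm (mul m F) \<le> B * norm F" using mul_bounded[OF assms] by blast
 show ?thesis
 proof (rule bounded_linear_intro[where K = B])
  show "mul m (r *\<^sub>R F) = r *\<^sub>R mul m F" for r F
   unfolding scaleC_of_real[symmetric] by (rule mul_scaleC[OF assms])
 qed (use B in \<open>simp_all add: mul_add[OF assms] mult.commute\<close>)
qed

lemma mul_mul:
 assumes "bounded_multiplier m" "bounded_multiplier n"
 shows "bounded_multiplier (%x. m x * n x)" "mul m (mul n F) = mul (%x. m x * n x) F"
proof -
 obtain A B where AB: "!!x. cmod (m x) \<le> A" "!!x. cmod (n x) \<le> B"
  using assms by (auto simp: bounded_multiplier_def)
 have "cmod (m x * n x) \<le> A * B" for x
  unfolding norm_mult using AB norm_ge_zero order_trans by (intro mult_mono) blast+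
 then show 1: "bounded_multiplier (%x. m x * n x)"
  using assms by (auto simp: bounded_multiplier_def)
 show "mul m (mul n F) = mul (%x. m x * n x) F"
  unfolding mul_def[of n] mul_abs[OF assms(1) mul_sq[OF assms(2) square_integrable_rep]]
  unfolding mul_def mult.assoc ..
qed

lemma bounded_multiplier_cnj: "bounded_multiplier m ==> bounded_multiplier (%x. cnj (m x))"
 using borel_measurable_continuous_onI[OF continuous_on_cnj[OF continuous_on_id]]
 by (auto simp: bounded_multiplier_def intro: measurable_compose)

lemma inner_mul:
 assumes m: "bounded_multiplier m" shows "mul m F \<bullet> G = F \<bullet> mul (%x. cnj (m x)) G"
proof -
 have s: "square_integrable lborel (rep_L2 F)" "square_integrable lborel (rep_L2 G)" by simp_all
 have e: "(a * x) \<bullet> y = x \<bullet> (cnj a * y)" for a x y :: complex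
  by (simp add: inner_complex_def algebra_simps)
 have "mul m F \<bullet> G = mul m F \<bullet> abs_L2 (rep_L2 G)" by simp
 also have "... = abs_L2 (rep_L2 F) \<bullet> mul (%x. cnj (m x)) G"
  unfolding mul_def inner_abs_L2[OF mul_sq[OF m s(1)] s(2)] e
   inner_abs_L2[OF s(1) mul_sq[OF bounded_multiplier_cnj[OF m] s(2)]] ..
 finally show ?thesis by simp
qed

lemma bm_test_fun: "test_fun UNIV m ==> bounded_multiplier m"
 using test_fun_bounded[of UNIV m] smooth_fun_measurable[OF test_fun_smooth] by (auto simp: bounded_multiplier_def)

lemma bm_indicator: "D \<in> sets borel ==> bounded_multiplier (indicator D)"
 by (auto simp: bounded_multiplier_def indicator_def intro!: exI[of _ 1])

text \<open>Restriction to \<open>D\<close>, extended by zero: functions on \<Omega>, on the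
  exterior and on the plane then share one Hilbert space. The result is in general not in
  \<open>H1_plane\<close>, as its first entry may jump across the boundary.\<close>

definition cut :: "(real^2) set => L2 \<times> L2 \<times> L2 => L2 \<times> L2 \<times> L2" where
 "cut D u = (mul (indicator D) (fst u), mul (indicator D) (fst (snd u)), mul (indicator D) (snd (snd u)))"

lemma bounded_linear_cut:
 assumes "D \<in> sets borel" shows "bounded_linear (cut D)"
 unfolding cut_def[abs_def]
 by (intro bounded_linear_Pair bl_comp[OF bounded_linear_mul[OF bm_indicator[OF assms]]]
   bounded_linear_fst bl_comp[OF bounded_linear_fst] bl_comp[OF bounded_linear_snd]
   bounded_linear_snd)

lemma mul_diff: "bounded_multiplier m ==> mul m (F - G) = mul m F - mul m G"
 using linear_diff[OF bounded_linear.linear[OF bounded_linear_mul]] .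

lemma DB_cut: assumes "D \<in> sets borel" shows "DB (cut D u) = mul (indicator D) (DB u)"
 unfolding DB_def cut_def mul_scaleC[OF bm_indicator[OF assms]]
  mul_add[OF bm_indicator[OF assms]] by simp

lemma DZ_cut: assumes "D \<in> sets borel" shows "DZ (cut D u) = mul (indicator D) (DZ u)"
 unfolding DZ_def cut_def mul_scaleC[OF bm_indicator[OF assms]]
  mul_diff[OF bm_indicator[OF assms]] by simp

lemma mul_UNIV: "mul (indicator UNIV) F = F"
 by (simp add: mul_def)

lemma cut_UNIV: "cut UNIV u = u"
 unfolding cut_def mul_UNIV by simp

lemma mul_indicator_Int:
 assumes "D \<in> sets borel" "E \<in> sets borel"
 shows "mul (indicator D) (mul (indicator E) F) = mul (indicator (D \<inter> E)) F"
proof -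
 have e: "(%x. indicator D x * indicator E x) = (indicator (D \<inter> E) :: real^2 => complex)"
  by (auto simp: fun_eq_iff indicator_def)
 show ?thesis using mul_mul(2)[OF assms[THEN bm_indicator], of F] unfolding e .
qed

lemma inner_mul_indicator:
 assumes "D \<in> sets borel" shows "mul (indicator D) F \<bullet> G = F \<bullet> mul (indicator D) G"
proof -
 have e: "(%x. cnj (indicator D x)) = (indicator D :: real^2 => complex)"
  by (auto simp: fun_eq_iff indicator_def)
 show ?thesis using inner_mul[OF bm_indicator[OF assms], of F G] unfolding e .
qed

lemma test_fun_outside: "test_fun D phi ==> x \<notin> D ==> phi x = 0"
 by (rule test_funE) auto

lemma mul_indicator_test:
 assumes "D \<in> sets borel" "test_fun D phi" shows "mul (indicator D) (abs_L2 phi) = abs_L2 phi"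
proof -
 have "(%x. indicator D x * phi x) = phi"
  using test_fun_outside[OF assms(2)] by (auto simp: fun_eq_iff indicator_def)
 then show ?thesis
  using mul_abs[OF bm_indicator[OF assms(1)] test_fun_sq[OF assms(2)]] by simp
qed

lemma L2_eq_on_open:
 assumes D: "open D" and eq: "!!phi. test_fun D phi ==> F \<bullet> abs_L2 phi = G \<bullet> abs_L2 phi"
 shows "mul (indicator D) F = mul (indicator D) G"
proof -
 have b: "bounded_multiplier (indicator D)" by (rule bm_indicator) (use D in simp)
 have "AE x in lborel. x \<in> D --> rep_L2 (F - G) x = 0"
  by (rule fundamental_lemma_L2[OF D]) (simp add: inner_diff_left eq)
 then have ae: "AE x in lborel. indicator D x * rep_L2 (F - G) x = 0"
  by eventually_elim (auto simp: indicator_def)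
 have "mul (indicator D) (F - G) = abs_L2 (%x. 0)"
  unfolding mul_def
  using abs_L2_eq_iff[OF mul_sq[OF b square_integrable_rep] square_integrable_zero] ae by blast
 then show ?thesis by (simp add: mul_diff[OF b] abs_L2_zero)
qed

section \<open>Restriction to a domain and weak derivatives\<close>

definition res :: "(real^2) set => (real^2 => complex) => L2" where
 "res D f = abs_L2 (%x. indicator D x * f x)"

lemma L2_on_iff:
 assumes "D \<in> sets borel" shows "L2_on D f \<longleftrightarrow> square_integrable lborel (%x. indicator D x * f x)"
proof -
 have e: "(%x. indicator D x *\<^sub>R f x) = (%x. indicator D x * f x)"
  "(%x. indicator D x *\<^sub>R (cmod (f x))\<^sup>2) = (%x. (cmod (indicator D x * f x))\<^sup>2)"
  by (auto simp: fun_eq_iff indicator_def)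
 have D: "D \<inter> space lborel \<in> sets lborel" using assms by simp
 show ?thesis
  unfolding L2_on_def square_integrable_def borel_measurable_restrict_space_iff[OF D] integrable_restrict_space[OF D] e
  by simp
qed

lemma L2_on_rep: "D \<in> sets borel ==> L2_on D (rep_L2 F)"
 by (simp add: L2_on_iff mul_sq bm_indicator)

lemma res_rep: "res D (rep_L2 F) = mul (indicator D) F"
 by (simp add: res_def mul_def)

lemma mul_res: assumes "D \<in> sets borel" "L2_on D f" shows "mul (indicator D) (res D f) = res D f"
proof -
 have "(%x. indicator D x * (indicator D x * f x)) = (%x. indicator D x * f x)"
  by (auto simp: fun_eq_iff indicator_def)
 then show ?thesis
  using mul_abs[OF bm_indicator[OF assms(1)]] assms by (simp add: res_def L2_on_iff)
qed

lemma res_eq_iff: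
 assumes "D \<in> sets borel" "L2_on D f" "L2_on D g"
 shows "res D f = res D g \<longleftrightarrow> (AE x in lborel. x \<in> D --> f x = g x)"
proof -
 have "(indicator D x * f x = indicator D x * g x) = (x \<in> D --> f x = g x)" for x by (auto simp: indicator_def)
 then show ?thesis
  unfolding res_def using abs_L2_eq_iff[of "%x. indicator D x * f x" "%x. indicator D x * g x"] assms
  by (simp add: L2_on_iff)
qed

lemma L2_on_add: "D \<in> sets borel ==> L2_on D f ==> L2_on D g ==> L2_on D (%x. f x + g x)"
 and L2_on_diff: "D \<in> sets borel ==> L2_on D f ==> L2_on D g ==> L2_on D (%x. f x - g x)"
 and L2_on_cmult: "L2_on D f ==> L2_on D (%x. a * f x)"
 by (simp_all add: L2_on_def square_integrable_add square_integrable_diff square_integrable_mult)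

lemma res_add: assumes "D \<in> sets borel" "L2_on D f" "L2_on D g" shows "res D (%x. f x + g x) = res D f + res D g"
 using abs_L2_add[of "%x. indicator D x * f x" "%x. indicator D x * g x"] assms
 by (simp add: res_def L2_on_iff distrib_left)

lemma res_diff: assumes "D \<in> sets borel" "L2_on D f" "L2_on D g" shows "res D (%x. f x - g x) = res D f - res D g"
 using abs_L2_diff[of "%x. indicator D x * f x" "%x. indicator D x * g x"] assms
 by (simp add: res_def L2_on_iff right_diff_distrib)

lemma res_cmult: assumes "D \<in> sets borel" "L2_on D f" shows "res D (%x. a * f x) = a *\<^sub>C res D f"
 using abs_L2_scaleC[of "%x. indicator D x * f x" a] assms
 by (simp add: res_def L2_on_iff mult.left_commute)

lemma L2_on_test: "D \<in> sets borel ==> test_fun UNIV phi ==> L2_on D phi"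
 by (simp add: L2_on_iff mul_sq bm_indicator test_fun_sq)

lemma res_test: "D \<in> sets borel ==> test_fun UNIV phi ==> res D phi = mul (indicator D) (abs_L2 phi)"
 by (simp add: res_def mul_abs bm_indicator test_fun_sq)

lemma set_integral_test:
 assumes D: "D \<in> sets borel" and f: "L2_on D f" and phi: "test_fun D phi"
 shows "Re (LINT x:D|lborel. f x * phi x) = res D f \<bullet> abs_L2 (%x. cnj (phi x))"
  "Im (LINT x:D|lborel. f x * phi x) = - (res D f \<bullet> abs_L2 (%x. cnj (\<i> * phi x)))"
proof -
 let ?F = "%x. indicator D x * f x"
 have F: "square_integrable lborel ?F" using D f by (simp add: L2_on_iff)
 have t: "square_integrable lborel (%x. cnj (phi x))" "square_integrable lborel (%x. cnj (\<i> * phi x))"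
  by (rule test_fun_sq[OF test_fun_cnj[OF phi]],
   rule test_fun_sq[OF test_fun_cnj[OF test_fun_cmult[OF phi]]])
 have m: "?F \<in> borel_measurable lborel" "phi \<in> borel_measurable lborel"
  using F test_fun_sq[OF phi] by (auto simp: square_integrable_def)
 have i: "integrable lborel (%x. ?F x * phi x)"
 proof (rule Bochner_Integration.integrable_bound)
  show "integrable lborel (%x. (cmod (?F x))\<^sup>2 + (cmod (phi x))\<^sup>2)"
   using F test_fun_sq[OF phi] by (intro Bochner_Integration.integrable_add) (auto simp: square_integrable_def)
  have "cmod (a * b) \<le> norm ((cmod a)\<^sup>2 + (cmod b)\<^sup>2)" for a b
  proof -
   have "cmod (a * b) \<le> 2 * cmod a * cmod b" by (simp add: norm_mult)
   also have "... \<le> (cmod a)\<^sup>2 + (cmod b)\<^sup>2" by (rule sum_squares_bound)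
   finally show ?thesis by simp
  qed
  then show "AE x in lborel. norm (?F x * phi x) \<le> norm ((cmod (?F x))\<^sup>2 + (cmod (phi x))\<^sup>2)"
   by (intro AE_I2)
 qed (use m in measurable)
 have e: "(LINT x:D|lborel. f x * phi x) = (LBINT x. ?F x * phi x)"
  unfolding set_lebesgue_integral_def by (rule lint_cong) (auto simp: indicator_def)
 show "Re (LINT x:D|lborel. f x * phi x) = res D f \<bullet> abs_L2 (%x. cnj (phi x))"
  unfolding e res_def inner_abs_L2[OF F t(1)] integral_Re[OF i, symmetric]
  by (rule lint_cong) (simp_all add: inner_complex_def)
 have "Im (LBINT x. ?F x * phi x) = (LBINT x. - (?F x \<bullet> cnj (\<i> * phi x)))"
  unfolding integral_Im[OF i, symmetric]
  by (rule lint_cong) (simp_all add: inner_complex_def)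
 then show "Im (LINT x:D|lborel. f x * phi x) = - (res D f \<bullet> abs_L2 (%x. cnj (\<i> * phi x)))"
  unfolding e res_def inner_abs_L2[OF F t(2)] by simp
qed

text \<open>The definitions test with complex bilinear integrals, \<open>L2\<close> with a real
  inner product. Passing to \<open>cnj (phi x)\<close> matches the real parts, and a further factor
  \<open>\<i>\<close> the imaginary parts; this is why \<open>A\<close> has to commute with
  both.\<close>

lemma weak_equation_iff:
 assumes D: "D \<in> sets borel" and f: "L2_on D f" and g: "L2_on D g"
  and A: "!!phi. test_fun D phi ==> test_fun D (A phi)"
   "!!phi. test_fun D phi ==> A (%x. cnj (phi x)) = (%x. cnj (A phi x))"
   "!!phi. test_fun D phi ==> A (%x. \<i> * phi x) = (%x. \<i> * A phi x)"
 shows "(\<forall>phi. test_fun D phi --> (LINT x:D|lborel. f x * A phi x) = (LINT x:D|lborel. g x * phi x)) \<longleftrightarrow>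
  (\<forall>phi. test_fun D phi --> res D f \<bullet> abs_L2 (A phi) = res D g \<bullet> abs_L2 phi)" (is "?L \<longleftrightarrow> ?R")
proof
 assume L: ?L
 show ?R
 proof (intro allI impI)
  fix phi assume phi: "test_fun D phi"
  note c = test_fun_cnj[OF phi]
  have "(LINT x:D|lborel. f x * A (%x. cnj (phi x)) x) = (LINT x:D|lborel. g x * cnj (phi x))"
   by (rule L[rule_format, OF c])
  then show "res D f \<bullet> abs_L2 (A phi) = res D g \<bullet> abs_L2 phi"
   using set_integral_test(1)[OF D f A(1)[OF c]] set_integral_test(1)[OF D g c] by (simp add: A(2)[OF phi])
 qed
next
 assume R: ?R
 show ?L
 proof (intro allI impI complex_eqI)
  fix phi assume phi: "test_fun D phi"
  show "Re (LINT x:D|lborel. f x * A phi x) = Re (LINT x:D|lborel. g x * phi x)"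
   unfolding set_integral_test(1)[OF D f A(1)[OF phi]] set_integral_test(1)[OF D g phi] A(2)[OF phi, symmetric]
   by (rule R[rule_format, OF test_fun_cnj[OF phi]])
  note i = test_fun_cmult[OF phi, of \<i>]
  have e: "(%x. cnj (\<i> * A phi x)) = A (%x. cnj (\<i> * phi x))"
   unfolding A(2)[OF i] A(3)[OF phi] ..
  show "Im (LINT x:D|lborel. f x * A phi x) = Im (LINT x:D|lborel. g x * phi x)"
   unfolding set_integral_test(2)[OF D f A(1)[OF phi]] set_integral_test(2)[OF D g phi] e
    R[rule_format, OF test_fun_cnj[OF i]] ..
 qed
qed

lemma pd_fun_cnj: "smooth_fun phi ==> pd j (%x. cnj (phi x)) = (%x. cnj (pd j phi x))"
 by (rule ext) (simp add: pd_cnj smooth_fun_diffb)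

lemma pd_fun_cmult: "smooth_fun phi ==> pd j (%x. a * phi x) = (%x. a * pd j phi x)"
 by (rule ext) (simp add: pd_cmult smooth_fun_diffb)

lemma is_weak_pd_iff:
 assumes D: "D \<in> sets borel"
 shows "is_weak_pd D j f g \<longleftrightarrow> L2_on D f \<and> L2_on D g \<and>
  (\<forall>phi. test_fun D phi --> res D f \<bullet> abs_L2 (pd j phi) = - (res D g \<bullet> abs_L2 phi))"
proof (cases "L2_on D f \<and> L2_on D g")
 case True
 have n: "L2_on D (%x. (-1) * g x)" by (rule L2_on_cmult) (use True in simp)
 have r: "res D (%x. (-1) * g x) = - res D g" using res_cmult[OF D, of g "-1"] True by (simp add: scaleC_minus_one)
 have e: "(LINT x:D|lborel. (-1) * g x * phi x) = - (LINT x:D|lborel. g x * phi x)" for phi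
  by (simp add: set_lebesgue_integral_def)
 show ?thesis
  unfolding is_weak_pd_def
  using weak_equation_iff[OF D _ n, of f "pd j"] True
  by (simp only: e r inner_minus_left) (simp add: test_fun_pd pd_fun_cnj pd_fun_cmult test_fun_smooth)
qed (auto simp: is_weak_pd_def)

lemma is_weak_laplacian_iff:
 assumes D: "D \<in> sets borel"
 shows "is_weak_laplacian D f g \<longleftrightarrow> L2_on D f \<and> L2_on D g \<and>
  (\<forall>phi. test_fun D phi --> res D f \<bullet> (4 *\<^sub>C DZ (jet (dbar phi))) = res D g \<bullet> abs_L2 phi)"
proof (cases "L2_on D f \<and> L2_on D g")
 case True
 define A where "A phi x = pd 1 (pd 1 phi) x + pd 2 (pd 2 phi) x" for phi :: "real^2 => complex" and x
 have Af: "A phi = (%x. 4 * dz (dbar phi) x)" if t: "test_fun D phi" for phi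
  by (rule ext) (simp add: A_def dz_dbar[OF test_fun_smooth[OF t]])
 have "abs_L2 (A phi) = 4 *\<^sub>C DZ (jet (dbar phi))" if t: "test_fun D phi" for phi
 proof -
  have u: "test_fun UNIV (dbar phi)" using test_fun_dbar[OF t] test_fun_mono by blast
  then show ?thesis by (simp add: DZ_jet Af[OF t] abs_L2_scaleC test_fun_sq[OF test_fun_dz])
 qed
 moreover have "(\<forall>phi. test_fun D phi --> (LINT x:D|lborel. f x * A phi x) = (LINT x:D|lborel. g x * phi x)) \<longleftrightarrow>
  (\<forall>phi. test_fun D phi --> res D f \<bullet> abs_L2 (A phi) = res D g \<bullet> abs_L2 phi)"
 proof (rule weak_equation_iff[OF D])
  fix phi assume t: "test_fun D phi"
  show "test_fun D (A phi)" unfolding A_def[abs_def] by (intro test_fun_add test_fun_pd t)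
  have p: "smooth_fun phi" "smooth_fun (pd j phi)" for j using t test_fun_smooth test_fun_pd by blast+
  show "A (%x. cnj (phi x)) = (%x. cnj (A phi x))" "A (%x. \<i> * phi x) = (%x. \<i> * A phi x)"
   unfolding A_def[abs_def] pd_fun_cnj[OF p(1)] pd_fun_cmult[OF p(1)] pd_fun_cnj[OF p(2)] pd_fun_cmult[OF p(2)]
   by (simp_all add: distrib_left)
 qed (use True in auto)
 ultimately show ?thesis using True unfolding is_weak_laplacian_def A_def by simp
qed (auto simp: is_weak_laplacian_def)

lemma is_weak_pd_weak_pd: "H1 D f ==> is_weak_pd D j f (weak_pd D j f)"
 unfolding weak_pd_def H1_def by (metis someI)

lemma H1_L2_on: "H1 D f ==> L2_on D f" "H1 D f ==> L2_on D (weak_pd D j f)"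
 using is_weak_pd_weak_pd[of D f j] by (auto simp: is_weak_pd_def)

text \<open>\<open>weak_pd\<close> is an arbitrary choice, but by the fundamental lemma its class on
  \<open>D\<close> does not depend on it.\<close>

lemma res_weak_pd:
 assumes D: "open D" and w: "is_weak_pd D j f g"
 shows "res D (weak_pd D j f) = res D g"
proof -
 have Db: "D \<in> sets borel" using D by simp
 have w': "is_weak_pd D j f (weak_pd D j f)" unfolding weak_pd_def by (rule someI[of "is_weak_pd D j f", OF w])
 note e = w[unfolded is_weak_pd_iff[OF Db]] w'[unfolded is_weak_pd_iff[OF Db]]
 have "mul (indicator D) (res D (weak_pd D j f)) = mul (indicator D) (res D g)"
 proof (rule L2_eq_on_open[OF D])
  fix phi assume "test_fun D phi"
  then have "res D f \<bullet> abs_L2 (pd j phi) = - (res D (weak_pd D j f) \<bullet> abs_L2 phi)"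
   "res D f \<bullet> abs_L2 (pd j phi) = - (res D g \<bullet> abs_L2 phi)" using e by blast+
  then show "res D (weak_pd D j f) \<bullet> abs_L2 phi = res D g \<bullet> abs_L2 phi" by linarith
 qed
 moreover have "L2_on D (weak_pd D j f)" "L2_on D g" using e by blast+
 ultimately show ?thesis by (simp only: mul_res[OF Db])
qed

definition weak_jet :: "(real^2) set => (real^2 => complex) => L2 \<times> L2 \<times> L2" where
 "weak_jet D f = (res D f, res D (weak_pd D 1 f), res D (weak_pd D 2 f))"

lemma all_2: "(\<forall>j::2. P j) \<longleftrightarrow> P 1 \<and> P 2"
 by (metis (full_types) exhaust_2)

lemma weak_jet_eqI:
 assumes D: "open D" and f: "L2_on D f"
  and w: "res D f = fst w" "mul (indicator D) (fst (snd w)) = fst (snd w)" "mul (indicator D) (snd (snd w)) = snd (snd w)"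
  and weak: "!!phi. test_fun D phi ==> fst w \<bullet> abs_L2 (pd 1 phi) = - (fst (snd w) \<bullet> abs_L2 phi)"
   "!!phi. test_fun D phi ==> fst w \<bullet> abs_L2 (pd 2 phi) = - (snd (snd w) \<bullet> abs_L2 phi)"
 shows "H1 D f" "weak_jet D f = w"
proof -
 have Db: "D \<in> sets borel" using D by simp
 have 1: "is_weak_pd D 1 f (rep_L2 (fst (snd w)))" and 2: "is_weak_pd D 2 f (rep_L2 (snd (snd w)))"
  using f w weak by (simp_all add: is_weak_pd_iff[OF Db] L2_on_rep[OF Db] res_rep)
 then show "H1 D f" using f by (auto simp: H1_def all_2)
 show "weak_jet D f = w"
  using res_weak_pd[OF D 1] res_weak_pd[OF D 2] w by (simp add: weak_jet_def res_rep prod_eq_iff)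
qed

lemma weak_jet_weak:
 assumes D: "D \<in> sets borel" and H: "H1 D f" and phi: "test_fun D phi"
 shows "fst (weak_jet D f) \<bullet> abs_L2 (pd 1 phi) = - (fst (snd (weak_jet D f)) \<bullet> abs_L2 phi)"
  "fst (weak_jet D f) \<bullet> abs_L2 (pd 2 phi) = - (snd (snd (weak_jet D f)) \<bullet> abs_L2 phi)"
 using is_weak_pd_weak_pd[OF H] phi by (auto simp: weak_jet_def is_weak_pd_iff[OF D])

text \<open>The factor \<open>\<i>\<close> of the second derivative is absorbed into the test
  function \<open>- \<i> * phi x\<close>. Crossing the real inner product it changes sign, so
  \<open>DZ\<close> on the test function becomes \<open>DB\<close> on the triple, and
  conversely.\<close>

lemma inner_DZ_jet:
 assumes phi: "test_fun UNIV phi"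
  and w: "w \<bullet> abs_L2 (pd 1 phi) = - (w1 \<bullet> abs_L2 phi)" "w \<bullet> abs_L2 (pd 2 phi) = - (w2 \<bullet> abs_L2 phi)"
   "w \<bullet> abs_L2 (pd 1 (%x. - \<i> * phi x)) = - (w1 \<bullet> abs_L2 (%x. - \<i> * phi x))"
   "w \<bullet> abs_L2 (pd 2 (%x. - \<i> * phi x)) = - (w2 \<bullet> abs_L2 (%x. - \<i> * phi x))"
 shows "w \<bullet> DZ (jet phi) = - (DB (w, w1, w2) \<bullet> abs_L2 phi)" "w \<bullet> DB (jet phi) = - (DZ (w, w1, w2) \<bullet> abs_L2 phi)"
proof -
 have sm: "smooth_fun phi" by (rule test_fun_smooth[OF phi])
 have i: "abs_L2 (%x. - \<i> * phi x) = (- \<i>) *\<^sub>C abs_L2 phi" "abs_L2 (%x. - \<i> * pd j phi x) = (- \<i>) *\<^sub>C abs_L2 (pd j phi)" for j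
  by (simp_all only: abs_L2_scaleC[OF test_fun_sq[OF phi]] abs_L2_scaleC[OF test_fun_sq[OF test_fun_pd[OF phi]]])
 have s: "1 / 2 = (of_real (1 / 2) :: complex)" by simp
 have a: "w \<bullet> (\<i> *\<^sub>C abs_L2 (pd 2 phi)) = - (w2 \<bullet> (\<i> *\<^sub>C abs_L2 phi))"
  using w(4) unfolding pd_fun_cmult[OF sm] i scaleC_minus_left by simp
 have b: "(\<i> *\<^sub>C w2) \<bullet> abs_L2 phi = - (w2 \<bullet> (\<i> *\<^sub>C abs_L2 phi))" by (rule inner_iC_antisym)
 show "w \<bullet> DZ (jet phi) = - (DB (w, w1, w2) \<bullet> abs_L2 phi)"
  unfolding DZ_def DB_def jet_def s scaleC_of_real
  using a b w(1) by (simp add: inner_diff_right inner_add_left field_simps)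
 show "w \<bullet> DB (jet phi) = - (DZ (w, w1, w2) \<bullet> abs_L2 phi)"
  unfolding DZ_def DB_def jet_def s scaleC_of_real
  using a b w(1) by (simp add: inner_add_right inner_diff_left field_simps)
qed

lemma weak_jet_DZ:
 assumes D: "D \<in> sets borel" and H: "H1 D f" and phi: "test_fun D phi"
 shows "res D f \<bullet> DZ (jet phi) = - (DB (weak_jet D f) \<bullet> abs_L2 phi)"
proof -
 have u: "test_fun UNIV phi" using test_fun_mono[OF phi] by blast
 note w = weak_jet_weak[OF D H]
 note i = test_fun_cmult[OF phi, of "- \<i>"]
 show ?thesis using inner_DZ_jet(1)[OF u w[OF phi] w[OF i]] by (simp add: weak_jet_def)
qed

lemma H1_plane_DZ_DB:
 assumes v: "v \<in> H1_plane" and u: "test_fun UNIV phi"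
 shows "fst v \<bullet> DZ (jet phi) = - (DB v \<bullet> abs_L2 phi)" "fst v \<bullet> DB (jet phi) = - (DZ v \<bullet> abs_L2 phi)"
proof -
 note w = H1_plane_weak_pd[OF v]
 note i = test_fun_cmult[OF u, of "- \<i>"]
 show "fst v \<bullet> DZ (jet phi) = - (DB v \<bullet> abs_L2 phi)" "fst v \<bullet> DB (jet phi) = - (DZ v \<bullet> abs_L2 phi)"
  using inner_DZ_jet[OF u w[OF u] w[OF i]] by simp_all
qed

text \<open>Test functions supported in \<open>D\<close> do not see the cut, so the weak derivatives
  of \<open>v\<close> in the plane restrict to those on \<open>D\<close>.\<close>

lemma weak_jet_cut:
 assumes D: "open D" and f: "L2_on D f" and v: "v \<in> H1_plane" and eq: "res D f = mul (indicator D) (fst v)"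
 shows "H1 D f" "weak_jet D f = cut D v"
proof -
 have Db: "D \<in> sets borel" using D by simp
 have p: "fst (cut D v) \<bullet> abs_L2 phi = fst v \<bullet> abs_L2 phi" "fst (snd (cut D v)) \<bullet> abs_L2 phi = fst (snd v) \<bullet> abs_L2 phi"
  "snd (snd (cut D v)) \<bullet> abs_L2 phi = snd (snd v) \<bullet> abs_L2 phi" if "test_fun D phi" for phi
  using mul_indicator_test[OF Db that] by (simp_all add: cut_def inner_mul_indicator[OF Db])
 have w: "fst (cut D v) \<bullet> abs_L2 (pd 1 phi) = - (fst (snd (cut D v)) \<bullet> abs_L2 phi)"
  "fst (cut D v) \<bullet> abs_L2 (pd 2 phi) = - (snd (snd (cut D v)) \<bullet> abs_L2 phi)" if t: "test_fun D phi" for phi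
  using H1_plane_weak_pd[OF v] test_fun_mono[OF t subset_UNIV] by (simp_all add: p[OF t] p[OF test_fun_pd[OF t]])
 have c: "res D f = fst (cut D v)" "mul (indicator D) (fst (snd (cut D v))) = fst (snd (cut D v))"
  "mul (indicator D) (snd (snd (cut D v))) = snd (snd (cut D v))"
  by (simp_all add: cut_def eq mul_indicator_Int[OF Db Db])
 show "H1 D f" "weak_jet D f = cut D v" by (rule weak_jet_eqI[OF D f c w]; assumption)+
qed

text \<open>\<open>H1_norm\<close> in \<open>has_trace\<close> uses weak derivatives chosen anew for
  the difference, which as functions are unrelated to those of \<open>f\<close>; on classes the
  difference may be taken entry by entry.\<close>

lemma weak_jet_test_diff:
 assumes D: "open D" and H: "H1 D f" and t: "test_fun UNIV phi"
 shows "H1 D (%x. phi x - f x)" "weak_jet D (%x. phi x - f x) = cut D (jet phi) - weak_jet D f"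
proof -
 have Db: "D \<in> sets borel" using D by simp
 note L = H1_L2_on[OF H]
 have wt: "fst (cut D (jet phi)) \<bullet> abs_L2 (pd 1 psi) = - (fst (snd (cut D (jet phi))) \<bullet> abs_L2 psi)"
  "fst (cut D (jet phi)) \<bullet> abs_L2 (pd 2 psi) = - (snd (snd (cut D (jet phi))) \<bullet> abs_L2 psi)" if "test_fun D psi" for psi
  using weak_jet_weak[OF Db _ that, of phi] weak_jet_cut[OF D L2_on_test[OF Db t] jet_in_H1_plane[OF t]]
  by (simp_all add: res_test[OF Db t]) (simp_all add: jet_def)
 let ?w = "cut D (jet phi) - weak_jet D f"
 have r: "res D (%x. phi x - f x) = fst ?w"
  by (simp add: res_diff[OF Db L2_on_test[OF Db t] L(1)] res_test[OF Db t] weak_jet_def cut_def) (simp add: jet_def)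
 have m: "mul (indicator D) (fst (snd ?w)) = fst (snd ?w)" "mul (indicator D) (snd (snd ?w)) = snd (snd ?w)"
  by (simp_all add: mul_diff bm_indicator Db weak_jet_def mul_res L cut_def mul_indicator_Int)
 have w: "fst ?w \<bullet> abs_L2 (pd 1 psi) = - (fst (snd ?w) \<bullet> abs_L2 psi)"
  "fst ?w \<bullet> abs_L2 (pd 2 psi) = - (snd (snd ?w) \<bullet> abs_L2 psi)" if "test_fun D psi" for psi
  using wt[OF that] weak_jet_weak[OF Db H that] by (simp_all add: inner_diff_left)
 note a = L2_on_diff[OF Db L2_on_test[OF Db t] L(1)]
 show "H1 D (%x. phi x - f x)" "weak_jet D (%x. phi x - f x) = ?w"
  by (rule weak_jet_eqI[OF D a r m w]; assumption)+
qed

section \<open>Traces as limits in the norm of triples\<close>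

lemma H1_norm_eq: assumes D: "D \<in> sets borel" and H: "H1 D f" shows "H1_norm D f = norm (weak_jet D f)"
proof -
 have e: "(LINT x:D|lborel. (cmod (g x))\<^sup>2) = (norm (res D g))\<^sup>2" if "L2_on D g" for g
 proof -
  have "(LINT x:D|lborel. (cmod (g x))\<^sup>2) = (LBINT x. (cmod (indicator D x * g x))\<^sup>2)"
   unfolding set_lebesgue_integral_def by (rule lint_cong) (auto simp: indicator_def)
  then show ?thesis unfolding res_def using norm_L2_abs that by (simp add: L2_on_iff[OF D])
 qed
 have "(norm (weak_jet D f))\<^sup>2 = (H1_norm D f)\<^sup>2"
  unfolding norm_triple H1_norm_def e[OF H1_L2_on(1)[OF H]] e[OF H1_L2_on(2)[OF H]] by (simp add: weak_jet_def sum_2)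
 moreover have "H1_norm D f \<ge> 0" unfolding H1_norm_def e[OF H1_L2_on(1)[OF H]] e[OF H1_L2_on(2)[OF H]] by (simp add: sum_nonneg)
 ultimately show ?thesis by (simp add: power2_eq_iff_nonneg)
qed

text \<open>\<open>has_trace\<close> with the Sobolev function replaced by its triple and the
  measure left free. With \<open>D = UNIV\<close> it also expresses the trace on the boundary of
  \<Omega> of a function on the whole plane, whose own frontier is empty.\<close>

definition jet_trace ::
  "(real^2) measure => (real^2) set => L2 \<times> L2 \<times> L2 => (real^2 => complex) => bool" where
 "jet_trace S D w g \<longleftrightarrow> square_integrable S g \<and>
  (\<exists>u. (\<forall>n. test_fun UNIV (u n)) \<and> (%n. cut D (jet (u n))) \<longlonglongrightarrow> w \<and>
   (%n. \<integral>x. (cmod (u n x - g x))\<^sup>2 \<partial>S) \<longlonglongrightarrow> 0)"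

lemma has_trace_iff:
 assumes D: "open D"
 shows "has_trace D f g \<longleftrightarrow> H1 D f \<and> jet_trace (surface_measure (frontier D)) D (weak_jet D f) g"
proof (cases "H1 D f")
 case True
 have "(%n. H1_norm D (%x. u n x - f x)) \<longlonglongrightarrow> 0 \<longleftrightarrow> (%n. cut D (jet (u n))) \<longlonglongrightarrow> weak_jet D f"
  if "\<forall>n. test_fun UNIV (u n)" for u
  using that D by (simp add: H1_norm_eq weak_jet_test_diff[OF D True] tendsto_norm_zero_iff LIM_zero_iff)
 then show ?thesis using True unfolding has_trace_def jet_trace_def by blast
qed (simp add: has_trace_def)

text \<open>The integral of the squared modulus of \<open>a x + t *\<^sub>R b x\<close> is a
  nonnegative polynomial in \<open>t\<close>; its value at the minimiser \<open>- X / B\<close>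
  gives the bound, and for \<open>B = 0\<close> it is affine, which forces
  \<open>X = 0\<close>.\<close>

lemma square_integrable_CS:
 assumes a: "square_integrable M a" and b: "square_integrable M b"
 shows "\<bar>\<integral>x. a x \<bullet> b x \<partial>M\<bar> \<le> sqrt (\<integral>x. (cmod (a x))\<^sup>2 \<partial>M) * sqrt (\<integral>x. (cmod (b x))\<^sup>2 \<partial>M)"
proof -
 define A B X where "A = (\<integral>x. (cmod (a x))\<^sup>2 \<partial>M)" and "B = (\<integral>x. (cmod (b x))\<^sup>2 \<partial>M)"
  and "X = (\<integral>x. a x \<bullet> b x \<partial>M)"
 have i: "integrable M (%x. (cmod (a x))\<^sup>2)" "integrable M (%x. (cmod (b x))\<^sup>2)" "integrable M (%x. a x \<bullet> b x)"
  using a b square_integrable_inner[OF a b] by (auto simp: square_integrable_def)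
 have q: "0 \<le> A + (2 * t * X + t\<^sup>2 * B)" for t
 proof -
  have "(cmod (a x + t *\<^sub>R b x))\<^sup>2 = (cmod (a x))\<^sup>2 + (2 * t * (a x \<bullet> b x) + t\<^sup>2 * (cmod (b x))\<^sup>2)" for x
   unfolding power2_norm_eq_inner
   by (simp add: inner_add_left inner_add_right inner_commute[of "b x" "a x"] power2_eq_square algebra_simps)
  then have "(\<integral>x. (cmod (a x + t *\<^sub>R b x))\<^sup>2 \<partial>M) = A + (2 * t * X + t\<^sup>2 * B)"
   unfolding A_def B_def X_def using i by simp
  moreover have "0 \<le> (\<integral>x. (cmod (a x + t *\<^sub>R b x))\<^sup>2 \<partial>M)" by simp
  ultimately show ?thesis by simp
 qed
 have A0: "A \<ge> 0" and B0: "B \<ge> 0" by (simp_all add: A_def B_def)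
 have "X\<^sup>2 \<le> A * B"
 proof (cases "B = 0")
  case True
  have "X = 0"
  proof (rule ccontr)
   assume "X \<noteq> 0"
   then show False using q[of "- (A + 1) / (2 * X)"] True by (simp add: field_simps)
  qed
  then show ?thesis using True by simp
 next
  case False
  then have Bp: "B > 0" using B0 by simp
  have "0 \<le> (A + (2 * (- X / B) * X + (- X / B)\<^sup>2 * B)) * B" using q Bp by (simp only: mult_nonneg_nonneg less_imp_le)
  also have "... = A * B - X\<^sup>2" using Bp by (simp add: field_simps power2_eq_square)
  finally show ?thesis by simp
 qed
 then have "sqrt (X\<^sup>2) \<le> sqrt (A * B)" by (rule real_sqrt_le_mono)
 then show ?thesis unfolding A_def B_def X_def by (simp add: real_sqrt_mult)
qed

lemma square_integrable_pairing_tendsto: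
 assumes u: "!!n. square_integrable M (u n)" and g: "square_integrable M g" and a: "square_integrable M a"
  and lim: "(%n. \<integral>x. (cmod (u n x - g x))\<^sup>2 \<partial>M) \<longlonglongrightarrow> 0"
 shows "(%n. \<integral>x. u n x \<bullet> a x \<partial>M) \<longlonglongrightarrow> (\<integral>x. g x \<bullet> a x \<partial>M)"
proof -
 have "(%n. sqrt (\<integral>x. (cmod (u n x - g x))\<^sup>2 \<partial>M) * sqrt (\<integral>x. (cmod (a x))\<^sup>2 \<partial>M))
   \<longlonglongrightarrow> sqrt 0 * sqrt (\<integral>x. (cmod (a x))\<^sup>2 \<partial>M)"
  by (intro tendsto_intros lim)
 then have z: "(%n. sqrt (\<integral>x. (cmod (u n x - g x))\<^sup>2 \<partial>M) * sqrt (\<integral>x. (cmod (a x))\<^sup>2 \<partial>M)) \<longlonglongrightarrow> 0" by simp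
 have "(%n. (\<integral>x. u n x \<bullet> a x \<partial>M) - (\<integral>x. g x \<bullet> a x \<partial>M)) \<longlonglongrightarrow> 0"
 proof (rule Lim_null_comparison[OF always_eventually z], rule allI)
  fix n
  have "(\<integral>x. u n x \<bullet> a x \<partial>M) - (\<integral>x. g x \<bullet> a x \<partial>M) = (\<integral>x. (u n x - g x) \<bullet> a x \<partial>M)"
   using square_integrable_inner[OF u a] square_integrable_inner[OF g a] by (simp add: inner_diff_left)
  then show "norm ((\<integral>x. u n x \<bullet> a x \<partial>M) - (\<integral>x. g x \<bullet> a x \<partial>M))
   \<le> sqrt (\<integral>x. (cmod (u n x - g x))\<^sup>2 \<partial>M) * sqrt (\<integral>x. (cmod (a x))\<^sup>2 \<partial>M)"
   using square_integrable_CS[OF square_integrable_diff[OF u g] a] by simp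
 qed
 then show ?thesis by (rule LIM_zero_cancel)
qed

section \<open>The product rule on triples\<close>

definition mul_jet :: "(real^2 => complex) => L2 \<times> L2 \<times> L2 => L2 \<times> L2 \<times> L2" where
 "mul_jet m u = (mul m (fst u), mul (pd 1 m) (fst u) + mul m (fst (snd u)), mul (pd 2 m) (fst u) + mul m (snd (snd u)))"

lemma bounded_linear_mul_jet:
 assumes m: "test_fun UNIV m" shows "bounded_linear (mul_jet m)"
proof -
 note b = bounded_linear_mul[OF bm_test_fun[OF m]]
  bounded_linear_mul[OF bm_test_fun[OF test_fun_pd[OF m]]]
 show ?thesis
  unfolding mul_jet_def[abs_def]
  by (intro bounded_linear_Pair bounded_linear_add bl_comp[OF b(1)] bl_comp[OF b(2)]
   bounded_linear_fst bl_comp[OF bounded_linear_fst] bl_comp[OF bounded_linear_snd]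
   bounded_linear_snd)
qed

lemma mul_jet_jet:
 assumes m: "test_fun UNIV m" and phi: "test_fun UNIV phi"
 shows "mul_jet m (jet phi) = jet (%x. m x * phi x)"
proof -
 note sm = test_fun_smooth[OF m] test_fun_smooth[OF phi]
 have p: "pd j (%x. m x * phi x) = (%x. pd j m x * phi x + m x * pd j phi x)" for j
  by (rule ext) (subst pd_mult, simp_all add: smooth_fun_diffb sm)
 note b = bm_test_fun[OF m] bm_test_fun[OF test_fun_pd[OF m]]
 note s = test_fun_sq[OF phi] test_fun_sq[OF test_fun_pd[OF phi]]
 show ?thesis
  unfolding mul_jet_def jet_def p fst_conv snd_conv mul_abs[OF b(1) s(1)] mul_abs[OF b(1) s(2)] mul_abs[OF b(2) s(1)]
   abs_L2_add[OF mul_sq[OF b(2) s(1)] mul_sq[OF b(1) s(2)]] ..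
qed

lemma mul_jet_H1_plane:
 assumes m: "test_fun UNIV m" and "u \<in> H1_plane" shows "mul_jet m u \<in> H1_plane"
 using assms(2)
proof (rule H1_plane_induct)
 have "{u. mul_jet m u \<in> H1_plane} = mul_jet m -` H1_plane" by auto
 also have "closed ..."
  by (intro continuous_closed_vimage closed_H1_plane linear_continuous_at bounded_linear_mul_jet m)
 finally show "closed {u. mul_jet m u \<in> H1_plane}" .
 show "mul_jet m (jet phi) \<in> H1_plane" if "test_fun UNIV phi" for phi
  unfolding mul_jet_jet[OF m that] by (rule jet_in_H1_plane[OF test_fun_mult[OF that test_fun_smooth[OF m]]])
qed

lemma DB_mul_jet:
 assumes m: "test_fun UNIV m" shows "DB (mul_jet m u) = mul (dbar m) (fst u) + mul m (DB u)"
proof -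
 note b = bm_test_fun[OF m] bm_test_fun[OF test_fun_pd[OF m]]
 have "mul (dbar m) F = (1 / 2) *\<^sub>C (mul (pd 1 m) F + \<i> *\<^sub>C mul (pd 2 m) F)" for F
 proof -
  note s = mul_sq[OF b(2) square_integrable_rep[of F]]
  have e: "(%x. dbar m x * rep_L2 F x) = (%x. 1 / 2 * (pd 1 m x * rep_L2 F x + \<i> * (pd 2 m x * rep_L2 F x)))"
   by (auto simp: dbar_def field_simps)
  show ?thesis
   unfolding mul_def e abs_L2_scaleC[OF s] abs_L2_add[OF s square_integrable_mult[OF s]]
    abs_L2_scaleC[OF square_integrable_add[OF s square_integrable_mult[OF s]]] ..
 qed
 then show ?thesis
  by (simp add: DB_def mul_jet_def mul_scaleC[OF b(1)] mul_add[OF b(1)] scaleC_add_right)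
qed

text \<open>The adjoint is taken for the real inner product; the last entry carries
  \<open>\<i> / 2\<close> because the coefficient \<open>- \<i> / 2\<close> in \<open>DZ\<close> is
  conjugated.\<close>

definition DZ_adj :: "L2 => L2 \<times> L2 \<times> L2" where
 "DZ_adj X = (0, (1 / 2) *\<^sub>C X, (\<i> / 2) *\<^sub>C X)"

lemma bounded_linear_DZ_adj: "bounded_linear DZ_adj"
 unfolding DZ_adj_def[abs_def] by (intro bounded_linear_Pair bounded_linear_zero bounded_linear_scaleC)

lemma inner_DZ: "X \<bullet> DZ v = DZ_adj X \<bullet> v"
proof -
 have "X \<bullet> DZ v = ((1 / 2) *\<^sub>C X) \<bullet> fst (snd v) - ((1 / 2) *\<^sub>C X) \<bullet> (\<i> *\<^sub>C snd (snd v))"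
  unfolding DZ_def inner_scaleC_right_L2[of X] by (simp add: inner_diff_right)
 also have "((1 / 2) *\<^sub>C X) \<bullet> (\<i> *\<^sub>C snd (snd v)) = - ((\<i> *\<^sub>C (1 / 2) *\<^sub>C X) \<bullet> snd (snd v))"
  unfolding inner_iC_antisym by simp
 finally show ?thesis by (simp add: inner_triple DZ_adj_def scaleC_scaleC)
qed

lemma tendsto_DZ: "(u \<longlongrightarrow> v) F ==> ((%n. DZ (u n)) \<longlongrightarrow> DZ v) F" for v :: "L2 \<times> L2 \<times> L2"
 by (rule bounded_linear.tendsto[OF bounded_linear_DZ])

lemma tendsto_DB: "(u \<longlongrightarrow> v) F ==> ((%n. DB (u n)) \<longlongrightarrow> DB v) F" for v :: "L2 \<times> L2 \<times> L2"
 by (rule bounded_linear.tendsto[OF bounded_linear_DB])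

lemma has_jet_trace_lincomb:
 assumes D: "D \<in> sets borel" and v: "jet_trace S D v s" and w: "jet_trace S D w t"
  and sq: "!!phi. test_fun UNIV phi ==> square_integrable S phi"
 shows "jet_trace S D (v + c *\<^sub>C w) (%x. s x + c * t x)"
proof -
 from v obtain phi where phi: "!!n. test_fun UNIV (phi n)" "(%n. cut D (jet (phi n))) \<longlonglongrightarrow> v"
  "(%n. \<integral>x. (cmod (phi n x - s x))\<^sup>2 \<partial>S) \<longlonglongrightarrow> 0" by (auto simp: jet_trace_def)
 from w obtain psi where psi: "!!n. test_fun UNIV (psi n)" "(%n. cut D (jet (psi n))) \<longlonglongrightarrow> w"
  "(%n. \<integral>x. (cmod (psi n x - t x))\<^sup>2 \<partial>S) \<longlonglongrightarrow> 0" by (auto simp: jet_trace_def)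
 have st: "square_integrable S s" "square_integrable S t" using v w by (auto simp: jet_trace_def)
 let ?u = "%n x. phi n x + c * psi n x"
 have u: "test_fun UNIV (?u n)" for n by (intro test_fun_add test_fun_cmult phi psi)
 have cl: "cut D (c *\<^sub>C y) = c *\<^sub>C cut D y" for y
  by (simp add: cut_def scaleC_prod_def mul_scaleC bm_indicator D)
 have j: "cut D (jet (?u n)) = cut D (jet (phi n)) + c *\<^sub>C cut D (jet (psi n))" for n
  unfolding jet_add[OF phi(1) test_fun_cmult[OF psi(1)], symmetric] jet_scaleC[OF psi(1), symmetric]
   linear_add[OF bounded_linear.linear[OF bounded_linear_cut[OF D]]] cl ..
 have "(%n. cut D (jet (?u n))) \<longlonglongrightarrow> v + c *\<^sub>C w"
  unfolding j by (intro tendsto_add tendsto_scaleC phi psi)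
 moreover have "(%n. \<integral>x. (cmod (?u n x - (s x + c * t x)))\<^sup>2 \<partial>S) \<longlonglongrightarrow> 0"
 proof (rule tendsto_sandwich[OF _ _ tendsto_const])
  show "(%n. 2 * (\<integral>x. (cmod (phi n x - s x))\<^sup>2 \<partial>S) + 2 * (cmod c)\<^sup>2 * (\<integral>x. (cmod (psi n x - t x))\<^sup>2 \<partial>S)) \<longlonglongrightarrow> 0"
   using tendsto_add[OF tendsto_mult_right_zero[OF phi(3)] tendsto_mult_right_zero[OF psi(3)]] by simp
  show "\<forall>\<^sub>F n in sequentially. (\<integral>x. (cmod (?u n x - (s x + c * t x)))\<^sup>2 \<partial>S)
   \<le> 2 * (\<integral>x. (cmod (phi n x - s x))\<^sup>2 \<partial>S) + 2 * (cmod c)\<^sup>2 * (\<integral>x. (cmod (psi n x - t x))\<^sup>2 \<partial>S)"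
  proof (rule always_eventually, rule allI)
   fix n
   have d: "square_integrable S (%x. phi n x - s x)" "square_integrable S (%x. psi n x - t x)"
    by (intro square_integrable_diff sq phi psi st)+
   note i = d[unfolded square_integrable_def, THEN conjunct2]
   have l: "integrable S (%x. (cmod (?u n x - (s x + c * t x)))\<^sup>2)"
    using square_integrable_diff[OF sq[OF u] square_integrable_add[OF st(1) square_integrable_mult[OF st(2)]]]
    by (simp add: square_integrable_def)
   have p: "(cmod (?u n x - (s x + c * t x)))\<^sup>2 \<le> 2 * (cmod (phi n x - s x))\<^sup>2 + 2 * (cmod c)\<^sup>2 * (cmod (psi n x - t x))\<^sup>2" for x
   proof -
    have "cmod (?u n x - (s x + c * t x)) \<le> cmod (phi n x - s x) + cmod (c * (psi n x - t x))"
     using norm_triangle_ineq[of "phi n x - s x" "c * (psi n x - t x)"] by (simp add: algebra_simps)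
    then have "(cmod (?u n x - (s x + c * t x)))\<^sup>2 \<le> (cmod (phi n x - s x) + cmod (c * (psi n x - t x)))\<^sup>2"
     by (rule power_mono) simp
    also have "... \<le> 2 * (cmod (phi n x - s x))\<^sup>2 + 2 * (cmod (c * (psi n x - t x)))\<^sup>2"
     unfolding power2_sum using sum_squares_bound[of "cmod (phi n x - s x)" "cmod (c * (psi n x - t x))"] by linarith
    finally show ?thesis by (simp add: norm_mult power_mult_distrib)
   qed
   have "(\<integral>x. (cmod (?u n x - (s x + c * t x)))\<^sup>2 \<partial>S)
    \<le> (\<integral>x. 2 * (cmod (phi n x - s x))\<^sup>2 + 2 * (cmod c)\<^sup>2 * (cmod (psi n x - t x))\<^sup>2 \<partial>S)"
    by (rule integral_mono[OF l _ p]) (intro Bochner_Integration.integrable_add integrable_mult_right i)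
   then show "(\<integral>x. (cmod (?u n x - (s x + c * t x)))\<^sup>2 \<partial>S)
    \<le> 2 * (\<integral>x. (cmod (phi n x - s x))\<^sup>2 \<partial>S) + 2 * (cmod c)\<^sup>2 * (\<integral>x. (cmod (psi n x - t x))\<^sup>2 \<partial>S)"
    using i by simp
  qed
 qed (auto intro: always_eventually)
 moreover have "square_integrable S (%x. s x + c * t x)"
  by (rule square_integrable_add[OF st(1) square_integrable_mult[OF st(2)]])
 ultimately show ?thesis
  unfolding jet_trace_def by (intro conjI exI[of _ ?u]) (simp_all add: u)
qed

lemma has_jet_trace_cut:
 assumes D: "D \<in> sets borel" and v: "jet_trace S UNIV v s" shows "jet_trace S D (cut D v) s"
 using v bounded_linear.tendsto[OF bounded_linear_cut[OF D]] unfolding jet_trace_def cut_UNIV by blast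

lemma norm_DB_H1_plane:
 assumes "u \<in> H1_plane" shows "norm (DB u) = norm (DZ u)"
 using assms
proof (rule H1_plane_induct)
 show "norm (DB (jet phi)) = norm (DZ (jet phi))" if t: "test_fun UNIV phi" for phi
 proof -
  have "4 * (norm (DB (jet phi)))\<^sup>2 = 4 * (norm (DZ (jet phi)))\<^sup>2" using norm_DZ_jet[OF t] by simp
  then show ?thesis by (simp add: power2_eq_iff_nonneg)
 qed
qed (intro closed_Collect_eq continuous_intros)

text \<open>The multiplier \<open>\<theta>\<close> is bounded and increasing in \<open>x\<^sub>1\<close>, so \<open>\<integral> |phi|\<^sup>2 \<partial>\<^sub>1\<theta> = - \<integral> \<theta> \<partial>\<^sub>1|phi|\<^sup>2\<close>
 controls \<open>|phi|\<^sup>2\<close> on bounded sets.\<close>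

lemma poincare_bounded_set:
 assumes D: "bounded D" "D \<in> sets borel"
 shows "\<exists>C\<ge>0. \<forall>u\<in>H1_plane. (norm (mul (indicator D) (fst u)))\<^sup>2 \<le> C * (norm (fst u) * norm (fst (snd u)))"
proof -
 obtain R where R: "!!x. x \<in> D ==> norm x \<le> R" using D(1) by (auto simp: bounded_iff)
 \<comment> \<open>This is \<open>s / sqrt (1 + s\<^sup>2)\<close>, bounded by 1; its derivative
   \<open>g'\<close> decreases in the modulus of \<open>s\<close>, so \<open>eps\<close> below
   bounds it from below on the range of the first coordinate over \<open>D\<close>.\<close>
 define g where "g s = s * (1 + s\<^sup>2) powr (- 1 / 2)" for s :: real
 define g' where "g' s = (1 + s\<^sup>2) powr (- 3 / 2)" for s :: real
 define \<theta> where "\<theta> x = complex_of_real (g (x $ 1))" for x :: "real^2"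
 define eps where "eps = (1 + R\<^sup>2) powr (- 3 / 2)"
 have pos: "1 + s\<^sup>2 > 0" for s :: real by (simp add: add_pos_nonneg)
 have alg: "(1 + s\<^sup>2) * p + s * ((- 1 / 2) * p * (2 * s)) = p" for s p :: real
  by (simp add: power2_eq_square algebra_simps)
 have gd: "(g has_real_derivative g' s) (at s)" for s
 proof -
  have "(g has_real_derivative (1 + s\<^sup>2) powr (- 1 / 2) + s * ((- 1 / 2) * (1 + s\<^sup>2) powr (- 1 / 2 - 1) * (2 * s))) (at s)"
   unfolding g_def by (auto intro!: derivative_eq_intros simp: pos)
  also have "(1 + s\<^sup>2) powr (- 1 / 2) = (1 + s\<^sup>2) * (1 + s\<^sup>2) powr (- 3 / 2)"
   using powr_add[of "1 + s\<^sup>2" 1 "- 3 / 2"] pos[of s] by simp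
  also have "(1 + s\<^sup>2) * (1 + s\<^sup>2) powr (- 3 / 2) + s * ((- 1 / 2) * (1 + s\<^sup>2) powr (- 1 / 2 - 1) * (2 * s)) = g' s"
  proof -
   have e: "- 1 / 2 - 1 = - 3 / (2::real)" by simp
   show ?thesis unfolding g'_def e by (rule alg)
  qed
  finally show ?thesis .
 qed
 have smooth: "smooth_fun \<theta>"
 proof -
  have r: "smooth_fun (%x. complex_of_real (1 + (x $ 1)\<^sup>2))"
   using smooth_fun_add[OF smooth_fun_const[of 1] smooth_fun_mult[OF smooth_fun_coord[of 1] smooth_fun_coord[of 1]]]
   by (simp add: power2_eq_square)
  have "smooth_fun (%x. complex_of_real (x $ 1) * complex_of_real ((1 + (x $ 1)\<^sup>2) powr (- 1 / 2)))"
   by (rule smooth_fun_mult[OF smooth_fun_coord smooth_fun_powr[OF r]]) (simp_all add: pos)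
  then show ?thesis unfolding \<theta>_def g_def by simp
 qed
 have pd\<theta>: "pd 1 \<theta> x = of_real (g' (x $ 1))" for x
 proof -
  have "((%x::real^2. g (x $ 1)) has_derivative (%h. g' (x $ 1) * h $ 1)) (at x)"
   by (rule has_derivative_compose[OF bounded_linear_imp_has_derivative[OF bounded_linear_vec_nth]
     gd[of "x $ 1", unfolded has_field_derivative_def]])
  then have "(\<theta> has_derivative (%h. of_real (g' (x $ 1) * h $ 1))) (at x)"
   unfolding \<theta>_def by (rule has_derivative_of_real)
  then show ?thesis by (simp add: pd_eq axis_def)
 qed
 have bound: "cmod (\<theta> x) \<le> 1" for x
 proof -
  let ?s = "x $ 1"
  have "(g ?s)\<^sup>2 = ?s\<^sup>2 * (1 + ?s\<^sup>2) powr (- 1)"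
   unfolding g_def power_mult_distrib using powr_add[of "1 + ?s\<^sup>2" "- 1 / 2" "- 1 / 2"] by (simp add: power2_eq_square)
  also have "... \<le> 1" using pos[of ?s] by (simp add: powr_minus powr_one divide_simps)
  finally have "\<bar>g ?s\<bar> \<le> 1" by (simp add: abs_square_le_1)
  then show ?thesis by (simp add: \<theta>_def)
 qed
 have eps: "eps > 0" using pos[of R] by (simp add: eps_def)
 have below: "eps \<le> g' (x $ 1)" if "x \<in> D" for x
 proof -
  have "\<bar>x $ 1\<bar> \<le> R" using component_le_norm_cart[of x 1] R[OF that] by simp
  then have "(x $ 1)\<^sup>2 \<le> R\<^sup>2" using abs_le_square_iff[of "x $ 1" R] by simp
  then show ?thesis unfolding eps_def g'_def using pos[of "x $ 1"] by (intro powr_mono2') simp_all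
 qed
 have g'0: "g' s \<ge> 0" for s by (simp add: g'_def)
 have "(norm (mul (indicator D) (fst u)))\<^sup>2 \<le> 2 / eps * (norm (fst u) * norm (fst (snd u)))" if "u \<in> H1_plane" for u
  using that
 proof (rule H1_plane_induct)
  show "closed {u. (norm (mul (indicator D) (fst u)))\<^sup>2 \<le> 2 / eps * (norm (fst u) * norm (fst (snd u)))}"
   by (intro closed_Collect_le continuous_intros
     bounded_linear.continuous_on[OF bounded_linear_mul[OF bm_indicator[OF D(2)]]])
  fix phi assume t: "test_fun UNIV phi"
  have t\<theta>: "test_fun UNIV (%x. \<theta> x * phi x)" by (rule test_fun_mult[OF t smooth])
  have tg: "test_fun UNIV (%x. pd 1 \<theta> x * phi x)" "test_fun UNIV (%x. \<theta> x * pd 1 phi x)"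
   by (rule test_fun_mult[OF t smooth_fun_pd[OF smooth]], rule test_fun_mult[OF test_fun_pd[OF t] smooth])
  note sq = test_fun_sq[OF t] test_fun_sq[OF test_fun_pd[OF t], of 1]
   test_fun_sq[OF t\<theta>] test_fun_sq[OF tg(1)] test_fun_sq[OF tg(2)]
  have p: "pd 1 (%x. \<theta> x * phi x) = (%x. pd 1 \<theta> x * phi x + \<theta> x * pd 1 phi x)"
   by (rule ext) (subst pd_mult, simp_all add: smooth_fun_diffb smooth test_fun_smooth[OF t])
  have "abs_L2 (pd 1 phi) \<bullet> abs_L2 (%x. \<theta> x * phi x)
    = - (abs_L2 phi \<bullet> abs_L2 (%x. pd 1 \<theta> x * phi x) + abs_L2 phi \<bullet> abs_L2 (%x. \<theta> x * pd 1 phi x))"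
   unfolding inner_pd_L2[OF t t\<theta>] p abs_L2_add[OF sq(4,5), symmetric] inner_add_right ..
  \<comment> \<open>As \<open>\<theta>\<close> is real it may be moved across, and this term equals
    the left-hand side of the identity before; hence the factor 2.\<close>
  moreover have "abs_L2 phi \<bullet> abs_L2 (%x. \<theta> x * pd 1 phi x) = abs_L2 (pd 1 phi) \<bullet> abs_L2 (%x. \<theta> x * phi x)"
   unfolding inner_abs_L2[OF sq(1,5)] inner_abs_L2[OF sq(2,3)]
   by (rule lint_cong) (simp_all add: \<theta>_def inner_complex_def algebra_simps)
  ultimately have e: "abs_L2 phi \<bullet> abs_L2 (%x. pd 1 \<theta> x * phi x) = - 2 * (abs_L2 (pd 1 phi) \<bullet> abs_L2 (%x. \<theta> x * phi x))"
   by simp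
  have m\<theta>: "\<theta> \<in> borel_measurable borel" by (rule smooth_fun_measurable[OF smooth])
  have n\<theta>: "norm (abs_L2 (%x. \<theta> x * phi x)) \<le> norm (abs_L2 phi)"
   unfolding norm_L2_abs[OF sq(3)] norm_L2_abs[OF sq(1)]
   using square_integrable_multiplier(2)[OF m\<theta> bound sq(1)] by (intro real_sqrt_le_mono) simp
  have "eps * (norm (mul (indicator D) (abs_L2 phi)))\<^sup>2 = (LBINT x. eps * (cmod (indicator D x * phi x))\<^sup>2)"
   unfolding mul_abs[OF bm_indicator[OF D(2)] sq(1)]
   by (simp add: norm_L2_abs[OF mul_sq[OF bm_indicator[OF D(2)] sq(1)]])
  also have "... \<le> (LBINT x. phi x \<bullet> (pd 1 \<theta> x * phi x))"
  proof (rule integral_mono)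
   show "integrable lborel (%x. eps * (cmod (indicator D x * phi x))\<^sup>2)"
    using mul_sq[OF bm_indicator[OF D(2)] sq(1)] by (simp add: square_integrable_def)
   show "integrable lborel (%x. phi x \<bullet> (pd 1 \<theta> x * phi x))" by (rule square_integrable_inner[OF sq(1,4)])
   have "phi x \<bullet> (pd 1 \<theta> x * phi x) = g' (x $ 1) * (cmod (phi x))\<^sup>2" for x
    unfolding pd\<theta> by (simp add: inner_complex_def cmod_power2) (simp add: power2_eq_square algebra_simps)
   moreover have "eps * (cmod (indicator D x * phi x))\<^sup>2 \<le> g' (x $ 1) * (cmod (phi x))\<^sup>2" for x
    using below[of x] g'0[of "x $ 1"] by (auto simp: indicator_def intro!: mult_right_mono)
   ultimately show "eps * (cmod (indicator D x * phi x))\<^sup>2 \<le> phi x \<bullet> (pd 1 \<theta> x * phi x)" for x by simp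
  qed
  also have "... = - 2 * (abs_L2 (pd 1 phi) \<bullet> abs_L2 (%x. \<theta> x * phi x))"
   unfolding e[symmetric] inner_abs_L2[OF sq(1,4)] ..
  also have "... \<le> 2 * (norm (abs_L2 (pd 1 phi)) * norm (abs_L2 phi))"
   using Cauchy_Schwarz_ineq2[of "abs_L2 (pd 1 phi)" "abs_L2 (%x. \<theta> x * phi x)"]
    mult_left_mono[OF n\<theta> norm_ge_zero[of "abs_L2 (pd 1 phi)"]] by linarith
  finally show "(norm (mul (indicator D) (fst (jet phi))))\<^sup>2 \<le> 2 / eps * (norm (fst (jet phi)) * norm (fst (snd (jet phi))))"
   using eps by (simp add: jet_def field_simps)
 qed
 moreover have "2 / eps \<ge> 0" using eps by simp
 ultimately show ?thesis by blast
qed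

lemma norm_mul_indicator: assumes "D \<in> sets borel" shows "norm (mul (indicator D) F) \<le> norm F"
proof -
 have "(norm (mul (indicator D) F))\<^sup>2 = F \<bullet> mul (indicator D) F"
  unfolding power2_norm_eq_inner inner_mul_indicator[OF assms, of F] mul_indicator_Int[OF assms assms] by simp
 also have "... \<le> norm F * norm (mul (indicator D) F)" by (rule norm_cauchy_schwarz)
 finally show ?thesis by (cases "mul (indicator D) F = 0") (simp_all add: power2_eq_square)
qed

section \<open>The boundary form\<close>

context green_domain
begin

abbreviation "\<sigma> \<equiv> surface_measure (frontier \<Omega>)"

definition normal :: "real^2 => complex" where
 "normal x = of_real (N 1 x) + \<i> * of_real (N 2 x)"

definition conormal :: "real^2 => complex" where
 "conormal x = cnj (normal x)"

lemma test_fun_normal: "test_fun UNIV normal"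
 unfolding normal_def[abs_def] by (intro test_fun_add test_fun_cmult N_test)

lemma test_fun_conormal: "test_fun UNIV conormal"
 unfolding conormal_def[abs_def] by (rule test_fun_cnj[OF test_fun_normal])

lemma normal_conormal: "x \<in> frontier \<Omega> ==> normal x * conormal x = 1"
 using N_unit[of x] by (simp add: normal_def conormal_def complex_eq_iff power2_eq_square)

lemma cmod_normal: assumes "x \<in> frontier \<Omega>" shows "cmod (normal x) = 1"
proof -
 have "(cmod (normal x))\<^sup>2 = 1" using N_unit[OF assms] by (simp add: normal_def cmod_power2)
 then show ?thesis by (simp add: power2_eq_1_iff) (smt (verit) norm_ge_zero)
qed

lemma normal_isometry:
 "x \<in> frontier \<Omega> ==> cmod (normal x * z) = cmod z"
 "x \<in> frontier \<Omega> ==> (normal x * z) \<bullet> (normal x * w) = z \<bullet> w"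
proof -
 assume x: "x \<in> frontier \<Omega>"
 show "cmod (normal x * z) = cmod z" by (simp add: norm_mult cmod_normal[OF x])
 have "(normal x * z) \<bullet> (normal x * w) = Re (normal x * conormal x * (z * cnj w))"
  by (simp add: inner_complex_def conormal_def algebra_simps)
 then show "(normal x * z) \<bullet> (normal x * w) = z \<bullet> w"
  by (simp add: normal_conormal[OF x]) (simp add: inner_complex_def)
qed

section \<open>Integration over the boundary\<close>

lemma space_surface: "space \<sigma> = frontier \<Omega>"
 by (simp add: surface_measure_def space_restrict_space)

lemma borel_measurable_surface: "f \<in> borel_measurable borel ==> f \<in> borel_measurable \<sigma>"
 unfolding surface_measure_def by (intro measurable_restrict_space1) (simp cong: measurable_cong_sets)

lemma test_fun_surface:
 assumes t: "test_fun UNIV phi" shows "square_integrable \<sigma> phi" "integrable \<sigma> phi"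
proof -
 interpret F: finite_measure \<sigma> by (rule finite_surface)
 obtain B where B: "!!x. cmod (phi x) \<le> B" using test_fun_bounded[OF t] by blast
 have m: "phi \<in> borel_measurable \<sigma>" by (rule borel_measurable_surface[OF smooth_fun_measurable[OF test_fun_smooth[OF t]]])
 show "integrable \<sigma> phi" by (rule F.integrable_const_bound[of _ B, rotated]) (use B m in auto)
 have "integrable \<sigma> (%x. (cmod (phi x))\<^sup>2)"
  by (rule F.integrable_const_bound[of _ "B\<^sup>2", rotated]) (use B m in \<open>auto intro!: AE_I2 power_mono\<close>)
 then show "square_integrable \<sigma> phi" using m by (simp add: square_integrable_def)
qed

lemma square_integrable_test_mult:
 assumes t: "test_fun UNIV m" and g: "square_integrable \<sigma> g"
 shows "square_integrable \<sigma> (%x. m x * g x)"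
proof -
 obtain B where B: "!!x. cmod (m x) \<le> B" using test_fun_bounded[OF t] by blast
 have m: "m \<in> borel_measurable \<sigma>" "g \<in> borel_measurable \<sigma>"
  using borel_measurable_surface[OF smooth_fun_measurable[OF test_fun_smooth[OF t]]] g by (auto simp: square_integrable_def)
 have "integrable \<sigma> (%x. B\<^sup>2 * (cmod (g x))\<^sup>2)" using g by (simp add: square_integrable_def)
 then have "integrable \<sigma> (%x. (cmod (m x * g x))\<^sup>2)"
 proof (rule Bochner_Integration.integrable_bound)
  show "AE x in \<sigma>. norm ((cmod (m x * g x))\<^sup>2) \<le> norm (B\<^sup>2 * (cmod (g x))\<^sup>2)"
   using B by (auto simp: norm_mult power_mult_distrib intro!: AE_I2 mult_right_mono power_mono)
 qed (use m in measurable)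
 then show ?thesis using m by (simp add: square_integrable_def)
qed

lemma sets_dom [simp]: "\<Omega> \<in> sets borel" "exterior \<Omega> \<in> sets borel" and open_exterior: "open (exterior \<Omega>)"
 using open_dom by auto

lemma AE_not_frontier: "AE x in lborel. x \<in> \<Omega> \<or> x \<in> exterior \<Omega>"
 using AE_not_in[OF null_frontier] by eventually_elim (use open_dom in \<open>auto simp: frontier_def interior_open\<close>)

lemma mul_split: "mul (indicator \<Omega>) F + mul (indicator (exterior \<Omega>)) F = F"
proof -
 note s = mul_sq[OF bm_indicator[OF sets_dom(1)] square_integrable_rep[of F]]
  mul_sq[OF bm_indicator[OF sets_dom(2)] square_integrable_rep[of F]]
 have disj: "x \<in> \<Omega> ==> x \<in> closure \<Omega>" for x using closure_subset by blast
 have "AE x in lborel. indicator \<Omega> x * rep_L2 F x + indicator (exterior \<Omega>) x * rep_L2 F x = rep_L2 F x"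
  using AE_not_frontier
 proof eventually_elim
  fix x assume "x \<in> \<Omega> \<or> x \<in> exterior \<Omega>"
  then show "indicator \<Omega> x * rep_L2 F x + indicator (exterior \<Omega>) x * rep_L2 F x = rep_L2 F x"
   using disj[of x] by (cases "x \<in> \<Omega>") (simp_all add: indicator_def)
 qed
 then have "abs_L2 (%x. indicator \<Omega> x * rep_L2 F x + indicator (exterior \<Omega>) x * rep_L2 F x) = abs_L2 (rep_L2 F)"
  by (simp only: abs_L2_eq_iff[OF square_integrable_add[OF s] square_integrable_rep])
 then show ?thesis unfolding mul_def abs_L2_add[OF s] by simp
qed

lemma L2_eq_sides:
 assumes "mul (indicator \<Omega>) F = mul (indicator \<Omega>) G" "mul (indicator (exterior \<Omega>)) F = mul (indicator (exterior \<Omega>)) G"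
 shows "F = G"
 using trans[OF mul_split[of F, symmetric, unfolded assms] mul_split[of G]] .

lemma cut_split: "cut \<Omega> u + cut (exterior \<Omega>) u = u"
 unfolding cut_def add_Pair mul_split by simp

text \<open>Green's formula for \<open>cnj (psi x) * phi x\<close>, its two directions combined into
  \<open>dbar\<close>. Under the conjugate \<open>dbar\<close> turns into \<open>dz\<close>, which
  is why the second term comes with \<open>DZ\<close>; the factor \<open>1 / 2\<close> is that of
  the Wirtinger derivative.\<close>

lemma green_test_dom:
 assumes phi: "test_fun UNIV phi" and psi: "test_fun UNIV psi"
 shows "DB (cut \<Omega> (jet phi)) \<bullet> abs_L2 psi + fst (cut \<Omega> (jet phi)) \<bullet> DZ (jet psi) = 1 / 2 * (\<integral>x. (normal x * phi x) \<bullet> psi x \<partial>\<sigma>)"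
proof -
 define \<omega> where "\<omega> x = cnj (psi x) * phi x" for x
 note sm = test_fun_smooth[OF phi] test_fun_smooth[OF psi] smooth_fun_cnj[OF test_fun_smooth[OF psi]]
 have \<omega>: "test_fun UNIV \<omega>" unfolding \<omega>_def[abs_def] by (rule test_fun_mult[OF phi sm(3)])
 have ii: "integrable lborel (%x. indicator \<Omega> x *\<^sub>R a x)" if "test_fun UNIV a" for a :: "real^2 => complex"
  using integrable_mult_indicator[OF _ test_fun_integrable[OF that], of \<Omega>] by simp
 have inner_ind: "mul (indicator \<Omega>) (abs_L2 a) \<bullet> abs_L2 b = Re (LBINT x. indicator \<Omega> x *\<^sub>R (cnj (b x) * a x))"
  if a: "test_fun UNIV a" and b: "test_fun UNIV b" for a b :: "real^2 => complex"
 proof -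
  note bi = bm_indicator[OF sets_dom(1)]
  note sq = test_fun_sq[OF a] test_fun_sq[OF b]
  have t: "test_fun UNIV (%x. cnj (b x) * a x)" by (rule test_fun_mult[OF a smooth_fun_cnj[OF test_fun_smooth[OF b]]])
  show ?thesis
   unfolding mul_abs[OF bi sq(1)] inner_abs_L2[OF mul_sq[OF bi sq(1)] sq(2)] integral_Re[OF ii[OF t], symmetric]
   by (rule lint_cong) (auto simp: indicator_def inner_complex_def)
 qed
 have p: "pd j \<omega> x = cnj (pd j psi x) * phi x + cnj (psi x) * pd j phi x" for j x
  unfolding \<omega>_def[abs_def] by (subst pd_mult) (simp_all add: smooth_fun_diffb sm pd_cnj)
 have db: "dbar \<omega> x = cnj (psi x) * dbar phi x + cnj (dz psi x) * phi x" for x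
  unfolding dbar_def dz_def p by (simp add: field_simps)
 have t: "test_fun UNIV (%x. cnj (psi x) * dbar phi x)" "test_fun UNIV (%x. cnj (dz psi x) * phi x)"
  by (intro test_fun_mult smooth_fun_cnj test_fun_smooth[of UNIV] test_fun_dz test_fun_dbar phi psi)+
 have e: "DB (cut \<Omega> (jet phi)) = mul (indicator \<Omega>) (abs_L2 (dbar phi))" "fst (cut \<Omega> (jet phi)) = mul (indicator \<Omega>) (abs_L2 phi)"
  unfolding DB_cut[OF sets_dom(1)] DB_jet[OF phi] by (simp_all add: cut_def jet_def)
 have L: "DB (cut \<Omega> (jet phi)) \<bullet> abs_L2 psi + fst (cut \<Omega> (jet phi)) \<bullet> DZ (jet psi) = Re (LBINT x. indicator \<Omega> x *\<^sub>R dbar \<omega> x)"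
  unfolding e DZ_jet[OF psi] using inner_ind[OF test_fun_dbar[OF phi] psi] inner_ind[OF phi test_fun_dz[OF psi]]
  by (simp add: db scaleR_add_right lint_add[OF ii[OF t(1)] ii[OF t(2)]])
 have "(LBINT x. indicator \<Omega> x *\<^sub>R dbar \<omega> x)
   = (LBINT x. 1 / 2 * (indicator \<Omega> x *\<^sub>R pd 1 \<omega> x + \<i> * (indicator \<Omega> x *\<^sub>R pd 2 \<omega> x)))"
  by (rule lint_cong) (auto simp: dbar_def indicator_def)
 also have "... = 1 / 2 * ((LBINT x. indicator \<Omega> x *\<^sub>R pd 1 \<omega> x) + \<i> * (LBINT x. indicator \<Omega> x *\<^sub>R pd 2 \<omega> x))"
  by (simp only: integral_mult_right_zero lint_add[OF ii[OF test_fun_pd[OF \<omega>]]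
    integrable_mult_right[OF ii[OF test_fun_pd[OF \<omega>]]]])
 also have "... = 1 / 2 * ((\<integral>x. N 1 x *\<^sub>R \<omega> x \<partial>\<sigma>) + \<i> * (\<integral>x. N 2 x *\<^sub>R \<omega> x \<partial>\<sigma>))"
  unfolding green[OF \<omega>] ..
 also have "... = 1 / 2 * (\<integral>x. normal x * \<omega> x \<partial>\<sigma>)"
 proof -
  have i: "integrable \<sigma> (%x. of_real (N j x) * \<omega> x)" for j
   by (rule test_fun_surface(2)[OF test_fun_mult[OF \<omega> test_fun_smooth[OF N_test]]])
  have "(\<integral>x. normal x * \<omega> x \<partial>\<sigma>) = (\<integral>x. of_real (N 1 x) * \<omega> x + \<i> * (of_real (N 2 x) * \<omega> x) \<partial>\<sigma>)"
   by (rule lint_cong) (simp_all add: normal_def algebra_simps)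
  then show ?thesis using i by (simp add: scaleR_conv_of_real)
 qed
 finally have f: "(LBINT x. indicator \<Omega> x *\<^sub>R dbar \<omega> x) = 1 / 2 * (\<integral>x. normal x * \<omega> x \<partial>\<sigma>)" .
 have "Re (LBINT x. indicator \<Omega> x *\<^sub>R dbar \<omega> x) = 1 / 2 * Re (\<integral>x. normal x * \<omega> x \<partial>\<sigma>)"
  unfolding f by simp
 also have "Re (\<integral>x. normal x * \<omega> x \<partial>\<sigma>) = (\<integral>x. (normal x * phi x) \<bullet> psi x \<partial>\<sigma>)"
  unfolding integral_Re[OF test_fun_surface(2)[OF test_fun_mult[OF \<omega> test_fun_smooth[OF test_fun_normal]]], symmetric]
  by (rule lint_cong) (simp_all add: \<omega>_def inner_complex_def algebra_simps)
 finally show ?thesis unfolding L .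
qed

text \<open>\<open>e\<close> is the sign of the outward normal of \<open>D\<close> relative to that
  of \<Omega>; Green's formula can then be stated once for both sides.\<close>

definition side :: "(real^2) set => real => bool" where
 "side D e \<longleftrightarrow> D = \<Omega> \<and> e = 1 \<or> D = exterior \<Omega> \<and> e = - 1"

lemma side_dom: "side \<Omega> 1" "side (exterior \<Omega>) (- 1)"
 by (simp_all add: side_def)

lemma side_open: "side D e ==> open D" and side_sets: "side D e ==> D \<in> sets borel"
 and side_frontier: "side D e ==> surface_measure (frontier D) = \<sigma>" and side_nonzero: "side D e ==> e \<noteq> 0"
 using open_dom open_exterior frontier_exterior by (auto simp: side_def)

text \<open>The formula in the whole plane has no boundary term, so the exterior contributes the
  negative of what \<Omega> contributes.\<close>

lemma green_test:
 assumes D: "side D e" and phi: "test_fun UNIV phi" and psi: "test_fun UNIV psi"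
 shows "DB (cut D (jet phi)) \<bullet> abs_L2 psi + fst (cut D (jet phi)) \<bullet> DZ (jet psi) = e / 2 * (\<integral>x. phi x \<bullet> (conormal x * psi x) \<partial>\<sigma>)"
proof -
 have e: "(normal x * phi x) \<bullet> psi x = phi x \<bullet> (conormal x * psi x)" for x
  by (simp add: conormal_def inner_complex_def algebra_simps)
 note g = green_test_dom[OF phi psi, unfolded e]
 have z: "DB (jet phi) \<bullet> abs_L2 psi + fst (jet phi) \<bullet> DZ (jet psi) = 0"
  unfolding DB_jet[OF phi] DZ_jet[OF psi] using inner_dz_L2[OF phi psi] by (simp add: jet_def)
 have x: "cut (exterior \<Omega>) (jet phi) = jet phi - cut \<Omega> (jet phi)" using cut_split[of "jet phi"] by (simp add: algebra_simps)
 from D consider "D = \<Omega>" "e = 1" | "D = exterior \<Omega>" "e = - 1" by (auto simp: side_def)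
 then show ?thesis
 proof cases
  case 1
  then show ?thesis using g by simp
 next
  case 2
  show ?thesis unfolding 2 x DB_diff fst_diff inner_diff_left using g z by simp
 qed
qed

lemma green_jet_test:
 assumes D: "side D e" and w: "jet_trace \<sigma> D w g" and psi: "test_fun UNIV psi"
 shows "DB w \<bullet> abs_L2 psi + fst w \<bullet> DZ (jet psi) = e / 2 * (\<integral>x. g x \<bullet> (conormal x * psi x) \<partial>\<sigma>)"
proof -
 from w obtain u where u: "!!n. test_fun UNIV (u n)" "(%n. cut D (jet (u n))) \<longlonglongrightarrow> w"
  "(%n. \<integral>x. (cmod (u n x - g x))\<^sup>2 \<partial>\<sigma>) \<longlonglongrightarrow> 0" and g: "square_integrable \<sigma> g"
  by (auto simp: jet_trace_def)
 have "(%n. DB (cut D (jet (u n))) \<bullet> abs_L2 psi + fst (cut D (jet (u n))) \<bullet> DZ (jet psi)) \<longlonglongrightarrow> DB w \<bullet> abs_L2 psi + fst w \<bullet> DZ (jet psi)"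
  by (intro tendsto_add tendsto_inner tendsto_DB tendsto_fst tendsto_const u)
 moreover have "(%n. e / 2 * (\<integral>x. u n x \<bullet> (conormal x * psi x) \<partial>\<sigma>)) \<longlonglongrightarrow> e / 2 * (\<integral>x. g x \<bullet> (conormal x * psi x) \<partial>\<sigma>)"
  by (intro tendsto_mult tendsto_const square_integrable_pairing_tendsto test_fun_surface u g
    square_integrable_test_mult[OF test_fun_conormal] psi)
 ultimately show ?thesis unfolding green_test[OF D u(1) psi] by (rule LIMSEQ_unique)
qed

lemma green_jet:
 assumes D: "side D e" and w: "jet_trace \<sigma> D w g" and v: "jet_trace \<sigma> UNIV v t"
 shows "DB w \<bullet> fst v + fst w \<bullet> DZ v = e / 2 * (\<integral>x. t x \<bullet> (normal x * g x) \<partial>\<sigma>)"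
proof -
 from v obtain u where u: "!!n. test_fun UNIV (u n)" "(%n. jet (u n)) \<longlonglongrightarrow> v"
  "(%n. \<integral>x. (cmod (u n x - t x))\<^sup>2 \<partial>\<sigma>) \<longlonglongrightarrow> 0" and t: "square_integrable \<sigma> t"
  by (auto simp: jet_trace_def cut_UNIV)
 have g: "square_integrable \<sigma> g" using w by (simp add: jet_trace_def)
 have e: "g x \<bullet> (conormal x * y) = y \<bullet> (normal x * g x)" for x y
  by (simp add: conormal_def inner_complex_def algebra_simps)
 have f: "abs_L2 (u n) = fst (jet (u n))" for n by (simp add: jet_def)
 have "(%n. DB w \<bullet> fst (jet (u n)) + fst w \<bullet> DZ (jet (u n))) \<longlonglongrightarrow> DB w \<bullet> fst v + fst w \<bullet> DZ v"
  by (intro tendsto_add tendsto_inner tendsto_DZ tendsto_fst tendsto_const u)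
 moreover have "(%n. e / 2 * (\<integral>x. u n x \<bullet> (normal x * g x) \<partial>\<sigma>)) \<longlonglongrightarrow> e / 2 * (\<integral>x. t x \<bullet> (normal x * g x) \<partial>\<sigma>)"
  by (intro tendsto_mult tendsto_const square_integrable_pairing_tendsto test_fun_surface u g t
    square_integrable_test_mult[OF test_fun_normal])
 ultimately show ?thesis
  using green_jet_test[OF D w u(1)] unfolding e f by (simp only: LIMSEQ_unique)
qed

text \<open>By Green's formula \<open>w\<close> determines the pairings of a trace with all
  \<open>conormal x * psi x\<close>, so the difference \<open>d\<close> is orthogonal to these. As
  \<open>normal\<close> has modulus 1 it may be put on both sides of the product, and
  \<open>d\<close> is orthogonal to test functions, hence to their limits \<open>g\<close> and
  \<open>g'\<close>, hence to itself.\<close>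

lemma has_jet_trace_unique:
 assumes D: "side D e" and g: "jet_trace \<sigma> D w g" and g': "jet_trace \<sigma> D w g'"
 shows "AE x in \<sigma>. g x = g' x"
proof -
 define d where "d x = g x - g' x" for x
 have sq: "square_integrable \<sigma> g" "square_integrable \<sigma> g'" using g g' by (auto simp: jet_trace_def)
 have d: "square_integrable \<sigma> d" unfolding d_def[abs_def] by (rule square_integrable_diff[OF sq])
 have orth: "(\<integral>x. psi x \<bullet> (normal x * d x) \<partial>\<sigma>) = 0" if psi: "test_fun UNIV psi" for psi
 proof -
  have s: "square_integrable \<sigma> (%x. conormal x * psi x)"
   by (rule square_integrable_test_mult[OF test_fun_conormal test_fun_surface(1)[OF psi]])
  have "(\<integral>x. g x \<bullet> (conormal x * psi x) \<partial>\<sigma>) = (\<integral>x. g' x \<bullet> (conormal x * psi x) \<partial>\<sigma>)"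
   using green_jet_test[OF D g psi] green_jet_test[OF D g' psi] side_nonzero[OF D] by simp
  then have "(\<integral>x. d x \<bullet> (conormal x * psi x) \<partial>\<sigma>) = 0"
   unfolding d_def inner_diff_left using square_integrable_inner[OF sq(1) s] square_integrable_inner[OF sq(2) s] by simp
  moreover have "d x \<bullet> (conormal x * psi x) = psi x \<bullet> (normal x * d x)" for x
   by (simp add: conormal_def inner_complex_def algebra_simps)
  ultimately show ?thesis by simp
 qed
 have lim: "(\<integral>x. a x \<bullet> d x \<partial>\<sigma>) = 0" if a: "jet_trace \<sigma> D w a" for a
 proof -
  from a obtain u where u: "!!n. test_fun UNIV (u n)" "(%n. \<integral>x. (cmod (u n x - a x))\<^sup>2 \<partial>\<sigma>) \<longlonglongrightarrow> 0"
   and sa: "square_integrable \<sigma> a" by (auto simp: jet_trace_def)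
  have "(\<integral>x. u n x \<bullet> d x \<partial>\<sigma>) = (\<integral>x. (normal x * u n x) \<bullet> (normal x * d x) \<partial>\<sigma>)" for n
   by (rule lint_cong) (simp_all add: space_surface normal_isometry)
  then have "(\<integral>x. u n x \<bullet> d x \<partial>\<sigma>) = 0" for n
   using orth[OF test_fun_mult[OF u(1) test_fun_smooth[OF test_fun_normal]]] by simp
  then show ?thesis
   using square_integrable_pairing_tendsto[OF test_fun_surface(1)[OF u(1)] sa d u(2)] by (simp add: LIMSEQ_const_iff)
 qed
 have "(\<integral>x. d x \<bullet> d x \<partial>\<sigma>) = (\<integral>x. g x \<bullet> d x - g' x \<bullet> d x \<partial>\<sigma>)"
  by (simp add: d_def inner_diff_left)
 also have "... = 0"
  using square_integrable_inner[OF sq(1) d] square_integrable_inner[OF sq(2) d] lim[OF g] lim[OF g'] by simp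
 finally have "(\<integral>x. d x \<bullet> d x \<partial>\<sigma>) = 0" .
 then have "AE x in \<sigma>. d x \<bullet> d x = 0"
  using integral_nonneg_eq_0_iff_AE[OF square_integrable_inner[OF d d]] by simp
 then show ?thesis by eventually_elim (simp add: d_def)
qed

text \<open>Green's formula on \<Omega> for \<open>conormal x * u x\<close> has the pairing of
  \<open>u\<close> and \<open>v\<close> as its boundary term, because
  \<open>normal x * conormal x = 1\<close> there. Taking the volume side as the definition gives a
  form that is bounded on triples from the start; \<open>surface_op\<close> represents it.\<close>

definition surface_op :: "L2 \<times> L2 \<times> L2 => L2 \<times> L2 \<times> L2" where
 "surface_op u = 2 *\<^sub>R ((DB (cut \<Omega> (mul_jet conormal u)), 0, 0) + DZ_adj (fst (cut \<Omega> (mul_jet conormal u))))"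

definition surface_form :: "L2 \<times> L2 \<times> L2 => L2 \<times> L2 \<times> L2 => real" where
 "surface_form u v = 2 * (DB (cut \<Omega> (mul_jet conormal u)) \<bullet> fst v + fst (cut \<Omega> (mul_jet conormal u)) \<bullet> DZ v)"

lemma surface_op_form: "surface_op u \<bullet> v = surface_form u v"
 unfolding surface_op_def surface_form_def inner_DZ by (simp add: inner_add_left) (simp add: inner_triple)

lemma bounded_linear_surface_op: "bounded_linear surface_op"
proof -
 have b: "bounded_linear (%u. cut \<Omega> (mul_jet conormal u))"
  by (rule bl_comp[OF bounded_linear_cut[OF sets_dom(1)] bounded_linear_mul_jet[OF test_fun_conormal]])
 show ?thesis
  unfolding surface_op_def[abs_def]
  by (intro bounded_linear_const_scaleR bounded_linear_add bounded_linear_Pair bounded_linear_zero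
    bl_comp[OF bounded_linear_DB b] bl_comp[OF bounded_linear_DZ_adj]
    bl_comp[OF bounded_linear_fst b])
qed

lemma surface_form_jet:
 assumes phi: "test_fun UNIV phi" and psi: "test_fun UNIV psi"
 shows "surface_form (jet phi) (jet psi) = (\<integral>x. phi x \<bullet> psi x \<partial>\<sigma>)"
proof -
 have "surface_form (jet phi) (jet psi) = (\<integral>x. (conormal x * phi x) \<bullet> (conormal x * psi x) \<partial>\<sigma>)"
  unfolding surface_form_def mul_jet_jet[OF test_fun_conormal phi]
  using green_test[OF side_dom(1) test_fun_mult[OF phi test_fun_smooth[OF test_fun_conormal]] psi] by (simp add: jet_def)
 also have "... = (\<integral>x. phi x \<bullet> psi x \<partial>\<sigma>)"
 proof (rule lint_cong[OF refl])
  fix x assume "x \<in> space \<sigma>"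
  then have n: "normal x * conormal x = 1" by (simp add: space_surface normal_conormal)
  have "(conormal x * phi x) \<bullet> (conormal x * psi x) = Re (normal x * conormal x * (phi x * cnj (psi x)))"
   by (simp add: inner_complex_def conormal_def algebra_simps)
  then show "(conormal x * phi x) \<bullet> (conormal x * psi x) = phi x \<bullet> psi x"
   unfolding n by (simp add: inner_complex_def)
 qed
 finally show ?thesis .
qed

text \<open>Boundedness of \<open>surface_op\<close> is the trace inequality on test functions:
  converging jets have boundary values that are Cauchy in \<open>L\<^sup>2\<close> of the boundary,
  which is complete.\<close>

lemma H1_plane_trace:
 assumes "v \<in> H1_plane" shows "\<exists>t. jet_trace \<sigma> UNIV v t"
proof -
 obtain phi where phi: "!!n. test_fun UNIV (phi n)" "(%n. jet (phi n)) \<longlonglongrightarrow> v" using H1_plane_sequence[OF assms] by blast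
 obtain B where B: "B > 0" "!!u. norm (surface_op u) \<le> norm u * B"
  using bounded_linear.pos_bounded[OF bounded_linear_surface_op] by blast
 have d: "(\<integral>x. (cmod (phi m x - phi n x))\<^sup>2 \<partial>\<sigma>) \<le> B * (dist (jet (phi m)) (jet (phi n)))\<^sup>2" for m n
 proof -
  note t = test_fun_diff[OF phi(1)[of m] phi(1)[of n]]
  have "(\<integral>x. (cmod (phi m x - phi n x))\<^sup>2 \<partial>\<sigma>) = surface_op (jet (%x. phi m x - phi n x)) \<bullet> jet (%x. phi m x - phi n x)"
   unfolding surface_op_form surface_form_jet[OF t t] by (simp add: power2_norm_eq_inner)
  also have "... \<le> norm (surface_op (jet (%x. phi m x - phi n x))) * norm (jet (%x. phi m x - phi n x))"
   by (rule norm_cauchy_schwarz)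
  also have "... \<le> (norm (jet (%x. phi m x - phi n x)) * B) * norm (jet (%x. phi m x - phi n x))"
   by (rule mult_right_mono[OF B(2) norm_ge_zero])
  finally show ?thesis
   unfolding jet_diff[OF phi(1) phi(1), symmetric] dist_norm by (simp add: power2_eq_square mult_ac)
 qed
 have "\<exists>g. square_integrable \<sigma> g \<and> (%n. \<integral>x. (cmod (phi n x - g x))\<^sup>2 \<partial>\<sigma>) \<longlonglongrightarrow> 0"
 proof (rule square_integrable_complete)
  show "square_integrable \<sigma> (phi n)" for n by (rule test_fun_surface(1)[OF phi(1)])
  fix e :: real assume e: "e > 0"
  then have "sqrt (e / B) > 0" using B by simp
  then obtain M where M: "\<forall>m\<ge>M. \<forall>n\<ge>M. dist (jet (phi m)) (jet (phi n)) < sqrt (e / B)"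
   using LIMSEQ_imp_Cauchy[OF phi(2)] unfolding Cauchy_def by blast
  have "(\<integral>x. (cmod (phi m x - phi n x))\<^sup>2 \<partial>\<sigma>) < e" if "m \<ge> M" "n \<ge> M" for m n
  proof -
   have "dist (jet (phi m)) (jet (phi n)) < sqrt (e / B)" using M that by blast
   then have "(dist (jet (phi m)) (jet (phi n)))\<^sup>2 < (sqrt (e / B))\<^sup>2" by (rule power_strict_mono) simp_all
   then have "B * (dist (jet (phi m)) (jet (phi n)))\<^sup>2 < e" using B e by (simp add: field_simps)
   with d[of m n] show ?thesis by linarith
  qed
  then show "\<exists>N. \<forall>m\<ge>N. \<forall>n\<ge>N. (\<integral>x. (cmod (phi m x - phi n x))\<^sup>2 \<partial>\<sigma>) < e" by blast
 qed
 then obtain g where g: "square_integrable \<sigma> g" "(%n. \<integral>x. (cmod (phi n x - g x))\<^sup>2 \<partial>\<sigma>) \<longlonglongrightarrow> 0" by blast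
 then have "jet_trace \<sigma> UNIV v g"
  unfolding jet_trace_def cut_UNIV by (intro conjI exI[of _ phi]) (simp_all add: phi)
 then show ?thesis by blast
qed

lemma has_jet_trace_mul_jet:
 assumes m: "test_fun UNIV m" and v: "jet_trace \<sigma> UNIV v t"
 shows "jet_trace \<sigma> UNIV (mul_jet m v) (%x. m x * t x)"
proof -
 from v obtain u where u: "!!n. test_fun UNIV (u n)" "(%n. jet (u n)) \<longlonglongrightarrow> v"
  "(%n. \<integral>x. (cmod (u n x - t x))\<^sup>2 \<partial>\<sigma>) \<longlonglongrightarrow> 0" and t: "square_integrable \<sigma> t"
  by (auto simp: jet_trace_def cut_UNIV)
 obtain B where B: "!!x. cmod (m x) \<le> B" using test_fun_bounded[OF m] by blast
 have tm: "test_fun UNIV (%x. m x * u n x)" for n by (rule test_fun_mult[OF u(1) test_fun_smooth[OF m]])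
 have j: "(%n. jet (%x. m x * u n x)) \<longlonglongrightarrow> mul_jet m v"
  unfolding mul_jet_jet[OF m u(1), symmetric] by (rule bounded_linear.tendsto[OF bounded_linear_mul_jet[OF m] u(2)])
 have l: "(%n. \<integral>x. (cmod (m x * u n x - m x * t x))\<^sup>2 \<partial>\<sigma>) \<longlonglongrightarrow> 0"
 proof (rule tendsto_sandwich[OF _ _ tendsto_const])
  show "(%n. B\<^sup>2 * (\<integral>x. (cmod (u n x - t x))\<^sup>2 \<partial>\<sigma>)) \<longlonglongrightarrow> 0"
   by (rule tendsto_mult_right_zero[OF u(3)])
  show "\<forall>\<^sub>F n in sequentially. (\<integral>x. (cmod (m x * u n x - m x * t x))\<^sup>2 \<partial>\<sigma>) \<le> B\<^sup>2 * (\<integral>x. (cmod (u n x - t x))\<^sup>2 \<partial>\<sigma>)"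
  proof (rule always_eventually, rule allI)
   fix n
   note d = square_integrable_diff[OF test_fun_surface(1)[OF u(1)[of n]] t]
   have p: "(cmod (m x * u n x - m x * t x))\<^sup>2 \<le> B\<^sup>2 * (cmod (u n x - t x))\<^sup>2" for x
    unfolding right_diff_distrib[symmetric] norm_mult power_mult_distrib
    by (intro mult_right_mono power_mono B) auto
   have "(\<integral>x. (cmod (m x * u n x - m x * t x))\<^sup>2 \<partial>\<sigma>) \<le> (\<integral>x. B\<^sup>2 * (cmod (u n x - t x))\<^sup>2 \<partial>\<sigma>)"
    by (rule integral_mono[OF _ _ p])
     (use square_integrable_test_mult[OF m d] d in \<open>simp_all add: square_integrable_def right_diff_distrib\<close>)
   then show "(\<integral>x. (cmod (m x * u n x - m x * t x))\<^sup>2 \<partial>\<sigma>) \<le> B\<^sup>2 * (\<integral>x. (cmod (u n x - t x))\<^sup>2 \<partial>\<sigma>)" by simp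
  qed
 qed (auto intro: always_eventually)
 show ?thesis
  unfolding jet_trace_def cut_UNIV
  by (intro conjI exI[of _ "%n x. m x * u n x"] square_integrable_test_mult[OF m t] allI tm j l)
qed

lemma surface_form_trace:
 assumes u: "jet_trace \<sigma> UNIV u t" and v: "jet_trace \<sigma> UNIV v s"
 shows "surface_form u v = (\<integral>x. s x \<bullet> t x \<partial>\<sigma>)"
proof -
 have "surface_form u v = (\<integral>x. s x \<bullet> (normal x * (conormal x * t x)) \<partial>\<sigma>)"
  unfolding surface_form_def
  using green_jet[OF side_dom(1) has_jet_trace_cut[OF sets_dom(1) has_jet_trace_mul_jet[OF test_fun_conormal u]] v] by simp
 also have "... = (\<integral>x. s x \<bullet> t x \<partial>\<sigma>)"
  by (rule lint_cong)
   (simp_all add: space_surface normal_conormal mult.assoc[symmetric])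
 finally show ?thesis .
qed

end

section \<open>Coercive equations as bounded operators\<close>

lemma mul_empty: "mul (indicator {}) F = 0"
 by (simp add: mul_def abs_L2_zero)

lemma inner_scaleC_triple: "(a *\<^sub>C X) \<bullet> v = X \<bullet> (cnj a *\<^sub>C v)" for X v :: "L2 \<times> L2 \<times> L2"
 by (simp add: inner_triple inner_scaleC_left_L2)

lemma inner_scaleC_self: "(a *\<^sub>C F) \<bullet> F = Re a * (norm F)\<^sup>2" for F :: L2
proof -
 have e: "(\<i> *\<^sub>C F) \<bullet> F = 0" using inner_iC_antisym[of F F] by (simp add: inner_commute)
 have "a *\<^sub>C F = Re a *\<^sub>R F + Im a *\<^sub>R (\<i> *\<^sub>C F)"
  by (simp add: scaleC_of_real[symmetric] scaleC_scaleC scaleC_add_left[symmetric] complex_eq[symmetric] mult.commute)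
 then show ?thesis by (simp add: inner_add_left e power2_norm_eq_inner)
qed

lemma DZ_adj_scaleC: "DZ_adj (a *\<^sub>C X) = a *\<^sub>C DZ_adj X"
 by (simp add: DZ_adj_def scaleC_prod_def scaleC_scaleC mult.commute)

lemma norm_H1_plane_DZ:
 assumes "u \<in> H1_plane" shows "(norm u)\<^sup>2 = (norm (fst u))\<^sup>2 + 4 * (norm (DZ u))\<^sup>2"
 using norm_H1_plane[OF assms] norm_triple[of u] by simp

text \<open>Coercivity makes the solution unique and bounds it by \<open>1 / \<kappa>\<close> times
  the data. The equivalence is the form in which a bounded inverse is recognised later.\<close>

lemma lax_milgram_operator:
 fixes V :: "'a::{real_inner, complete_space} set"
 assumes V: "closed V" "subspace V" and L: "bounded_linear L" and \<kappa>: "\<kappa> > 0"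
  and coercive: "!!v. v \<in> V ==> \<kappa> * (norm v)\<^sup>2 \<le> L v \<bullet> v"
 shows "\<exists>R. bounded_linear R \<and> (\<forall>r u. u = R r \<longleftrightarrow> u \<in> V \<and> (\<forall>v\<in>V. L u \<bullet> v = r \<bullet> v))"
proof -
 have bound: "norm u \<le> norm r * (1 / \<kappa>)" if u: "u \<in> V" and e: "!!v. v \<in> V ==> L u \<bullet> v = r \<bullet> v" for u r
 proof -
  have "\<kappa> * (norm u)\<^sup>2 \<le> norm r * norm u"
   using coercive[OF u] e[OF u] norm_cauchy_schwarz[of r u] by simp
  then have "\<kappa> * norm u \<le> norm r"
   by (cases "u = 0") (simp_all add: power2_eq_square mult.assoc[symmetric])
  then show ?thesis using \<kappa> by (simp add: field_simps)
 qed
 have lin: "linear L" using L by (simp add: bounded_linear.linear)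
 have uniq: "u = w" if "u \<in> V" "w \<in> V" "!!v. v \<in> V ==> L u \<bullet> v = r \<bullet> v" "!!v. v \<in> V ==> L w \<bullet> v = r \<bullet> v" for u w r
 proof -
  have "norm (u - w) \<le> norm (0::'a) * (1 / \<kappa>)"
   by (rule bound) (use that subspace_diff[OF V(2)] in \<open>simp_all add: linear_diff[OF lin] inner_diff_left\<close>)
  then show ?thesis by simp
 qed
 have "\<forall>r. \<exists>u. u \<in> V \<and> (\<forall>v\<in>V. L u \<bullet> v = r \<bullet> v)"
  using lax_milgram_exists[OF V L \<kappa> coercive] by blast
 then obtain R where R: "\<forall>r. R r \<in> V \<and> (\<forall>v\<in>V. L (R r) \<bullet> v = r \<bullet> v)" by (rule choice[THEN exE])
 then have RV: "!!r. R r \<in> V" and RL: "!!r v. v \<in> V ==> L (R r) \<bullet> v = r \<bullet> v" by blast+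
 have b: "bounded_linear R"
 proof (rule bounded_linear_intro[where K = "1 / \<kappa>"])
  show "R (x + y) = R x + R y" for x y
   by (rule uniq[where r = "x + y", OF RV subspace_add[OF V(2) RV RV]])
    (simp_all add: RL linear_add[OF lin] inner_add_left)
  show "R (c *\<^sub>R x) = c *\<^sub>R R x" for c x
   by (rule uniq[where r = "c *\<^sub>R x", OF RV subspace_scale[OF V(2) RV]]) (simp_all add: RL linear_scale[OF lin])
  show "norm (R x) \<le> norm x * (1 / \<kappa>)" for x by (rule bound[OF RV RL])
 qed
 have U: "u = R r" if "u \<in> V" "!!v. v \<in> V ==> L u \<bullet> v = r \<bullet> v" for r u
  by (rule uniq[where r = r, OF that(1) RV that(2) RL])
 have "u = R r \<longleftrightarrow> u \<in> V \<and> (\<forall>v\<in>V. L u \<bullet> v = r \<bullet> v)" for r u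
 proof
  assume "u = R r"
  then show "u \<in> V \<and> (\<forall>v\<in>V. L u \<bullet> v = r \<bullet> v)" using RV RL by simp
 qed (use U in blast)
 with b show ?thesis by blast
qed

section \<open>Jump conditions and the weak equation\<close>

context green_domain
begin

lemma has_jet_trace_zero: "jet_trace \<sigma> UNIV 0 (%x. 0)"
proof -
 have "jet (%x. 0) = 0" using jet_scaleC[of "%x. 0" 0] by simp
 then show ?thesis
  unfolding jet_trace_def cut_UNIV by (intro conjI exI[of _ "%n x. 0"]) (simp_all add: square_integrable_zero)
qed

lemma has_jet_trace_scaleC: "jet_trace \<sigma> UNIV u t ==> jet_trace \<sigma> UNIV (a *\<^sub>C u) (%x. a * t x)"
 using has_jet_trace_lincomb[OF _ has_jet_trace_zero _ test_fun_surface(1), of u t a] by simp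

text \<open>Green's formulas for the two sides have opposite signs, so their sum contains only the
  jump; their factor \<open>1 / 2\<close> turns \<open>- 2 * \<alpha>\<close> into
  \<open>- \<alpha>\<close>.\<close>

lemma jump_imp_weak:
 assumes p: "jet_trace \<sigma> \<Omega> wp a" and m: "jet_trace \<sigma> (exterior \<Omega>) wm b"
  and u: "jet_trace \<sigma> UNIV u t"
  and jump: "AE x in \<sigma>. normal x * (a x - b x) = of_real (- 2 * \<alpha>) * t x"
  and v: "v \<in> H1_plane"
 shows "(DB wp + DB wm) \<bullet> fst v + (fst wp + fst wm) \<bullet> DZ v = - \<alpha> * surface_form u v"
proof -
 obtain s where s: "jet_trace \<sigma> UNIV v s" using H1_plane_trace[OF v] by blast
 have sq: "square_integrable \<sigma> s" "square_integrable \<sigma> t" "square_integrable \<sigma> (%x. normal x * a x)"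
  "square_integrable \<sigma> (%x. normal x * b x)"
  using s u p m square_integrable_test_mult[OF test_fun_normal] by (auto simp: jet_trace_def)
 have meas [measurable]: "s \<in> borel_measurable \<sigma>" "t \<in> borel_measurable \<sigma>" "(%x. normal x * a x) \<in> borel_measurable \<sigma>"
  "(%x. normal x * b x) \<in> borel_measurable \<sigma>"
  using sq by (auto simp: square_integrable_def)
 have "(\<integral>x. s x \<bullet> (normal x * a x) \<partial>\<sigma>) - (\<integral>x. s x \<bullet> (normal x * b x) \<partial>\<sigma>)
   = (\<integral>x. s x \<bullet> (normal x * a x) - s x \<bullet> (normal x * b x) \<partial>\<sigma>)"
  using square_integrable_inner[OF sq(1,3)] square_integrable_inner[OF sq(1,4)] by simp
 also have "... = (\<integral>x. (- 2 * \<alpha>) * (s x \<bullet> t x) \<partial>\<sigma>)"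
 proof (rule integral_cong_AE)
  show "AE x in \<sigma>. s x \<bullet> (normal x * a x) - s x \<bullet> (normal x * b x) = (- 2 * \<alpha>) * (s x \<bullet> t x)"
   using jump
  proof eventually_elim
   fix x assume e: "normal x * (a x - b x) = of_real (- 2 * \<alpha>) * t x"
   have "s x \<bullet> (normal x * a x) - s x \<bullet> (normal x * b x) = s x \<bullet> (normal x * (a x - b x))"
    by (simp add: inner_diff_right right_diff_distrib)
   also have "... = (- 2 * \<alpha>) * (s x \<bullet> t x)"
    unfolding e scaleR_conv_of_real[symmetric] by simp
   finally show "s x \<bullet> (normal x * a x) - s x \<bullet> (normal x * b x) = (- 2 * \<alpha>) * (s x \<bullet> t x)" .
  qed
 qed measurable
 also have "... = - 2 * \<alpha> * surface_form u v" unfolding surface_form_trace[OF u s] by simp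
 finally show ?thesis
  using green_jet[OF side_dom(1) p s] green_jet[OF side_dom(2) m s] by (simp add: inner_add_left)
qed

text \<open>Once the correction is subtracted, the weak identity for test functions has no boundary
  term, and \<open>H1_plane_of_dbar\<close> yields a single \<open>y'\<close> for the whole plane.
  It represents the data outside; inside, \<open>y' + c *\<^sub>C M\<close> does. The trace of the
  latter is built from that of \<open>y'\<close>, so the jump relation holds at every boundary point
  and not only almost everywhere.\<close>

lemma weak_imp_jump:
 assumes u: "jet_trace \<sigma> UNIV u t" "u \<in> H1_plane"
  and weak: "!!v. v \<in> H1_plane ==> K \<bullet> fst v + F \<bullet> DZ v = - \<alpha> * surface_form u v"
 obtains y y' a b where "y \<in> H1_plane" "y' \<in> H1_plane" "jet_trace \<sigma> UNIV y a" "jet_trace \<sigma> UNIV y' b"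
  "mul (indicator \<Omega>) F = mul (indicator \<Omega>) (fst y)" "mul (indicator \<Omega>) K = mul (indicator \<Omega>) (DB y)"
  "mul (indicator (exterior \<Omega>)) F = mul (indicator (exterior \<Omega>)) (fst y')"
  "mul (indicator (exterior \<Omega>)) K = mul (indicator (exterior \<Omega>)) (DB y')"
  "\<forall>x\<in>frontier \<Omega>. normal x * (a x - b x) = of_real (- 2 * \<alpha>) * t x"
proof -
 define c where "c = complex_of_real (- 2 * \<alpha>)"
 define M where "M = mul_jet conormal u"
 define k where "k = c *\<^sub>C mul (indicator \<Omega>) (fst M)"
 define l where "l = c *\<^sub>C mul (indicator \<Omega>) (DB M)"
 have M: "M \<in> H1_plane" unfolding M_def by (rule mul_jet_H1_plane[OF test_fun_conormal u(2)])
 have c: "c *\<^sub>C X = (- 2 * \<alpha>) *\<^sub>R X" for X :: L2 unfolding c_def by (rule scaleC_of_real)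
 have "\<exists>y\<in>H1_plane. fst y = F - k \<and> DB y = K - l"
 proof (rule H1_plane_of_dbar)
  fix phi assume t: "test_fun UNIV phi"
  have "surface_form u (jet phi) = 2 * (mul (indicator \<Omega>) (DB M) \<bullet> abs_L2 phi + mul (indicator \<Omega>) (fst M) \<bullet> DZ (jet phi))"
   unfolding surface_form_def M_def[symmetric] DB_cut[OF sets_dom(1)] by (simp add: cut_def) (simp add: jet_def)
  then have "l \<bullet> abs_L2 phi + k \<bullet> DZ (jet phi) = - \<alpha> * surface_form u (jet phi)"
   unfolding k_def l_def c by (simp add: algebra_simps)
  moreover have "K \<bullet> abs_L2 phi + F \<bullet> DZ (jet phi) = - \<alpha> * surface_form u (jet phi)"
   using weak[OF jet_in_H1_plane[OF t]] by (simp add: jet_def)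
  ultimately show "(F - k) \<bullet> DZ (jet phi) = - ((K - l) \<bullet> abs_L2 phi)" by (simp add: inner_diff_left)
 qed
 then obtain y' where y': "y' \<in> H1_plane" "fst y' = F - k" "DB y' = K - l" by blast
 obtain b where b: "jet_trace \<sigma> UNIV y' b" using H1_plane_trace[OF y'(1)] by blast
 have a: "jet_trace \<sigma> UNIV (y' + c *\<^sub>C M) (%x. b x + c * (conormal x * t x))"
  by (rule has_jet_trace_lincomb[OF _ b has_jet_trace_mul_jet[OF test_fun_conormal u(1), folded M_def] test_fun_surface(1)]) simp_all
 have Y: "y' + c *\<^sub>C M \<in> H1_plane"
  by (rule subspace_add[OF subspace_H1_plane y'(1) H1_plane_scaleC[OF M]])
 have ms: "mul (indicator \<Omega>) (X - c *\<^sub>C mul (indicator \<Omega>) Y + c *\<^sub>C Y) = mul (indicator \<Omega>) X" for X Y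
  by (simp add: mul_add mul_diff mul_scaleC bm_indicator mul_indicator_Int)
 have e1: "mul (indicator \<Omega>) F = mul (indicator \<Omega>) (fst (y' + c *\<^sub>C M))"
  unfolding fst_add scaleC_fst_snd y'(2) k_def ms ..
 have "DB (y' + c *\<^sub>C M) = DB y' + c *\<^sub>C DB M"
  using bounded_linear_DB by (simp add: bounded_linear.linear linear_add DB_scaleC)
 then have e2: "mul (indicator \<Omega>) K = mul (indicator \<Omega>) (DB (y' + c *\<^sub>C M))"
  using ms[of K "DB M"] unfolding y'(3) l_def by simp
 have disj: "exterior \<Omega> \<inter> \<Omega> = {}" using closure_subset by blast
 have me: "mul (indicator (exterior \<Omega>)) (X - c *\<^sub>C mul (indicator \<Omega>) Y) = mul (indicator (exterior \<Omega>)) X" for X Y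
  by (simp add: mul_diff mul_scaleC bm_indicator mul_indicator_Int disj mul_empty del: Compl_iff)
 have e3: "mul (indicator (exterior \<Omega>)) F = mul (indicator (exterior \<Omega>)) (fst y')"
  "mul (indicator (exterior \<Omega>)) K = mul (indicator (exterior \<Omega>)) (DB y')"
  unfolding y' k_def l_def me by simp_all
 have j: "normal x * (b x + c * (conormal x * t x) - b x) = of_real (- 2 * \<alpha>) * t x" if "x \<in> frontier \<Omega>" for x
 proof -
  have "normal x * (b x + c * (conormal x * t x) - b x) = c * (normal x * conormal x) * t x" by (simp add: algebra_simps)
  then show ?thesis unfolding normal_conormal[OF that] c_def by simp
 qed
 then have "\<forall>x\<in>frontier \<Omega>. normal x * (b x + c * (conormal x * t x) - b x) = of_real (- 2 * \<alpha>) * t x" by blast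
 then show ?thesis by (rule that[OF Y y'(1) a b e1 e2 e3])
qed

text \<open>The form is hermitian: on the boundary \<open>\<i> * t x\<close> is orthogonal to
  \<open>t x\<close> for the real inner product. Hence the imaginary part of a rotation never meets
  the boundary term.\<close>

lemma surface_op_scaleC_self:
 assumes "u \<in> H1_plane" shows "(a *\<^sub>C surface_op u) \<bullet> u = Re a * surface_form u u"
proof -
 obtain t where t: "jet_trace \<sigma> UNIV u t" using H1_plane_trace[OF assms] by blast
 have "(a *\<^sub>C surface_op u) \<bullet> u = (\<integral>x. (cnj a * t x) \<bullet> t x \<partial>\<sigma>)"
  unfolding inner_scaleC_triple surface_op_form by (rule surface_form_trace[OF t has_jet_trace_scaleC[OF t]])
 also have "... = (\<integral>x. Re a * (t x \<bullet> t x) \<partial>\<sigma>)"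
  by (rule lint_cong) (simp_all add: inner_complex_def algebra_simps)
 finally show ?thesis unfolding surface_form_trace[OF t t] by simp
qed

text \<open>The bound has to be a product: in the rotated form the coefficient of
  \<open>(norm (fst u))\<^sup>2\<close> is only known to be at least 1, so a term can be absorbed by
  a larger gradient term only if it has a factor \<open>norm (DZ u)\<close>. The term of order zero,
  where \<open>dbar\<close> falls on \<open>conormal\<close>, is localised in \<Omega> and gets this
  factor from \<open>poincare_bounded_set\<close>.\<close>

lemma surface_form_bound:
 "\<exists>C\<ge>0. \<forall>u\<in>H1_plane. \<bar>surface_form u u\<bar> \<le> C * (norm (fst u) * norm (DZ u))"
proof -
 let ?I = "indicator \<Omega> :: real^2 => complex"
 note t = test_fun_conormal
 obtain B where B: "B \<ge> 0" "!!F. norm (mul conormal F) \<le> B * norm F"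
  using mul_bounded[OF bm_test_fun[OF t]] by blast
 obtain B' where B': "B' \<ge> 0" "!!F. norm (mul (dbar conormal) F) \<le> B' * norm F"
  using mul_bounded[OF bm_test_fun[OF test_fun_dbar[OF t]]] by blast
 obtain P where P: "P \<ge> 0" "!!u. u \<in> H1_plane ==> (norm (mul ?I (fst u)))\<^sup>2 \<le> P * (norm (fst u) * norm (fst (snd u)))"
  using poincare_bounded_set[OF bounded_dom sets_dom(1)] by blast
 have "\<bar>surface_form u u\<bar> \<le> (4 * B + 4 * B' * P) * (norm (fst u) * norm (DZ u))" if u: "u \<in> H1_plane" for u
 proof -
  let ?q = "norm (fst u)" and ?d = "norm (DZ u)"
  have comm: "mul ?I (mul (dbar conormal) F) = mul (dbar conormal) (mul ?I F)" for F
   using mul_mul(2)[OF bm_indicator[OF sets_dom(1)] bm_test_fun[OF test_fun_dbar[OF t]], of F]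
    mul_mul(2)[OF bm_test_fun[OF test_fun_dbar[OF t]] bm_indicator[OF sets_dom(1)], of F]
   by (simp add: mult.commute)
  have "mul ?I (mul (dbar conormal) (fst u)) \<bullet> fst u = mul ?I (mul ?I (mul (dbar conormal) (fst u))) \<bullet> fst u"
   by (simp add: mul_indicator_Int)
  also have "... = mul ?I (mul (dbar conormal) (fst u)) \<bullet> mul ?I (fst u)"
   by (rule inner_mul_indicator[OF sets_dom(1)])
  also have "... = mul (dbar conormal) (mul ?I (fst u)) \<bullet> mul ?I (fst u)" by (simp only: comm)
  finally have i: "mul ?I (mul (dbar conormal) (fst u)) \<bullet> fst u = mul (dbar conormal) (mul ?I (fst u)) \<bullet> mul ?I (fst u)" .
  have "(norm (fst (snd u)))\<^sup>2 \<le> (2 * ?d)\<^sup>2"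
   using norm_H1_plane[OF u] by (simp add: power_mult_distrib)
  then have n: "norm (fst (snd u)) \<le> 2 * ?d" by (rule power2_le_imp_le) simp
  have p: "(norm (mul ?I (fst u)))\<^sup>2 \<le> P * (?q * (2 * ?d))"
   by (rule order_trans[OF P(2)[OF u] mult_left_mono[OF mult_left_mono[OF n norm_ge_zero] P(1)]])
  have 1: "\<bar>mul ?I (mul (dbar conormal) (fst u)) \<bullet> fst u\<bar> \<le> B' * (P * (?q * (2 * ?d)))"
  proof -
   have "\<bar>mul (dbar conormal) (mul ?I (fst u)) \<bullet> mul ?I (fst u)\<bar>
     \<le> norm (mul (dbar conormal) (mul ?I (fst u))) * norm (mul ?I (fst u))" by (rule Cauchy_Schwarz_ineq2)
   also have "... \<le> B' * norm (mul ?I (fst u)) * norm (mul ?I (fst u))"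
    by (rule mult_right_mono[OF B'(2) norm_ge_zero])
   also have "... = B' * (norm (mul ?I (fst u)))\<^sup>2" by (simp add: power2_eq_square)
   also have "... \<le> B' * (P * (?q * (2 * ?d)))" by (rule mult_left_mono[OF p B'(1)])
   finally show ?thesis unfolding i .
  qed
  have 2: "\<bar>mul ?I (mul conormal F) \<bullet> G\<bar> \<le> B * (norm F * norm G)" for F G
  proof -
   have "\<bar>mul ?I (mul conormal F) \<bullet> G\<bar> \<le> norm (mul ?I (mul conormal F)) * norm G" by (rule Cauchy_Schwarz_ineq2)
   also have "... \<le> (B * norm F) * norm G"
    by (rule mult_right_mono[OF order_trans[OF norm_mul_indicator[OF sets_dom(1)] B(2)] norm_ge_zero])
   finally show ?thesis by (simp add: mult.assoc)
  qed
  have sum3: "\<bar>2 * (a + b + c)\<bar> \<le> 2 * (p + q + r)" if "\<bar>a\<bar> \<le> p" "\<bar>b\<bar> \<le> q" "\<bar>c\<bar> \<le> r" for a b c p q r :: real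
   using that unfolding abs_le_iff by auto
  have e: "surface_form u u = 2 * (mul ?I (mul (dbar conormal) (fst u)) \<bullet> fst u + mul ?I (mul conormal (DB u)) \<bullet> fst u
    + mul ?I (mul conormal (fst u)) \<bullet> DZ u)"
   unfolding surface_form_def DB_cut[OF sets_dom(1)] DB_mul_jet[OF t] mul_add[OF bm_indicator[OF sets_dom(1)]]
    inner_add_left by (simp add: cut_def mul_jet_def)
  have "\<bar>surface_form u u\<bar> \<le> 2 * (B' * (P * (?q * (2 * ?d))) + B * (?d * ?q) + B * (?q * ?d))"
   unfolding e by (rule sum3[OF 1 2[of "DB u" "fst u", unfolded norm_DB_H1_plane[OF u]] 2[of "fst u" "DZ u"]])
  then show ?thesis by (simp add: algebra_simps)
 qed
 moreover have "4 * B + 4 * B' * P \<ge> 0" using B(1) B'(1) P(1) by simp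
 ultimately show ?thesis by blast
qed

section \<open>Coercivity of the form\<close>

definition form_op :: "real => complex => real => L2 \<times> L2 \<times> L2 => L2 \<times> L2 \<times> L2" where
 "form_op \<alpha> z \<kappa> u = (4 / z) *\<^sub>C DZ_adj (DZ u) - \<alpha> *\<^sub>R surface_op u - (1 + z * of_real \<kappa>) *\<^sub>C (fst u, 0, 0)"

lemma bounded_linear_form_op: "bounded_linear (form_op \<alpha> z \<kappa>)"
 unfolding form_op_def[abs_def]
 by (intro bounded_linear_sub bl_comp[OF bounded_linear_scaleC] bounded_linear_Pair bounded_linear_zero
   bl_comp[OF bounded_linear_DZ_adj] bounded_linear_DZ bounded_linear_const_scaleR
   bounded_linear_surface_op bounded_linear_fst)

text \<open>Rotating the form by a complex number with large imaginary part makes the gradient term dominate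
 the boundary term, uniformly in \<open>\<kappa>\<close>.\<close>

lemma form_op_coercive:
 assumes z: "z \<notin> \<real>"
 shows "\<exists>\<omega>. \<omega> \<noteq> 0 \<and> (\<forall>\<kappa>\<ge>0. \<forall>u\<in>H1_plane. 1 / 2 * (norm u)\<^sup>2 \<le> (\<omega> *\<^sub>C form_op \<alpha> z \<kappa> u) \<bullet> u)"
proof -
 obtain C where C: "C \<ge> 0" "!!u. u \<in> H1_plane ==> \<bar>surface_form u u\<bar> \<le> C * (norm (fst u) * norm (DZ u))"
  using surface_form_bound by blast
 define x where "x = Re z" define y where "y = Im z"
 have y: "y \<noteq> 0" using z complex_is_Real_iff by (auto simp: y_def)
 then have z0: "z \<noteq> 0" by (auto simp: y_def)
 \<comment> \<open>\<open>S \<ge> \<bar>x\<bar>\<close> makes the \<kappa>-term nonnegative. The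
   second summand makes the coefficient of the gradient term at least
   \<open>(\<alpha> * C)\<^sup>2 / 2 + 2\<close>: the first part absorbs the boundary term by
   Young's inequality, and 2 is half of the 4 in \<open>norm_H1_plane_DZ\<close>.\<close>
 define S where "S = (\<bar>x\<bar> + (cmod z)\<^sup>2 * ((\<alpha> * C)\<^sup>2 / 2 + 2) / 4)"
 \<comment> \<open>The real part \<open>- 1\<close> gives the term of order zero a positive sign;
   dividing by \<open>y\<close> makes the real part of \<open>\<omega> * cnj z\<close> equal to
   \<open>S - x\<close>, whatever the sign of \<open>y\<close>.\<close>
 define \<omega> where "\<omega> = Complex (- 1) (S / y)"
 have zz: "(cmod z)\<^sup>2 > 0" using z0 by simp
 have S: "S \<ge> \<bar>x\<bar>" by (simp add: S_def)
 have zcn: "x\<^sup>2 + y\<^sup>2 = (cmod z)\<^sup>2" by (simp add: cmod_power2 x_def y_def)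
 have "\<omega> * (4 / z) = of_real (4 / (cmod z)\<^sup>2) * (\<omega> * cnj z)"
  by (subst complex_div_cnj) simp
 then have "Re (\<omega> * (4 / z)) = 4 / (cmod z)\<^sup>2 * Re (\<omega> * cnj z)" by (simp only: times_complex.sel Re_complex_of_real Im_complex_of_real)
 also have "Re (\<omega> * cnj z) = S - x"
  using y by (simp add: \<omega>_def x_def[symmetric] y_def[symmetric])
 also have "4 / (cmod z)\<^sup>2 * (S - x) = 4 * (S - x) / (cmod z)\<^sup>2" by simp
 also have "... \<ge> 4 * ((cmod z)\<^sup>2 * ((\<alpha> * C)\<^sup>2 / 2 + 2) / 4) / (cmod z)\<^sup>2"
  by (intro divide_right_mono mult_left_mono) (simp_all add: S_def)
 finally have A: "(\<alpha> * C)\<^sup>2 / 2 + 2 \<le> Re (\<omega> * (4 / z))" using zz by simp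
 have R: "Re (\<omega> * (1 + z * of_real \<kappa>)) = - 1 - \<kappa> * (x + S)" for \<kappa>
  using y by (simp add: \<omega>_def x_def[symmetric] y_def[symmetric] algebra_simps)
 have main: "1 / 2 * (norm u)\<^sup>2 \<le> (\<omega> *\<^sub>C form_op \<alpha> z \<kappa> u) \<bullet> u" if \<kappa>: "\<kappa> \<ge> 0" and u: "u \<in> H1_plane" for \<kappa> u
 proof -
  define q where "q = norm (fst u)" define d where "d = norm (DZ u)"
  have qd: "q \<ge> 0" "d \<ge> 0" by (simp_all add: q_def d_def)
  have "(\<omega> *\<^sub>C form_op \<alpha> z \<kappa> u) \<bullet> u = ((\<omega> * (4 / z)) *\<^sub>C DZ_adj (DZ u)) \<bullet> u - \<alpha> * ((\<omega> *\<^sub>C surface_op u) \<bullet> u)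
    - ((\<omega> * (1 + z * of_real \<kappa>)) *\<^sub>C (fst u, 0, 0)) \<bullet> u"
   unfolding form_op_def by (simp add: scaleC_diff_right scaleC_scaleC scaleC_scaleR_commute inner_diff_left)
  also have "((\<omega> * (4 / z)) *\<^sub>C DZ_adj (DZ u)) \<bullet> u = Re (\<omega> * (4 / z)) * d\<^sup>2"
   unfolding DZ_adj_scaleC[symmetric] inner_DZ[symmetric] inner_scaleC_self d_def ..
  also have "((\<omega> * (1 + z * of_real \<kappa>)) *\<^sub>C (fst u, 0, 0)) \<bullet> u = (- 1 - \<kappa> * (x + S)) * q\<^sup>2"
  proof -
   have "((\<omega> * (1 + z * of_real \<kappa>)) *\<^sub>C (fst u, 0, 0)) \<bullet> u = ((\<omega> * (1 + z * of_real \<kappa>)) *\<^sub>C fst u) \<bullet> fst u"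
    unfolding inner_triple by simp
   then show ?thesis unfolding inner_scaleC_self R q_def .
  qed
  also have "(\<omega> *\<^sub>C surface_op u) \<bullet> u = - surface_form u u"
   unfolding surface_op_scaleC_self[OF u] by (simp add: \<omega>_def)
  finally have e: "(\<omega> *\<^sub>C form_op \<alpha> z \<kappa> u) \<bullet> u = Re (\<omega> * (4 / z)) * d\<^sup>2 + \<alpha> * surface_form u u + (1 + \<kappa> * (x + S)) * q\<^sup>2"
   by (simp add: algebra_simps)
  have 1: "((\<alpha> * C)\<^sup>2 / 2 + 2) * d\<^sup>2 \<le> Re (\<omega> * (4 / z)) * d\<^sup>2" by (rule mult_right_mono[OF A]) simp
  have "\<bar>\<alpha> * surface_form u u\<bar> \<le> \<bar>\<alpha>\<bar> * (C * (q * d))"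
   unfolding abs_mult q_def d_def by (rule mult_left_mono[OF C(2)[OF u]]) simp
  then have 2: "- ((\<bar>\<alpha>\<bar> * C * d) * q) \<le> \<alpha> * surface_form u u" by (simp add: mult_ac abs_le_iff)
  have "0 \<le> \<kappa> * (x + S)" using \<kappa> S by simp
  then have 3: "q\<^sup>2 \<le> (1 + \<kappa> * (x + S)) * q\<^sup>2" using mult_right_mono[of 1 "1 + \<kappa> * (x + S)" "q\<^sup>2"] by simp
  have "0 \<le> (q - \<bar>\<alpha>\<bar> * C * d)\<^sup>2" by simp
  also have "... = q\<^sup>2 - 2 * ((\<bar>\<alpha>\<bar> * C * d) * q) + (\<alpha> * C)\<^sup>2 * d\<^sup>2"
   by (simp add: power2_diff power_mult_distrib)
  finally show ?thesis
   unfolding e norm_H1_plane_DZ[OF u] q_def[symmetric] d_def[symmetric] using 1 2 3 by (simp add: algebra_simps)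
 qed
 have "\<omega> \<noteq> 0" by (simp add: \<omega>_def complex_eq_iff)
 then show ?thesis using main by blast
qed

end

section \<open>Weak formulation of the operators\<close>

definition wirtinger_dz :: "(real^2) set => (real^2 => complex) => real^2 => complex" where
 "wirtinger_dz D f x = (weak_pd D 1 f x - \<i> * weak_pd D 2 f x) / 2"

lemma res_wirtinger:
 assumes D: "D \<in> sets borel" and H: "H1 D f"
 shows "L2_on D (wirtinger_dbar D f)" "res D (wirtinger_dbar D f) = DB (weak_jet D f)"
  "L2_on D (wirtinger_dz D f)" "res D (wirtinger_dz D f) = DZ (weak_jet D f)"
proof -
 note L = H1_L2_on(2)[OF H]
 have e: "wirtinger_dbar D f = (%x. 1 / 2 * (weak_pd D 1 f x + \<i> * weak_pd D 2 f x))"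
  "wirtinger_dz D f = (%x. 1 / 2 * (weak_pd D 1 f x - \<i> * weak_pd D 2 f x))"
  by (auto simp: wirtinger_dbar_def wirtinger_dz_def)
 have p: "L2_on D (%x. weak_pd D 1 f x + \<i> * weak_pd D 2 f x)" "L2_on D (%x. weak_pd D 1 f x - \<i> * weak_pd D 2 f x)"
  by (rule L2_on_add[OF D L L2_on_cmult[OF L]], rule L2_on_diff[OF D L L2_on_cmult[OF L]])
 show "L2_on D (wirtinger_dbar D f)" "L2_on D (wirtinger_dz D f)"
  unfolding e by (rule L2_on_cmult[OF p(1)], rule L2_on_cmult[OF p(2)])
 show "res D (wirtinger_dbar D f) = DB (weak_jet D f)" "res D (wirtinger_dz D f) = DZ (weak_jet D f)"
  unfolding e res_cmult[OF D p(1)] res_cmult[OF D p(2)] res_add[OF D L L2_on_cmult[OF L]] res_diff[OF D L L2_on_cmult[OF L]]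
   res_cmult[OF D L] DB_def DZ_def weak_jet_def by simp_all
qed

lemma spinor_components [simp]: "spinor F x $ 1 = rep_L2 (fst F) x" "spinor F x $ 2 = rep_L2 (snd F) x"
 by (simp_all add: spinor_def)

lemma spinor_functions: "(%x. spinor F x $ 1) = rep_L2 (fst F)" "(%x. spinor F x $ 2) = rep_L2 (snd F)"
 by (simp_all add: spinor_def)

lemma H1_spinor_iff: "H1_spinor D (spinor F) \<longleftrightarrow> H1 D (rep_L2 (fst F)) \<and> H1 D (rep_L2 (snd F))"
 by (simp add: H1_spinor_def all_2 spinor_functions)

lemma dirac_expr_spinor:
 "dirac_expr D c (spinor F) x $ 1 = (- 2 * \<i> * of_real c) * wirtinger_dz D (rep_L2 (snd F)) x + of_real (c\<^sup>2 / 2) * rep_L2 (fst F) x"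
 "dirac_expr D c (spinor F) x $ 2 = (- 2 * \<i> * of_real c) * wirtinger_dbar D (rep_L2 (fst F)) x - of_real (c\<^sup>2 / 2) * rep_L2 (snd F) x"
 by (simp_all add: dirac_expr_def pauli1_def pauli2_def pauli3_def matrix_vector_mult_def sum_2 weak_pd_spinor_def
   spinor_functions wirtinger_dz_def wirtinger_dbar_def field_simps)

lemma dirac_equation_iff:
 assumes D: "D \<in> sets borel" and H: "H1 D (rep_L2 (fst F))" "H1 D (rep_L2 (snd F))"
 shows "(AE x in lborel. x \<in> D --> spinor G x = dirac_expr D c (spinor F) x) \<longleftrightarrow>
  mul (indicator D) (fst G) = (- 2 * \<i> * of_real c) *\<^sub>C DZ (weak_jet D (rep_L2 (snd F))) + of_real (c\<^sup>2 / 2) *\<^sub>C mul (indicator D) (fst F) \<and>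
  mul (indicator D) (snd G) = (- 2 * \<i> * of_real c) *\<^sub>C DB (weak_jet D (rep_L2 (fst F))) - of_real (c\<^sup>2 / 2) *\<^sub>C mul (indicator D) (snd F)"
  (is "?L \<longleftrightarrow> ?A \<and> ?B")
proof -
 let ?k = "- 2 * \<i> * of_real c" and ?m = "of_real (c\<^sup>2 / 2)"
 note W1 = res_wirtinger[OF D H(1)] and W2 = res_wirtinger[OF D H(2)]
 note Lk = L2_on_cmult[where a = ?k] and Lm = L2_on_cmult[where a = ?m, OF L2_on_rep[OF D]]
 have "?L \<longleftrightarrow> (AE x in lborel. (x \<in> D --> rep_L2 (fst G) x = ?k * wirtinger_dz D (rep_L2 (snd F)) x + ?m * rep_L2 (fst F) x) \<and>
  (x \<in> D --> rep_L2 (snd G) x = ?k * wirtinger_dbar D (rep_L2 (fst F)) x - ?m * rep_L2 (snd F) x))"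
  unfolding vec_eq_iff all_2 dirac_expr_spinor spinor_components by (intro AE_cong) blast
 also have "... \<longleftrightarrow> res D (rep_L2 (fst G)) = res D (%x. ?k * wirtinger_dz D (rep_L2 (snd F)) x + ?m * rep_L2 (fst F) x) \<and>
  res D (rep_L2 (snd G)) = res D (%x. ?k * wirtinger_dbar D (rep_L2 (fst F)) x - ?m * rep_L2 (snd F) x)"
  unfolding res_eq_iff[OF D L2_on_rep[OF D] L2_on_add[OF D Lk[OF W2(3)] Lm]]
   res_eq_iff[OF D L2_on_rep[OF D] L2_on_diff[OF D Lk[OF W1(1)] Lm]] by (rule AE_conj_iff)
 also have "... \<longleftrightarrow> ?A \<and> ?B"
  unfolding res_add[OF D Lk[OF W2(3)] Lm] res_diff[OF D Lk[OF W1(1)] Lm] res_cmult[OF D W2(3)] res_cmult[OF D W1(1)]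
   res_cmult[OF D L2_on_rep[OF D]] W1(2) W2(4) res_rep ..
 finally show ?thesis .
qed

context green_domain
begin

lemma has_trace_side:
 assumes "side D e" shows "has_trace D f g \<longleftrightarrow> H1 D f \<and> jet_trace \<sigma> D (weak_jet D f) g"
 using has_trace_iff[OF side_open[OF assms]] side_frontier[OF assms] by simp

lemma has_trace_cut:
 assumes D: "side D e" and v: "v \<in> H1_plane" "jet_trace \<sigma> UNIV v t" and f: "L2_on D f" "res D f = mul (indicator D) (fst v)"
 shows "H1 D f" "weak_jet D f = cut D v" "has_trace D f t"
proof -
 show "H1 D f" "weak_jet D f = cut D v" by (rule weak_jet_cut[OF side_open[OF D] f(1) v(1) f(2)])+
 then show "has_trace D f t"
  unfolding has_trace_side[OF D] using has_jet_trace_cut[OF side_sets[OF D] v(2)] by simp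
qed

lemma trace_cut_unique:
 assumes D: "side D e" and v: "v \<in> H1_plane" "jet_trace \<sigma> UNIV v t" and f: "L2_on D f" "res D f = mul (indicator D) (fst v)"
  and g: "has_trace D f g"
 shows "AE x in \<sigma>. g x = t x"
 using has_trace_cut(2)[OF D v f] g has_jet_trace_unique[OF D _ has_jet_trace_cut[OF side_sets[OF D] v(2)]]
 by (simp add: has_trace_side[OF D])

lemma disjoint_sides: "\<Omega> \<inter> exterior \<Omega> = {}" "exterior \<Omega> \<inter> \<Omega> = {}"
 using closure_subset by blast+

lemma glue_res:
 assumes f: "L2_on \<Omega> f" "L2_on (exterior \<Omega>) g"
 shows "L2_on UNIV (glue \<Omega> f g)" "res UNIV (glue \<Omega> f g) = res \<Omega> f + res (exterior \<Omega>) g"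
proof -
 have e: "(%x. indicator UNIV x * glue \<Omega> f g x) = (%x. indicator \<Omega> x * f x + indicator (exterior \<Omega>) x * g x)"
 proof
  fix x
  show "indicator UNIV x * glue \<Omega> f g x = indicator \<Omega> x * f x + indicator (exterior \<Omega>) x * g x"
   using closure_subset[of \<Omega>] by (cases "x \<in> \<Omega>"; cases "x \<in> exterior \<Omega>") (auto simp: glue_def indicator_def)
 qed
 note s = f(1)[unfolded L2_on_iff[OF sets_dom(1)]] f(2)[unfolded L2_on_iff[OF sets_dom(2)]]
 have U: "UNIV \<in> sets borel" by simp
 show "L2_on UNIV (glue \<Omega> f g)" unfolding L2_on_iff[OF U] e by (rule square_integrable_add[OF s])
 show "res UNIV (glue \<Omega> f g) = res \<Omega> f + res (exterior \<Omega>) g" unfolding res_def e abs_L2_add[OF s] ..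
qed

text \<open>The Laplacian is four times \<open>dz\<close> after \<open>dbar\<close>. One integration
  by parts on \<open>D\<close> puts \<open>dbar\<close> on \<open>F\<close>, where it is
  \<open>fst u\<close>; the other is done in the plane, since test functions in \<open>D\<close> do
  not see the cut, and puts \<open>DZ\<close> on \<open>u\<close>.\<close>

lemma laplacian_iff:
 assumes D: "side D e" and H: "H1 D (rep_L2 F)" and u: "u \<in> H1_plane"
  and db: "DB (weak_jet D (rep_L2 F)) = mul (indicator D) (fst u)"
 shows "is_weak_laplacian D (rep_L2 F) (%x. - rep_L2 G x) \<longleftrightarrow> mul (indicator D) G = mul (indicator D) ((- 4) *\<^sub>R DZ u)"
proof -
 note Db = side_sets[OF D]
 have n: "(%x. - rep_L2 G x) = (%x. (- 1) * rep_L2 G x)" by simp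
 have L: "L2_on D (%x. (- 1) * rep_L2 G x)" by (rule L2_on_cmult[OF L2_on_rep[OF Db]])
 have r: "res D (%x. (- 1) * rep_L2 G x) = - mul (indicator D) G"
  unfolding res_cmult[OF Db L2_on_rep[OF Db]] res_rep scaleC_minus_one ..
 have f4: "4 *\<^sub>C X = 4 *\<^sub>R X" for X :: L2 using scaleC_of_real[of 4 X] by simp
 have key: "res D (rep_L2 F) \<bullet> (4 *\<^sub>C DZ (jet (dbar phi))) = - (((- 4) *\<^sub>R DZ u) \<bullet> abs_L2 phi)"
  "res D (%x. (- 1) * rep_L2 G x) \<bullet> abs_L2 phi = - (G \<bullet> abs_L2 phi)" if t: "test_fun D phi" for phi
 proof -
  have tU: "test_fun UNIV phi" using test_fun_mono[OF t] by blast
  have "res D (rep_L2 F) \<bullet> DZ (jet (dbar phi)) = - (mul (indicator D) (fst u) \<bullet> abs_L2 (dbar phi))"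
   using weak_jet_DZ[OF Db H test_fun_dbar[OF t]] unfolding db .
  also have "... = - (fst u \<bullet> DB (jet phi))"
   unfolding inner_mul_indicator[OF Db] mul_indicator_test[OF Db test_fun_dbar[OF t]] DB_jet[OF tU] ..
  also have "... = DZ u \<bullet> abs_L2 phi" unfolding H1_plane_DZ_DB(2)[OF u tU] by simp
  finally show "res D (rep_L2 F) \<bullet> (4 *\<^sub>C DZ (jet (dbar phi))) = - (((- 4) *\<^sub>R DZ u) \<bullet> abs_L2 phi)" unfolding f4 by simp
  show "res D (%x. (- 1) * rep_L2 G x) \<bullet> abs_L2 phi = - (G \<bullet> abs_L2 phi)"
   unfolding r inner_minus_left inner_mul_indicator[OF Db] mul_indicator_test[OF Db t] ..
 qed
 have "is_weak_laplacian D (rep_L2 F) (%x. - rep_L2 G x) \<longleftrightarrow>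
   (\<forall>phi. test_fun D phi --> ((- 4) *\<^sub>R DZ u) \<bullet> abs_L2 phi = G \<bullet> abs_L2 phi)"
 proof -
  have "(\<forall>phi. test_fun D phi --> res D (rep_L2 F) \<bullet> (4 *\<^sub>C DZ (jet (dbar phi))) = res D (%x. (- 1) * rep_L2 G x) \<bullet> abs_L2 phi) \<longleftrightarrow>
   (\<forall>phi. test_fun D phi --> ((- 4) *\<^sub>R DZ u) \<bullet> abs_L2 phi = G \<bullet> abs_L2 phi)"
  proof (intro iff_allI imp_cong refl)
   fix phi assume t: "test_fun D phi"
   show "(res D (rep_L2 F) \<bullet> (4 *\<^sub>C DZ (jet (dbar phi))) = res D (%x. (- 1) * rep_L2 G x) \<bullet> abs_L2 phi) =
    (((- 4) *\<^sub>R DZ u) \<bullet> abs_L2 phi = G \<bullet> abs_L2 phi)" unfolding key[OF t] neg_equal_iff_equal ..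
  qed
  then show ?thesis unfolding n is_weak_laplacian_iff[OF Db] using L L2_on_rep[OF Db] by blast
 qed
 also have "... \<longleftrightarrow> mul (indicator D) G = mul (indicator D) ((- 4) *\<^sub>R DZ u)"
 proof
  assume "\<forall>phi. test_fun D phi --> ((- 4) *\<^sub>R DZ u) \<bullet> abs_L2 phi = G \<bullet> abs_L2 phi"
  then show "mul (indicator D) G = mul (indicator D) ((- 4) *\<^sub>R DZ u)"
   by (intro L2_eq_on_open[OF side_open[OF D]]) (simp only:)
 next
  assume a: "mul (indicator D) G = mul (indicator D) ((- 4) *\<^sub>R DZ u)"
  have m: "X \<bullet> abs_L2 phi = mul (indicator D) X \<bullet> abs_L2 phi" if "test_fun D phi" for X phi
   unfolding inner_mul_indicator[OF Db] mul_indicator_test[OF Db that] ..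
  show "\<forall>phi. test_fun D phi --> ((- 4) *\<^sub>R DZ u) \<bullet> abs_L2 phi = G \<bullet> abs_L2 phi"
  proof (intro allI impI)
   fix phi assume t: "test_fun D phi"
   show "((- 4) *\<^sub>R DZ u) \<bullet> abs_L2 phi = G \<bullet> abs_L2 phi"
    unfolding m[OF t, of G] m[OF t, of "(- 4) *\<^sub>R DZ u"] a ..
  qed
 qed
 finally show ?thesis .
qed

lemma outward_normal_eq:
 "x \<in> frontier \<Omega> ==> of_real (outward_normal \<Omega> x $ 1) + \<i> * of_real (outward_normal \<Omega> x $ 2) = normal x"
 by (simp add: normal_def N_normal)

text \<open>Here \<open>fst u\<close> is the Wirtinger derivative of \<open>F\<close> on both sides of the boundary.\<close>

theorem op_T_iff:
 "(F, G) \<in> op_T \<Omega> \<alpha> \<longleftrightarrow> (\<exists>u\<in>H1_plane. G = (- 4) *\<^sub>R DZ u \<and>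
  (\<forall>v\<in>H1_plane. fst u \<bullet> fst v + F \<bullet> DZ v = - \<alpha> * surface_form u v))"
proof
 let ?f = "rep_L2 F"
 let ?p = "wirtinger_dbar \<Omega> ?f" and ?m = "wirtinger_dbar (exterior \<Omega>) ?f"
 assume FG: "(F, G) \<in> op_T \<Omega> \<alpha>"
 then obtain a b p q where H: "H1 \<Omega> ?f" "H1 (exterior \<Omega>) ?f" "H1 UNIV (glue \<Omega> ?p ?m)"
  and tr: "has_trace \<Omega> ?f a" "has_trace (exterior \<Omega>) ?f b" "has_trace \<Omega> ?p p" "has_trace (exterior \<Omega>) ?m q"
  and jump: "AE x in \<sigma>. (of_real (outward_normal \<Omega> x $ 1) + \<i> * of_real (outward_normal \<Omega> x $ 2)) * (a x - b x)
       = - of_real \<alpha> * (p x + q x)"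
  and lap: "is_weak_laplacian \<Omega> ?f (%x. - rep_L2 G x)" "is_weak_laplacian (exterior \<Omega>) ?f (%x. - rep_L2 G x)"
  unfolding op_T_def dom_T_def Let_def by blast
 note W = res_wirtinger(1,2)[OF sets_dom(1) H(1)] and W' = res_wirtinger(1,2)[OF sets_dom(2) H(2)]
 note gl = glue_res[OF W(1) W'(1)]
 have U: "UNIV \<in> sets borel" by simp
 \<comment> \<open>The glued Wirtinger derivative satisfies \<open>H1\<close>, which speaks of weak
   derivatives; this step produces it as an element of \<open>H1_plane\<close>, a limit of test
   functions.\<close>
 have "\<exists>u\<in>H1_plane. fst u = res UNIV (glue \<Omega> ?p ?m) \<and> DB u = DB (weak_jet UNIV (glue \<Omega> ?p ?m))"
  by (rule H1_plane_of_dbar) (rule weak_jet_DZ[OF U H(3)])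
 then obtain u where u: "u \<in> H1_plane" "fst u = res \<Omega> ?p + res (exterior \<Omega>) ?m" unfolding gl(2) by blast
 obtain t where t: "jet_trace \<sigma> UNIV u t" using H1_plane_trace[OF u(1)] by blast
 note bi = bm_indicator[OF sets_dom(1)] bm_indicator[OF sets_dom(2)]
 have mm: "mul (indicator D) (res E f) = mul (indicator (D \<inter> E)) (res E f)" if "L2_on E f" "D \<in> sets borel" "E \<in> sets borel" for D E f
  using mul_indicator_Int[OF that(2,3), of "res E f"] unfolding mul_res[OF that(3,1)] .
 have rp: "res \<Omega> ?p = mul (indicator \<Omega>) (fst u)"
  unfolding u(2) mul_add[OF bi(1)] mul_res[OF sets_dom(1) W(1)] mm[OF W'(1) sets_dom] disjoint_sides mul_empty by simp
 have rm: "res (exterior \<Omega>) ?m = mul (indicator (exterior \<Omega>)) (fst u)"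
  unfolding u(2) mul_add[OF bi(2)] mul_res[OF sets_dom(2) W'(1)] mm[OF W(1) sets_dom(2,1)] disjoint_sides mul_empty by simp
 have "mul (indicator \<Omega>) G = mul (indicator \<Omega>) ((- 4) *\<^sub>R DZ u)"
  by (rule laplacian_iff[OF side_dom(1) H(1) u(1) _, THEN iffD1, OF _ lap(1)]) (simp only: rp[symmetric] W(2))
 moreover have "mul (indicator (exterior \<Omega>)) G = mul (indicator (exterior \<Omega>)) ((- 4) *\<^sub>R DZ u)"
  by (rule laplacian_iff[OF side_dom(2) H(2) u(1) _, THEN iffD1, OF _ lap(2)]) (simp only: rm[symmetric] W'(2))
 ultimately have G: "G = (- 4) *\<^sub>R DZ u" by (rule L2_eq_sides)
 \<comment> \<open>The traces of the Wirtinger derivative from both sides are the trace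
   \<open>t\<close> of \<open>u\<close>, so their sum is \<open>2 * t x\<close>; this is the origin
   of the factor in \<open>- 2 * \<alpha>\<close>.\<close>
 note tu = trace_cut_unique[OF side_dom(1) u(1) t W(1) rp tr(3)] trace_cut_unique[OF side_dom(2) u(1) t W'(1) rm tr(4)]
 have "AE x in \<sigma>. normal x * (a x - b x) = of_real (- 2 * \<alpha>) * t x"
  using AE_space[of \<sigma>] jump tu
 proof eventually_elim
  fix x assume x: "x \<in> space \<sigma>" and j: "(of_real (outward_normal \<Omega> x $ 1) + \<i> * of_real (outward_normal \<Omega> x $ 2)) * (a x - b x)
       = - of_real \<alpha> * (p x + q x)" and pq: "p x = t x" "q x = t x"
  have "x \<in> frontier \<Omega>" using x by (simp add: space_surface)
  from j[unfolded outward_normal_eq[OF this] pq] show "normal x * (a x - b x) = of_real (- 2 * \<alpha>) * t x" by simp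
 qed
 note w = jump_imp_weak[OF tr(1)[unfolded has_trace_side[OF side_dom(1)], THEN conjunct2]
   tr(2)[unfolded has_trace_side[OF side_dom(2)], THEN conjunct2] t this]
 have "fst u \<bullet> fst v + F \<bullet> DZ v = - \<alpha> * surface_form u v" if v: "v \<in> H1_plane" for v
  using w[OF v] unfolding W(2)[symmetric] W'(2)[symmetric] u(2)[symmetric]
  by (simp add: weak_jet_def res_rep mul_split)
 with u(1) G show "\<exists>u\<in>H1_plane. G = (- 4) *\<^sub>R DZ u \<and> (\<forall>v\<in>H1_plane. fst u \<bullet> fst v + F \<bullet> DZ v = - \<alpha> * surface_form u v)"
  by blast
next
 let ?f = "rep_L2 F"
 let ?p = "wirtinger_dbar \<Omega> ?f" and ?m = "wirtinger_dbar (exterior \<Omega>) ?f"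
 assume "\<exists>u\<in>H1_plane. G = (- 4) *\<^sub>R DZ u \<and> (\<forall>v\<in>H1_plane. fst u \<bullet> fst v + F \<bullet> DZ v = - \<alpha> * surface_form u v)"
 then obtain u where u: "u \<in> H1_plane" and G: "G = (- 4) *\<^sub>R DZ u"
  and weak: "!!v. v \<in> H1_plane ==> fst u \<bullet> fst v + F \<bullet> DZ v = - \<alpha> * surface_form u v" by blast
 obtain t where t: "jet_trace \<sigma> UNIV u t" using H1_plane_trace[OF u] by blast
 obtain y y' a b where y: "y \<in> H1_plane" "y' \<in> H1_plane" "jet_trace \<sigma> UNIV y a" "jet_trace \<sigma> UNIV y' b"
  and e: "mul (indicator \<Omega>) F = mul (indicator \<Omega>) (fst y)" "mul (indicator \<Omega>) (fst u) = mul (indicator \<Omega>) (DB y)"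
  "mul (indicator (exterior \<Omega>)) F = mul (indicator (exterior \<Omega>)) (fst y')"
  "mul (indicator (exterior \<Omega>)) (fst u) = mul (indicator (exterior \<Omega>)) (DB y')"
  and jump: "\<forall>x\<in>frontier \<Omega>. normal x * (a x - b x) = of_real (- 2 * \<alpha>) * t x"
  by (rule weak_imp_jump[OF t u weak]) (assumption, rule that)
 note c = has_trace_cut[OF side_dom(1) y(1,3) L2_on_rep[OF sets_dom(1)] res_rep[of \<Omega> F, unfolded e(1)]]
  and c' = has_trace_cut[OF side_dom(2) y(2,4) L2_on_rep[OF sets_dom(2)] res_rep[of "exterior \<Omega>" F, unfolded e(3)]]
 note W = res_wirtinger(1,2)[OF sets_dom(1) c(1)] and W' = res_wirtinger(1,2)[OF sets_dom(2) c'(1)]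
 have d: "DB (weak_jet \<Omega> ?f) = mul (indicator \<Omega>) (fst u)" "DB (weak_jet (exterior \<Omega>) ?f) = mul (indicator (exterior \<Omega>)) (fst u)"
  unfolding c(2) c'(2) DB_cut[OF sets_dom(1)] DB_cut[OF sets_dom(2)] e by simp_all
 have r: "res \<Omega> ?p = mul (indicator \<Omega>) (fst u)" "res (exterior \<Omega>) ?m = mul (indicator (exterior \<Omega>)) (fst u)"
  unfolding W(2) W'(2) d by simp_all
 note gl = glue_res[OF W(1) W'(1)]
 have "res UNIV (glue \<Omega> ?p ?m) = mul (indicator UNIV) (fst u)"
  unfolding gl(2) r mul_split mul_UNIV ..
 then have H: "H1 UNIV (glue \<Omega> ?p ?m)" by (rule weak_jet_cut(1)[OF open_UNIV gl(1) u])
 have lap: "is_weak_laplacian \<Omega> ?f (%x. - rep_L2 G x)" "is_weak_laplacian (exterior \<Omega>) ?f (%x. - rep_L2 G x)"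
  unfolding laplacian_iff[OF side_dom(1) c(1) u d(1)] laplacian_iff[OF side_dom(2) c'(1) u d(2)] G by simp_all
 have J: "AE x in \<sigma>. (of_real (outward_normal \<Omega> x $ 1) + \<i> * of_real (outward_normal \<Omega> x $ 2)) * (a x - b x)
       = - of_real \<alpha> * (t x + t x)"
 proof (rule AE_I2)
  fix x assume "x \<in> space \<sigma>"
  then have x: "x \<in> frontier \<Omega>" by (simp add: space_surface)
  show "(of_real (outward_normal \<Omega> x $ 1) + \<i> * of_real (outward_normal \<Omega> x $ 2)) * (a x - b x) = - of_real \<alpha> * (t x + t x)"
   unfolding outward_normal_eq[OF x] jump[rule_format, OF x] by simp
 qed
 note tp = has_trace_cut(3)[OF side_dom(1) u t W(1) r(1)] has_trace_cut(3)[OF side_dom(2) u t W'(1) r(2)]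
 have "F \<in> dom_T \<Omega> \<alpha>"
  unfolding dom_T_def Let_def mem_Collect_eq
  by (intro conjI exI[of _ a] exI[of _ b] exI[of _ t] c(1) c'(1) H c(3) c'(3) tp J)
 with lap show "(F, G) \<in> op_T \<Omega> \<alpha>" by (simp add: op_T_def)
qed

end

section \<open>The Dirac transmission condition\<close>

lemma transmission_components:
 fixes d s :: "complex^2" and n :: "real^2"
 shows "(\<i> * of_real c) *s (sigma_dot n *v d) + (1 / 2) *s ((\<eta> *\<^sub>R mat 1 + \<tau> *\<^sub>R pauli3) *v s) = 0 \<longleftrightarrow>
  \<i> * of_real c * ((of_real (n $ 1) - \<i> * of_real (n $ 2)) * d $ 2) + 1 / 2 * (of_real (\<eta> + \<tau>) * s $ 1) = 0 \<and>
  \<i> * of_real c * ((of_real (n $ 1) + \<i> * of_real (n $ 2)) * d $ 1) + 1 / 2 * (of_real (\<eta> - \<tau>) * s $ 2) = 0"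
 unfolding vec_eq_iff all_2
 by (simp add: sigma_dot_def pauli1_def pauli2_def pauli3_def mat_def matrix_vector_mult_def sum_2)
  (simp add: scaleR_conv_of_real algebra_simps)

context green_domain
begin

text \<open>With these strengths \<open>\<eta> + \<tau>\<close> is 0, so the row with the jump of
  the lower component says that there is none. The other row has the factor
  \<open>\<eta> - \<tau>\<close>, equal to \<open>- \<alpha> * c\<^sup>2\<close>, in front of the
  mean of the lower components, which is \<open>a $ 2\<close>.\<close>

lemma transmission_iff:
 assumes x: "x \<in> frontier \<Omega>" and c: "c > 0"
 shows "(\<i> * of_real c) *s (sigma_dot (outward_normal \<Omega> x) *v (a - b))
   + (1 / 2) *s (((- \<alpha> * c\<^sup>2 / 2) *\<^sub>R mat 1 + (\<alpha> * c\<^sup>2 / 2) *\<^sub>R pauli3) *v (a + b)) = 0 \<longleftrightarrow>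
  a $ 2 = b $ 2 \<and> normal x * (a $ 1 - b $ 1) = - (\<i> * of_real (\<alpha> * c)) * a $ 2"
proof -
 note n = outward_normal_eq[OF x]
 have cn: "of_real (outward_normal \<Omega> x $ 1) - \<i> * of_real (outward_normal \<Omega> x $ 2) = conormal x"
  unfolding conormal_def n[symmetric] by simp
 have nz: "conormal x \<noteq> 0" using normal_conormal[OF x] by auto
 have 1: "\<i> * of_real c * (conormal x * (a - b) $ 2) + 1 / 2 * (of_real (- \<alpha> * c\<^sup>2 / 2 + \<alpha> * c\<^sup>2 / 2) * (a + b) $ 1) = 0 \<longleftrightarrow> a $ 2 = b $ 2"
  using c nz by simp
 have e: "- \<alpha> * c\<^sup>2 / 2 - \<alpha> * c\<^sup>2 / 2 = c * (- (\<alpha> * c))" by (simp add: power2_eq_square)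
 have 2: "\<i> * of_real c * (normal x * (a - b) $ 1) + 1 / 2 * (of_real (- \<alpha> * c\<^sup>2 / 2 - \<alpha> * c\<^sup>2 / 2) * (a + b) $ 2) = 0 \<longleftrightarrow>
   normal x * (a $ 1 - b $ 1) = - (\<i> * of_real (\<alpha> * c)) * a $ 2" if ab: "a $ 2 = b $ 2"
 proof -
  have "\<i> * of_real c * (normal x * (a - b) $ 1) + 1 / 2 * (of_real (- \<alpha> * c\<^sup>2 / 2 - \<alpha> * c\<^sup>2 / 2) * (a + b) $ 2)
    = (\<i> * of_real c) * (normal x * (a $ 1 - b $ 1) + (\<i> * of_real (\<alpha> * c)) * a $ 2)"
   unfolding e using ab by (simp add: algebra_simps)
  then show ?thesis using c by (simp add: eq_neg_iff_add_eq_0)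
 qed
 show ?thesis unfolding transmission_components n cn 1 using 2 by blast
qed

text \<open>Here \<open>fst u\<close> is \<open>i c / 2\<close> times the lower component of the spinor.\<close>

theorem op_A_iff:
 assumes c: "c > 0"
 shows "(F, G) \<in> op_A \<Omega> c (- \<alpha> * c\<^sup>2 / 2) (\<alpha> * c\<^sup>2 / 2) \<longleftrightarrow> (\<exists>u\<in>H1_plane.
  snd F = (- 2 * \<i> / of_real c) *\<^sub>C fst u \<and> fst G = (- 4) *\<^sub>R DZ u + of_real (c\<^sup>2 / 2) *\<^sub>C fst F \<and>
  (\<forall>v\<in>H1_plane. ((\<i> / (2 * of_real c)) *\<^sub>C (snd G + of_real (c\<^sup>2 / 2) *\<^sub>C snd F)) \<bullet> fst v + fst F \<bullet> DZ v
   = - \<alpha> * surface_form u v))"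
  (is "_ \<longleftrightarrow> (\<exists>u\<in>H1_plane. ?P u)")
proof
 let ?f = "rep_L2 (fst F)" and ?g = "rep_L2 (snd F)"
 define k where "k = \<i> * of_real c / (2::complex)"
 \<comment> \<open>The second row of the Dirac equation solved for the Wirtinger derivative of the
   upper component; \<open>\<i> / (2 * of_real c)\<close> is the inverse of
   \<open>- 2 * \<i> * of_real c\<close>.\<close>
 define K where "K = (\<i> / (2 * of_real c)) *\<^sub>C (snd G + of_real (c\<^sup>2 / 2) *\<^sub>C snd F)"
 have k: "(- 2 * \<i> / of_real c) * k = 1" "(- 2 * \<i> * of_real c) = (- 4) * k" "(\<i> / (2 * of_real c)) * (- 2 * \<i> * of_real c) = 1"
  using c by (simp_all add: k_def)
 have m4: "(- 4) *\<^sub>C X = (- 4) *\<^sub>R X" for X :: L2 using scaleC_of_real[of "- 4" X] by simp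
 assume FG: "(F, G) \<in> op_A \<Omega> c (- \<alpha> * c\<^sup>2 / 2) (\<alpha> * c\<^sup>2 / 2)"
 then obtain a b where H: "H1_spinor \<Omega> (spinor F)" "H1_spinor (exterior \<Omega>) (spinor F)"
  and tr: "has_trace_spinor \<Omega> (spinor F) a" "has_trace_spinor (exterior \<Omega>) (spinor F) b"
  and tc: "AE x in \<sigma>. (\<i> * of_real c) *s (sigma_dot (outward_normal \<Omega> x) *v (a x - b x))
   + (1 / 2) *s (((- \<alpha> * c\<^sup>2 / 2) *\<^sub>R mat 1 + (\<alpha> * c\<^sup>2 / 2) *\<^sub>R pauli3) *v (a x + b x)) = 0"
  and eq: "AE x in lborel. x \<in> \<Omega> --> spinor G x = dirac_expr \<Omega> c (spinor F) x"
   "AE x in lborel. x \<in> exterior \<Omega> --> spinor G x = dirac_expr (exterior \<Omega>) c (spinor F) x"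
  unfolding op_A_def dom_A_def Let_def by blast
 note h = H(1)[unfolded H1_spinor_iff, THEN conjunct1] H(1)[unfolded H1_spinor_iff, THEN conjunct2]
  H(2)[unfolded H1_spinor_iff, THEN conjunct1] H(2)[unfolded H1_spinor_iff, THEN conjunct2]
 note t1 = tr(1)[unfolded has_trace_spinor_def all_2 spinor_functions has_trace_side[OF side_dom(1)]]
  and t2 = tr(2)[unfolded has_trace_spinor_def all_2 spinor_functions has_trace_side[OF side_dom(2)]]
 have a1: "jet_trace \<sigma> \<Omega> (weak_jet \<Omega> ?f) (%x. a x $ 1)" and a2: "jet_trace \<sigma> \<Omega> (weak_jet \<Omega> ?g) (%x. a x $ 2)"
  and b1: "jet_trace \<sigma> (exterior \<Omega>) (weak_jet (exterior \<Omega>) ?f) (%x. b x $ 1)"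
  and b2: "jet_trace \<sigma> (exterior \<Omega>) (weak_jet (exterior \<Omega>) ?g) (%x. b x $ 2)"
  using t1 t2 by blast+
 have jump: "AE x in \<sigma>. a x $ 2 = b x $ 2 \<and> normal x * (a x $ 1 - b x $ 1) = - (\<i> * of_real (\<alpha> * c)) * a x $ 2"
  using AE_space[of \<sigma>] tc
 proof eventually_elim
  fix x assume "x \<in> space \<sigma>" and e: "(\<i> * of_real c) *s (sigma_dot (outward_normal \<Omega> x) *v (a x - b x))
   + (1 / 2) *s (((- \<alpha> * c\<^sup>2 / 2) *\<^sub>R mat 1 + (\<alpha> * c\<^sup>2 / 2) *\<^sub>R pauli3) *v (a x + b x)) = 0"
  then have "x \<in> frontier \<Omega>" by (simp add: space_surface)
  from e[unfolded transmission_iff[OF this c]]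
  show "a x $ 2 = b x $ 2 \<and> normal x * (a x $ 1 - b x $ 1) = - (\<i> * of_real (\<alpha> * c)) * a x $ 2" .
 qed
 have fsum: "fst (weak_jet \<Omega> (rep_L2 X)) + fst (weak_jet (exterior \<Omega>) (rep_L2 X)) = X" for X
  by (simp add: weak_jet_def res_rep mul_split)
 \<comment> \<open>The traces of the lower component from both sides agree, so the boundary terms of
   the two Green formulas cancel, and its one-sided Wirtinger derivatives form a weak Wirtinger
   derivative in the plane.\<close>
 have "\<exists>w\<in>H1_plane. fst w = snd F \<and> DB w = DB (weak_jet \<Omega> ?g) + DB (weak_jet (exterior \<Omega>) ?g)"
 proof (rule H1_plane_of_dbar)
  fix phi assume t: "test_fun UNIV phi"
  have ms: "(%x. a x $ 2) \<in> borel_measurable \<sigma>" "(%x. b x $ 2) \<in> borel_measurable \<sigma>"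
   "(%x. conormal x * phi x) \<in> borel_measurable \<sigma>"
   using a2 b2 square_integrable_test_mult[OF test_fun_conormal test_fun_surface(1)[OF t]]
   by (auto simp: jet_trace_def square_integrable_def)
  have "(\<integral>x. a x $ 2 \<bullet> (conormal x * phi x) \<partial>\<sigma>) = (\<integral>x. b x $ 2 \<bullet> (conormal x * phi x) \<partial>\<sigma>)"
   by (rule integral_cong_AE) (use ms jump in \<open>auto intro: borel_measurable_inner\<close>)
  then have "(DB (weak_jet \<Omega> ?g) + DB (weak_jet (exterior \<Omega>) ?g)) \<bullet> abs_L2 phi
    + (fst (weak_jet \<Omega> ?g) + fst (weak_jet (exterior \<Omega>) ?g)) \<bullet> DZ (jet phi) = 0"
   using green_jet_test[OF side_dom(1) a2 t] green_jet_test[OF side_dom(2) b2 t] by (simp add: inner_add_left)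
  then show "snd F \<bullet> DZ (jet phi) = - ((DB (weak_jet \<Omega> ?g) + DB (weak_jet (exterior \<Omega>) ?g)) \<bullet> abs_L2 phi)"
   unfolding fsum by simp
 qed
 then obtain w where w: "w \<in> H1_plane" "fst w = snd F" by blast
 obtain t where t: "jet_trace \<sigma> UNIV w t" using H1_plane_trace[OF w(1)] by blast
 have r: "res D ?g = mul (indicator D) (fst w)" for D unfolding w(2) by (rule res_rep)
 define u where "u = k *\<^sub>C w"
 have u: "u \<in> H1_plane" unfolding u_def by (rule H1_plane_scaleC[OF w(1)])
 have ut: "jet_trace \<sigma> UNIV u (%x. k * t x)" unfolding u_def by (rule has_jet_trace_scaleC[OF t])
 have s2: "snd F = (- 2 * \<i> / of_real c) *\<^sub>C fst u"
  unfolding u_def scaleC_fst_snd scaleC_scaleC k(1) w(2) scaleC_one ..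
 note wj = weak_jet_cut(2)[OF open_dom L2_on_rep[OF sets_dom(1)] w(1) r]
  weak_jet_cut(2)[OF open_exterior L2_on_rep[OF sets_dom(2)] w(1) r]
 note E1 = eq(1)[unfolded dirac_equation_iff[OF sets_dom(1) h(1,2)]]
  and E2 = eq(2)[unfolded dirac_equation_iff[OF sets_dom(2) h(3,4)]]
 note bi = bm_indicator[OF sets_dom(1)] bm_indicator[OF sets_dom(2)]
 have G1: "fst G = (- 4) *\<^sub>R DZ u + of_real (c\<^sup>2 / 2) *\<^sub>C fst F"
 proof (rule L2_eq_sides)
  have dz: "(- 4) *\<^sub>R DZ u = (- 2 * \<i> * of_real c) *\<^sub>C DZ w"
   unfolding u_def DZ_scaleC m4[symmetric] scaleC_scaleC k(2) ..
  show "mul (indicator \<Omega>) (fst G) = mul (indicator \<Omega>) ((- 4) *\<^sub>R DZ u + of_real (c\<^sup>2 / 2) *\<^sub>C fst F)"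
   unfolding E1[THEN conjunct1] wj DZ_cut[OF sets_dom(1)] dz mul_add[OF bi(1)] mul_scaleC[OF bi(1)] ..
  show "mul (indicator (exterior \<Omega>)) (fst G) = mul (indicator (exterior \<Omega>)) ((- 4) *\<^sub>R DZ u + of_real (c\<^sup>2 / 2) *\<^sub>C fst F)"
   unfolding E2[THEN conjunct1] wj DZ_cut[OF sets_dom(2)] dz mul_add[OF bi(2)] mul_scaleC[OF bi(2)] ..
 qed
 have sub: "X - Y + Y = X" for X Y :: L2 by simp
 have KD: "DB (weak_jet \<Omega> ?f) = mul (indicator \<Omega>) K"
  unfolding K_def mul_scaleC[OF bi(1)] mul_add[OF bi(1)] E1[THEN conjunct2] sub scaleC_scaleC k(3) scaleC_one ..
 have KE: "DB (weak_jet (exterior \<Omega>) ?f) = mul (indicator (exterior \<Omega>)) K"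
  unfolding K_def mul_scaleC[OF bi(2)] mul_add[OF bi(2)] E2[THEN conjunct2] sub scaleC_scaleC k(3) scaleC_one ..
 note ta = has_jet_trace_unique[OF side_dom(1) a2[unfolded wj] has_jet_trace_cut[OF sets_dom(1) t]]
 \<comment> \<open>As \<open>k\<close> is \<open>\<i> * of_real c / 2\<close>, the factor
   \<open>- (\<i> * of_real (\<alpha> * c))\<close> of the transmission condition is
   \<open>- 2 * \<alpha>\<close> times \<open>k\<close>, so that the jump has the same form as for
   \<open>T\<close>.\<close>
 have "AE x in \<sigma>. normal x * (a x $ 1 - b x $ 1) = of_real (- 2 * \<alpha>) * (k * t x)"
  using jump ta by eventually_elim (simp add: k_def)
 from jump_imp_weak[OF a1 b1 ut this]
 have weak: "\<forall>v\<in>H1_plane. K \<bullet> fst v + fst F \<bullet> DZ v = - \<alpha> * surface_form u v"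
  unfolding KD KE mul_split fsum by blast
 show "\<exists>u\<in>H1_plane. ?P u"
  using u s2 G1 weak unfolding K_def by blast
next
 let ?f = "rep_L2 (fst F)" and ?g = "rep_L2 (snd F)"
 define k where "k = - 2 * \<i> / complex_of_real c"
 define K where "K = (\<i> / (2 * of_real c)) *\<^sub>C (snd G + of_real (c\<^sup>2 / 2) *\<^sub>C snd F)"
 have k: "(- 2 * \<i> * of_real c) * k = - 4" "(- 2 * \<i> * of_real c) * (\<i> / (2 * of_real c)) = 1"
  using c by (simp_all add: k_def)
 have m4: "(- 4) *\<^sub>C X = (- 4) *\<^sub>R X" for X :: L2 using scaleC_of_real[of "- 4" X] by simp
 assume "\<exists>u\<in>H1_plane. ?P u"
 then obtain u where u: "u \<in> H1_plane" and F2: "snd F = k *\<^sub>C fst u"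
  and G1: "fst G = (- 4) *\<^sub>R DZ u + of_real (c\<^sup>2 / 2) *\<^sub>C fst F"
  and weak: "!!v. v \<in> H1_plane ==> K \<bullet> fst v + fst F \<bullet> DZ v = - \<alpha> * surface_form u v"
  unfolding K_def k_def by blast
 obtain t where t: "jet_trace \<sigma> UNIV u t" using H1_plane_trace[OF u] by blast
 obtain y y' a b where y: "y \<in> H1_plane" "y' \<in> H1_plane" "jet_trace \<sigma> UNIV y a" "jet_trace \<sigma> UNIV y' b"
  and e: "mul (indicator \<Omega>) (fst F) = mul (indicator \<Omega>) (fst y)" "mul (indicator \<Omega>) K = mul (indicator \<Omega>) (DB y)"
  "mul (indicator (exterior \<Omega>)) (fst F) = mul (indicator (exterior \<Omega>)) (fst y')"
  "mul (indicator (exterior \<Omega>)) K = mul (indicator (exterior \<Omega>)) (DB y')"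
  and jump: "\<forall>x\<in>frontier \<Omega>. normal x * (a x - b x) = of_real (- 2 * \<alpha>) * t x"
  by (rule weak_imp_jump[OF t u weak]) (assumption, rule that)
 define w where "w = k *\<^sub>C u"
 have w: "w \<in> H1_plane" unfolding w_def by (rule H1_plane_scaleC[OF u])
 have wt: "jet_trace \<sigma> UNIV w (%x. k * t x)" unfolding w_def by (rule has_jet_trace_scaleC[OF t])
 have r: "res D ?g = mul (indicator D) (fst w)" for D unfolding res_rep F2 w_def scaleC_fst_snd ..
 note c1 = has_trace_cut[OF side_dom(1) y(1,3) L2_on_rep[OF sets_dom(1)] res_rep[of \<Omega> "fst F", unfolded e(1)]]
  and c1' = has_trace_cut[OF side_dom(2) y(2,4) L2_on_rep[OF sets_dom(2)] res_rep[of "exterior \<Omega>" "fst F", unfolded e(3)]]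
  and c2 = has_trace_cut[OF side_dom(1) w wt L2_on_rep[OF sets_dom(1)] r]
  and c2' = has_trace_cut[OF side_dom(2) w wt L2_on_rep[OF sets_dom(2)] r]
 define A B where "A x = (vector [a x, k * t x] :: complex^2)" and "B x = (vector [b x, k * t x] :: complex^2)" for x
 have tr: "has_trace_spinor \<Omega> (spinor F) A" "has_trace_spinor (exterior \<Omega>) (spinor F) B"
  unfolding has_trace_spinor_def all_2 spinor_functions A_def B_def vector_2 using c1 c1' c2 c2' by blast+
 have H: "H1_spinor \<Omega> (spinor F)" "H1_spinor (exterior \<Omega>) (spinor F)"
  unfolding H1_spinor_iff using c1 c1' c2 c2' by blast+
 have tc: "AE x in \<sigma>. (\<i> * of_real c) *s (sigma_dot (outward_normal \<Omega> x) *v (A x - B x))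
   + (1 / 2) *s (((- \<alpha> * c\<^sup>2 / 2) *\<^sub>R mat 1 + (\<alpha> * c\<^sup>2 / 2) *\<^sub>R pauli3) *v (A x + B x)) = 0"
 proof (rule AE_I2)
  fix x assume "x \<in> space \<sigma>"
  then have x: "x \<in> frontier \<Omega>" by (simp add: space_surface)
  show "(\<i> * of_real c) *s (sigma_dot (outward_normal \<Omega> x) *v (A x - B x))
   + (1 / 2) *s (((- \<alpha> * c\<^sup>2 / 2) *\<^sub>R mat 1 + (\<alpha> * c\<^sup>2 / 2) *\<^sub>R pauli3) *v (A x + B x)) = 0"
   unfolding transmission_iff[OF x c] A_def B_def vector_2 using jump[rule_format, OF x] c by (simp add: k_def)
 qed
 note bi = bm_indicator[OF sets_dom(1)] bm_indicator[OF sets_dom(2)]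
 have GK: "snd G = (- 2 * \<i> * of_real c) *\<^sub>C K - of_real (c\<^sup>2 / 2) *\<^sub>C snd F"
  unfolding K_def scaleC_scaleC k(2) scaleC_one by simp
 have dz: "(- 4) *\<^sub>R DZ u = (- 2 * \<i> * of_real c) *\<^sub>C DZ w"
  unfolding w_def DZ_scaleC m4[symmetric] scaleC_scaleC k(1) ..
 have "AE x in lborel. x \<in> \<Omega> --> spinor G x = dirac_expr \<Omega> c (spinor F) x"
  unfolding dirac_equation_iff[OF sets_dom(1) c1(1) c2(1)] c1(2) c2(2) DZ_cut[OF sets_dom(1)] DB_cut[OF sets_dom(1)] e(2)[symmetric]
   G1 GK dz mul_add[OF bi(1)] mul_diff[OF bi(1)] mul_scaleC[OF bi(1)] by (intro conjI refl)
 moreover have "AE x in lborel. x \<in> exterior \<Omega> --> spinor G x = dirac_expr (exterior \<Omega>) c (spinor F) x"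
  unfolding dirac_equation_iff[OF sets_dom(2) c1'(1) c2'(1)] c1'(2) c2'(2) DZ_cut[OF sets_dom(2)] DB_cut[OF sets_dom(2)] e(4)[symmetric]
   G1 GK dz mul_add[OF bi(2)] mul_diff[OF bi(2)] mul_scaleC[OF bi(2)] by (intro conjI refl)
 moreover have "F \<in> dom_A \<Omega> c (- \<alpha> * c\<^sup>2 / 2) (\<alpha> * c\<^sup>2 / 2)"
  unfolding dom_A_def Let_def mem_Collect_eq by (intro conjI exI[of _ A] exI[of _ B] H tr tc)
 ultimately show "(F, G) \<in> op_A \<Omega> c (- \<alpha> * c\<^sup>2 / 2) (\<alpha> * c\<^sup>2 / 2)" by (simp add: op_A_def)
qed

end

section \<open>Resolvents\<close>

lemma norm_fst_le_norm: "norm (fst p) \<le> norm p"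
 and norm_snd_le_norm: "norm (snd p) \<le> norm p" for p :: "'a::real_normed_vector \<times> 'b::real_normed_vector"
 using norm_fst_le[of "fst p" "snd p"] norm_snd_le[of "snd p" "fst p"] by simp_all

lemma op_minus_iff: "(f, g) \<in> op_minus T z \<longleftrightarrow> (f, g + z *\<^sub>C f) \<in> T"
 by (force simp: op_minus_def)

lemma resolvent_eqI:
 assumes "is_bounded_inverse (op_minus T z) R"
 shows "z \<in> resolvent_set T" "resolvent T z = R"
proof -
 show "z \<in> resolvent_set T" using assms by (auto simp: resolvent_set_def)
 then show "resolvent T z = R" using is_bounded_inverse_unique[OF is_bounded_inverse_resolvent assms] by blast
qed

context green_domain
begin

lemma form_op_inner:
 "form_op \<alpha> z \<kappa> u \<bullet> v = ((4 / z) *\<^sub>C DZ u) \<bullet> DZ v - \<alpha> * surface_form u v - ((1 + z * of_real \<kappa>) *\<^sub>C fst u) \<bullet> fst v"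
 unfolding form_op_def inner_diff_left inner_scaleR_left surface_op_form DZ_adj_scaleC[symmetric] inner_DZ
 by (simp add: inner_triple)

text \<open>The bound \<open>B\<close> is an argument so that one value can serve all \<kappa>; the
  rate depends on this uniformity.\<close>

definition solution_op :: "real => complex => real => real => (L2 \<times> L2 \<times> L2 => L2 \<times> L2 \<times> L2) => bool" where
 "solution_op \<alpha> z B \<kappa> S \<longleftrightarrow> bounded_linear S \<and>
  (\<forall>r u. u = S r \<longleftrightarrow> u \<in> H1_plane \<and> (\<forall>v\<in>H1_plane. form_op \<alpha> z \<kappa> u \<bullet> v = r \<bullet> v)) \<and> (\<forall>r. norm (S r) \<le> B * norm r)"

text \<open>\<open>H1_plane\<close> is a complex subspace, so testing the rotated equation with all
  \<open>v\<close> amounts to testing the original one. The rotation enters only the bound, where 2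
  is the inverse of the coercivity constant.\<close>

lemma form_solution:
 assumes z: "z \<notin> \<real>"
 shows "\<exists>B>0. \<forall>\<kappa>\<ge>0. \<exists>S. solution_op \<alpha> z B \<kappa> S"
proof -
 obtain \<omega> where \<omega>: "\<omega> \<noteq> 0" and co: "!!\<kappa> u. \<kappa> \<ge> 0 ==> u \<in> H1_plane ==> 1 / 2 * (norm u)\<^sup>2 \<le> (\<omega> *\<^sub>C form_op \<alpha> z \<kappa> u) \<bullet> u"
  using form_op_coercive[OF z] by blast
 have "\<exists>S. solution_op \<alpha> z (2 * cmod \<omega>) \<kappa> S"
  if \<kappa>: "\<kappa> \<ge> 0" for \<kappa>
 proof -
  have L: "bounded_linear (%u. \<omega> *\<^sub>C form_op \<alpha> z \<kappa> u)"
   by (rule bl_comp[OF bounded_linear_scaleC bounded_linear_form_op])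
  have "\<exists>R. bounded_linear R \<and> (\<forall>r u. u = R r \<longleftrightarrow> u \<in> H1_plane \<and> (\<forall>v\<in>H1_plane. (\<omega> *\<^sub>C form_op \<alpha> z \<kappa> u) \<bullet> v = r \<bullet> v))"
   by (rule lax_milgram_operator[OF closed_H1_plane subspace_H1_plane L _ co[OF \<kappa>]]) simp_all
  then obtain R where R1: "bounded_linear R"
   and iff: "!!r u. u = R r \<longleftrightarrow> u \<in> H1_plane \<and> (\<forall>v\<in>H1_plane. (\<omega> *\<^sub>C form_op \<alpha> z \<kappa> u) \<bullet> v = r \<bullet> v)" by blast
  have R: "R r \<in> H1_plane" "v \<in> H1_plane ==> (\<omega> *\<^sub>C form_op \<alpha> z \<kappa> (R r)) \<bullet> v = r \<bullet> v" for r v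
   using iff[of "R r" r] by blast+
  define S where "S r = R (\<omega> *\<^sub>C r)" for r
  have bl: "bounded_linear S" unfolding S_def[abs_def] by (rule bl_comp[OF R1 bounded_linear_scaleC])
  have eq: "form_op \<alpha> z \<kappa> (S r) \<bullet> v = r \<bullet> v" if v: "v \<in> H1_plane" for r v
  proof -
   have c: "cnj \<omega> *\<^sub>C ((1 / cnj \<omega>) *\<^sub>C v) = v" using \<omega> by (simp add: scaleC_scaleC scaleC_one)
   show ?thesis using R(2)[OF H1_plane_scaleC[OF v, of "1 / cnj \<omega>"], of "\<omega> *\<^sub>C r"] unfolding S_def inner_scaleC_triple c .
  qed
  have iffS: "u = S r \<longleftrightarrow> u \<in> H1_plane \<and> (\<forall>v\<in>H1_plane. form_op \<alpha> z \<kappa> u \<bullet> v = r \<bullet> v)" for r u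
  proof
   assume "u \<in> H1_plane \<and> (\<forall>v\<in>H1_plane. form_op \<alpha> z \<kappa> u \<bullet> v = r \<bullet> v)"
   then show "u = S r" unfolding S_def iff inner_scaleC_triple using H1_plane_scaleC by blast
  next
   assume u: "u = S r"
   show "u \<in> H1_plane \<and> (\<forall>v\<in>H1_plane. form_op \<alpha> z \<kappa> u \<bullet> v = r \<bullet> v)"
    unfolding u using eq R(1) by (simp add: S_def)
  qed
  have "norm (S r) \<le> 2 * cmod \<omega> * norm r" for r
  proof -
   have S: "S r \<in> H1_plane" by (simp add: S_def R(1))
   have "1 / 2 * (norm (S r))\<^sup>2 \<le> (\<omega> *\<^sub>C r) \<bullet> S r"
    using co[OF \<kappa> S] unfolding inner_scaleC_triple[of \<omega>] eq[OF H1_plane_scaleC[OF S]] .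
   also have "... \<le> cmod \<omega> * norm r * norm (S r)" using norm_cauchy_schwarz[of "\<omega> *\<^sub>C r" "S r"] by (simp add: norm_scaleC)
   finally have "norm (S r) * norm (S r) \<le> (2 * cmod \<omega> * norm r) * norm (S r)" by (simp add: power2_eq_square)
   then show ?thesis
    by (cases "norm (S r) = 0") simp_all
  qed
  with bl iffS have "solution_op \<alpha> z (2 * cmod \<omega>) \<kappa> S" unfolding solution_op_def by (intro conjI allI)
  then show ?thesis by blast
 qed
 moreover have "2 * cmod \<omega> > 0" using \<omega> by simp
 ultimately show ?thesis by blast
qed

text \<open>The right-hand side of the weak equation as a triple; \<open>eps\<close> is 0 for
  \<open>T\<close> and \<open>\<i> / (2 * of_real c)\<close> for the Dirac operator.\<close>

definition source :: "complex => complex => L2 => L2 => L2 \<times> L2 \<times> L2" where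
 "source z eps g h = DZ_adj ((- 1 / z) *\<^sub>C g) + (eps *\<^sub>C h, 0, 0)"

text \<open>Substituting \<open>F\<close> moves its part with \<open>DZ u\<close> into the gradient
  term of the form and its part with \<open>g\<close> into the source.\<close>

lemma weak_form_iff:
 assumes z: "z \<noteq> 0" and F: "F = (- 1 / z) *\<^sub>C (g + 4 *\<^sub>R DZ u)"
 shows "((1 + z * of_real \<kappa>) *\<^sub>C fst u + eps *\<^sub>C h) \<bullet> fst v + F \<bullet> DZ v = - \<alpha> * surface_form u v
  \<longleftrightarrow> form_op \<alpha> z \<kappa> u \<bullet> v = source z eps g h \<bullet> v"
proof -
 have "F = (- 1 / z) *\<^sub>C g - (4 / z) *\<^sub>C DZ u"
  unfolding F scaleC_add_right scaleC_scaleR_commute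
  by (simp add: scaleC_of_real[symmetric] scaleC_scaleC scaleC_minus_left[symmetric] flip: scaleC_minus_left)
 then have e: "F \<bullet> DZ v = ((- 1 / z) *\<^sub>C g) \<bullet> DZ v - ((4 / z) *\<^sub>C DZ u) \<bullet> DZ v" by (simp add: inner_diff_left)
 have s: "source z eps g h \<bullet> v = ((- 1 / z) *\<^sub>C g) \<bullet> DZ v + (eps *\<^sub>C h) \<bullet> fst v"
  unfolding source_def inner_add_left inner_DZ by (simp add: inner_triple)
 show ?thesis unfolding e s form_op_inner inner_add_left by linarith
qed

lemma solve_resolvent:
 fixes F g X :: L2
 assumes z: "z \<noteq> 0"
 shows "g + z *\<^sub>C F = (- 4) *\<^sub>R X \<longleftrightarrow> F = (- 1 / z) *\<^sub>C (g + 4 *\<^sub>R X)"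
proof -
 have "a + b = - c \<longleftrightarrow> b = - (a + c)" for a b c :: L2 by (auto simp: algebra_simps eq_neg_iff_add_eq_0)
 from this[of g "z *\<^sub>C F" "4 *\<^sub>R X"]
 have "g + z *\<^sub>C F = (- 4) *\<^sub>R X \<longleftrightarrow> z *\<^sub>C F = - (g + 4 *\<^sub>R X)" by simp
 also have "... \<longleftrightarrow> F = (- 1 / z) *\<^sub>C (g + 4 *\<^sub>R X)"
 proof
  assume "z *\<^sub>C F = - (g + 4 *\<^sub>R X)"
  then have "(1 / z) *\<^sub>C z *\<^sub>C F = (1 / z) *\<^sub>C (- (g + 4 *\<^sub>R X))" by simp
  then show "F = (- 1 / z) *\<^sub>C (g + 4 *\<^sub>R X)" using z by (simp only: scaleC_scaleC scaleC_minus_right) (simp add: scaleC_one scaleC_minus_left)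
 next
  assume F: "F = (- 1 / z) *\<^sub>C (g + 4 *\<^sub>R X)"
  show "z *\<^sub>C F = - (g + 4 *\<^sub>R X)" unfolding F scaleC_scaleC using z by (simp add: scaleC_minus_one)
 qed
 finally show ?thesis .
qed

lemma resolvent_T_iff:
 assumes z: "z \<noteq> 0"
  and S: "!!r u. u = S r \<longleftrightarrow> u \<in> H1_plane \<and> (\<forall>v\<in>H1_plane. form_op \<alpha> z 0 u \<bullet> v = r \<bullet> v)"
 shows "(F, g) \<in> op_minus (op_T \<Omega> \<alpha>) z \<longleftrightarrow> (- 1 / z) *\<^sub>C (g + 4 *\<^sub>R DZ (S (source z 0 g 0))) = F"
proof -
 have w: "(\<forall>v\<in>H1_plane. fst u \<bullet> fst v + F \<bullet> DZ v = - \<alpha> * surface_form u v) \<longleftrightarrow>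
   (\<forall>v\<in>H1_plane. form_op \<alpha> z 0 u \<bullet> v = source z 0 g 0 \<bullet> v)" if "F = (- 1 / z) *\<^sub>C (g + 4 *\<^sub>R DZ u)" for u
  using weak_form_iff[OF z that, of 0 0 0] by (simp add: scaleC_one)
 have "(F, g) \<in> op_minus (op_T \<Omega> \<alpha>) z \<longleftrightarrow> (\<exists>u\<in>H1_plane. F = (- 1 / z) *\<^sub>C (g + 4 *\<^sub>R DZ u) \<and>
   (\<forall>v\<in>H1_plane. fst u \<bullet> fst v + F \<bullet> DZ v = - \<alpha> * surface_form u v))"
  unfolding op_minus_iff op_T_iff solve_resolvent[OF z] ..
 also have "... \<longleftrightarrow> (\<exists>u. u = S (source z 0 g 0) \<and> F = (- 1 / z) *\<^sub>C (g + 4 *\<^sub>R DZ u))"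
  unfolding S using w by blast
 finally show ?thesis by auto
qed

lemma resolvent_A_iff:
 assumes z: "z \<noteq> 0" and c: "c > 0"
  and S: "!!r u. u = S r \<longleftrightarrow> u \<in> H1_plane \<and> (\<forall>v\<in>H1_plane. form_op \<alpha> z (1 / c\<^sup>2) u \<bullet> v = r \<bullet> v)"
  and u_def: "u = S (source z (\<i> / (2 * of_real c)) (fst g) (snd g))"
 shows "(F, g) \<in> op_minus (op_A \<Omega> c (- \<alpha> * c\<^sup>2 / 2) (\<alpha> * c\<^sup>2 / 2)) (z + of_real (c\<^sup>2 / 2)) \<longleftrightarrow>
  ((- 1 / z) *\<^sub>C (fst g + 4 *\<^sub>R DZ u), (- 2 * \<i> / of_real c) *\<^sub>C fst u) = F"
proof -
 let ?eps = "\<i> / (2 * of_real c)" and ?k = "- 2 * \<i> / complex_of_real c" and ?m = "complex_of_real (c\<^sup>2 / 2)"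
 have f1: "fst g + (z + ?m) *\<^sub>C fst F = (- 4) *\<^sub>R X + ?m *\<^sub>C fst F \<longleftrightarrow> fst F = (- 1 / z) *\<^sub>C (fst g + 4 *\<^sub>R X)" for X
  unfolding solve_resolvent[OF z, symmetric] scaleC_add_left by (simp add: add.assoc[symmetric])
 have f2: "?eps *\<^sub>C ((snd g + (z + ?m) *\<^sub>C snd F) + ?m *\<^sub>C snd F) = (1 + z * of_real (1 / c\<^sup>2)) *\<^sub>C fst y + ?eps *\<^sub>C snd g"
  if F: "snd F = ?k *\<^sub>C fst y" for y :: "L2 \<times> L2 \<times> L2"
 proof -
  \<comment> \<open>The shift of the spectral parameter and the mass term add up to
    \<open>z + of_real (c\<^sup>2)\<close>, and \<open>?eps * ?k\<close> is
    \<open>1 / c\<^sup>2\<close>; this is where the value of \<kappa> comes from.\<close>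
  have "?eps * ((z + ?m) * ?k) + ?eps * (?m * ?k) = 1 + z * of_real (1 / c\<^sup>2)"
   using c by (simp add: field_simps power2_eq_square)
  then have "(?eps * ((z + ?m) * ?k)) *\<^sub>C fst y + (?eps * (?m * ?k)) *\<^sub>C fst y = (1 + z * of_real (1 / c\<^sup>2)) *\<^sub>C fst y"
   unfolding scaleC_add_left[symmetric] by simp
  then show ?thesis unfolding F scaleC_add_right scaleC_scaleC by (simp add: add_ac)
 qed
 have E: "((?eps *\<^sub>C ((snd g + (z + ?m) *\<^sub>C snd F) + ?m *\<^sub>C snd F)) \<bullet> fst v + fst F \<bullet> DZ v = - \<alpha> * surface_form y v)
   = (form_op \<alpha> z (1 / c\<^sup>2) y \<bullet> v = source z ?eps (fst g) (snd g) \<bullet> v)"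
  if s: "snd F = ?k *\<^sub>C fst y" and f: "fst F = (- 1 / z) *\<^sub>C (fst g + 4 *\<^sub>R DZ y)" for y v
  unfolding f2[OF s] by (rule weak_form_iff[OF z f])
 have "(F, g) \<in> op_minus (op_A \<Omega> c (- \<alpha> * c\<^sup>2 / 2) (\<alpha> * c\<^sup>2 / 2)) (z + ?m) \<longleftrightarrow>
  (\<exists>y\<in>H1_plane. snd F = ?k *\<^sub>C fst y \<and> fst F = (- 1 / z) *\<^sub>C (fst g + 4 *\<^sub>R DZ y) \<and>
  (\<forall>v\<in>H1_plane. (?eps *\<^sub>C ((snd g + (z + ?m) *\<^sub>C snd F) + ?m *\<^sub>C snd F)) \<bullet> fst v + fst F \<bullet> DZ v = - \<alpha> * surface_form y v))"
  unfolding op_minus_iff op_A_iff[OF c] fst_add snd_add scaleC_fst_snd f1 ..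
 also have "... \<longleftrightarrow> (\<exists>y\<in>H1_plane. snd F = ?k *\<^sub>C fst y \<and> fst F = (- 1 / z) *\<^sub>C (fst g + 4 *\<^sub>R DZ y) \<and>
  (\<forall>v\<in>H1_plane. form_op \<alpha> z (1 / c\<^sup>2) y \<bullet> v = source z ?eps (fst g) (snd g) \<bullet> v))"
  by (intro bex_cong refl conj_cong ball_cong E)
 also have "... \<longleftrightarrow> (\<exists>y. y = u \<and> snd F = ?k *\<^sub>C fst y \<and> fst F = (- 1 / z) *\<^sub>C (fst g + 4 *\<^sub>R DZ y))"
  unfolding u_def S by blast
 finally show ?thesis by (auto simp: prod_eq_iff)
qed

section \<open>The difference of the resolvents\<close>

lemma source_eq: "source z eps g h = source z 0 g 0 + (eps *\<^sub>C h, 0, 0)"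
 by (simp add: source_def zero_prod_def)

lemma bounded_linear_source: "bounded_linear (%p. source z eps (fst p) (snd p))"
 unfolding source_def[abs_def]
 by (intro bounded_linear_add bounded_linear_Pair bounded_linear_zero bl_comp[OF bounded_linear_DZ_adj]
   bl_comp[OF bounded_linear_scaleC] bounded_linear_fst bounded_linear_snd)

text \<open>The Dirac solution satisfies the limit equation up to a residual, made of the source
  with \<open>eps\<close> and the \<kappa>-term. The residual is of order \<open>1 / c\<close>
  relative to the data, and the solution operator of the limit equation is bounded; the lower
  component has the factor \<open>2 / c\<close> outright.\<close>

theorem resolvent_convergence:
 assumes z: "z \<notin> \<real>"
 obtains C where "z \<in> resolvent_set (op_T \<Omega> \<alpha>)"
  "!!c. c > 0 ==> z + of_real (c\<^sup>2 / 2) \<in> resolvent_set (op_A \<Omega> c (- \<alpha> * c\<^sup>2 / 2) (\<alpha> * c\<^sup>2 / 2))"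
  "!!c. c \<ge> 1 ==> norm (resolvent (op_A \<Omega> c (- \<alpha> * c\<^sup>2 / 2) (\<alpha> * c\<^sup>2 / 2)) (z + of_real (c\<^sup>2 / 2))
     - block_op (resolvent (op_T \<Omega> \<alpha>) z) 0 0 0) \<le> C * (1 / c)"
proof -
 have z0: "z \<noteq> 0" using z by auto
 obtain B where B: "B > 0" and ex: "\<forall>\<kappa>\<ge>0. \<exists>S. solution_op \<alpha> z B \<kappa> S" using form_solution[OF z] by blast
 then have "\<forall>\<kappa>. \<exists>S. \<kappa> \<ge> 0 --> solution_op \<alpha> z B \<kappa> S" by blast
 then obtain S where S: "\<forall>\<kappa>. \<kappa> \<ge> 0 --> solution_op \<alpha> z B \<kappa> (S \<kappa>)" by (rule choice[THEN exE])
 note S = S[unfolded solution_op_def]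
 have bS: "bounded_linear (S \<kappa>)" and nS: "norm (S \<kappa> r) \<le> B * norm r"
  and iS: "u = S \<kappa> r \<longleftrightarrow> u \<in> H1_plane \<and> (\<forall>v\<in>H1_plane. form_op \<alpha> z \<kappa> u \<bullet> v = r \<bullet> v)" if k: "\<kappa> \<ge> 0" for \<kappa> r u
  by (rule S[rule_format, OF k, THEN conjunct1],
   rule S[rule_format, OF k, THEN conjunct2, THEN conjunct2, rule_format],
   rule S[rule_format, OF k, THEN conjunct2, THEN conjunct1, rule_format])
 obtain M where M: "M > 0" "!!X. norm (DZ_adj X) \<le> norm X * M" using bounded_linear.pos_bounded[OF bounded_linear_DZ_adj] by blast
 obtain M' where M': "M' > 0" "!!w. norm (DZ w) \<le> norm w * M'" using bounded_linear.pos_bounded[OF bounded_linear_DZ] by blast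
 define RT where "RT g = (- 1 / z) *\<^sub>C (g + 4 *\<^sub>R DZ (S 0 (source z 0 g 0)))" for g
 have bRT: "bounded_linear RT"
 proof -
  have "bounded_linear (%g. source z 0 g 0)"
   using bl_comp[OF bounded_linear_source[of z 0] bounded_linear_Pair[OF bounded_linear_ident bounded_linear_zero]] by simp
  then show ?thesis
   unfolding RT_def[abs_def]
   by (intro bl_comp[OF bounded_linear_scaleC] bounded_linear_add bounded_linear_ident
     bounded_linear_const_scaleR bl_comp[OF bounded_linear_DZ] bl_comp[OF bS]) simp_all
 qed
 define u where "u c g = S (1 / c\<^sup>2) (source z (\<i> / (2 * of_real c)) (fst g) (snd g))" for c :: real and g
 define RA where "RA c g = ((- 1 / z) *\<^sub>C (fst g + 4 *\<^sub>R DZ (u c g)), (- 2 * \<i> / of_real c) *\<^sub>C fst (u c g))" for c g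
 have bu: "bounded_linear (u c)" if "c > 0" for c
  unfolding u_def[abs_def] by (rule bl_comp[OF bS bounded_linear_source]) simp
 have bRA: "bounded_linear (RA c)" if "c > 0" for c
  unfolding RA_def[abs_def]
  by (intro bounded_linear_Pair bl_comp[OF bounded_linear_scaleC] bounded_linear_add bounded_linear_fst
    bounded_linear_const_scaleR bl_comp[OF bounded_linear_DZ] bl_comp[OF bounded_linear_fst] bu that)
 have "is_bounded_inverse (op_minus (op_T \<Omega> \<alpha>) z) (Blinfun RT)"
  unfolding is_bounded_inverse_def bounded_linear_Blinfun_apply[OF bRT] RT_def
  using resolvent_T_iff[OF z0 iS[of 0]] by simp
 note rT = resolvent_eqI[OF this]
 have "is_bounded_inverse (op_minus (op_A \<Omega> c (- \<alpha> * c\<^sup>2 / 2) (\<alpha> * c\<^sup>2 / 2)) (z + of_real (c\<^sup>2 / 2))) (Blinfun (RA c))" if c: "c > 0" for c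
 proof -
  have k: "1 / c\<^sup>2 \<ge> 0" by simp
  show ?thesis
   unfolding is_bounded_inverse_def bounded_linear_Blinfun_apply[OF bRA[OF c]] RA_def
   using resolvent_A_iff[OF z0 c iS[OF k] u_def] by blast
 qed
 note rA = resolvent_eqI[OF this]
 \<comment> \<open>\<open>C1\<close> bounds \<open>u c g\<close> through its source,
   \<open>C2\<close> bounds the difference \<open>d\<close> through the residual, and
   \<open>C\<close> adds the contributions of the two components.\<close>
 define C1 where "C1 = B * (M / cmod z + 1)"
 define C2 where "C2 = B * (1 + cmod z * C1)"
 define C where "C = 4 / cmod z * (C2 * M') + 2 * C1"
 have C1: "C1 \<ge> 0" using B M by (simp add: C1_def)
 have est: "norm (RA c g - (RT (fst g), 0)) \<le> C * (1 / c) * norm g" if c: "c \<ge> 1" for c g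
 proof -
  have c0: "c > 0" and k: "1 / c\<^sup>2 \<ge> 0" using c by simp_all
  let ?eps = "\<i> / (2 * complex_of_real c)"
  have ne: "cmod ?eps \<le> 1 / c" using c by (simp add: norm_divide norm_mult field_simps)
  \<comment> \<open>Here \<open>c \<ge> 1\<close> enters: it makes the bound \<open>C1\<close>
    independent of \<open>c\<close> and lets the \<kappa>-term, of order
    \<open>1 / c\<^sup>2\<close>, count as \<open>1 / c\<close>.\<close>
  have c1: "1 / c \<le> 1" and c2: "1 / c\<^sup>2 \<le> 1 / c" using c by (simp_all add: field_simps power2_eq_square)
  have g: "norm (fst g) \<le> norm g" "norm (snd g) \<le> norm g" by (rule norm_fst_le_norm norm_snd_le_norm)+
  have eh: "norm (?eps *\<^sub>C snd g) \<le> 1 / c * norm g"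
   unfolding norm_scaleC by (rule mult_mono[OF ne g(2)]) (use c in simp_all)
  have eh1: "norm (?eps *\<^sub>C snd g) \<le> norm g"
   using order_trans[OF eh mult_right_mono[OF c1 norm_ge_zero]] by simp
  have triple: "norm ((X, 0, 0) :: L2 \<times> L2 \<times> L2) = norm X" for X by (simp add: norm_Pair)
  have "norm (source z ?eps (fst g) (snd g)) \<le> norm (DZ_adj ((- 1 / z) *\<^sub>C fst g)) + norm (?eps *\<^sub>C snd g)"
   unfolding source_def using norm_triangle_ineq[of "DZ_adj ((- 1 / z) *\<^sub>C fst g)" "(?eps *\<^sub>C snd g, 0, 0)"] unfolding triple .
  also have "... \<le> norm g * (M / cmod z) + norm g"
  proof (intro add_mono eh1)
   have "norm (DZ_adj ((- 1 / z) *\<^sub>C fst g)) \<le> norm ((- 1 / z) *\<^sub>C fst g) * M" by (rule M(2))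
   also have "... = norm (fst g) * (M / cmod z)" by (simp add: norm_scaleC norm_divide)
   also have "... \<le> norm g * (M / cmod z)" by (rule mult_right_mono[OF g(1)]) (use M in simp)
   finally show "norm (DZ_adj ((- 1 / z) *\<^sub>C fst g)) \<le> norm g * (M / cmod z)" .
  qed
  also have "... = (M / cmod z + 1) * norm g" by (simp add: algebra_simps)
  finally have "B * norm (source z ?eps (fst g) (snd g)) \<le> B * ((M / cmod z + 1) * norm g)"
   by (rule mult_left_mono) (use B in simp)
  then have nu: "norm (u c g) \<le> C1 * norm g"
   using nS[OF k, of "source z ?eps (fst g) (snd g)"] unfolding u_def C1_def by (simp add: mult.assoc)
  let ?w = "S 0 (source z 0 (fst g) 0)"
  define d where "d = u c g - ?w"
  \<comment> \<open>The residual of \<open>u c g\<close> in the equation with \<kappa> = 0; the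
    difference \<open>d\<close> is the solution of that equation with this source.\<close>
  let ?r = "?eps *\<^sub>C snd g + (z * of_real (1 / c\<^sup>2)) *\<^sub>C fst (u c g)"
  have uV: "u c g \<in> H1_plane" and ue: "!!v. v \<in> H1_plane ==> form_op \<alpha> z (1 / c\<^sup>2) (u c g) \<bullet> v = source z ?eps (fst g) (snd g) \<bullet> v"
   using iS[OF k, THEN iffD1, OF u_def] by blast+
  have wV: "?w \<in> H1_plane" and we: "!!v. v \<in> H1_plane ==> form_op \<alpha> z 0 ?w \<bullet> v = source z 0 (fst g) 0 \<bullet> v"
   using iS[of 0, THEN iffD1, OF order_refl refl] by blast+
  have "form_op \<alpha> z 0 d \<bullet> v = (?r, 0, 0) \<bullet> v" if v: "v \<in> H1_plane" for v
  proof -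
   have "form_op \<alpha> z 0 d \<bullet> v = form_op \<alpha> z 0 (u c g) \<bullet> v - form_op \<alpha> z 0 ?w \<bullet> v"
    unfolding d_def linear_diff[OF bounded_linear.linear[OF bounded_linear_form_op]] inner_diff_left ..
   also have "form_op \<alpha> z 0 (u c g) \<bullet> v = form_op \<alpha> z (1 / c\<^sup>2) (u c g) \<bullet> v + ((z * of_real (1 / c\<^sup>2)) *\<^sub>C fst (u c g)) \<bullet> fst v"
    unfolding form_op_inner scaleC_add_left inner_add_left by simp
   also have "form_op \<alpha> z (1 / c\<^sup>2) (u c g) \<bullet> v = source z 0 (fst g) 0 \<bullet> v + (?eps *\<^sub>C snd g) \<bullet> fst v"
    unfolding ue[OF v] source_eq[of z ?eps] inner_add_left by (simp add: inner_triple)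
   finally show ?thesis unfolding we[OF v] by (simp add: inner_triple inner_add_left)
  qed
  then have d: "d = S 0 (?r, 0, 0)"
   unfolding iS[OF order_refl] using subspace_diff[OF subspace_H1_plane uV wV] by (simp add: d_def)
  have "norm ?r \<le> norm (?eps *\<^sub>C snd g) + norm ((z * of_real (1 / c\<^sup>2)) *\<^sub>C fst (u c g))" by (rule norm_triangle_ineq)
  also have "... \<le> 1 / c * norm g + 1 / c * (cmod z * (C1 * norm g))"
  proof (intro add_mono eh)
   have "norm ((z * of_real (1 / c\<^sup>2)) *\<^sub>C fst (u c g)) = 1 / c\<^sup>2 * (cmod z * norm (fst (u c g)))"
    by (simp add: norm_scaleC norm_mult norm_divide norm_power)
   also have "... \<le> 1 / c * (cmod z * (C1 * norm g))"
    by (intro mult_mono c2 order_trans[OF norm_fst_le_norm nu] order_refl) (use c C1 in simp_all)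
   finally show "norm ((z * of_real (1 / c\<^sup>2)) *\<^sub>C fst (u c g)) \<le> 1 / c * (cmod z * (C1 * norm g))" .
  qed
  finally have "B * norm ?r \<le> B * (1 / c * norm g + 1 / c * (cmod z * (C1 * norm g)))"
   by (rule mult_left_mono) (use B in simp)
  moreover have "norm d \<le> B * norm ?r" unfolding d using nS[OF order_refl, of "(?r, 0, 0)"] unfolding triple .
  ultimately have nd: "norm d \<le> C2 * (1 / c * norm g)" by (simp add: C2_def algebra_simps)
  have "RA c g - (RT (fst g), 0) = ((- 4 / z) *\<^sub>C DZ d, (- 2 * \<i> / of_real c) *\<^sub>C fst (u c g))"
  proof -
   have f4: "4 *\<^sub>R X = 4 *\<^sub>C X" for X :: L2 using scaleC_of_real[of 4 X] by simp
   have "(- 1 / z) *\<^sub>C (fst g + 4 *\<^sub>R DZ (u c g)) - (- 1 / z) *\<^sub>C (fst g + 4 *\<^sub>R DZ ?w) = (- 4 / z) *\<^sub>C DZ d"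
    unfolding scaleC_diff_right[symmetric] add_diff_cancel_left f4 d_def DZ_diff scaleC_scaleC by (simp add: scaleC_diff_right scaleC_scaleC)
   then show ?thesis by (simp add: RA_def RT_def)
  qed
  then have "norm (RA c g - (RT (fst g), 0)) \<le> norm ((- 4 / z) *\<^sub>C DZ d) + norm ((- 2 * \<i> / of_real c) *\<^sub>C fst (u c g))"
   by (simp only: norm_Pair_le)
  also have "... \<le> 4 / cmod z * (C2 * (1 / c * norm g) * M') + 2 / c * (C1 * norm g)"
  proof (rule add_mono)
   have "norm (DZ d) \<le> C2 * (1 / c * norm g) * M'"
    using M'(2)[of d] mult_right_mono[OF nd, of M'] M'(1) by linarith
   moreover have "cmod (- 4 / z) = 4 / cmod z" by (simp add: norm_divide)
   ultimately show "norm ((- 4 / z) *\<^sub>C DZ d) \<le> 4 / cmod z * (C2 * (1 / c * norm g) * M')"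
    unfolding norm_scaleC by (simp only: mult_left_mono divide_nonneg_nonneg norm_ge_zero zero_le_numeral)
   have "norm (fst (u c g)) \<le> C1 * norm g" by (rule order_trans[OF norm_fst_le_norm nu])
   moreover have "cmod (- 2 * \<i> / of_real c) = 2 / c" "0 \<le> 2 / c" using c by (simp_all add: norm_divide norm_mult)
   ultimately show "norm ((- 2 * \<i> / of_real c) *\<^sub>C fst (u c g)) \<le> 2 / c * (C1 * norm g)"
    unfolding norm_scaleC by (simp only: mult_left_mono)
  qed
  also have "... = C * (1 / c) * norm g" by (simp add: C_def algebra_simps)
  finally show ?thesis .
 qed
 have "norm (Blinfun (RA c) - block_op (Blinfun RT) 0 0 0) \<le> C * (1 / c)" if c: "c \<ge> 1" for c
 proof (rule norm_blinfun_bound)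
  have c0: "c > 0" using c by simp
  have "C \<ge> 0" using C1 B M'(1) by (simp add: C_def C2_def)
  then show "0 \<le> C * (1 / c)" using c by simp
  show "norm (blinfun_apply (Blinfun (RA c) - block_op (Blinfun RT) 0 0 0) g) \<le> C * (1 / c) * norm g" for g
   unfolding minus_blinfun.rep_eq block_op.rep_eq bounded_linear_Blinfun_apply[OF bRA[OF c0]] bounded_linear_Blinfun_apply[OF bRT]
   using est[OF c, of g] by simp
 qed
 then have fin: "norm (resolvent (op_A \<Omega> c (- \<alpha> * c\<^sup>2 / 2) (\<alpha> * c\<^sup>2 / 2)) (z + of_real (c\<^sup>2 / 2))
     - block_op (resolvent (op_T \<Omega> \<alpha>) z) 0 0 0) \<le> C * (1 / c)" if "c \<ge> 1" for c
  unfolding rT(2) using that rA(2)[of c] by simp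
 show ?thesis by (rule that[OF rT(1) rA(1) fin])
qed

end

theorem theorem1p2:
  fixes \<Omega> :: "(real^2) set" and \<alpha> :: real
  assumes "smooth_domain \<Omega>" and "bounded \<Omega>" and "simply_connected \<Omega>"
  shows "\<forall>z::complex. z \<notin> \<real> \<longrightarrow>
    z \<in> resolvent_set (op_T \<Omega> \<alpha>) \<and>
    (\<forall>c>0. z + of_real (c\<^sup>2 / 2) \<in> resolvent_set (op_A \<Omega> c (- \<alpha> * c\<^sup>2 / 2) (\<alpha> * c\<^sup>2 / 2))) \<and>
    ((\<lambda>c. resolvent (op_A \<Omega> c (- \<alpha> * c\<^sup>2 / 2) (\<alpha> * c\<^sup>2 / 2)) (z + of_real (c\<^sup>2 / 2)))
       \<longlongrightarrow> block_op (resolvent (op_T \<Omega> \<alpha>) z) 0 0 0) at_top \<and>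
    (\<lambda>c. norm (resolvent (op_A \<Omega> c (- \<alpha> * c\<^sup>2 / 2) (\<alpha> * c\<^sup>2 / 2)) (z + of_real (c\<^sup>2 / 2))
          - block_op (resolvent (op_T \<Omega> \<alpha>) z) 0 0 0)) \<in> O[at_top](\<lambda>c. 1 / c)"
proof (intro allI impI)
 fix z :: complex assume z: "z \<notin> \<real>"
 obtain N where "green_domain \<Omega> N" using smooth_domain_green[OF assms(1,2)] by blast
 then interpret green_domain \<Omega> N .
 let ?R = "%c. resolvent (op_A \<Omega> c (- \<alpha> * c\<^sup>2 / 2) (\<alpha> * c\<^sup>2 / 2)) (z + of_real (c\<^sup>2 / 2))"
 let ?T = "block_op (resolvent (op_T \<Omega> \<alpha>) z) 0 0 0"
 obtain C where T: "z \<in> resolvent_set (op_T \<Omega> \<alpha>)"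
  and A: "!!c. c > 0 ==> z + of_real (c\<^sup>2 / 2) \<in> resolvent_set (op_A \<Omega> c (- \<alpha> * c\<^sup>2 / 2) (\<alpha> * c\<^sup>2 / 2))"
  and C: "!!c. c \<ge> 1 ==> norm (?R c - ?T) \<le> C * (1 / c)"
  using resolvent_convergence[OF z, of \<alpha>] by blast
 have ev: "\<forall>\<^sub>F c in at_top. norm (?R c - ?T) \<le> C * (1 / c)"
  using eventually_ge_at_top[of 1] by eventually_elim (rule C)
 have "((%c. C * (1 / c)) \<longlongrightarrow> 0) at_top" by real_asymp
 then have "((%c. ?R c - ?T) \<longlongrightarrow> 0) at_top" by (rule Lim_null_comparison[OF ev])
 then have "(?R \<longlongrightarrow> ?T) at_top" by (rule LIM_zero_cancel)
 moreover have "(%c. norm (?R c - ?T)) \<in> O[at_top](%c. 1 / c)"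
 proof (rule bigoI)
  show "\<forall>\<^sub>F c in at_top. norm (norm (?R c - ?T)) \<le> C * norm (1 / c)"
   using ev eventually_ge_at_top[of 1] by eventually_elim simp
 qed
 ultimately show "z \<in> resolvent_set (op_T \<Omega> \<alpha>) \<and>
  (\<forall>c>0. z + of_real (c\<^sup>2 / 2) \<in> resolvent_set (op_A \<Omega> c (- \<alpha> * c\<^sup>2 / 2) (\<alpha> * c\<^sup>2 / 2))) \<and>
  (?R \<longlongrightarrow> ?T) at_top \<and> (%c. norm (?R c - ?T)) \<in> O[at_top](%c. 1 / c)"
  using T A by blast
qed

end
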